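(* Let $\chi_1$ and $\chi_2$ be nontrivial primitive Dirichlet characters modulo $q_1$ and $q_2$, respectively, such that $\chi_1\chi_2(-1)=1$, and let $c$ be a positive integer with $q_1q_2\mid c$. Then \[\sum_{\substack{a\bmod c\\(a,c)=1}}\lvert S_{\chi_1,\chi_2}(a,c)\rvert^2=q_1c^{2+o(1)};\] that is, for every $\varepsilon>0$ there are constants $A_\varepsilon,B_\varepsilon>0$ depending only on $\varepsilon$ such that \[A_\varepsilon\,q_1c^{2-\varepsilon}\le\sum_{\substack{a\bmod c\\(a,c)=1}}\lvert S_{\chi_1,\chi_2}(a,c)\rvert^2\le B_\varepsilon\,q_1c^{2+\varepsilon}.\]
   Context: Dirichlet characters are extended by $0$ to integers not coprime to their modulus. $B_1(x)=0$ if $x\in\mathbb{Z}$ and $B_1(x)=x-\lfloor x\rfloor-\tfrac12$ otherwise. For integers $a$ and $c\ge1$ with $q_1q_2\mid c$, \[S_{\chi_1,\chi_2}(a,c)=\sum_{j\bmod c}\sum_{n\bmod q_1}\overline{\chi_2}(j)\overline{\chi_1}(n)B_1\!\Big(\frac{j}{c}\Big)B_1\!\Big(\frac{n}{q_1}+\frac{aj}{c}\Big).\] *)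

theory Defs
  imports Complex_Main
begin

text \<open>
  A Dirichlet character modulo \<open>q\<close> is a homomorphism from the unit group of the integers modulo
  \<open>q\<close> to the nonzero complex numbers, extended by 0 to the integers not coprime to \<open>q\<close>. It is
  represented by the resulting \<open>q\<close>-periodic, completely multiplicative function on the integers.
  The value 1 at 1 is not required separately: it follows from multiplicativity and \<open>\<chi> 1 \<noteq> 0\<close>.
\<close>

definition dirichlet_character :: "nat \<Rightarrow> (int \<Rightarrow> complex) \<Rightarrow> bool" where
  "dirichlet_character q \<chi> \<longleftrightarrow>
     q > 0 \<and>
     (\<forall>a b. \<chi> (a * b) = \<chi> a * \<chi> b) \<and>
     (\<forall>a. \<chi> (a + int q) = \<chi> a) \<and>
     (\<forall>a. \<chi> a = 0 \<longleftrightarrow> \<not> coprime a (int q))"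

definition nontrivial_character :: "nat \<Rightarrow> (int \<Rightarrow> complex) \<Rightarrow> bool" where
  "nontrivial_character q \<chi> \<longleftrightarrow> (\<exists>a. coprime a (int q) \<and> \<chi> a \<noteq> 1)"

text \<open>
  \<open>induced_by q \<chi> d \<psi>\<close>: the character \<open>\<chi>\<close> modulo \<open>q\<close> is induced by the character \<open>\<psi>\<close> modulo
  the divisor \<open>d\<close> of \<open>q\<close>.
\<close>

definition induced_by ::
    "nat \<Rightarrow> (int \<Rightarrow> complex) \<Rightarrow> nat \<Rightarrow> (int \<Rightarrow> complex) \<Rightarrow> bool" where
  "induced_by q \<chi> d \<psi> \<longleftrightarrow>
     d dvd q \<and> dirichlet_character d \<psi> \<and> (\<forall>a. coprime a (int q) \<longrightarrow> \<chi> a = \<psi> a)"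

definition primitive_character :: "nat \<Rightarrow> (int \<Rightarrow> complex) \<Rightarrow> bool" where
  "primitive_character q \<chi> \<longleftrightarrow>
     dirichlet_character q \<chi> \<and> \<not> (\<exists>d \<psi>. d < q \<and> induced_by q \<chi> d \<psi>)"

definition B1 :: "real \<Rightarrow> real" where
  "B1 x = (if x \<in> \<int> then 0 else x - of_int \<lfloor>x\<rfloor> - 1 / 2)"

text \<open>
  For \<open>\<chi>1\<close>, \<open>\<chi>2\<close> characters modulo \<open>q1\<close>, \<open>q2\<close> and \<open>q1 * q2 dvd c\<close>, the summand depends
  on \<open>j\<close> only modulo \<open>c\<close> and on \<open>n\<close> only modulo \<open>q1\<close>, so the sums over residue classes are taken
  over the least nonnegative representatives. The modulus \<open>q2\<close> does not occur in the formula.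
\<close>

definition dedekind_sum ::
    "nat \<Rightarrow> (int \<Rightarrow> complex) \<Rightarrow> (int \<Rightarrow> complex) \<Rightarrow> int \<Rightarrow> nat \<Rightarrow> complex" where
  "dedekind_sum q1 \<chi>1 \<chi>2 a c =
     (\<Sum>j\<in>{0..<int c}. \<Sum>n\<in>{0..<int q1}.
        cnj (\<chi>2 j) * cnj (\<chi>1 n) *
        of_real (B1 (of_int j / of_nat c)) *
        of_real (B1 (of_int n / of_nat q1 + of_int (a * j) / of_nat c)))"

end

theory Submission
  imports Defs "HOL-Analysis.Analysis" "HOL-Number_Theory.Number_Theory"
begin

text \<open>
  Fourier expansion of the sawtooth function turns the Dedekind sum into
  \<open>R a = \<Sum>\<^sub>l\<^sub>,\<^sub>m w(l) w(m) \<chi>1(m) \<kappa>(l + a m)\<close>, where \<open>w(m) = cot(\<pi> m/c)/c\<close> decays like \<open>1/m\<close>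
  and \<open>\<kappa>(n) = \<chi>2(n/D)\<close> is supported on the multiples of \<open>D = c/q2\<close>; up to Gauss sums the second moment
  is \<open>D\<^sup>2 q1 q2\<close> times that of \<open>R\<close>. The upper bound then follows from the Cauchy--Schwarz inequality.

  For large \<open>c\<close>, correlating \<open>R(-\<beta> + k D)\<close> with \<open>\<chi>2\<close> over the admissible \<open>k\<close> isolates a diagonal
  dominated by \<open>m = \<plusminus>1\<close>, and a sieve with the vanishing of primitive characters on progressions
  controls the remaining terms.

  For bounded \<open>c\<close> there are finitely many characters, so it suffices that the moment never vanishes.
  A Hecke relation and an \<open>l\<^sup>2\<close> argument on the units reduce this to levels without redundant primes.
  There the vanishing of \<open>R\<close> says that \<open>\<chi>1(y) \<kappa>(x + y)\<close> is annihilated by a cotangent pairing under all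
  unit dilations of \<open>x\<close> and \<open>y\<close>. Combining dilations removes the non-units one prime at a time, and
  the nonvanishing of \<open>L(1,\<lambda>)\<close> for odd characters \<open>\<lambda>\<close> forces the odd-odd part of the resulting
  function to vanish, which is refuted at a single point.
\<close>

section \<open>Periodic functions and the sawtooth function\<close>

text \<open>At bounded level the difficulty sits at the primes \<open>p\<close> dividing
  \<open>q2\<close> but not \<open>D\<close>, where \<open>X1\<close> does not kill the non-units.
  Primitivity of \<open>X2\<close> makes the sums over the cosets of \<open>c/p\<close> vanish, so
  that averaging over unit dilations can restrict both variables to units. This destroys everything
  at \<open>p = 2\<close>, because two odd arguments have an even sum, where \<open>kap\<close> is
  0; and at 3, if it divides \<open>q2\<close> exactly once, because \<open>unit_part\<close> is
  identically 0 for the character modulo 3. At these small primes only the second variable is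
  averaged: an idempotent \<open>e\<close> removes its component at \<open>p\<close>, so that
  \<open>x + e y\<close> is divisible by \<open>p\<close> along with \<open>x\<close>, and the price
  is a difference of the dilations by 1 and \<open>p\<close>. The final relation thus involves the
  dilations 1, -2, -3, 6 with both signs. A suitable point isolates one of them unless some coincide
  modulo \<open>D\<close>; this leaves \<open>D = 3, 4, 5\<close>, settled by comparing absolute
  values. A prime is redundant if it divides \<open>D\<close> but not \<open>q1\<close>. Without
  such primes \<open>X1\<close> removes the non-units at the primes of \<open>D\<close>.\<close>

definition periodic :: "nat \<Rightarrow> (int \<Rightarrow> 'a) \<Rightarrow> bool" where
  "periodic n f \<longleftrightarrow> (\<forall>x. f (x + int n) = f x)"

lemma periodicD_mult: assumes "periodic n f" shows "f (x + int n * k) = f x"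
proof -
  have *: "f (x + int n * int m) = f x" for x m
  proof (induction m arbitrary: x)
    case (Suc m)
    have "f (x + int n * int (Suc m)) = f ((x + int n * int m) + int n)" by (simp add: algebra_simps)
    then show ?case using assms Suc by (simp add: periodic_def)
  qed simp
  show ?thesis
  proof (cases "k \<ge> 0")
    case True then show ?thesis using *[of x "nat k"] by simp
  next
    case False
    then show ?thesis using *[of "x + int n * k" "nat (-k)"] by (simp add: algebra_simps)
  qed
qed

lemma periodic_cong: assumes "periodic n f" "[x = y] (mod int n)" shows "f x = f y"
proof -
  obtain k where "y = x + int n * k" using assms(2) by (metis cong_iff_lin)
  then show ?thesis using periodicD_mult[OF assms(1)] by simp
qed

lemma periodic_mod: "periodic n f \<Longrightarrow> f (x mod int n) = f x"
  by (rule periodic_cong[of n]) (simp_all add: cong_def)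

lemma periodic_dvd: assumes "periodic d f" "d dvd n" shows "periodic n f"
proof -
  obtain k where k: "n = d * k" using assms(2) by (rule dvdE)
  show ?thesis unfolding periodic_def k by (simp add: periodicD_mult[OF assms(1)])
qed

lemma periodic_affine: assumes "periodic n f" shows "periodic n (\<lambda>x. f (a + b * x))"
  unfolding periodic_def
proof
  fix x
  have "a + b * (x + int n) = (a + b * x) + int n * b" by (simp add: algebra_simps)
  then show "f (a + b * (x + int n)) = f (a + b * x)" by (simp only: periodicD_mult[OF assms])
qed

lemma sum_residues_bij:
  assumes "periodic n f" and h: "\<And>x y. x \<in> {0..<int n} \<Longrightarrow> y \<in> {0..<int n} \<Longrightarrow> [h x = h y] (mod int n) \<Longrightarrow> x = y"
    and "n > 0"
  shows "(\<Sum>x\<in>{0..<int n}. f (h x)) = (\<Sum>x\<in>{0..<int n}. f x)"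
proof -
  let ?A = "{0..<int n}"
  have inj: "inj_on (\<lambda>x. h x mod int n) ?A"
    by (rule inj_onI, rule h) (simp_all add: cong_def)
  have img: "(\<lambda>x. h x mod int n) ` ?A = ?A"
    by (rule endo_inj_surj[OF _ _ inj]) (use assms(3) in auto)
  have "(\<Sum>x\<in>?A. f x) = (\<Sum>x\<in>?A. f (h x mod int n))"
    using sum.reindex[OF inj, of f] img by simp
  then show ?thesis by (simp add: periodic_mod[OF assms(1)])
qed

lemma sum_residues_shift:
  assumes "periodic n f" shows "(\<Sum>x\<in>{0..<int n}. f (x + a)) = (\<Sum>x\<in>{0..<int n}. f x)"
proof (cases "n = 0")
  case False
  show ?thesis
  proof (rule sum_residues_bij[OF assms])
    fix x y assume "x \<in> {0..<int n}" "y \<in> {0..<int n}" "[x + a = y + a] (mod int n)"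
    then have "[x = y] (mod int n)" by (simp add: cong_add_rcancel)
    then show "x = y" using \<open>x \<in> _\<close> \<open>y \<in> _\<close> by (simp add: cong_def)
  qed (use False in auto)
qed simp

lemma sum_residues_mult:
  assumes "periodic n f" "coprime u (int n)"
  shows "(\<Sum>x\<in>{0..<int n}. f (u * x)) = (\<Sum>x\<in>{0..<int n}. f x)"
proof (cases "n = 0")
  case False
  show ?thesis
  proof (rule sum_residues_bij[OF assms(1)])
    fix x y assume "x \<in> {0..<int n}" "y \<in> {0..<int n}" "[u * x = u * y] (mod int n)"
    then have "[x = y] (mod int n)" using assms(2) by (simp add: cong_mult_lcancel)
    then show "x = y" using \<open>x \<in> _\<close> \<open>y \<in> _\<close> by (simp add: cong_def)
  qed (use False in auto)
qed simp

lemma sum_residues_affine: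
  assumes "periodic n f" "coprime u (int n)"
  shows "(\<Sum>x\<in>{0..<int n}. f (a + u * x)) = (\<Sum>x\<in>{0..<int n}. f x)"
proof -
  have "(\<Sum>x\<in>{0..<int n}. f (a + u * x)) = (\<Sum>x\<in>{0..<int n}. f (x + a))"
    using sum_residues_mult[OF periodic_affine[OF assms(1), of a 1] assms(2)] by (simp add: add.commute)
  then show ?thesis by (simp add: sum_residues_shift[OF assms(1)])
qed

lemma sum_residues_split:
  fixes f :: "int \<Rightarrow> 'a::comm_monoid_add"
  assumes "d > 0"
  shows "(\<Sum>x\<in>{0..<int (d * k)}. f x) = (\<Sum>r\<in>{0..<int d}. \<Sum>s\<in>{0..<int k}. f (r + int d * s))"
proof -
  let ?h = "\<lambda>(r, s). r + int d * s"
  have "(\<Sum>r\<in>{0..<int d}. \<Sum>s\<in>{0..<int k}. f (r + int d * s)) =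
        (\<Sum>p\<in>{0..<int d} \<times> {0..<int k}. f (?h p))"
    by (simp add: sum.cartesian_product case_prod_beta)
  also have "\<dots> = (\<Sum>x\<in>{0..<int (d * k)}. f x)"
  proof (rule sum.reindex_bij_witness[where j = ?h and i = "\<lambda>x. (x mod int d, x div int d)"])
    fix p assume "p \<in> {0..<int d} \<times> {0..<int k}"
    then obtain r s where p: "p = (r, s)" "0 \<le> r" "r < int d" "0 \<le> s" "s < int k" by auto
    show "(?h p mod int d, ?h p div int d) = p" using p assms by auto
    have "r + int d * s < int d * (s + 1)" using p by (simp add: algebra_simps)
    also have "\<dots> \<le> int d * int k" by (rule mult_left_mono) (use p in auto)
    finally show "?h p \<in> {0..<int (d * k)}" using p by auto
  next
    fix x assume x: "x \<in> {0..<int (d * k)}"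
    show "?h (x mod int d, x div int d) = x" by simp
    have "x div int d < int k"
    proof (rule ccontr)
      assume "\<not> ?thesis"
      then have "int d * int k \<le> int d * (x div int d)" by (intro mult_left_mono) auto
      also have "\<dots> \<le> x" using mult_div_mod_eq[of "int d" x] pos_mod_sign[of "int d" x] assms by linarith
      finally show False using x by simp
    qed
    then show "(x mod int d, x div int d) \<in> {0..<int d} \<times> {0..<int k}" using x assms
      by (auto simp: pos_imp_zdiv_nonneg_iff)
  qed auto
  finally show ?thesis by simp
qed

lemma sum_residues_period:
  fixes f :: "int \<Rightarrow> 'a::comm_semiring_1"
  assumes "d > 0" "periodic d f"
  shows "(\<Sum>x\<in>{0..<int (d * k)}. f x) = of_nat k * (\<Sum>r\<in>{0..<int d}. f r)"
  using assms by (simp add: sum_residues_split periodicD_mult[OF assms(2)] sum_distrib_left del: of_nat_mult)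

lemma sum_residues_dvd:
  fixes f :: "int \<Rightarrow> 'a::comm_monoid_add"
  assumes "k > 0"
  shows "(\<Sum>x\<in>{0..<int (k * d)}. if int k dvd x then f x else 0) = (\<Sum>y\<in>{0..<int d}. f (int k * y))"
proof -
  have "(\<Sum>x\<in>{0..<int (k * d)}. if int k dvd x then f x else 0) =
     (\<Sum>r\<in>{0..<int k}. \<Sum>s\<in>{0..<int d}. if int k dvd r + int k * s then f (r + int k * s) else 0)"
    by (rule sum_residues_split[OF assms])
  also have "\<dots> = (\<Sum>r\<in>{0..<int k}. if r = 0 then (\<Sum>s\<in>{0..<int d}. f (int k * s)) else 0)"
  proof (rule sum.cong[OF refl])
    fix r assume r: "r \<in> {0..<int k}"
    have "int k dvd r + int k * s \<longleftrightarrow> r = 0" for s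
      using r zdvd_imp_le[of "int k" r] by (cases "r = 0") (auto simp: dvd_add_left_iff)
    then show "(\<Sum>s\<in>{0..<int d}. if int k dvd r + int k * s then f (r + int k * s) else 0) =
      (if r = 0 then \<Sum>s\<in>{0..<int d}. f (int k * s) else 0)" by simp
  qed
  finally show ?thesis using assms by (simp add: sum.delta)
qed

section \<open>Additive characters modulo \<open>n\<close> and finite Fourier inversion\<close>

definition ee :: "nat \<Rightarrow> int \<Rightarrow> complex" where
  "ee n k = cis (2 * pi * of_int k / of_nat n)"

lemma ee_add: "ee n (a + b) = ee n a * ee n b"
  by (simp add: ee_def cis_mult add_divide_distrib distrib_left)

lemma ee_0 [simp]: "ee n 0 = 1" by (simp add: ee_def)

lemma ee_minus: "ee n (- a) = cnj (ee n a)" by (simp add: ee_def cis_cnj)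

lemma norm_ee [simp]: "cmod (ee n a) = 1" by (simp add: ee_def)

lemma ee_self: "ee n (int n * k) = 1"
proof (cases "n = 0")
  case False
  then have "ee n (int n * k) = cis (2 * pi * of_int k)" by (simp add: ee_def mult.assoc)
  also have "\<dots> = 1" by (rule cis_multiple_2pi) auto
  finally show ?thesis .
qed (simp add: ee_def)

lemma periodic_ee: "periodic n (\<lambda>x. ee n (a * x))"
  unfolding periodic_def using ee_self[of n a] by (simp add: distrib_left ee_add mult.commute)

lemma ee_scale: "k > 0 \<Longrightarrow> ee (k * n) (int k * x) = ee n x"
  by (simp add: ee_def mult.assoc)

lemma ee_eq_1_iff: assumes "n > 0" shows "ee n a = 1 \<longleftrightarrow> int n dvd a"
proof
  assume "ee n a = 1"
  then have "cos (2 * pi * of_int a / of_nat n) = 1" by (simp add: ee_def complex_eq_iff)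
  then obtain k :: int where "2 * pi * of_int a / of_nat n = of_int k * 2 * pi"
    by (auto simp: cos_one_2pi_int)
  then have "real_of_int a = of_int k * of_nat n" using assms by (simp add: field_simps)
  then have "a = k * int n" by (metis of_int_eq_iff of_int_mult of_int_of_nat_eq)
  then show "int n dvd a" by simp
next
  assume "int n dvd a" then show "ee n a = 1" using ee_self by auto
qed

lemma sum_ee:
  assumes "n > 0"
  shows "(\<Sum>x\<in>{0..<int n}. ee n (a * x)) = (if int n dvd a then of_nat n else 0)"
proof (cases "int n dvd a")
  case True
  then have "ee n (a * x) = 1" for x using assms by (simp add: ee_eq_1_iff)
  then show ?thesis using True by simp
next
  case False
  have "(\<Sum>x\<in>{0..<int n}. ee n (a * x)) = (\<Sum>x\<in>{0..<int n}. ee n (a * (x + 1)))"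
    by (rule sum_residues_shift[OF periodic_ee, symmetric])
  also have "\<dots> = (\<Sum>x\<in>{0..<int n}. ee n (a * x)) * ee n a"
    by (simp add: distrib_left ee_add sum_distrib_right)
  finally have "(\<Sum>x\<in>{0..<int n}. ee n (a * x)) * (ee n a - 1) = 0" by (simp add: algebra_simps)
  then show ?thesis using False assms by (simp add: ee_eq_1_iff)
qed

lemma sum_int_of_nat: "(\<Sum>x\<in>{0..<int n}. f x) = (\<Sum>x<n. f (int x))"
  by (rule sum.reindex_bij_witness[where i = int and j = nat]) auto

lemma sum_ee_fourier_inv:
  assumes "n > 0" "periodic n f"
  shows "(\<Sum>m\<in>{0..<int n}. (\<Sum>j\<in>{0..<int n}. f j * ee n (- (m * j))) * ee n (m * k)) = of_nat n * f k"
proof -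
  have "(\<Sum>m\<in>{0..<int n}. (\<Sum>j\<in>{0..<int n}. f j * ee n (- (m * j))) * ee n (m * k)) =
      (\<Sum>m\<in>{0..<int n}. \<Sum>j\<in>{0..<int n}. f j * ee n ((k - j) * m))"
  proof (rule sum.cong[OF refl])
    fix m :: int
    have "ee n (- (m * j)) * ee n (m * k) = ee n ((k - j) * m)" for j
      by (subst ee_add[symmetric]) (simp add: algebra_simps)
    then show "(\<Sum>j\<in>{0..<int n}. f j * ee n (- (m * j))) * ee n (m * k) = (\<Sum>j\<in>{0..<int n}. f j * ee n ((k - j) * m))"
      by (simp add: sum_distrib_right mult.assoc)
  qed
  also have "\<dots> = (\<Sum>j\<in>{0..<int n}. f j * (\<Sum>m\<in>{0..<int n}. ee n ((k - j) * m)))"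
    by (subst sum.swap) (simp add: sum_distrib_left)
  also have "\<dots> = (\<Sum>j\<in>{0..<int n}. if j = k mod int n then of_nat n * f j else 0)"
  proof (rule sum.cong[OF refl])
    fix j assume j: "j \<in> {0..<int n}"
    have "int n dvd k - j \<longleftrightarrow> j = k mod int n"
      using j by (metis atLeastLessThan_iff mod_eq_dvd_iff mod_pos_pos_trivial)
    then show "f j * (\<Sum>m\<in>{0..<int n}. ee n ((k - j) * m)) = (if j = k mod int n then of_nat n * f j else 0)"
      using assms(1) by (simp add: sum_ee)
  qed
  also have "\<dots> = of_nat n * f k" using assms by (simp add: sum.delta periodic_mod)
  finally show ?thesis .
qed

text \<open>Up to the factor \<open>i c/2\<close>, this is the finite Fourier transform of
  \<open>B1(j/c)\<close>. Since \<open>cot\<close> is \<open>cos/sin\<close> and division by 0 gives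
  0, the value at multiples of \<open>c\<close> is 0, in agreement with the vanishing of the sum of
  \<open>B1(j/c)\<close> over \<open>j\<close>.\<close>

definition wt :: "nat \<Rightarrow> int \<Rightarrow> real" where
  "wt c m = cot (pi * of_int m / of_nat c) / of_nat c"

lemma sin_pi_frac_eq_0: assumes "c > 0" shows "sin (pi * of_int m / of_nat c) = 0 \<longleftrightarrow> int c dvd m"
proof
  assume "sin (pi * of_int m / of_nat c) = 0"
  then obtain k :: int where "pi * of_int m / of_nat c = of_int k * pi" by (auto simp: sin_zero_iff_int2)
  then have "real_of_int m = of_int k * of_nat c" using assms by (simp add: field_simps)
  then have "m = k * int c" by (metis of_int_eq_iff of_int_mult of_int_of_nat_eq)
  then show "int c dvd m" by simp
next
  assume "int c dvd m"
  then obtain k where k: "m = int c * k" ..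
  have "pi * of_int m / of_nat c = of_int k * pi" using assms by (simp add: k)
  then show "sin (pi * of_int m / of_nat c) = 0" by (simp only: sin_zero_iff_int2) blast
qed

lemma wt_dvd: "int c dvd m \<Longrightarrow> wt c m = 0"
  using sin_pi_frac_eq_0[of c m] by (cases "c = 0") (auto simp: wt_def cot_def)

lemma wt_minus: "wt c (- m) = - wt c m"
  by (simp add: wt_def)

lemma wt_periodic: "periodic c (wt c)"
  unfolding periodic_def
proof
  fix x
  show "wt c (x + int c) = wt c x"
  proof (cases "c = 0")
    case False
    then have "pi * of_int (x + int c) / of_nat c = pi * of_int x / of_nat c + pi"
      by (simp add: field_simps)
    then show ?thesis by (simp add: wt_def cot_def)
  qed simp
qed

text \<open>On \<open>(0, pi/2]\<close> one has \<open>x cos x <= sin x\<close>, that is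
  \<open>cot x <= 1/x\<close>; it follows from \<open>x <= tan x\<close> except at the endpoint,
  which is treated separately.\<close>

lemma wt_nonneg_le:
  assumes "m > 0" "2 * m \<le> int c"
  shows "0 \<le> wt c m" "wt c m \<le> 1 / (pi * of_int m)"
proof -
  define x where "x = pi * of_int m / of_nat c"
  have c: "c > 0" using assms by (cases c) auto
  have mc: "real_of_int m * 2 \<le> of_nat c" using assms(2)
    by (metis of_int_le_iff of_int_mult of_int_numeral of_int_of_nat_eq mult.commute)
  have x0: "x > 0" using assms c by (simp add: x_def)
  have x2: "x \<le> pi / 2" using mc c by (simp add: x_def field_simps)
  have sx: "sin x > 0" using x0 x2 by (intro sin_gt_zero) (auto intro: le_less_trans[OF x2])
  have "x * cos x \<le> sin x"
  proof (cases "x < pi / 2")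
    case True
    have "x \<le> tan x"
    proof (rule ccontr)
      assume "\<not> x \<le> tan x"
      then have "arctan (tan x) < arctan x" by (simp add: arctan_less_iff)
      moreover have "arctan (tan x) = x" using True x0 by (intro arctan_tan) auto
      moreover have "arctan x \<le> x" using x0 by (simp add: arctan_le_self)
      ultimately show False by simp
    qed
    moreover have "cos x > 0" using True x0 by (intro cos_gt_zero) auto
    ultimately show ?thesis by (simp add: tan_def field_simps)
  next
    case False
    then have x: "x = pi / 2" using x2 by simp
    show ?thesis unfolding x by simp
  qed
  then have "cot x \<le> 1 / x" using sx x0 by (simp add: cot_def field_simps)
  moreover have "0 \<le> cot x" using sx x0 x2 by (simp add: cot_def cos_ge_zero)
  ultimately show "0 \<le> wt c m" "wt c m \<le> 1 / (pi * of_int m)"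
    using c assms(1) unfolding wt_def x_def by (auto simp: field_simps)
qed

text \<open>From \<open>sin x <= x\<close> and \<open>cos x >= 1 - x^2/2\<close> at
  \<open>x = pi/c\<close>; the 8 comes from \<open>pi^2/2 < 8\<close>, and \<open>c > 3\<close>
  keeps the bound nonnegative.\<close>

lemma wt_1_ge: assumes "c > 3" shows "wt c 1 \<ge> (1 - 8 / (real c)\<^sup>2) / pi"
proof -
  define x where "x = pi / real c"
  have x0: "x > 0" using assms by (simp add: x_def)
  have "x < pi" using assms by (simp add: x_def field_simps)
  then have sx: "sin x > 0" using x0 by (intro sin_gt_zero) auto
  have c1: "cos x \<ge> 1 - x\<^sup>2 / 2" 
  proof -
    have "cos x = 1 - 2 * (sin (x / 2))\<^sup>2" using cos_double_sin[of "x / 2"] by simp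
    moreover have "(sin (x / 2))\<^sup>2 \<le> (x / 2)\<^sup>2"
      using x0 sin_x_le_x[of "x / 2"] abs_sin_x_le_abs_x[of "x / 2"] by (intro power2_le_iff_abs_le[THEN iffD2]) auto
    ultimately show ?thesis by (simp add: power_divide)
  qed
  have "x\<^sup>2 / 2 \<le> 8 / (real c)\<^sup>2"
  proof -
    have "pi * pi \<le> 4 * 4" using pi_less_4 pi_gt_zero by (intro mult_mono) auto
    then show ?thesis using assms by (simp add: x_def field_simps power2_eq_square)
  qed
  with c1 have c2: "cos x \<ge> 1 - 8 / (real c)\<^sup>2" by linarith
  have "8 / (real c)\<^sup>2 \<le> 8 / 4\<^sup>2" using assms by (intro divide_left_mono power_mono) auto
  then have pos: "1 - 8 / (real c)\<^sup>2 \<ge> 0" by simp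
  have "(1 - 8 / (real c)\<^sup>2) / x \<le> cot x"
    unfolding cot_def using c2 pos sx x0 sin_x_le_x[of x] by (intro frac_le) auto
  then show ?thesis using assms by (simp add: wt_def x_def field_simps)
qed

section \<open>The sawtooth function and its finite Fourier transform\<close>

lemma B1_periodic: assumes "c > 0" shows "periodic c (\<lambda>j. B1 (of_int j / of_nat c))"
  unfolding periodic_def
proof
  fix j
  have "of_int (j + int c) / real c = of_int j / real c + 1" using assms by (simp add: field_simps)
  moreover have "B1 (x + 1) = B1 x" for x
  proof -
    have "x + 1 \<in> \<int> \<longleftrightarrow> x \<in> \<int>"
      using Ints_diff[of "x + 1" 1] Ints_add[of x 1] by auto
    then show ?thesis by (simp add: B1_def)
  qed
  ultimately show "B1 (of_int (j + int c) / of_nat c) = B1 (of_int j / of_nat c)" by simp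
qed

lemma B1_frac: assumes "0 < j" "j < c" shows "B1 (real j / real c) = real j / real c - 1 / 2"
proof -
  have "\<lfloor>real j / real c\<rfloor> = 0" using assms by (simp add: floor_eq_iff)
  moreover from this have "real j / real c \<notin> \<int>" using assms by (auto elim!: Ints_cases)
  ultimately show ?thesis by (simp add: B1_def)
qed

lemma B1_0 [simp]: "B1 0 = 0" by (simp add: B1_def)

lemma sum_nat_power_root:
  fixes z :: complex
  assumes "z ^ n = 1" "z \<noteq> 1"
  shows "(\<Sum>j<n. of_nat j * z ^ j) = of_nat n / (z - 1)" "(\<Sum>j<n. z ^ j) = 0"
proof -
  show 2: "(\<Sum>j<n. z ^ j) = 0" using assms by (simp add: geometric_sum)
  have "(z - 1) * (\<Sum>j<m. of_nat j * z ^ j) = of_nat m * z ^ m - z * (\<Sum>j<m. z ^ j)" for m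
    by (induction m) (auto simp: algebra_simps)
  from this[of n] have "(z - 1) * (\<Sum>j<n. of_nat j * z ^ j) = of_nat n" using assms 2 by simp
  then show "(\<Sum>j<n. of_nat j * z ^ j) = of_nat n / (z - 1)" using assms(2) by (simp add: field_simps)
qed

lemma B1_sum_0: assumes "c > 0" shows "(\<Sum>j<c. B1 (real j / real c)) = 0"
proof -
  have "(\<Sum>j<c. B1 (real j / real c)) = (\<Sum>j<c. real j / real c - 1 / 2) + 1 / 2"
  proof -
    have "(\<Sum>j<c. B1 (real j / real c)) = (\<Sum>j<c. (real j / real c - 1 / 2) + (if j = 0 then 1/2 else 0))"
      by (intro sum.cong) (auto simp: B1_frac)
    then show ?thesis using assms by (simp add: sum.distrib)
  qed
  also have "(\<Sum>j<c. real j / real c - 1 / 2) = (\<Sum>j<c. real j) / real c - real c / 2"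
    by (simp add: sum_subtractf sum_divide_distrib)
  also have "(\<Sum>j<c. real j) = real c * (real c - 1) / 2"
    by (induction c) (auto simp: field_simps)
  finally show ?thesis using assms by (simp add: field_simps)
qed

text \<open>The sum is evaluated with \<open>j/c - 1/2\<close> in place of \<open>B1(j/c)\<close>;
  the two differ only at \<open>j = 0\<close>, by 1/2. With \<open>z = e^(-2 i \<phi>)\<close> and
  \<open>\<phi> = pi m/c\<close>, the result \<open>1/(z - 1) + 1/2\<close> is
  \<open>(i/2) cot \<phi>\<close>.\<close>

lemma B1_dft:
  assumes "c > 0"
  shows "(\<Sum>j\<in>{0..<int c}. of_real (B1 (of_int j / of_nat c)) * ee c (- (m * j)))
           = \<i> * of_nat c / 2 * of_real (wt c m)"
proof (cases "int c dvd m")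
  case True
  then have "ee c (- (m * j)) = 1" for j using assms by (simp add: ee_eq_1_iff)
  then have "(\<Sum>j\<in>{0..<int c}. of_real (B1 (of_int j / of_nat c)) * ee c (- (m * j)))
     = of_real (\<Sum>j<c. B1 (real j / real c))"
    by (simp add: sum_int_of_nat)
  then show ?thesis using True assms by (simp add: B1_sum_0 wt_dvd)
next
  case False
  define z where "z = ee c (- m)"
  have zj: "ee c (- (m * int j)) = z ^ j" for j
  proof (induction j)
    case (Suc j)
    have "- (m * int (Suc j)) = - m + - (m * int j)" by (simp add: algebra_simps)
    then show ?case using Suc by (simp only: ee_add z_def power_Suc)
  qed simp
  have z1: "z \<noteq> 1" using False assms by (simp add: z_def ee_eq_1_iff)
  have zc: "z ^ c = 1" unfolding zj[symmetric] using assms by (simp add: ee_eq_1_iff)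
  have "(\<Sum>j\<in>{0..<int c}. of_real (B1 (of_int j / of_nat c)) * ee c (- (m * j)))
     = (\<Sum>j<c. of_real (B1 (real j / real c)) * z ^ j)"
    by (simp add: sum_int_of_nat zj)
  also have "\<dots> = (\<Sum>j<c. (of_nat j / of_nat c - 1 / 2) * z ^ j + (if j = 0 then 1/2 else 0))"
    by (intro sum.cong) (auto simp: B1_frac)
  also have "\<dots> = (\<Sum>j<c. of_nat j * z ^ j) / of_nat c - (\<Sum>j<c. z ^ j) / 2 + 1 / 2"
    using assms by (simp add: sum.distrib left_diff_distrib sum_subtractf sum_divide_distrib)
  also have "\<dots> = 1 / (z - 1) + 1 / 2" using sum_nat_power_root[OF zc z1] assms by simp
  also have "\<dots> = \<i> / 2 * of_real (cot (pi * of_int m / of_nat c))"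
  proof -
    define \<phi> where "\<phi> = pi * of_int m / of_nat c"
    define s where "s = complex_of_real (sin \<phi>)"
    define t where "t = complex_of_real (cos \<phi>)"
    have s0: "s \<noteq> 0" using False assms sin_pi_frac_eq_0[of c m] by (simp add: s_def \<phi>_def)
    have st: "s * s + t * t = 1"
    proof -
      have "s * s + t * t = of_real ((sin \<phi>)\<^sup>2 + (cos \<phi>)\<^sup>2)"
        by (simp add: s_def t_def power2_eq_square)
      then show ?thesis by simp
    qed
    have "z = cis (- \<phi>) * cis (- \<phi>)" by (simp add: z_def ee_def \<phi>_def cis_mult mult.assoc)
    also have "cis (- \<phi>) = t - \<i> * s" by (simp add: complex_eq_iff t_def s_def)
    finally have z: "z = (t - \<i> * s) * (t - \<i> * s)" .
    have a1: "z - 1 = - 2 * \<i> * s * (t - \<i> * s)" 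
    proof -
      have "z - 1 = z - (s * s + t * t)" by (simp only: st)
      then show ?thesis by (simp add: z algebra_simps)
    qed
    have a2: "z + 1 = 2 * t * (t - \<i> * s)" 
    proof -
      have "z + 1 = z + (s * s + t * t)" by (simp only: st)
      then show ?thesis by (simp add: z algebra_simps)
    qed
    have nz: "t - \<i> * s \<noteq> 0" using a1 z1 by auto
    have "1 / (z - 1) + 1 / 2 = (z + 1) / (2 * (z - 1))" using z1 by (simp add: field_simps)
    also have "\<dots> = \<i> / 2 * (t / s)"
    proof -
      have "(2 * t * N) / (2 * (- 2 * \<i> * s * N)) = \<i> / 2 * (t / s)" if "N \<noteq> 0" for N
        using that s0 by (simp add: divide_simps)
      from this[OF nz] show ?thesis unfolding a1 a2 .
    qed
    finally show ?thesis by (simp add: cot_def s_def t_def \<phi>_def)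
  qed
  finally show ?thesis using assms by (simp add: wt_def)
qed

lemma B1_fourier:
  assumes "c > 0"
  shows "of_real (B1 (of_int k / of_nat c)) = \<i> / 2 * (\<Sum>m\<in>{0..<int c}. of_real (wt c m) * ee c (m * k))"
proof -
  have p: "periodic c (\<lambda>j. complex_of_real (B1 (of_int j / of_nat c)))"
    using B1_periodic[OF assms] by (simp add: periodic_def)
  have "of_nat c * complex_of_real (B1 (of_int k / of_nat c)) =
      (\<Sum>m\<in>{0..<int c}. (\<i> * of_nat c / 2 * of_real (wt c m)) * ee c (m * k))"
    unfolding sum_ee_fourier_inv[OF assms p, symmetric] B1_dft[OF assms] ..
  also have "\<dots> = of_nat c * (\<i> / 2 * (\<Sum>m\<in>{0..<int c}. of_real (wt c m) * ee c (m * k)))"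
    by (simp add: sum_distrib_left mult_ac)
  finally show ?thesis using assms by simp
qed

text \<open>Distribution relation of the cotangent. On the Fourier side the sum over
  \<open>s\<close> selects the \<open>j\<close> divisible by \<open>k\<close>, and
  \<open>B1(k y/(d k)) = B1(y/d)\<close>.\<close>

lemma wt_distribution:
  assumes "d > 0" "k > 0"
  shows "(\<Sum>s\<in>{0..<int k}. wt (d * k) (x + int d * s)) = wt d x"
proof -
  let ?c = "d * k"
  have c: "?c > 0" using assms by simp
  have "(\<Sum>s\<in>{0..<int k}. \<i> * of_nat ?c / 2 * of_real (wt ?c (x + int d * s))) =
     (\<Sum>s\<in>{0..<int k}. \<Sum>j\<in>{0..<int ?c}. of_real (B1 (of_int j / of_nat ?c)) * ee ?c (- ((x + int d * s) * j)))"
    by (simp only: B1_dft[OF c])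
  also have "\<dots> = (\<Sum>j\<in>{0..<int ?c}. of_real (B1 (of_int j / of_nat ?c)) * ee ?c (- (x * j)) * (\<Sum>s\<in>{0..<int k}. ee k (- j * s)))"
  proof -
    have "ee ?c (- ((x + int d * s) * j)) = ee ?c (- (x * j)) * ee k (- j * s)" for s j
    proof -
      have "- ((x + int d * s) * j) = - (x * j) + int d * (- j * s)" by (simp add: algebra_simps)
      then have "ee ?c (- ((x + int d * s) * j)) = ee ?c (- (x * j)) * ee ?c (int d * (- j * s))" by (simp only: ee_add)
      then show ?thesis using ee_scale[OF assms(1), of k "- j * s"] by simp
    qed
    then show ?thesis by (subst sum.swap) (simp add: sum_distrib_left mult.assoc)
  qed
  also have "\<dots> = (\<Sum>j\<in>{0..<int (k * d)}. if int k dvd j then of_nat k * of_real (B1 (of_int j / of_nat ?c)) * ee ?c (- (x * j)) else 0)"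
  proof -
    have "int k dvd - j \<longleftrightarrow> int k dvd j" for j by simp
    then have "(\<Sum>s\<in>{0..<int k}. ee k (- j * s)) = (if int k dvd j then of_nat k else 0)" for j
      using sum_ee[OF assms(2), of "- j"] by simp
    then show ?thesis by (intro sum.cong) (simp_all add: mult.commute)
  qed
  also have "\<dots> = (\<Sum>y\<in>{0..<int d}. of_nat k * (of_real (B1 (of_int y / of_nat d)) * ee d (- (x * y))))"
    unfolding sum_residues_dvd[OF assms(2)]
  proof (rule sum.cong[OF refl])
    fix y
    have "ee ?c (- (x * (int k * y))) = ee d (- (x * y))"
      using ee_scale[OF assms(2), of d "- (x * y)"] by (simp add: mult_ac)
    then show "of_nat k * of_real (B1 (of_int (int k * y) / of_nat ?c)) * ee ?c (- (x * (int k * y))) =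
       of_nat k * (of_real (B1 (of_int y / of_nat d)) * ee d (- (x * y)))"
      using assms by (simp add: mult_ac)
  qed
  also have "\<dots> = of_nat k * (\<i> * of_nat d / 2 * of_real (wt d x))"
    by (simp add: sum_distrib_left[symmetric] B1_dft[OF assms(1)])
  finally have "\<i> * of_nat ?c / 2 * of_real (\<Sum>s\<in>{0..<int k}. wt ?c (x + int d * s)) = \<i> * of_nat ?c / 2 * of_real (wt d x)"
    by (simp add: sum_distrib_left mult_ac)
  then have "complex_of_real (\<Sum>s\<in>{0..<int k}. wt ?c (x + int d * s)) = of_real (wt d x)"
    using assms by (simp del: of_real_sum)
  then show ?thesis by (simp only: of_real_eq_iff)
qed

lemma wt_scale: "p > 0 \<Longrightarrow> real p * wt (p * d) (int p * m) = wt d m"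
  by (cases "d = 0") (auto simp: wt_def field_simps)

text \<open>Exact analogue of the identity that the sum of \<open>f(m)/m\<close> over multiples of
  \<open>p\<close> is \<open>1/p\<close> times the sum of \<open>f(p m)/m\<close>:
  \<open>wt_scale\<close> passes to level \<open>c/p\<close>, where \<open>f(p m)\<close> is still
  periodic, and \<open>wt_distribution\<close> returns to level \<open>c\<close>.\<close>

lemma sum_wt_multiples:
  fixes f :: "int \<Rightarrow> complex"
  assumes "p > 0" "p dvd c" "c > 0" "periodic c f"
  shows "(\<Sum>m\<in>{0..<int c}. if int p dvd m then of_real (wt c m) * f m else 0)
          = (\<Sum>m\<in>{0..<int c}. of_real (wt c m) * f (int p * m)) / of_nat p"
proof -
  obtain d where c: "c = p * d" using assms(2) by (elim dvdE)
  have d: "d > 0" using assms(3) c by simp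
  have "(\<Sum>m\<in>{0..<int c}. if int p dvd m then of_real (wt c m) * f m else 0)
     = (\<Sum>y\<in>{0..<int d}. of_real (wt d y) / of_nat p * f (int p * y))"
    unfolding c sum_residues_dvd[OF assms(1)]
    using assms(1) by (intro sum.cong) (auto simp flip: wt_scale[OF assms(1), of d])
  also have "\<dots> = (\<Sum>y\<in>{0..<int d}. (\<Sum>s\<in>{0..<int p}. of_real (wt (d * p) (y + int d * s))) * f (int p * y)) / of_nat p"
    by (simp add: wt_distribution[OF d assms(1), symmetric] sum_divide_distrib[symmetric] flip: of_real_sum)
  also have "(\<Sum>y\<in>{0..<int d}. (\<Sum>s\<in>{0..<int p}. complex_of_real (wt (d * p) (y + int d * s))) * f (int p * y)) =
     (\<Sum>y\<in>{0..<int d}. \<Sum>s\<in>{0..<int p}. of_real (wt (d * p) (y + int d * s)) * f (int p * (y + int d * s)))"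
  proof -
    have "f (int p * (y + int d * s)) = f (int p * y)" for y s
      using periodicD_mult[OF assms(4), of "int p * y" s] by (simp add: c distrib_left mult.assoc)
    then show ?thesis by (simp add: sum_distrib_right)
  qed
  also have "\<dots> = (\<Sum>m\<in>{0..<int (d * p)}. of_real (wt (d * p) m) * f (int p * m))"
    by (rule sum_residues_split[OF d, symmetric])
  finally show ?thesis by (simp add: c mult.commute)
qed

section \<open>Dirichlet characters\<close>

lemma dirichlet_characterD:
  assumes "dirichlet_character q \<xi>"
  shows "q > 0" "\<xi> (a * b) = \<xi> a * \<xi> b" "periodic q \<xi>" "\<xi> a = 0 \<longleftrightarrow> \<not> coprime a (int q)"
    "\<xi> 1 = 1"
proof -
  show "q > 0" "\<xi> (a * b) = \<xi> a * \<xi> b" "periodic q \<xi>" "\<xi> a = 0 \<longleftrightarrow> \<not> coprime a (int q)"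
    using assms by (auto simp: dirichlet_character_def periodic_def)
  have "\<xi> (1 * 1) = \<xi> 1 * \<xi> 1" using assms unfolding dirichlet_character_def by blast
  moreover have "\<xi> 1 \<noteq> 0" using assms by (auto simp: dirichlet_character_def)
  ultimately show "\<xi> 1 = 1" by simp
qed

lemma coprime_int_inverse:
  assumes "coprime a (int n)" obtains b where "[a * b = 1] (mod int n)" "coprime b (int n)"
proof -
  obtain b where b: "[a * b = 1] (mod int n)" using assms cong_solve_coprime_int by blast
  then have "coprime (a * b) (int n)" by (metis cong_imp_coprime cong_sym coprime_1_left)
  then have "coprime b (int n)" by simp
  with b show thesis by (rule that)
qed

lemma dirichlet_character_power:
  assumes "dirichlet_character q \<xi>" shows "\<xi> (a ^ n) = \<xi> a ^ n"
  by (induction n) (simp_all add: dirichlet_characterD(2,5)[OF assms])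

lemma dirichlet_character_root:
  assumes "dirichlet_character q \<xi>" "coprime a (int q)" shows "\<xi> a ^ totient q = 1"
proof -
  note D = dirichlet_characterD[OF assms(1)]
  define b where "b = nat (a mod int q)"
  have b: "int b = a mod int q" using D(1) by (simp add: b_def)
  have "coprime (int b) (int q)" using assms(2) D(1) unfolding b by simp
  then have "coprime b q" by simp
  then have "[b ^ totient q = 1] (mod q)" by (rule euler_theorem)
  then have "[int b ^ totient q = 1] (mod int q)" by (metis cong_int_iff of_nat_1 of_nat_power)
  then have "\<xi> (int b ^ totient q) = 1" using periodic_cong[OF D(3)] D(5) by metis
  moreover have "\<xi> (int b) = \<xi> a" unfolding b by (rule periodic_mod[OF D(3)])
  ultimately show ?thesis by (simp add: dirichlet_character_power[OF assms(1)])
qed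

lemma dirichlet_character_norm:
  assumes "dirichlet_character q \<xi>" "coprime a (int q)" shows "cmod (\<xi> a) = 1"
proof -
  have "cmod (\<xi> a) ^ totient q = 1" using dirichlet_character_root[OF assms] by (metis norm_one norm_power)
  then have "cmod (\<xi> a) ^ totient q = 1 ^ totient q" by simp
  then show ?thesis by (rule power_eq_imp_eq_base) (use dirichlet_characterD(1)[OF assms(1)] in auto)
qed

lemma dirichlet_character_norm_le:
  assumes "dirichlet_character q \<xi>" shows "cmod (\<xi> a) \<le> 1"
  using dirichlet_character_norm[OF assms, of a] dirichlet_characterD(4)[OF assms, of a] by (cases "coprime a (int q)") auto

lemma dirichlet_character_minus_one:
  assumes "dirichlet_character q \<xi>" shows "\<xi> (- a) = \<xi> (- 1) * \<xi> a" "\<xi> (- 1) = 1 \<or> \<xi> (- 1) = - 1"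
proof -
  note D = dirichlet_characterD[OF assms]
  show "\<xi> (- a) = \<xi> (- 1) * \<xi> a" using D(2)[of "- 1" a] by simp
  have "\<xi> (- 1) * \<xi> (- 1) = 1" using D(2)[of "- 1" "- 1"] D(5) by simp
  then show "\<xi> (- 1) = 1 \<or> \<xi> (- 1) = - 1" by (simp add: square_eq_1_iff)
qed

text \<open>Add \<open>k d\<close> to \<open>n\<close>, where \<open>k\<close> is the product of the
  primes of \<open>q\<close> that do not divide \<open>n\<close>. A prime of \<open>q\<close> then
  divides exactly one of the two summands: if it divides \<open>n\<close>, it divides neither
  \<open>d\<close> nor \<open>k\<close>.\<close>

lemma coprime_lift:
  assumes "coprime n (int d)" "d dvd q" "q > 0"
  obtains m where "[m = n] (mod int d)" "coprime m (int q)"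
proof -
  define k where "k = \<Prod>{p \<in> prime_factors q. \<not> int p dvd n}"
  define m where "m = n + int k * int d"
  have "coprime m (int q)"
  proof (rule ccontr)
    assume "\<not> coprime m (int q)"
    then have "\<not> is_unit (gcd m (int q))" by (simp add: coprime_iff_gcd_eq_1)
    moreover have "gcd m (int q) \<noteq> 0" using assms(3) by simp
    ultimately obtain P where P: "P dvd gcd m (int q)" "prime P" using prime_divisor_exists by blast
    define p where "p = nat P"
    have Pp: "P = int p" using P(2) prime_ge_0_int[of P] by (simp add: p_def)
    have p: "prime p" "int p dvd m" "p dvd q" using P unfolding Pp by auto
    then have pq: "p \<in> prime_factors q" using assms(3) by (simp add: prime_factors_dvd)
    show False
    proof (cases "int p dvd n")
      case True
      then have "int p dvd int k * int d" using p(2) by (simp add: m_def dvd_add_right_iff)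
      then have "p dvd k * d" by (metis int_dvd_int_iff of_nat_mult)
      then have "p dvd k \<or> p dvd d" using p(1) by (simp add: prime_dvd_mult_iff)
      moreover have "\<not> p dvd d"
      proof
        assume "p dvd d"
        then have "int p dvd 1" using True assms(1) by (metis coprime_common_divisor int_dvd_int_iff)
        then show False using p(1) by simp
      qed
      moreover have "\<not> p dvd k"
      proof
        assume "p dvd k"
        then obtain p' where "p' \<in> {p \<in> prime_factors q. \<not> int p dvd n}" "p dvd p'"
          unfolding k_def using p(1) by (subst (asm) prime_dvd_prod_iff) auto
        then show False using True p(1) primes_dvd_imp_eq[of p p'] by (auto simp: in_prime_factors_iff)
      qed
      ultimately show False by blast
    next
      case False
      then have "p dvd k" unfolding k_def using pq by (intro dvd_prodI) auto
      then have "int p dvd int k * int d" by simp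
      then show False using p(2) False by (simp add: m_def dvd_add_left_iff)
    qed
  qed
  moreover have "[m = n] (mod int d)" by (simp add: m_def cong_def)
  ultimately show thesis using that by blast
qed

text \<open>Otherwise the character would depend, on units of \<open>q\<close>, only on the class
  modulo \<open>g\<close>; transported along lifts of units modulo \<open>g\<close> it would give a
  character modulo \<open>g\<close> inducing it.\<close>

lemma primitive_character_witness:
  assumes "primitive_character q \<xi>" "g dvd q" "g < q"
  obtains (witness) a where "[a = 1] (mod int g)" "coprime a (int q)" "\<xi> a \<noteq> 1"
proof (rule ccontr)
  assume contra: "\<not> thesis"
  have dc: "dirichlet_character q \<xi>" using assms(1) by (simp add: primitive_character_def)
  note D = dirichlet_characterD[OF dc]
  have one: "\<xi> a = 1" if "[a = 1] (mod int g)" "coprime a (int q)" for a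
    using contra witness that by blast
  have g: "g > 0" using assms(2) D(1) by (cases g) auto
  have eq: "\<xi> x = \<xi> y" if x: "coprime x (int q)" and y: "coprime y (int q)" and xy: "[x = y] (mod int g)" for x y
  proof -
    obtain z where z: "[y * z = 1] (mod int q)" "coprime z (int q)" using coprime_int_inverse[OF y] by blast
    have "[x * z = y * z] (mod int g)" using xy by (rule cong_scalar_right)
    moreover have "[y * z = 1] (mod int g)" using z(1) assms(2) by (meson cong_dvd_modulus int_dvd_int_iff)
    ultimately have "[x * z = 1] (mod int g)" by (rule cong_trans)
    then have "\<xi> (x * z) = 1" using one x z(2) by simp
    moreover have "\<xi> (y * z) = 1" using periodic_cong[OF D(3) z(1)] D(5) by simp
    moreover have "\<xi> z \<noteq> 0" using z(2) D(4) by simp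
    ultimately show ?thesis by (metis D(2) mult_cancel_right)
  qed
  define L where "L n = (SOME m. [m = n] (mod int g) \<and> coprime m (int q))" for n
  have L: "[L n = n] (mod int g)" "coprime (L n) (int q)" if "coprime n (int g)" for n
  proof -
    have "\<exists>m. [m = n] (mod int g) \<and> coprime m (int q)" using coprime_lift[OF that assms(2) D(1)] by blast
    from someI_ex[OF this] show "[L n = n] (mod int g)" "coprime (L n) (int q)" by (auto simp: L_def)
  qed
  define \<psi> where "\<psi> n = (if coprime n (int g) then \<xi> (L n) else 0)" for n
  have cg: "coprime x (int g)" if "coprime x (int q)" for x
    using that assms(2) by (meson coprime_divisors dvd_refl int_dvd_int_iff)
  have psi: "\<psi> n = \<xi> m" if "coprime m (int q)" "[m = n] (mod int g)" for m n
  proof -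
    have "coprime n (int g)" using cg[OF that(1)] that(2) cong_imp_coprime by blast
    then show ?thesis using L[of n] that eq unfolding \<psi>_def by (metis cong_sym cong_trans)
  qed
  have "dirichlet_character g \<psi>"
    unfolding dirichlet_character_def
  proof (intro conjI allI)
    show "g > 0" by fact
  next
    fix a b
    show "\<psi> (a * b) = \<psi> a * \<psi> b"
    proof (cases "coprime a (int g) \<and> coprime b (int g)")
      case True
      then have "\<psi> (a * b) = \<xi> (L a * L b)" using L[of a] L[of b] by (intro psi) (auto intro: cong_mult)
      then show ?thesis using True by (simp add: \<psi>_def D(2))
    qed (auto simp: \<psi>_def)
  next
    fix a
    have "coprime (a + int g) (int g) \<longleftrightarrow> coprime a (int g)" by (simp add: coprime_iff_gcd_eq_1)
    then show "\<psi> (a + int g) = \<psi> a"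
      using L[of a] psi[of "L a" "a + int g"] psi[of "L a" a] by (auto simp: \<psi>_def cong_def)
  next
    fix a show "\<psi> a = 0 \<longleftrightarrow> \<not> coprime a (int g)" using L[of a] D(4) by (auto simp: \<psi>_def)
  qed
  then have "induced_by q \<xi> g \<psi>" unfolding induced_by_def using assms(2) psi by (auto simp: cong_def)
  then show False using assms(1,3) by (auto simp: primitive_character_def)
qed

text \<open>This is the only consequence of primitivity that is used.\<close>

lemma primitive_character_class_sum:
  assumes "primitive_character q \<xi>" "q = g * k" "g < q"
  shows "(\<Sum>s\<in>{0..<int k}. \<xi> (A + int g * s)) = 0"
proof -
  have dc: "dirichlet_character q \<xi>" using assms(1) by (simp add: primitive_character_def)
  note D = dirichlet_characterD[OF dc]
  obtain a where a: "[a = 1] (mod int g)" "coprime a (int q)" "\<xi> a \<noteq> 1"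
    using primitive_character_witness[OF assms(1), of g] assms by auto
  obtain t where t: "a = 1 + int g * t" using a(1) by (metis cong_iff_lin cong_sym add.commute mult.commute)
  have p: "periodic k (\<lambda>s. \<xi> (A + int g * s))"
    unfolding periodic_def using periodicD_mult[OF D(3), of _ 1] by (simp add: assms(2) distrib_left add.assoc[symmetric])
  have ak: "coprime a (int k)" using a(2) assms(2) by simp
  \<comment> \<open>Multiplication by \<open>a = 1 + g t\<close> permutes the progression
    \<open>A + g s\<close>: it sends \<open>s\<close> to \<open>A t + a s\<close>, and
    \<open>a\<close> is a unit modulo \<open>k\<close>.\<close>
  have "\<xi> a * (\<Sum>s\<in>{0..<int k}. \<xi> (A + int g * s)) = (\<Sum>s\<in>{0..<int k}. \<xi> (A + int g * (A * t + a * s)))"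
    unfolding sum_distrib_left by (intro sum.cong refl, subst D(2)[symmetric]) (simp add: t algebra_simps)
  also have "\<dots> = (\<Sum>s\<in>{0..<int k}. \<xi> (A + int g * s))"
    by (rule sum_residues_affine[OF p ak])
  finally have "(\<xi> a - 1) * (\<Sum>s\<in>{0..<int k}. \<xi> (A + int g * s)) = 0" by (simp add: algebra_simps)
  then show ?thesis using a(3) by simp
qed

lemma nontrivial_character_modulus_ge_3:
  assumes "dirichlet_character q \<xi>" "nontrivial_character q \<xi>" shows "q \<ge> 3"
proof (rule ccontr)
  assume "\<not> q \<ge> 3"
  note D = dirichlet_characterD[OF assms(1)]
  have q: "q = 1 \<or> q = 2" using \<open>\<not> q \<ge> 3\<close> D(1) by linarith
  obtain a where a: "coprime a (int q)" "\<xi> a \<noteq> 1" using assms(2) by (auto simp: nontrivial_character_def)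
  have "[a = 1] (mod int q)" using q a(1) by (auto simp: cong_def odd_iff_mod_2_eq_one)
  then show False using periodic_cong[OF D(3)] D(5) a(2) by metis
qed

section \<open>Gauss sums of primitive characters\<close>

definition gauss_sum :: "nat \<Rightarrow> (int \<Rightarrow> complex) \<Rightarrow> complex" where
  "gauss_sum q \<xi> = (\<Sum>n\<in>{0..<int q}. cnj (\<xi> n) * ee q n)"

text \<open>For a unit \<open>m\<close> substitute \<open>m n\<close> for \<open>n\<close>.
  Otherwise, with \<open>h = gcd m q\<close>, the additive character has period \<open>q/h\<close>,
  and the character sums to 0 over each progression modulo \<open>q/h\<close>.\<close>

lemma primitive_gauss_separable:
  assumes "primitive_character q \<xi>"
  shows "(\<Sum>n\<in>{0..<int q}. cnj (\<xi> n) * ee q (m * n)) = \<xi> m * gauss_sum q \<xi>"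
proof -
  have dc: "dirichlet_character q \<xi>" using assms(1) by (simp add: primitive_character_def)
  note D = dirichlet_characterD[OF dc]
  show ?thesis
  proof (cases "coprime m (int q)")
    case True
    have nz: "\<xi> m * cnj (\<xi> m) = 1"
      using dirichlet_character_norm[OF dc True] complex_norm_square[of "\<xi> m"] by simp
    have p: "periodic q (\<lambda>n. cnj (\<xi> n) * ee q n)"
      using D(3) periodic_ee[of q 1] by (simp add: periodic_def)
    have "gauss_sum q \<xi> = (\<Sum>n\<in>{0..<int q}. cnj (\<xi> (m * n)) * ee q (m * n))"
      unfolding gauss_sum_def by (rule sum_residues_mult[OF p True, symmetric])
    also have "\<dots> = cnj (\<xi> m) * (\<Sum>n\<in>{0..<int q}. cnj (\<xi> n) * ee q (m * n))"
      by (simp add: D(2) sum_distrib_left mult.assoc)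
    finally show ?thesis using nz by (simp add: mult.assoc[symmetric])
  next
    case False
    define h where "h = nat (gcd m (int q))"
    have h: "int h = gcd m (int q)" by (simp add: h_def)
    have "int h dvd int q" unfolding h by simp
    then obtain g where g: "q = h * g" by auto
    have "h \<noteq> 1" using False h by (simp add: coprime_iff_gcd_eq_1)
    moreover have "h \<noteq> 0" using g D(1) by auto
    ultimately have h1: "h > 1" by simp
    have gq: "g < q" "g > 0" using g h1 D(1) by auto
    obtain m' where m': "m = int h * m'" using h by (metis gcd_dvd1 dvdE)
    have "(\<Sum>n\<in>{0..<int q}. cnj (\<xi> n) * ee q (m * n)) =
       (\<Sum>r\<in>{0..<int g}. \<Sum>s\<in>{0..<int h}. cnj (\<xi> (r + int g * s)) * ee q (m * (r + int g * s)))"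
      using sum_residues_split[OF gq(2), of "\<lambda>n. cnj (\<xi> n) * ee q (m * n)" h] by (simp only: g mult.commute[of h g])
    also have "\<dots> = (\<Sum>r\<in>{0..<int g}. ee q (m * r) * cnj (\<Sum>s\<in>{0..<int h}. \<xi> (r + int g * s)))"
    proof -
      have "ee q (m * (r + int g * s)) = ee q (m * r)" for r s
      proof -
        have "m * (r + int g * s) = m * r + int q * (m' * s)" by (simp add: m' g algebra_simps)
        then show ?thesis by (simp only: ee_add ee_self mult_1_right)
      qed
      then show ?thesis by (simp add: sum_distrib_left mult.commute)
    qed
    also have "\<dots> = 0"
      using primitive_character_class_sum[OF assms, of g h] gq g by (simp add: mult.commute)
    finally show ?thesis using False D(4) by simp
  qed
qed

text \<open>Fourier inversion of the conjugate character, evaluated at 1: by separability its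
  transform is again a character times the Gauss sum, and a second separation produces the conjugate
  Gauss sum.\<close>

lemma norm_gauss_sum:
  assumes "primitive_character q \<xi>"
  shows "(cmod (gauss_sum q \<xi>))\<^sup>2 = real q"
proof -
  have dc: "dirichlet_character q \<xi>" using assms(1) by (simp add: primitive_character_def)
  note D = dirichlet_characterD[OF dc]
  let ?G = "gauss_sum q \<xi>"
  have p: "periodic q (\<lambda>n. cnj (\<xi> n))" using D(3) by (simp add: periodic_def)
  have "(\<Sum>m\<in>{0..<int q}. (\<Sum>j\<in>{0..<int q}. cnj (\<xi> j) * ee q (- (m * j))) * ee q (m * 1)) = of_nat q * cnj (\<xi> 1)"
    by (rule sum_ee_fourier_inv[OF D(1) p])
  moreover have "(\<Sum>j\<in>{0..<int q}. cnj (\<xi> j) * ee q (- (m * j))) = \<xi> (- 1) * \<xi> m * ?G" for m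
    using primitive_gauss_separable[OF assms, of "- m"] by (simp add: dirichlet_character_minus_one(1)[OF dc, of m])
  ultimately have "\<xi> (- 1) * ?G * (\<Sum>m\<in>{0..<int q}. \<xi> m * ee q m) = of_nat q"
    by (simp add: D(5) sum_distrib_left mult_ac)
  moreover have "(\<Sum>m\<in>{0..<int q}. \<xi> m * ee q m) = \<xi> (- 1) * cnj ?G"
  proof -
    have pp: "periodic q (\<lambda>m. \<xi> m * ee q m)" using D(3) periodic_ee[of q 1] by (simp add: periodic_def)
    have "(\<Sum>m\<in>{0..<int q}. \<xi> m * ee q m) = (\<Sum>m\<in>{0..<int q}. \<xi> (- 1 * m) * ee q (- 1 * m))"
      by (rule sum_residues_mult[OF pp, symmetric]) simp
    also have "\<dots> = (\<Sum>m\<in>{0..<int q}. \<xi> (- 1) * (\<xi> m * cnj (ee q m)))"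
      by (intro sum.cong refl, subst D(2)) (simp add: ee_minus)
    also have "\<dots> = \<xi> (- 1) * cnj ?G" by (simp add: gauss_sum_def sum_distrib_left)
    finally show ?thesis .
  qed
  moreover have "\<xi> (- 1) * \<xi> (- 1) = 1" using dirichlet_character_minus_one(2)[OF dc] by auto
  ultimately have "?G * cnj ?G = of_nat q" by (metis (no_types, lifting) mult.assoc mult.commute mult_1_left)
  then have "complex_of_real ((cmod ?G)\<^sup>2) = of_real (real q)" by (simp only: complex_norm_square of_real_of_nat_eq)
  then show ?thesis by (simp only: of_real_eq_iff)
qed

section \<open>The Dedekind sum as a cotangent sum\<close>

locale dedekind_data =
  fixes q1 q2 D c :: nat and X1 X2 :: "int \<Rightarrow> complex"
  assumes prim1: "primitive_character q1 X1" and nontriv1: "nontrivial_character q1 X1"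
    and prim2: "primitive_character q2 X2" and nontriv2: "nontrivial_character q2 X2"
    and parity: "X1 (- 1) * X2 (- 1) = 1"
    and c_eq: "c = D * q2" and D_pos: "D > 0" and q1_dvd_D: "q1 dvd D"
begin

text \<open>Up to the factor \<open>D\<close> times a Gauss sum, the Fourier transform modulo
  \<open>c\<close> of the conjugate of \<open>X2\<close>; see \<open>kap_gauss\<close>.\<close>

definition kap :: "int \<Rightarrow> complex" where
  "kap n = (if int D dvd n then X2 (n div int D) else 0)"

definition R :: "int \<Rightarrow> complex" where
  "R a = (\<Sum>m\<in>{0..<int c}. \<Sum>l\<in>{0..<int c}. of_real (wt c l) * of_real (wt c m) * X1 m * kap (l + a * m))"

lemma dc1: "dirichlet_character q1 X1" and dc2: "dirichlet_character q2 X2"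
  using prim1 prim2 by (auto simp: primitive_character_def)

lemmas D1 = dirichlet_characterD[OF dc1] and D2 = dirichlet_characterD[OF dc2]

lemma q1_ge: "q1 \<ge> 3" and q2_ge: "q2 \<ge> 3"
  using nontrivial_character_modulus_ge_3 dc1 dc2 nontriv1 nontriv2 by auto

lemma c_pos: "c > 0" using c_eq D_pos q2_ge by simp

lemma q1_dvd_c: "q1 dvd c" using q1_dvd_D by (simp add: c_eq)

lemma D_ge: "D \<ge> 3" using q1_ge q1_dvd_D D_pos by (meson dvd_imp_le le_trans)

lemma kap_mult: "kap (int D * n) = X2 n" using D_pos by (simp add: kap_def)

lemma kap_periodic: "periodic c kap"
  unfolding periodic_def
proof
  fix x
  show "kap (x + int c) = kap x"
  proof (cases "int D dvd x")
    case True
    then obtain y where y: "x = int D * y" ..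
    have "x + int c = int D * (y + int q2)" by (simp add: y c_eq distrib_left)
    then show ?thesis using D2(3) by (simp add: kap_mult y periodic_def)
  next
    case False
    then show ?thesis by (simp add: kap_def c_eq dvd_add_left_iff)
  qed
qed

lemma kap_eq_0: "\<not> int D dvd n \<Longrightarrow> kap n = 0" by (simp add: kap_def)

lemma norm_kap_le: "cmod (kap n) \<le> 1"
  using dirichlet_character_norm_le[OF dc2] by (simp add: kap_def)

lemma X1_periodic_c: "periodic c X1" by (rule periodic_dvd[OF D1(3) q1_dvd_c])

text \<open>Write \<open>j = r + q2 s\<close>. The sum over \<open>s\<close> forces \<open>D\<close>
  to divide \<open>n\<close>, and what remains is a separable Gauss sum modulo
  \<open>q2\<close>.\<close>

lemma kap_gauss:
  "(\<Sum>j\<in>{0..<int c}. cnj (X2 j) * ee c (n * j)) = of_nat D * gauss_sum q2 X2 * kap n"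
proof -
  have q2: "q2 > 0" using q2_ge by simp
  have "(\<Sum>j\<in>{0..<int c}. cnj (X2 j) * ee c (n * j)) =
     (\<Sum>r\<in>{0..<int q2}. \<Sum>s\<in>{0..<int D}. cnj (X2 (r + int q2 * s)) * ee c (n * (r + int q2 * s)))"
    using sum_residues_split[OF q2, of "\<lambda>j. cnj (X2 j) * ee c (n * j)" D] by (simp only: c_eq mult.commute[of D q2])
  also have "\<dots> = (\<Sum>r\<in>{0..<int q2}. cnj (X2 r) * ee c (n * r) * (\<Sum>s\<in>{0..<int D}. ee D (n * s)))"
  proof -
    have "ee c (n * (r + int q2 * s)) = ee c (n * r) * ee D (n * s)" for r s
    proof -
      have "n * (r + int q2 * s) = n * r + int q2 * (n * s)" by (simp add: algebra_simps)
      then show ?thesis using ee_scale[OF q2, of D "n * s"] by (simp only: ee_add c_eq mult.commute[of D q2])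
    qed
    then show ?thesis by (simp add: periodicD_mult[OF D2(3)] sum_distrib_left mult.assoc)
  qed
  also have "\<dots> = (\<Sum>r\<in>{0..<int q2}. cnj (X2 r) * ee c (n * r)) * (if int D dvd n then of_nat D else 0)"
    by (simp add: sum_ee[OF D_pos] sum_distrib_right)
  also have "\<dots> = of_nat D * gauss_sum q2 X2 * kap n"
  proof (cases "int D dvd n")
    case True
    then obtain y where y: "n = int D * y" ..
    have "ee c (n * r) = ee q2 (y * r)" for r
      using ee_scale[OF D_pos, of q2 "y * r"] by (simp add: y c_eq mult.assoc)
    then have "(\<Sum>r\<in>{0..<int q2}. cnj (X2 r) * ee c (n * r)) = X2 y * gauss_sum q2 X2"
      using primitive_gauss_separable[OF prim2, of y] by simp
    then show ?thesis using True unfolding y kap_mult by simp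
  qed (simp add: kap_eq_0)
  finally show ?thesis .
qed

text \<open>Each of the two sawtooth factors contributes \<open>i/2\<close> through
  \<open>B1_fourier\<close>, hence \<open>-1/4\<close>. The sums over \<open>n\<close> and over
  \<open>j\<close> become Gauss sums by separability and by \<open>kap_gauss\<close>.\<close>

lemma dedekind_sum_eq_R:
  "dedekind_sum q1 X1 X2 a c = - (1 / 4) * of_nat D * gauss_sum q1 X1 * gauss_sum q2 X2 * R a"
proof -
  let ?C = "{0..<int c}"
  obtain k where k: "c = q1 * k" using q1_dvd_c by (elim dvdE)
  have k0: "k > 0" using k c_pos by (cases k) auto
  have q10: "q1 > 0" using q1_ge by simp
  have inner: "(\<Sum>n\<in>{0..<int q1}. cnj (X1 n) * of_real (B1 (of_int n / of_nat q1 + of_int (a * j) / of_nat c)))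
     = \<i> / 2 * gauss_sum q1 X1 * (\<Sum>m\<in>?C. of_real (wt c m) * X1 m * ee c (m * (a * j)))" for j
  proof -
    have B: "of_real (B1 (of_int n / of_nat q1 + of_int (a * j) / of_nat c)) =
       \<i> / 2 * (\<Sum>m\<in>?C. of_real (wt c m) * (ee q1 (m * n) * ee c (m * (a * j))))" for n
    proof -
      have "of_int n / real q1 + of_int (a * j) / real c = of_int (int k * n + a * j) / real c"
        using k0 q10 by (simp add: k field_simps)
      moreover have "ee c (m * (int k * n + a * j)) = ee q1 (m * n) * ee c (m * (a * j))" for m
      proof -
        have "m * (int k * n + a * j) = int k * (m * n) + m * (a * j)" by (simp add: algebra_simps)
        then show ?thesis using ee_scale[OF k0, of q1 "m * n"] by (simp only: ee_add k mult.commute[of q1 k])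
      qed
      ultimately show ?thesis by (simp only: B1_fourier[OF c_pos])
    qed
    have "(\<Sum>n\<in>{0..<int q1}. cnj (X1 n) * of_real (B1 (of_int n / of_nat q1 + of_int (a * j) / of_nat c)))
      = \<i> / 2 * (\<Sum>m\<in>?C. of_real (wt c m) * ee c (m * (a * j)) * (\<Sum>n\<in>{0..<int q1}. cnj (X1 n) * ee q1 (m * n)))"
      unfolding B by (simp only: sum_distrib_left, subst sum.swap) (simp only: mult_ac)
    then show ?thesis
      by (simp only: primitive_gauss_separable[OF prim1] sum_distrib_left mult_ac)
  qed
  have "dedekind_sum q1 X1 X2 a c = (\<Sum>j\<in>?C. cnj (X2 j) * of_real (B1 (of_int j / of_nat c)) *
     (\<Sum>n\<in>{0..<int q1}. cnj (X1 n) * of_real (B1 (of_int n / of_nat q1 + of_int (a * j) / of_nat c))))"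
    unfolding dedekind_sum_def by (simp only: sum_distrib_left mult_ac)
  also have "\<dots> = (\<Sum>j\<in>?C. \<Sum>m\<in>?C. \<Sum>l\<in>?C. - (1/4) * gauss_sum q1 X1 *
      (of_real (wt c l) * of_real (wt c m) * X1 m) * (cnj (X2 j) * ee c ((l + a * m) * j)))"
  proof (rule sum.cong[OF refl])
    fix j
    have e: "ee c ((l + a * m) * j) = ee c (l * j) * ee c (m * (a * j))" for l m
      by (subst ee_add[symmetric]) (simp add: algebra_simps)
    have "cnj (X2 j) * of_real (B1 (of_int j / of_nat c)) * (\<i> / 2 * gauss_sum q1 X1 * (\<Sum>m\<in>?C. of_real (wt c m) * X1 m * ee c (m * (a * j))))
      = (\<Sum>m\<in>?C. \<Sum>l\<in>?C. (\<i> / 2 * (\<i> / 2)) * gauss_sum q1 X1 * (of_real (wt c l) * of_real (wt c m) * X1 m) *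
         (cnj (X2 j) * (ee c (l * j) * ee c (m * (a * j)))))"
      unfolding B1_fourier[OF c_pos] by (simp only: sum_distrib_left sum_distrib_right mult_ac)
    then show "cnj (X2 j) * of_real (B1 (of_int j / of_nat c)) *
     (\<Sum>n\<in>{0..<int q1}. cnj (X1 n) * of_real (B1 (of_int n / of_nat q1 + of_int (a * j) / of_nat c))) =
      (\<Sum>m\<in>?C. \<Sum>l\<in>?C. - (1/4) * gauss_sum q1 X1 *
      (of_real (wt c l) * of_real (wt c m) * X1 m) * (cnj (X2 j) * ee c ((l + a * m) * j)))"
      unfolding inner e by simp
  qed
  also have "\<dots> = (\<Sum>m\<in>?C. \<Sum>l\<in>?C. - (1/4) * gauss_sum q1 X1 *
      (of_real (wt c l) * of_real (wt c m) * X1 m) * (\<Sum>j\<in>?C. cnj (X2 j) * ee c ((l + a * m) * j)))"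
    by (subst sum.swap, rule sum.cong[OF refl], subst sum.swap) (simp only: sum_distrib_left)
  also have "\<dots> = - (1 / 4) * of_nat D * gauss_sum q1 X1 * gauss_sum q2 X2 * R a"
    unfolding kap_gauss R_def by (simp only: sum_distrib_left mult_ac)
  finally show ?thesis .
qed

lemma norm_dedekind_sum:
  "(cmod (dedekind_sum q1 X1 X2 a c))\<^sup>2 = (real D)\<^sup>2 * real q1 * real q2 / 16 * (cmod (R a))\<^sup>2"
  unfolding dedekind_sum_eq_R
  by (simp add: norm_mult power_mult_distrib power_divide norm_gauss_sum[OF prim1] norm_gauss_sum[OF prim2])

lemma sum_norm_dedekind_sum:
  "(\<Sum>a\<in>A. (cmod (dedekind_sum q1 X1 X2 a c))\<^sup>2) =
     (real D)\<^sup>2 * real q1 * real q2 / 16 * (\<Sum>a\<in>A. (cmod (R a))\<^sup>2)"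
  by (simp add: norm_dedekind_sum sum_distrib_left)

end

section \<open>Nonvanishing of L-values of odd characters\<close>

text \<open>Logarithmic derivative of the reflection formula, written as the constancy of
  \<open>Gamma x * Gamma (1 - x) * sin (pi x)\<close>.\<close>

lemma Digamma_reflection_real:
  fixes x :: real
  assumes "0 < x" "x < 1"
  shows "Digamma (1 - x) - Digamma x = pi * cot (pi * x)"
proof -
  have G: "Gamma y * Gamma (1 - y) * sin (pi * y) = pi" if "0 < y" "y < 1" for y :: real
  proof -
    have "complex_of_real (Gamma y * Gamma (1 - y)) = of_real (pi / sin (pi * y))"
      using Gamma_reflection_complex[of "of_real y"]
      by (simp flip: Gamma_complex_of_real sin_of_real add: )
    then have "Gamma y * Gamma (1 - y) = pi / sin (pi * y)" by (simp only: of_real_eq_iff)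
    moreover have "sin (pi * y) > 0" using that by (intro sin_gt_zero) auto
    ultimately show ?thesis by (simp add: field_simps)
  qed
  let ?F = "\<lambda>y::real. Gamma y * Gamma (1 - y) * sin (pi * y)"
  have ni: "x \<notin> \<int>\<^sub>\<le>\<^sub>0" "1 - x \<notin> \<int>\<^sub>\<le>\<^sub>0" using assms by (auto elim!: nonpos_Ints_cases)
  have d1: "(?F has_field_derivative (Gamma x * Gamma (1 - x)) * ((Digamma x - Digamma (1 - x)) * sin (pi * x) + pi * cos (pi * x))) (at x)"
    using ni by (auto intro!: derivative_eq_intros simp: algebra_simps)
  have d2: "(?F has_field_derivative 0) (at x)"
  proof -
    have "((\<lambda>_. pi) has_field_derivative 0) (at x)" by simp
    then show ?thesis
      by (rule has_field_derivative_transform_within_open[of _ _ _ "{0<..<1}"]) (use assms G in auto)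
  qed
  have "(Gamma x * Gamma (1 - x)) * ((Digamma x - Digamma (1 - x)) * sin (pi * x) + pi * cos (pi * x)) = 0"
    by (rule DERIV_unique[OF d1 d2])
  moreover have "Gamma x * Gamma (1 - x) \<noteq> 0" using ni by (simp add: Gamma_eq_zero_iff)
  moreover have s: "sin (pi * x) > 0" using assms by (intro sin_gt_zero) auto
  ultimately have "(Digamma x - Digamma (1 - x)) * sin (pi * x) + pi * cos (pi * x) = 0" by simp
  then show ?thesis using s by (simp add: cot_def field_simps)
qed

text \<open>Identifies the cotangent sum with \<open>2/pi\<close> times the Dirichlet series of
  \<open>f\<close> at 1. Oddness pairs \<open>r\<close> with \<open>c - r\<close>; the logarithmic
  divergences of the sums \<open>S\<close> cancel in the pair, and the differences of digamma values
  are cotangents.\<close>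

lemma partial_sums_odd_periodic:
  fixes f :: "int \<Rightarrow> complex"
  assumes "c > 0" "periodic c f" and odd: "\<And>x. f (- x) = - f x"
  shows "(\<lambda>K. \<Sum>n<c * K. f (int n) / of_nat n) \<longlonglongrightarrow> of_real (pi / 2) * (\<Sum>r\<in>{0..<int c}. of_real (wt c r) * f r)"
proof -
  define S where "S K r = (\<Sum>k<K. inverse (real r / real c + real k))" for K r
  have f0: "f 0 = 0" using odd[of 0] by simp
  have eq: "(\<Sum>n<c * K. f (int n) / of_nat n) = (\<Sum>r\<in>{1..<c}. of_real (S K r) * f (int r)) / of_nat c" for K
  proof -
    have "(\<Sum>n<c * K. f (int n) / of_nat n) = (\<Sum>r<c. \<Sum>k<K. f (int (r + c * k)) / of_nat (r + c * k))"
    proof -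
      have "(\<Sum>n<c * K. f (int n) / of_nat n) = (\<Sum>n\<in>{0..<int (c * K)}. f n / of_int n)"
        by (subst sum_int_of_nat) simp
      also have "\<dots> = (\<Sum>r<c. \<Sum>k<K. f (int r + int c * int k) / of_int (int r + int c * int k))"
        by (subst sum_residues_split[OF assms(1)]) (simp only: sum_int_of_nat)
      finally show ?thesis by simp
    qed
    also have "\<dots> = (\<Sum>r<c. \<Sum>k<K. of_real (inverse (real r / real c + real k)) * f (int r) / of_nat c)"
    proof (intro sum.cong refl)
      fix r k
      have "f (int (r + c * k)) = f (int r)" using periodicD_mult[OF assms(2), of "int r" "int k"] by simp
      moreover have "real r / real c + real k = real (r + c * k) / real c" using assms(1) by (simp add: field_simps)
      then have "complex_of_real (inverse (real r / real c + real k)) = of_nat c / of_nat (r + c * k)"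
        by (simp only: inverse_divide of_real_divide of_real_of_nat_eq)
      ultimately show "f (int (r + c * k)) / of_nat (r + c * k) = of_real (inverse (real r / real c + real k)) * f (int r) / of_nat c"
        using assms(1) by simp
    qed
    also have "\<dots> = (\<Sum>r<c. of_real (S K r) * f (int r)) / of_nat c"
      by (simp add: S_def sum_distrib_right sum_divide_distrib)
    also have "(\<Sum>r<c. of_real (S K r) * f (int r)) = (\<Sum>r\<in>{1..<c}. of_real (S K r) * f (int r))"
      by (rule sum.mono_neutral_right) (use assms(1) f0 in \<open>auto simp: not_less_eq_eq\<close>)
    finally show ?thesis .
  qed
  have refl_sum: "(\<Sum>r\<in>{1..<c}. g (c - r)) = (\<Sum>r\<in>{1..<c}. g r)" for g :: "nat \<Rightarrow> complex"
    by (rule sum.reindex_bij_witness[where i = "\<lambda>r. c - r" and j = "\<lambda>r. c - r"]) auto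
  have eq2: "(\<Sum>r\<in>{1..<c}. of_real (S K r) * f (int r)) = (\<Sum>r\<in>{1..<c}. of_real (S K r - S K (c - r)) * f (int r)) / 2" for K
  proof -
    have "(\<Sum>r\<in>{1..<c}. of_real (S K (c - r)) * f (int r)) = (\<Sum>r\<in>{1..<c}. of_real (S K (c - (c - r))) * f (int (c - r)))"
      by (rule refl_sum[symmetric])
    also have "\<dots> = (\<Sum>r\<in>{1..<c}. - (of_real (S K r) * f (int r)))"
    proof (rule sum.cong[OF refl])
      fix r assume r: "r \<in> {1..<c}"
      have "f (int (c - r)) = f (- int r + int c)" using r by (simp add: of_nat_diff)
      also have "\<dots> = f (- int r)" using assms(2) unfolding periodic_def by blast
      also have "\<dots> = - f (int r)" by (rule odd)
      finally show "of_real (S K (c - (c - r))) * f (int (c - r)) = - (of_real (S K r) * f (int r))" using r by simp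
    qed
    finally show ?thesis by (simp add: left_diff_distrib sum_subtractf sum_negf)
  qed
  have lim: "(\<lambda>K. S K r - S K (c - r)) \<longlonglongrightarrow> pi * real c * wt c (int r)" if "r \<in> {1..<c}" for r
  proof -
    let ?x = "real r / real c"
    have x: "0 < ?x" "?x < 1" using that by auto
    have cx: "real (c - r) / real c = 1 - ?x" using that by (simp add: of_nat_diff field_simps)
    have "(\<lambda>K. (of_real (ln (real K)) - S K (c - r)) - (of_real (ln (real K)) - S K r)) \<longlonglongrightarrow> Digamma (1 - ?x) - Digamma ?x"
      unfolding S_def cx by (intro tendsto_diff Digamma_LIMSEQ; use x in linarith)
    then show ?thesis using that by (simp add: Digamma_reflection_real[OF x] wt_def)
  qed
  have "(\<lambda>K. (\<Sum>r\<in>{1..<c}. of_real (S K r - S K (c - r)) * f (int r)) / 2 / of_nat c) \<longlonglongrightarrow>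
      (\<Sum>r\<in>{1..<c}. of_real (pi * real c * wt c (int r)) * f (int r)) / 2 / of_nat c"
    using lim assms(1) by (intro tendsto_intros) auto
  also have "(\<Sum>r\<in>{1..<c}. of_real (pi * real c * wt c (int r)) * f (int r)) / 2 / of_nat c =
     of_real (pi / 2) * (\<Sum>r\<in>{1..<c}. of_real (wt c (int r)) * f (int r))"
    using assms(1) by (simp add: sum_distrib_left sum_divide_distrib mult_ac)
  also have "(\<Sum>r\<in>{1..<c}. of_real (wt c (int r)) * f (int r)) = (\<Sum>r\<in>{0..<int c}. of_real (wt c r) * f r)"
    unfolding sum_int_of_nat by (rule sum.mono_neutral_left) (use assms(1) f0 in \<open>auto simp: not_less_eq_eq\<close>)
  finally show ?thesis by (simp only: eq eq2)
qed

lemma abel_bound: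
  fixes f :: "nat \<Rightarrow> complex" and g :: "nat \<Rightarrow> real"
  assumes "\<And>n. cmod (\<Sum>k<n. f k) \<le> B" "\<And>n. 0 \<le> g n" "\<And>n. g (Suc n) \<le> g n"
  shows "cmod (\<Sum>k<n. f k * of_real (g k)) \<le> B * g 0"
proof -
  define S where "S n = (\<Sum>k<n. f k)" for n
  have S: "(\<Sum>k<n. f k * of_real (g k)) = S n * of_real (g n) + (\<Sum>k<n. S (Suc k) * of_real (g k - g (Suc k)))" for n
    by (induction n) (auto simp: S_def algebra_simps)
  have B: "B \<ge> 0" using order_trans[OF norm_ge_zero assms(1)] .
  have "cmod (\<Sum>k<n. S (Suc k) * of_real (g k - g (Suc k))) \<le> (\<Sum>k<n. B * (g k - g (Suc k)))"
  proof (rule sum_norm_le)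
    fix k
    have "cmod (S (Suc k) * of_real (g k - g (Suc k))) = cmod (S (Suc k)) * \<bar>g k - g (Suc k)\<bar>"
      by (simp only: norm_mult norm_of_real)
    also have "\<dots> \<le> B * (g k - g (Suc k))" using assms(1)[of "Suc k"] assms(3)[of k] by (simp add: S_def mult_right_mono)
    finally show "cmod (S (Suc k) * of_real (g k - g (Suc k))) \<le> B * (g k - g (Suc k))" .
  qed
  also have "\<dots> = B * (g 0 - g n)" by (simp add: sum_distrib_left[symmetric] sum_lessThan_telescope')
  finally have 1: "cmod (\<Sum>k<n. S (Suc k) * of_real (g k - g (Suc k))) \<le> B * (g 0 - g n)" .
  have 2: "cmod (S n * of_real (g n)) \<le> B * g n"
    using assms(1)[of n] assms(2)[of n] by (simp add: norm_mult S_def mult_right_mono)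
  show ?thesis unfolding S using norm_triangle_ineq[of "S n * of_real (g n)" "\<Sum>k<n. S (Suc k) * of_real (g k - g (Suc k))"] 1 2
    by (simp add: algebra_simps)
qed

lemma periodic_partial_sum_bound:
  fixes f :: "int \<Rightarrow> complex"
  assumes "c > 0" "periodic c f" "(\<Sum>r\<in>{0..<int c}. f r) = 0" "\<And>x. cmod (f x) \<le> 1"
  shows "cmod (\<Sum>k<n. f (int (a + k))) \<le> real c"
proof -
  have z: "(\<Sum>k<c. f (int (b + k))) = 0" for b
    using sum_residues_shift[OF assms(2), of "int b"] assms(3) unfolding sum_int_of_nat by (simp add: add.commute)
  have "(\<Sum>k<c * m + r. f (int (a + k))) = (\<Sum>k<r. f (int (a + c * m + k)))" for m r
  proof (induction m arbitrary: r)
    case (Suc m)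
    have "(\<Sum>k<c * Suc m + r. f (int (a + k))) = (\<Sum>k<c * m + (c + r). f (int (a + k)))" by (simp add: algebra_simps)
    also have "\<dots> = (\<Sum>k<c + r. f (int (a + c * m + k)))" by (rule Suc)
    also have "\<dots> = (\<Sum>k<c. f (int (a + c * m + k))) + (\<Sum>k<r. f (int (a + c * m + (c + k))))"
      by (induction r) (auto simp: algebra_simps)
    also have "\<dots> = (\<Sum>k<r. f (int (a + c * Suc m + k)))" by (simp only: z) (simp add: algebra_simps)
    finally show ?case .
  qed simp
  from this[of "n div c" "n mod c"]
  have "(\<Sum>k<n. f (int (a + k))) = (\<Sum>k<n mod c. f (int (a + c * (n div c) + k)))" by simp
  also have "cmod \<dots> \<le> (\<Sum>k<n mod c. 1)" by (intro sum_norm_le assms(4))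
  also have "\<dots> \<le> real c" using mod_less_divisor[OF assms(1), of n] by simp
  finally show ?thesis .
qed

section \<open>Divisor sums and Lambert series: \<open>L(1,X)\<close> for real characters\<close>

lemma multiplicity_power_times:
  fixes p :: nat
  assumes "prime p" "\<not> p dvd y" shows "multiplicity p (p ^ i * y) = i"
proof (rule multiplicity_eqI)
  show "\<not> p ^ Suc i dvd p ^ i * y" using assms by (simp add: mult.commute[of p] dvd_mult_cancel1)
qed simp

lemma divisor_sum_prime_power:
  fixes f :: "nat \<Rightarrow> real"
  assumes mult: "\<And>a b. f (a * b) = f a * f b" and p: "prime p" "\<not> p dvd m" and "m > 0"
  shows "(\<Sum>d | d dvd p ^ k * m. f d) = (\<Sum>i\<le>k. f (p ^ i)) * (\<Sum>d | d dvd m. f d)"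
proof -
  have "(\<Sum>i\<le>k. f (p ^ i)) * (\<Sum>d | d dvd m. f d) = (\<Sum>x\<in>{..k} \<times> {d. d dvd m}. f (p ^ fst x * snd x))"
    by (simp add: sum_product sum.cartesian_product mult case_prod_beta)
  also have "\<dots> = (\<Sum>d | d dvd p ^ k * m. f d)"
  proof (rule sum.reindex_bij_betw)
    have cop: "coprime (p ^ i) d" if "d dvd m" for i d
      using that p by (meson coprime_power_left_iff dvd_trans prime_imp_coprime)
    show "bij_betw (\<lambda>x. p ^ fst x * snd x) ({..k} \<times> {d. d dvd m}) {d. d dvd p ^ k * m}"
      unfolding bij_betw_def
    proof (intro conjI equalityI subsetI inj_onI)
      fix x y assume xy: "x \<in> {..k} \<times> {d. d dvd m}" "y \<in> {..k} \<times> {d. d dvd m}"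
        and e: "p ^ fst x * snd x = p ^ fst y * snd y"
      have "snd x dvd m" "snd y dvd m" using xy by auto
      then have nx: "\<not> p dvd snd x" "\<not> p dvd snd y" using p(2) by (meson dvd_trans)+
      have fe: "fst x = fst y" 
        using multiplicity_power_times[OF p(1) nx(1), of "fst x"] multiplicity_power_times[OF p(1) nx(2), of "fst y"] e by simp
      moreover have "snd x = snd y" using e p(1) unfolding fe by simp
      ultimately show "x = y" by (simp add: prod_eq_iff)
    next
      fix z assume "z \<in> (\<lambda>x. p ^ fst x * snd x) ` ({..k} \<times> {d. d dvd m})"
      then show "z \<in> {d. d dvd p ^ k * m}" by (auto intro!: mult_dvd_mono le_imp_power_dvd)
    next
      fix z assume "z \<in> {d. d dvd p ^ k * m}"
      then have "z dvd p ^ k * m" by simp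
      then obtain u v where uv: "z = u * v" "u dvd p ^ k" "v dvd m" by (elim dvd_productE)
      then obtain i where "i \<le> k" "u = p ^ i" using p(1) divides_primepow_nat by blast
      then show "z \<in> (\<lambda>x. p ^ fst x * snd x) ` ({..k} \<times> {d. d dvd m})"
        using uv by (intro image_eqI[of _ _ "(i, v)"]) auto
    qed
  qed
  finally show ?thesis by simp
qed

text \<open>At \<open>p^k\<close> the sum is 1 if \<open>f p = 0\<close>, \<open>k + 1\<close> if
  \<open>f p = 1\<close>, and 1 or 0 according to the parity of \<open>k\<close> if
  \<open>f p = -1\<close>. In a square all exponents are even, so every local factor is at least
  1.\<close>

lemma divisor_sum_nonneg:
  fixes f :: "nat \<Rightarrow> real"
  assumes mult: "\<And>a b. f (a * b) = f a * f b" and one: "f 1 = 1"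
    and val: "\<And>a. f a = 0 \<or> f a = 1 \<or> f a = - 1" and "n > 0"
  shows "(\<Sum>d | d dvd n. f d) \<ge> 0 \<and> ((\<exists>r. n = r * r) \<longrightarrow> (\<Sum>d | d dvd n. f d) \<ge> 1)"
  using \<open>n > 0\<close>
proof (induction n rule: less_induct)
  case (less n)
  show ?case
  proof (cases "n = 1")
    case True then show ?thesis using one by simp
  next
    case False
    then obtain p where p: "prime p" "p dvd n" using prime_factor_nat by blast
    define k where "k = multiplicity p n"
    obtain m where m: "n = p ^ k * m" "\<not> p dvd m"
      using multiplicity_decompose'[of n p] less.prems p(1) unfolding k_def by (metis neq0_conv not_prime_unit)
    have m0: "m > 0" using m less.prems by (cases m) auto
    have k: "k > 0" using p less.prems unfolding k_def by (simp add: prime_multiplicity_gt_zero_iff)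
    have "p ^ k > 1" using one_less_power[OF prime_gt_1_nat[OF p(1)] k] .
    then have "m < n" using m(1) m0 by simp
    note IH = less.IH[OF this m0]
    have fp: "f (p ^ i) = f p ^ i" for i by (induction i) (simp_all add: mult one[simplified])
    have s0: "(\<Sum>i\<le>k. f (p ^ i)) \<ge> 0 \<and> (even k \<longrightarrow> (\<Sum>i\<le>k. f (p ^ i)) \<ge> 1)"
    proof -
      consider "f p = 0" | "f p = 1" | "f p = -1" using val by blast
      then show ?thesis
      proof cases
        case 1
        then have "(\<Sum>i\<le>k. f (p ^ i)) = (\<Sum>i\<le>k. if i = 0 then 1 else 0)" unfolding fp by (intro sum.cong) auto
        then show ?thesis by simp
      next
        case 2 then show ?thesis by (simp add: fp)
      next
        case 3
        have "(\<Sum>i\<le>k. (- 1 :: real) ^ i) = (if even k then 1 else 0)" by (induction k) auto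
        then show ?thesis using 3 by (simp add: fp)
      qed
    qed
    have eq: "(\<Sum>d | d dvd n. f d) = (\<Sum>i\<le>k. f (p ^ i)) * (\<Sum>d | d dvd m. f d)"
      unfolding m(1) by (rule divisor_sum_prime_power[OF mult p(1) m(2) m0])
    have "(\<Sum>d | d dvd n. f d) \<ge> 1" if sq: "n = r * r" for r
    proof -
      have r0: "r \<noteq> 0" using sq less.prems by auto
      have "k = 2 * multiplicity p r" unfolding k_def sq
        using r0 p(1) by (simp add: prime_elem_multiplicity_mult_distrib prime_imp_prime_elem)
      then have ev: "even k" by simp
      have "\<exists>s. m = s * s"
      proof -
        define j where "j = multiplicity p r"
        obtain s where s: "r = p ^ j * s"
          using multiplicity_dvd[of p r] unfolding j_def by (elim dvdE)
        have kj: "k = 2 * j" using \<open>k = 2 * multiplicity p r\<close> by (simp add: j_def)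
        have "n = (p ^ j * s) * (p ^ j * s)" using sq s by simp
        then have "n = p ^ k * (s * s)" by (simp add: kj mult_2 power_add)
        then show ?thesis using m(1) p(1) by (metis mult_left_cancel power_eq_0_iff not_prime_0)
      qed
      then have "(\<Sum>d | d dvd m. f d) \<ge> 1" using IH by blast
      then show ?thesis unfolding eq using s0 ev by (metis mult_mono mult_1 zero_le_one order_trans)
    qed
    moreover have "(\<Sum>d | d dvd n. f d) \<ge> 0" unfolding eq using s0 IH by simp
    ultimately show ?thesis by blast
  qed
qed

text \<open>Arithmetic-geometric mean inequality, pairing the exponents \<open>i\<close> and
  \<open>n - 1 - i\<close>.\<close>

lemma geometric_amgm:
  fixes u :: real
  assumes "u \<ge> 0"
  shows "real n * u ^ (n - 1) \<le> (\<Sum>i<n. (u\<^sup>2) ^ i)"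
proof -
  have "2 * (real n * u ^ (n - 1)) = (\<Sum>i<n. 2 * u ^ (n - 1))" by simp
  also have "\<dots> \<le> (\<Sum>i<n. (u\<^sup>2) ^ i + (u\<^sup>2) ^ (n - Suc i))"
  proof (rule sum_mono)
    fix i assume i: "i \<in> {..<n}"
    have e: "n - 1 = i + (n - Suc i)" using i by auto
    have "0 \<le> (u ^ i - u ^ (n - Suc i))\<^sup>2" by simp
    also have "\<dots> = (u\<^sup>2) ^ i + (u\<^sup>2) ^ (n - Suc i) - 2 * u ^ (n - 1)"
      by (subst e) (simp add: power2_diff power_add power_mult[symmetric] mult.commute)
    finally show "2 * u ^ (n - 1) \<le> (u\<^sup>2) ^ i + (u\<^sup>2) ^ (n - Suc i)" by simp
  qed
  also have "\<dots> = 2 * (\<Sum>i<n. (u\<^sup>2) ^ i)"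
    by (simp add: sum.distrib sum.nat_diff_reindex)
  finally show ?thesis by simp
qed

text \<open>Compares \<open>1/(1 - t)\<close> times the series for \<open>L(1)\<close> with the
  Lambert series. These coefficients decrease in \<open>n\<close> from the value 1, so their sum
  against a character stays bounded as \<open>t\<close> tends to 1.\<close>

definition lambert_coeff :: "real \<Rightarrow> nat \<Rightarrow> real" where
  "lambert_coeff t n = 1 / ((real n) * (1 - t)) - t ^ n / (1 - t ^ n)"

lemma lambert_coeff_props:
  assumes t: "0 < t" "t < 1" and n: "n > 0"
  shows "lambert_coeff t n \<ge> 0" "lambert_coeff t (Suc n) \<le> lambert_coeff t n" "lambert_coeff t 1 = 1"
proof -
  define s where "s n = (\<Sum>i<n. t ^ i)" for n
  have s: "1 - t ^ n = (1 - t) * s n" for n unfolding s_def by (rule one_diff_power_eq)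
  have spos: "s n > 0" if "n > 0" for n
  proof -
    have "(1 - t) * s n > 0" unfolding s[symmetric] using t that by (simp add: power_less_one_iff)
    then show ?thesis using t by (simp add: zero_less_mult_iff)
  qed
  have b: "lambert_coeff t n = (1 / real n - t ^ n / s n) / (1 - t)" if "n > 0" for n
    using that t spos[OF that] unfolding lambert_coeff_def s by (simp add: diff_divide_distrib mult.commute)
  have "real n * t ^ n \<le> s n"
  proof -
    have "(\<Sum>i<n. t ^ n) \<le> s n" unfolding s_def using t by (intro sum_mono power_decreasing) auto
    then show ?thesis by simp
  qed
  then show "lambert_coeff t n \<ge> 0" unfolding b[OF n] using n t spos[OF n] by (simp add: field_simps)
  show "lambert_coeff t 1 = 1" using t by (simp add: lambert_coeff_def field_simps)
  \<comment> \<open>Monotonicity amounts to \<open>n (n + 1) t^n <= s n * s (n + 1)\<close>. The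
    square root splits the power between the two geometric sums: \<open>t^n <= u^(n-1) u^n\<close>,
    and \<open>geometric_amgm\<close> applies to each factor.\<close>
  define u where "u = sqrt t"
  have u: "u \<ge> 0" "t = u\<^sup>2" "u \<le> 1" using t by (auto simp: u_def)
  have m1: "real n * u ^ (n - 1) \<le> s n" "real (Suc n) * u ^ n \<le> s (Suc n)"
    using geometric_amgm[OF u(1), of n] geometric_amgm[OF u(1), of "Suc n"] by (simp_all add: s_def u(2))
  have "real n * real (Suc n) * t ^ n \<le> (real n * u ^ (n - 1)) * (real (Suc n) * u ^ n)"
  proof -
    have "t ^ n \<le> u ^ (n - 1) * u ^ n"
      unfolding u(2) power_mult[symmetric] power_add[symmetric] using u by (intro power_decreasing) auto
    then show ?thesis by (simp add: mult.assoc mult.left_commute mult_left_mono)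
  qed
  also have "\<dots> \<le> s n * s (Suc n)" using m1 u spos[OF n] by (intro mult_mono) auto
  finally have key: "real n * real (Suc n) * t ^ n \<le> s n * s (Suc n)" .
  have e: "t ^ n / s n - t ^ Suc n / s (Suc n) = t ^ n / (s n * s (Suc n))"
  proof -
    have "s (Suc n) = 1 + t * s n" unfolding s_def sum.lessThan_Suc_shift by (simp add: sum_distrib_left)
    then have "t ^ n * s (Suc n) - t ^ Suc n * s n = t ^ n" by (simp add: algebra_simps)
    then show ?thesis using spos[OF n] spos[of "Suc n"] by (simp add: diff_frac_eq mult.commute)
  qed
  have "t ^ n / (s n * s (Suc n)) \<le> 1 / (real n * real (Suc n))"
  proof -
    have "s n * s (Suc n) > 0" using spos[OF n] spos[of "Suc n"] by simp
    moreover have "real n * real (Suc n) > 0" using n by simp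
    ultimately show ?thesis using key by (simp only: pos_divide_le_eq pos_le_divide_eq mult_1_left times_divide_eq_left mult.commute[of "t ^ n"])
  qed
  also have "\<dots> = 1 / real n - 1 / real (Suc n)" using n by (simp add: field_simps)
  finally have "1 / real (Suc n) - t ^ Suc n / s (Suc n) \<le> 1 / real n - t ^ n / s n" using e by linarith
  then show "lambert_coeff t (Suc n) \<le> lambert_coeff t n"
    unfolding b[OF n] b[OF zero_less_Suc] using t by (intro divide_right_mono) auto
qed

lemma dirichlet_character_sum_0:
  assumes "dirichlet_character c X" "coprime a (int c)" "X a \<noteq> 1"
  shows "(\<Sum>r\<in>{0..<int c}. X r) = 0"
proof -
  note D = dirichlet_characterD[OF assms(1)]
  have "(\<Sum>r\<in>{0..<int c}. X r) = (\<Sum>r\<in>{0..<int c}. X (a * r))"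
    by (rule sum_residues_mult[OF D(3) assms(2), symmetric])
  also have "\<dots> = X a * (\<Sum>r\<in>{0..<int c}. X r)" by (simp add: D(2) sum_distrib_left)
  finally have "(X a - 1) * (\<Sum>r\<in>{0..<int c}. X r) = 0" by (simp add: algebra_simps)
  then show ?thesis using assms(3) by simp
qed

lemma sum_divisor_sum:
  fixes f :: "nat \<Rightarrow> real"
  shows "(\<Sum>n\<in>{1..N}. \<Sum>k\<in>{1..N div n}. f n * t ^ (n * k)) = (\<Sum>m\<in>{1..N}. (\<Sum>d | d dvd m. f d) * t ^ m)"
proof -
  have "(\<Sum>n\<in>{1..N}. \<Sum>k\<in>{1..N div n}. f n * t ^ (n * k)) =
     (\<Sum>x\<in>(SIGMA n:{1..N}. {1..N div n}). f (fst x) * t ^ (fst x * snd x))"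
    by (subst sum.Sigma) (auto simp: case_prod_beta)
  also have "\<dots> = (\<Sum>x\<in>(SIGMA m:{1..N}. {d. d dvd m}). f (snd x) * t ^ fst x)"
  proof (rule sum.reindex_bij_witness[where i = "\<lambda>(m, d). (d, m div d)" and j = "\<lambda>(n, k). (n * k, n)"])
    fix x assume "x \<in> (SIGMA n:{1..N}. {1..N div n})"
    then obtain n k where x: "x = (n, k)" "1 \<le> n" "n \<le> N" "1 \<le> k" "k \<le> N div n" by auto
    show "(case case x of (n, k) \<Rightarrow> (n * k, n) of (m, d) \<Rightarrow> (d, m div d)) = x" using x by simp
    have "n * k \<le> n * (N div n)" using x by simp
    also have "\<dots> \<le> N" by simp
    finally show "(case x of (n, k) \<Rightarrow> (n * k, n)) \<in> (SIGMA m:{1..N}. {d. d dvd m})" using x by simp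
    show "f (snd (case x of (n, k) \<Rightarrow> (n * k, n))) * t ^ fst (case x of (n, k) \<Rightarrow> (n * k, n)) = f (fst x) * t ^ (fst x * snd x)"
      using x by simp
  next
    fix x assume "x \<in> (SIGMA m:{1..N}. {d. d dvd m})"
    then obtain m d where x: "x = (m, d)" "1 \<le> m" "m \<le> N" "d dvd m" by auto
    have d: "1 \<le> d" "d \<le> m" using x by (auto intro: dvd_imp_le dvd_pos_nat simp: Suc_le_eq)
    show "(case case x of (m, d) \<Rightarrow> (d, m div d) of (n, k) \<Rightarrow> (n * k, n)) = x" using x by simp
    have "1 \<le> m div d" using d x by (simp add: div_greater_zero_iff Suc_le_eq)
    then show "(case x of (m, d) \<Rightarrow> (d, m div d)) \<in> (SIGMA n:{1..N}. {1..N div n})"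
      using x d by (auto intro: div_le_mono)
  qed
  also have "\<dots> = (\<Sum>m\<in>{1..N}. \<Sum>d | d dvd m. f d * t ^ m)"
    by (subst sum.Sigma) (auto simp: case_prod_beta)
  finally show ?thesis by (simp add: sum_distrib_right)
qed

text \<open>The Lambert series of \<open>f\<close> has the divisor sums as coefficients, so it
  dominates \<open>t + t^4 + t^9 + ...\<close>. If \<open>L(1)\<close> vanished, it would be minus
  the sum of \<open>f n * lambert_coeff t n\<close>, at most \<open>c\<close> for every
  \<open>t\<close>; but \<open>c + 1\<close> squares contribute \<open>c + 1\<close> in the limit
  \<open>t -> 1\<close>.\<close>

lemma L1_nonzero_real:
  assumes dc: "dirichlet_character c X" and c: "c > 1"
    and val: "\<And>a. X a = 0 \<or> X a = 1 \<or> X a = - 1"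
    and sum0: "(\<Sum>r\<in>{0..<int c}. X r) = 0"
    and lim: "(\<lambda>K. \<Sum>n<c * K. X (int n) / of_nat n) \<longlonglongrightarrow> 0"
  shows False
proof -
  note D = dirichlet_characterD[OF dc]
  define f where "f n = Re (X (int n))" for n
  have Xf: "X (int n) = of_real (f n)" for n using val[of "int n"] by (auto simp: f_def)
  have f_mult: "f (a * b) = f a * f b" for a b
  proof -
    have "complex_of_real (f (a * b)) = of_real (f a * f b)"
      using D(2)[of "int a" "int b"] unfolding of_nat_mult[symmetric] Xf of_real_mult .
    then show ?thesis by (simp only: of_real_eq_iff)
  qed
  have f1: "f 1 = 1" using D(5) by (simp add: f_def)
  have f_val: "f a = 0 \<or> f a = 1 \<or> f a = - 1" for a using val[of "int a"] by (auto simp: f_def)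
  have f_abs: "\<bar>f a\<bar> \<le> 1" for a using f_val[of a] by auto
  have fc: "f (c * K) = 0" for K
  proof -
    have "\<not> coprime (int (c * K)) (int c)" using c by simp
    then have "X (int (c * K)) = 0" using D(4) by blast
    then show ?thesis by (simp only: f_def zero_complex.sel)
  qed
  have P: "(\<lambda>K. \<Sum>n\<in>{1..c * K}. f n / real n) \<longlonglongrightarrow> 0"
  proof -
    have "(\<Sum>n<c * K. X (int n) / of_nat n) = of_real (\<Sum>n\<in>{1..c * K}. f n / real n)" for K
    proof -
      have "(\<Sum>n<c * K. X (int n) / of_nat n) = of_real (\<Sum>n<c * K. f n / real n)" by (simp add: Xf)
      also have "(\<Sum>n<c * K. f n / real n) = (\<Sum>n\<in>{1..c * K}. f n / real n)"
      proof (rule sum.mono_neutral_cong)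
        fix n assume "n \<in> {1..c * K} - {..<c * K}"
        then have "n = c * K" by auto
        then show "f n / real n = 0" using fc by simp
      qed (auto simp: not_less_eq_eq)
      finally show ?thesis .
    qed
    then have "(\<lambda>K. complex_of_real (\<Sum>n\<in>{1..c * K}. f n / real n)) \<longlonglongrightarrow> of_real 0" using lim by simp
    then show ?thesis by (simp only: tendsto_of_real_iff)
  qed
  have bound: "(\<Sum>m\<in>{1..M}. t ^ (m * m)) \<le> real c" if t: "0 < t" "t < 1" for t :: real and M
  proof -
    \<comment> \<open>Version truncated at \<open>N\<close>: cutting off the geometric series costs
      at most \<open>t^N/(1 - t)\<close> for each \<open>n\<close>, which disappears in the limit
      along \<open>N = c K\<close>.\<close>
    have ineq: "(\<Sum>m\<in>{1..M}. t ^ (m * m)) \<le> real N * (t ^ N / (1 - t)) + (\<Sum>n\<in>{1..N}. f n / real n) / (1 - t) + real c"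
      if N: "M * M \<le> N" for N
    proof -
      have pos: "0 \<le> (\<Sum>d | d dvd m. f d)" if "m > 0" for m
        using divisor_sum_nonneg[OF f_mult f1 f_val that] by blast
      have "(\<Sum>m\<in>{1..M}. t ^ (m * m)) = (\<Sum>m\<in>(\<lambda>m. m * m) ` {1..M}. t ^ m)"
        by (subst sum.reindex) (auto intro!: inj_onI simp flip: power2_eq_square)
      also have "\<dots> \<le> (\<Sum>m\<in>(\<lambda>m. m * m) ` {1..M}. (\<Sum>d | d dvd m. f d) * t ^ m)"
      proof (rule sum_mono)
        fix m assume "m \<in> (\<lambda>m. m * m) ` {1..M}"
        then obtain r where r: "m = r * r" "r > 0" by auto
        then have "m > 0" by simp
        with r have "1 \<le> (\<Sum>d | d dvd m. f d)" using divisor_sum_nonneg[OF f_mult f1 f_val, of m] by blast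
        then show "t ^ m \<le> (\<Sum>d | d dvd m. f d) * t ^ m" using t by simp
      qed
      also have "\<dots> \<le> (\<Sum>m\<in>{1..N}. (\<Sum>d | d dvd m. f d) * t ^ m)"
      proof (rule sum_mono2)
        show "(\<lambda>m. m * m) ` {1..M} \<subseteq> {1..N}" using N by (auto intro: order_trans[OF mult_le_mono])
      qed (use pos t in auto)
      also have "\<dots> = (\<Sum>n\<in>{1..N}. f n * (\<Sum>k\<in>{1..N div n}. (t ^ n) ^ k))"
        unfolding sum_divisor_sum[symmetric] by (simp add: sum_distrib_left power_mult)
      also have "\<dots> \<le> (\<Sum>n\<in>{1..N}. f n * (t ^ n / (1 - t ^ n)) + t ^ N / (1 - t))"
      proof (rule sum_mono)
        fix n assume n: "n \<in> {1..N}"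
        define K where "K = N div n"
        have tn: "t ^ n < 1" using t n by (simp add: power_less_one_iff)
        have tn': "t ^ n \<le> t" using t n power_decreasing[of 1 n t] by simp
        have "(1 - t ^ n) * (\<Sum>k\<in>{1..K}. (t ^ n) ^ k) = t ^ n - (t ^ n) ^ Suc K"
        proof (induction K)
          case (Suc K)
          have "(1 - t ^ n) * (\<Sum>k\<in>{1..Suc K}. (t ^ n) ^ k) = (1 - t ^ n) * (\<Sum>k\<in>{1..K}. (t ^ n) ^ k) + (1 - t ^ n) * (t ^ n) ^ Suc K"
            by (simp add: distrib_left)
          also have "\<dots> = t ^ n - (t ^ n) ^ Suc K + (1 - t ^ n) * (t ^ n) ^ Suc K" by (simp only: Suc.IH)
          also have "\<dots> = t ^ n - (t ^ n) ^ Suc (Suc K)" by (simp add: left_diff_distrib)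
          finally show ?case .
        qed simp
        then have s: "(\<Sum>k\<in>{1..K}. (t ^ n) ^ k) = t ^ n / (1 - t ^ n) - (t ^ n) ^ Suc K / (1 - t ^ n)"
          using tn by (simp only: diff_divide_distrib[symmetric]) (metis diff_gt_0_iff_gt less_irrefl nonzero_mult_div_cancel_left)
        have "N \<le> n * Suc K" using n unfolding K_def
          by (metis add.commute atLeastAtMost_iff div_mult_mod_eq less_imp_le mod_less_divisor mult.commute mult_Suc_right nat_add_left_cancel_le less_eq_Suc_le One_nat_def)
        then have "(t ^ n) ^ Suc K \<le> t ^ N" unfolding power_mult[symmetric] using t by (intro power_decreasing) auto
        then have "(t ^ n) ^ Suc K / (1 - t ^ n) \<le> t ^ N / (1 - t)" using tn' t by (intro frac_le) auto
        moreover have "0 \<le> (t ^ n) ^ Suc K / (1 - t ^ n)" using tn t by simp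
        ultimately have "- f n * ((t ^ n) ^ Suc K / (1 - t ^ n)) \<le> t ^ N / (1 - t)"
          using f_abs[of n] by (metis abs_le_iff mult_left_le_one_le mult_mono mult_1 order_trans zero_le_one)
        then show "f n * (\<Sum>k\<in>{1..N div n}. (t ^ n) ^ k) \<le> f n * (t ^ n / (1 - t ^ n)) + t ^ N / (1 - t)"
          unfolding K_def[symmetric] s by (simp add: right_diff_distrib)
      qed
      also have "\<dots> = (\<Sum>n\<in>{1..N}. f n * (t ^ n / (1 - t ^ n))) + real N * (t ^ N / (1 - t))"
        by (simp add: sum.distrib)
      also have "(\<Sum>n\<in>{1..N}. f n * (t ^ n / (1 - t ^ n))) =
          (\<Sum>n\<in>{1..N}. f n / real n) / (1 - t) - (\<Sum>n\<in>{1..N}. f n * lambert_coeff t n)"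
        unfolding sum_divide_distrib sum_subtractf[symmetric]
        by (intro sum.cong) (auto simp: lambert_coeff_def right_diff_distrib)
      finally have main: "(\<Sum>m\<in>{1..M}. t ^ (m * m)) \<le> (\<Sum>n\<in>{1..N}. f n / real n) / (1 - t) - (\<Sum>n\<in>{1..N}. f n * lambert_coeff t n) + real N * (t ^ N / (1 - t))" .
      have "- (\<Sum>n\<in>{1..N}. f n * lambert_coeff t n) \<le> real c"
      proof -
        have "cmod (\<Sum>k<N. X (int (1 + k)) * of_real (lambert_coeff t (Suc k))) \<le> real c * lambert_coeff t (Suc 0)"
        proof (rule abel_bound)
          show "cmod (\<Sum>k<n. X (int (1 + k))) \<le> real c" for n
            by (rule periodic_partial_sum_bound[OF D(1) D(3) sum0]) (rule dirichlet_character_norm_le[OF dc])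
        qed (use lambert_coeff_props[OF t] in auto)
        also have "(\<Sum>k<N. X (int (1 + k)) * of_real (lambert_coeff t (Suc k))) = of_real (\<Sum>n\<in>{1..N}. f n * lambert_coeff t n)"
        proof -
          have "(\<Sum>n\<in>{1..N}. f n * lambert_coeff t n) = (\<Sum>k<N. f (Suc k) * lambert_coeff t (Suc k))"
            by (rule sum.reindex_bij_witness[where i = Suc and j = "\<lambda>n. n - 1"]) auto
          then show ?thesis by (simp only: Xf plus_1_eq_Suc of_real_sum of_real_mult)
        qed
        finally have "\<bar>\<Sum>n\<in>{1..N}. f n * lambert_coeff t n\<bar> \<le> real c * lambert_coeff t 1"
          by (simp only: norm_of_real One_nat_def)
        then show ?thesis using lambert_coeff_props(3)[OF t zero_less_one] by (simp only: abs_le_iff) simp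
      qed
      with main show ?thesis by linarith
    qed
    have "(\<lambda>K. real (c * K) * (t ^ (c * K) / (1 - t)) + (\<Sum>n\<in>{1..c * K}. f n / real n) / (1 - t) + real c) \<longlonglongrightarrow> 0 / (1 - t) + 0 / (1 - t) + real c"
    proof (intro tendsto_add tendsto_divide P tendsto_const)
      have "(\<lambda>n. real n * t ^ n) \<longlonglongrightarrow> 0" using powser_times_n_limit_0[of t] t by simp
      moreover have "filterlim (\<lambda>K. c * K) at_top sequentially"
        using c by (intro mult_nat_left_at_top) simp
      ultimately have "(\<lambda>K. real (c * K) * t ^ (c * K)) \<longlonglongrightarrow> 0" by (rule filterlim_compose)
      then have "(\<lambda>K. real (c * K) * t ^ (c * K) / (1 - t)) \<longlonglongrightarrow> 0 / (1 - t)" by (intro tendsto_divide tendsto_const) (use t in auto)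
      then show "(\<lambda>K. real (c * K) * (t ^ (c * K) / (1 - t))) \<longlonglongrightarrow> 0 / (1 - t)" by simp
    qed (use t in auto)
    moreover have "eventually (\<lambda>K. (\<Sum>m\<in>{1..M}. t ^ (m * m)) \<le> real (c * K) * (t ^ (c * K) / (1 - t)) + (\<Sum>n\<in>{1..c * K}. f n / real n) / (1 - t) + real c) sequentially"
      using eventually_ge_at_top[of "M * M"]
    proof eventually_elim
      case (elim K)
      have "M * M \<le> c * K" using elim c by (metis le_trans mult_le_mono1 mult_1 less_imp_le)
      then show ?case by (rule ineq)
    qed
    ultimately have "(\<Sum>m\<in>{1..M}. t ^ (m * m)) \<le> 0 / (1 - t) + 0 / (1 - t) + real c"
      by (intro tendsto_lowerbound) auto
    then show ?thesis by simp
  qed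
  define M where "M = Suc c"
  have "((\<lambda>t::real. \<Sum>m\<in>{1..M}. t ^ (m * m)) \<longlongrightarrow> (\<Sum>m\<in>{1..M}. 1 ^ (m * m))) (at_left 1)"
    by (intro tendsto_intros)
  moreover have "eventually (\<lambda>t::real. (\<Sum>m\<in>{1..M}. t ^ (m * m)) \<le> real c) (at_left 1)"
    using eventually_at_left_real[of 0 1] by (rule eventually_mono) (use bound in auto)
  ultimately have "(\<Sum>m\<in>{1..M}. (1::real) ^ (m * m)) \<le> real c"
    by (intro tendsto_upperbound) auto
  then show False by (simp add: M_def)
qed

section \<open>Euler products and \<open>L(1,X)\<close> for complex characters\<close>

lemma three_four_one:
  fixes z :: complex and r :: real
  assumes "0 \<le> r" "r < 1" "cmod z = 1 \<or> z = 0"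
  shows "cmod (1 - of_real r) ^ 3 * cmod (1 - of_real r * z) ^ 4 * cmod (1 - of_real r * z\<^sup>2) \<le> 1"
proof (cases "z = 0")
  case True
  have "cmod (1 - of_real r) = 1 - r" using assms by (metis abs_of_nonneg diff_ge_0_iff_ge less_imp_le norm_of_real of_real_1 of_real_diff)
  then show ?thesis using assms True by (simp add: power_le_one)
next
  case False
  then have z: "cmod z = 1" using assms(3) by simp
  have log: "(\<lambda>n. Re (w ^ n) / real n) sums (- ln (cmod (1 - w)))" if "cmod w < 1" for w :: complex
  proof -
    have "w \<noteq> 1" using that by auto
    have "(\<lambda>n. - ((- (- w)) ^ n) / of_nat n) sums ln (1 + - w)" using that by (intro Ln_series') simp
    then have "(\<lambda>n. Re (- (w ^ n) / of_nat n)) sums Re (ln (1 - w))" using sums_Re by fastforce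
    then have "(\<lambda>n. - (Re (w ^ n) / real n)) sums ln (cmod (1 - w))" using \<open>w \<noteq> 1\<close> by (simp add: Re_Ln)
    from sums_minus[OF this] show ?thesis by simp
  qed
  have n1: "cmod (of_real r) < 1" "cmod (of_real r * z) < 1" "cmod (of_real r * z\<^sup>2) < 1"
    using assms z by (auto simp: norm_mult norm_power)
  have "(\<lambda>n. 3 * (Re (of_real r ^ n) / real n) + 4 * (Re ((of_real r * z) ^ n) / real n) + Re ((of_real r * z\<^sup>2) ^ n) / real n)
     sums (3 * (- ln (cmod (1 - of_real r))) + 4 * (- ln (cmod (1 - of_real r * z))) + - ln (cmod (1 - of_real r * z\<^sup>2)))"
    by (intro sums_add sums_mult log n1)
  \<comment> \<open>Termwise this is \<open>3 + 4 cos x + cos 2x = 2 (1 + cos x)^2\<close>.\<close>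
  moreover have "0 \<le> 3 * (Re (of_real r ^ n) / real n) + 4 * (Re ((of_real r * z) ^ n) / real n) + Re ((of_real r * z\<^sup>2) ^ n) / real n" for n
  proof -
    define u where "u = z ^ n"
    have "cmod u = 1" using z by (simp add: u_def norm_power)
    then have im: "(Im u)\<^sup>2 = 1 - (Re u)\<^sup>2" using cmod_power2[of u] by simp
    have A: "Re ((of_real r * z) ^ n) = r ^ n * Re u"
      by (simp add: power_mult_distrib u_def flip: of_real_power)
    have B: "Re ((of_real r * z\<^sup>2) ^ n) = r ^ n * (2 * (Re u)\<^sup>2 - 1)"
    proof -
      have "(of_real r * z\<^sup>2) ^ n = of_real (r ^ n) * u\<^sup>2"
        by (simp add: power_mult_distrib u_def flip: power_mult) (simp add: mult.commute)
      moreover have "Re (u\<^sup>2) = 2 * (Re u)\<^sup>2 - 1" using im by (simp add: power2_eq_square)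
      ultimately show ?thesis by simp
    qed
    have C: "Re (complex_of_real r ^ n) = r ^ n" by (simp flip: of_real_power)
    have "3 * (Re (of_real r ^ n) / real n) + 4 * (Re ((of_real r * z) ^ n) / real n) + Re ((of_real r * z\<^sup>2) ^ n) / real n
       = r ^ n * (2 * (1 + Re u)\<^sup>2) / real n"
      unfolding A B C by (simp add: add_divide_distrib[symmetric] power2_eq_square algebra_simps)
    also have "\<dots> \<ge> 0" using assms by simp
    finally show ?thesis .
  qed
  ultimately have le: "0 \<le> 3 * (- ln (cmod (1 - of_real r))) + 4 * (- ln (cmod (1 - of_real r * z))) + - ln (cmod (1 - of_real r * z\<^sup>2))"
    by (rule sums_le[OF _ sums_zero, rotated])
  have pos: "cmod (1 - w) > 0" if "cmod w < 1" for w using that by auto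
  have "ln (cmod (1 - of_real r) ^ 3 * cmod (1 - of_real r * z) ^ 4 * cmod (1 - of_real r * z\<^sup>2))
     = 3 * ln (cmod (1 - of_real r)) + 4 * ln (cmod (1 - of_real r * z)) + ln (cmod (1 - of_real r * z\<^sup>2))"
    using pos[OF n1(1)] pos[OF n1(2)] pos[OF n1(3)] by (simp add: ln_mult ln_realpow)
  then have "ln (cmod (1 - of_real r) ^ 3 * cmod (1 - of_real r * z) ^ 4 * cmod (1 - of_real r * z\<^sup>2)) \<le> ln 1" using le by simp
  then show ?thesis using pos[OF n1(1)] pos[OF n1(2)] pos[OF n1(3)] by (subst (asm) ln_le_cancel_iff) auto
qed

definition lser :: "(nat \<Rightarrow> complex) \<Rightarrow> real \<Rightarrow> nat \<Rightarrow> complex" where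
  "lser f s n = f n * of_real (real n powr (- s))"

lemma lser_summable:
  assumes "\<And>n. cmod (f n) \<le> 1" "s > 1" shows "lser f s summable_on A" "(\<lambda>n. real n powr (- s)) summable_on A"
proof -
  have "summable (\<lambda>n. real n powr (- s))" using assms(2) by (simp add: summable_real_powr_iff)
  then have *: "(\<lambda>n. real n powr (- s)) summable_on UNIV" by (intro norm_summable_imp_summable_on) simp
  then show "(\<lambda>n. real n powr (- s)) summable_on A" by (rule summable_on_subset_banach) simp
  have "lser f s summable_on UNIV"
  proof (rule norm_summable_imp_summable_on, rule summable_comparison_test')
    show "summable (\<lambda>n. real n powr (- s))" by fact
    show "norm (norm (lser f s n)) \<le> real n powr - s" for n
      using assms(1)[of n] by (simp add: lser_def norm_mult mult_left_le_one_le)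
  qed
  then show "lser f s summable_on A" by (rule summable_on_subset_banach) simp
qed

text \<open>Primes are removed one at a time: the integers free of \<open>P\<close> are those also
  prime to \<open>p\<close>, together with \<open>p\<close> times the integers free of
  \<open>P\<close>; complete multiplicativity pulls out the term at \<open>p\<close>.\<close>

lemma lser_euler:
  assumes f: "\<And>a b. f (a * b) = f a * f b" "\<And>n. cmod (f n) \<le> 1" and s: "s > 1"
    and P: "finite P" "\<And>p. p \<in> P \<Longrightarrow> prime p"
  shows "(\<Prod>p\<in>P. 1 - lser f s p) * infsum (lser f s) {n. n > 0} = infsum (lser f s) {n. n > 0 \<and> (\<forall>p\<in>P. \<not> p dvd n)}"
  using P
proof (induction P rule: finite_induct)
  case (insert p P)
  have aux: "(1 - x) * I = J" if "I = J + x * I" for I J x :: complex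
  proof -
    have "(1 - x) * I = I - x * I" by (simp add: left_diff_distrib)
    also have "\<dots> = J" using that by (metis add_diff_cancel_right')
    finally show ?thesis .
  qed
  let ?A = "{n. n > 0 \<and> (\<forall>q\<in>P. \<not> q dvd n)}"
  have p: "prime p" using insert.prems by simp
  have split: "?A = {n. n > 0 \<and> (\<forall>q\<in>insert p P. \<not> q dvd n)} \<union> (\<lambda>n. p * n) ` ?A"
  proof (intro equalityI subsetI)
    fix n assume n: "n \<in> ?A"
    show "n \<in> {n. n > 0 \<and> (\<forall>q\<in>insert p P. \<not> q dvd n)} \<union> (\<lambda>n. p * n) ` ?A"
    proof (cases "p dvd n")
      case True
      then obtain k where "n = p * k" ..
      then have "k \<in> ?A" using n by auto
      then show ?thesis using \<open>n = p * k\<close> by blast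
    qed (use n in auto)
  next
    fix n assume "n \<in> {n. n > 0 \<and> (\<forall>q\<in>insert p P. \<not> q dvd n)} \<union> (\<lambda>n. p * n) ` ?A"
    then show "n \<in> ?A"
    proof
      assume "n \<in> (\<lambda>n. p * n) ` ?A"
      then obtain k where k: "n = p * k" "k \<in> ?A" by blast
      have "\<not> q dvd n" if "q \<in> P" for q
      proof
        assume "q dvd n"
        moreover have q: "prime q" using insert.prems that by simp
        ultimately have "q dvd p \<or> q dvd k" using k(1) by (simp add: prime_dvd_mult_iff)
        then show False using k(2) that p q insert.hyps primes_dvd_imp_eq[of q p] by auto
      qed
      then show ?thesis using k p prime_gt_0_nat by auto
    qed auto
  qed
  have "infsum (lser f s) ?A = infsum (lser f s) {n. n > 0 \<and> (\<forall>q\<in>insert p P. \<not> q dvd n)} + infsum (lser f s) ((\<lambda>n. p * n) ` ?A)"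
    by (subst split, rule infsum_Un_disjoint) (use lser_summable[OF f(2) s] in auto)
  also have "infsum (lser f s) ((\<lambda>n. p * n) ` ?A) = infsum (\<lambda>n. lser f s p * lser f s n) ?A"
  proof (subst infsum_reindex)
    show "inj_on (\<lambda>n. p * n) ?A" using prime_gt_0_nat[OF p] by (auto intro: inj_onI)
    show "infsum (lser f s \<circ> (\<lambda>n. p * n)) ?A = infsum (\<lambda>n. lser f s p * lser f s n) ?A"
      by (intro infsum_cong) (simp add: lser_def f(1) powr_mult mult_ac)
  qed
  also have "\<dots> = lser f s p * infsum (lser f s) ?A" by (rule infsum_cmult_right')
  finally have "(1 - lser f s p) * infsum (lser f s) ?A = infsum (lser f s) {n. n > 0 \<and> (\<forall>q\<in>insert p P. \<not> q dvd n)}"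
    by (rule aux)
  then show ?case using insert by (simp add: mult.assoc)
qed simp

text \<open>Apart from 1, an integer without prime factors up to \<open>N\<close> exceeds
  \<open>N\<close>, so the deviation from 1 is bounded by a tail of the zeta series.\<close>

lemma lser_sieve_limit:
  assumes f1: "f 1 = 1" and f: "\<And>n. cmod (f n) \<le> 1" and s: "s > 1"
  shows "(\<lambda>N. infsum (lser f s) {n. n > 0 \<and> (\<forall>p\<in>{p. prime p \<and> p \<le> N}. \<not> p dvd n)}) \<longlonglongrightarrow> 1"
proof -
  let ?g = "\<lambda>n. real n powr (- s)"
  let ?A = "\<lambda>N. {n. n > 0 \<and> (\<forall>p\<in>{p. prime p \<and> p \<le> N}. \<not> p dvd n)}"
  have gs: "?g summable_on B" for B using lser_summable(2)[OF f s] .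
  have lim: "(\<lambda>N. infsum ?g UNIV - (\<Sum>n<Suc N. ?g n)) \<longlonglongrightarrow> 0"
  proof -
    have "(?g has_sum infsum ?g UNIV) UNIV" using gs by simp
    then have "?g sums infsum ?g UNIV" by (rule has_sum_imp_sums)
    then have "(\<lambda>N. \<Sum>n<Suc N. ?g n) \<longlonglongrightarrow> infsum ?g UNIV" unfolding sums_def by (rule LIMSEQ_Suc)
    then have "(\<lambda>N. infsum ?g UNIV - (\<Sum>n<Suc N. ?g n)) \<longlonglongrightarrow> infsum ?g UNIV - infsum ?g UNIV" by (intro tendsto_intros)
    then show ?thesis by simp
  qed
  have bound: "norm (infsum (lser f s) (?A N) - 1) \<le> infsum ?g UNIV - (\<Sum>n<Suc N. ?g n)" for N
  proof -
    have one: "1 \<in> ?A N" by (auto dest: prime_gt_1_nat)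
    have "infsum (lser f s) (insert 1 (?A N - {1})) = lser f s 1 + infsum (lser f s) (?A N - {1})"
      by (rule infsum_insert) (use lser_summable[OF f s] in auto)
    then have "infsum (lser f s) (?A N) = 1 + infsum (lser f s) (?A N - {1})"
      using one f1 by (simp add: insert_absorb lser_def)
    then have "norm (infsum (lser f s) (?A N) - 1) = norm (infsum (lser f s) (?A N - {1}))" by simp
    also have "\<dots> \<le> infsum ?g (?A N - {1})"
    proof (rule norm_infsum_le[OF has_sum_infsum[OF lser_summable(1)[OF f s]] has_sum_infsum[OF gs]])
      show "norm (lser f s n) \<le> ?g n" for n using f[of n] by (simp add: lser_def norm_mult mult_left_le_one_le)
    qed
    also have "\<dots> \<le> infsum ?g (UNIV - {..<Suc N})"
    proof (rule infsum_mono_neutral)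
      have "n > N" if n: "n \<in> ?A N" "n \<noteq> 1" for n
      proof (rule ccontr)
        assume "\<not> n > N"
        obtain p where p: "prime p" "p dvd n" using n(2) prime_factor_nat by blast
        then have "p \<le> N" using n \<open>\<not> n > N\<close> dvd_imp_le[of p n] by auto
        then show False using n p by auto
      qed
      then show "\<And>x. x \<in> ?A N - {1} - (UNIV - {..<Suc N}) \<Longrightarrow> ?g x \<le> 0" by fastforce
    qed (use gs in auto)
    also have "\<dots> = infsum ?g UNIV - infsum ?g {..<Suc N}" by (rule infsum_Diff) (use gs in auto)
    finally show ?thesis by simp
  qed
  have "(\<lambda>N. infsum (lser f s) (?A N) - 1) \<longlonglongrightarrow> 0"
    by (rule Lim_null_comparison[OF _ lim]) (use bound in auto)
  then show ?thesis by (simp add: LIM_zero_iff)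
qed

text \<open>By \<open>lser_euler\<close> a sifted sum is the full sum times finitely many Euler
  factors, whose combination is at most 1 by \<open>three_four_one\<close>; the sifted sums tend to
  1.\<close>

lemma euler_product_bound:
  assumes f: "\<And>a b. f (a * b) = f a * f b" "f 1 = 1" "\<And>n. cmod (f n) = 1 \<or> f n = 0" and s: "s > 1"
  shows "1 \<le> cmod (infsum (lser (\<lambda>_. 1) s) {n. n > 0}) ^ 3 * cmod (infsum (lser f s) {n. n > 0}) ^ 4
              * cmod (infsum (lser (\<lambda>n. (f n)\<^sup>2) s) {n. n > 0})"
proof -
  let ?P = "\<lambda>N. {p::nat. prime p \<and> p \<le> N}"
  let ?L = "\<lambda>f. infsum (lser f s) {n. n > 0}"
  let ?LN = "\<lambda>f N. infsum (lser f s) {n. n > 0 \<and> (\<forall>p\<in>?P N. \<not> p dvd n)}"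
  let ?f0 = "\<lambda>_::nat. 1 :: complex" and ?f2 = "\<lambda>n. (f n)\<^sup>2"
  have f': "cmod (f n) \<le> 1" for n using f(3)[of n] by auto
  have f2: "cmod (?f2 n) \<le> 1" for n using f'[of n] by (simp add: norm_power power_le_one)
  have fin: "finite (?P N)" for N by simp
  have E: "(\<Prod>p\<in>?P N. 1 - lser g s p) * ?L g = ?LN g N" if "\<And>a b. g (a * b) = g a * g b" "\<And>n. cmod (g n) \<le> 1" for g N
    by (rule lser_euler[OF that s fin]) auto
  have "(\<lambda>N. cmod (?LN ?f0 N) ^ 3 * cmod (?LN f N) ^ 4 * cmod (?LN ?f2 N)) \<longlonglongrightarrow> cmod 1 ^ 3 * cmod 1 ^ 4 * cmod 1"
    using f f' f2 s by (intro tendsto_intros lser_sieve_limit) auto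
  then have lim: "(\<lambda>N. cmod (?LN ?f0 N) ^ 3 * cmod (?LN f N) ^ 4 * cmod (?LN ?f2 N)) \<longlonglongrightarrow> 1" by simp
  have "cmod (?LN ?f0 N) ^ 3 * cmod (?LN f N) ^ 4 * cmod (?LN ?f2 N) \<le> cmod (?L ?f0) ^ 3 * cmod (?L f) ^ 4 * cmod (?L ?f2)" for N
  proof -
    have "cmod (?LN ?f0 N) ^ 3 * cmod (?LN f N) ^ 4 * cmod (?LN ?f2 N) =
      (\<Prod>p\<in>?P N. cmod (1 - lser ?f0 s p) ^ 3 * cmod (1 - lser f s p) ^ 4 * cmod (1 - lser ?f2 s p)) *
      (cmod (?L ?f0) ^ 3 * cmod (?L f) ^ 4 * cmod (?L ?f2))"
    proof -
      have N: "cmod (?LN g N) = (\<Prod>p\<in>?P N. cmod (1 - lser g s p)) * cmod (?L g)"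
        if "\<And>a b. g (a * b) = g a * g b" "\<And>n. cmod (g n) \<le> 1" for g
        by (subst E[OF that, symmetric]) (simp add: norm_mult prod_norm)
      have N0: "cmod (?LN ?f0 N) = (\<Prod>p\<in>?P N. cmod (1 - lser ?f0 s p)) * cmod (?L ?f0)" by (rule N) auto
      have N1: "cmod (?LN f N) = (\<Prod>p\<in>?P N. cmod (1 - lser f s p)) * cmod (?L f)" by (rule N[OF f(1) f'])
      have N2: "cmod (?LN ?f2 N) = (\<Prod>p\<in>?P N. cmod (1 - lser ?f2 s p)) * cmod (?L ?f2)"
        by (rule N[OF _ f2]) (simp add: f(1) power_mult_distrib)
      show ?thesis unfolding N0 N1 N2 prod.distrib prod_power_distrib[symmetric] by (simp only: power_mult_distrib mult_ac)
    qed
    also have "\<dots> \<le> 1 * (cmod (?L ?f0) ^ 3 * cmod (?L f) ^ 4 * cmod (?L ?f2))"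
    proof (rule mult_right_mono[OF prod_le_1])
      fix p assume "p \<in> ?P N"
      then have p: "real p > 1" by (auto dest: prime_gt_1_nat)
      have "real p powr (- s) < 1" using p s by (simp add: powr_less_one)
      then have "cmod (1 - of_real (real p powr (- s))) ^ 3 * cmod (1 - of_real (real p powr (- s)) * f p) ^ 4 * cmod (1 - of_real (real p powr (- s)) * (f p)\<^sup>2) \<le> 1"
        using f(3)[of p] by (intro three_four_one) auto
      then show "0 \<le> cmod (1 - lser ?f0 s p) ^ 3 * cmod (1 - lser f s p) ^ 4 * cmod (1 - lser ?f2 s p) \<and>
         cmod (1 - lser ?f0 s p) ^ 3 * cmod (1 - lser f s p) ^ 4 * cmod (1 - lser ?f2 s p) \<le> 1"
        by (simp add: lser_def mult.commute)
    qed simp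
    finally show ?thesis by simp
  qed
  then show ?thesis by (intro LIMSEQ_le_const2[OF lim]) auto
qed

text \<open>The first estimate controls the summation by parts in \<open>L_bound_zero\<close>; the
  second compares the zeta series with a telescoping sum.\<close>

lemma powr_neg_step:
  assumes "0 < d" "0 < n"
  shows "real n powr (- d) - real (Suc n) powr (- d) \<le> d / real n"
    and "d * real (Suc n) powr (- (1 + d)) \<le> real n powr (- d) - real (Suc n) powr (- d)"
proof -
  have n: "real n > 0" using assms by simp
  have "1 - d / real n \<le> (1 + 1 / real n) powr (- d)"
  proof -
    have "ln (1 + 1 / real n) \<le> 1 / real n" by (rule ln_add_one_self_le_self) simp
    then have "- d * (1 / real n) \<le> - d * ln (1 + 1 / real n)" using assms(1) by (intro mult_left_mono_neg) auto
    then have "1 - d / real n \<le> 1 + - d * ln (1 + 1 / real n)" by simp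
    also have "\<dots> \<le> exp (- d * ln (1 + 1 / real n))" by (rule exp_ge_add_one_self)
    also have "\<dots> = (1 + 1 / real n) powr (- d)"
    proof -
      have "1 + 1 / real n \<noteq> 0" using n by (simp add: add_pos_pos less_imp_neq[symmetric])
      then show ?thesis by (simp add: powr_def)
    qed
    finally show ?thesis .
  qed
  moreover have "real (Suc n) powr (- d) = real n powr (- d) * (1 + 1 / real n) powr (- d)"
  proof -
    have "real (Suc n) = real n * (1 + 1 / real n)" using n by (simp add: field_simps)
    then show ?thesis using n by (simp add: powr_mult)
  qed
  moreover have "real n powr (- d) \<le> 1" using assms by (simp add: powr_minus_divide ge_one_powr_ge_zero)
  ultimately show "real n powr (- d) - real (Suc n) powr (- d) \<le> d / real n"
  proof -
    assume h: "1 - d / real n \<le> (1 + 1 / real n) powr - d"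
      and e: "real (Suc n) powr (- d) = real n powr (- d) * (1 + 1 / real n) powr (- d)"
      and l: "real n powr (- d) \<le> 1"
    have "real n powr (- d) - real (Suc n) powr (- d) = real n powr (- d) * (1 - (1 + 1 / real n) powr (- d))"
      unfolding e by (simp add: right_diff_distrib)
    also have "\<dots> \<le> real n powr (- d) * (d / real n)" using h by (intro mult_left_mono) auto
    also have "\<dots> \<le> 1 * (d / real n)" using l assms by (intro mult_right_mono) auto
    finally show ?thesis by simp
  qed
  define M where "M = real (Suc n)"
  have M: "M > 1" using assms by (simp add: M_def)
  have "1 + d / M \<le> (1 - 1 / M) powr (- d)"
  proof -
    have p: "1 - 1 / M > 0" using M by simp
    have "ln (1 - 1 / M) \<le> - 1 / M" using ln_le_minus_one[OF p] by simp
    then have "- d * (- 1 / M) \<le> - d * ln (1 - 1 / M)" using assms(1) by (intro mult_left_mono_neg) auto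
    then have "1 + d / M \<le> 1 + - d * ln (1 - 1 / M)" by simp
    also have "\<dots> \<le> exp (- d * ln (1 - 1 / M))" by (rule exp_ge_add_one_self)
    finally show ?thesis using p M by (simp add: powr_def)
  qed
  then have "M powr (- d) * (1 + d / M) \<le> M powr (- d) * (1 - 1 / M) powr (- d)" by (intro mult_left_mono) auto
  also have "\<dots> = (M * (1 - 1 / M)) powr (- d)" using M by (simp add: powr_mult)
  also have "M * (1 - 1 / M) = real n" using M by (simp add: M_def field_simps)
  finally have "M powr (- d) + d * (M powr (- d) / M) \<le> real n powr (- d)" by (simp add: algebra_simps)
  moreover have "M powr (- (1 + d)) = M powr (- d) / M"
  proof -
    have "- (1 + d) = - d - 1" by simp
    then show ?thesis using M by (simp only: powr_diff) simp
  qed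
  ultimately show "d * real (Suc n) powr (- (1 + d)) \<le> real n powr (- d) - real (Suc n) powr (- d)"
    unfolding M_def by simp
qed

lemma lser_limit:
  assumes "\<And>n. cmod (f n) \<le> 1" "s > 1"
  shows "(\<lambda>N. \<Sum>k<N. lser f s (Suc k)) \<longlonglongrightarrow> infsum (lser f s) {n. n > 0}"
proof -
  have "infsum (lser f s) {n. n > 0} = infsum (lser f s) UNIV"
    by (rule infsum_cong_neutral) (auto simp: lser_def)
  moreover have "lser f s sums infsum (lser f s) UNIV"
    by (intro has_sum_imp_sums has_sum_infsum lser_summable assms)
  moreover have "(\<Sum>k<N. lser f s (Suc k)) = (\<Sum>k<Suc N. lser f s k)" for N
    by (subst sum.lessThan_Suc_shift) (simp add: lser_def)
  ultimately show ?thesis unfolding sums_def using LIMSEQ_Suc[of "\<lambda>n. sum (lser f s) {..<n}"] by (simp only:)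
qed

lemma zeta_bound:
  assumes "0 < d"
  shows "cmod (infsum (lser (\<lambda>_. 1) (1 + d)) {n. n > 0}) \<le> 1 + 1 / d"
proof -
  have *: "(\<Sum>k<N. real (Suc k) powr (- (1 + d))) \<le> 1 + (1 - real N powr (- d)) / d" if "N > 0" for N
    using that
  proof (induction N)
    case (Suc N)
    show ?case
    proof (cases "N = 0")
      case False
      then have "(\<Sum>k<N. real (Suc k) powr (- (1 + d))) \<le> 1 + (1 - real N powr (- d)) / d" using Suc.IH by simp
      moreover have "real (Suc N) powr (- (1 + d)) \<le> (real N powr (- d) - real (Suc N) powr (- d)) / d"
        using powr_neg_step(2)[OF assms, of N] False assms by (simp add: pos_le_divide_eq mult.commute)
      ultimately show ?thesis by (simp add: diff_divide_distrib)
    qed simp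
  qed simp
  have "(\<Sum>k<N. real (Suc k) powr (- (1 + d))) \<le> 1 + 1 / d" for N
  proof (cases "N = 0")
    case False
    have "1 + (1 - real N powr (- d)) / d \<le> 1 + 1 / d" using assms by (simp add: divide_right_mono)
    then show ?thesis using * False by (meson order_trans neq0_conv)
  qed (use assms in simp)
  then have "cmod (\<Sum>k<N. lser (\<lambda>_. 1) (1 + d) (Suc k)) \<le> 1 + 1 / d" for N
    by (intro order_trans[OF norm_sum]) (simp add: lser_def)
  then show ?thesis using assms by (intro LIMSEQ_le_const2[OF tendsto_norm[OF lser_limit]]) auto
qed

lemma L_bound:
  assumes dc: "dirichlet_character c X" and sum0: "(\<Sum>r\<in>{0..<int c}. X r) = 0" and s: "s > 1"
  shows "cmod (infsum (lser (\<lambda>n. X (int n)) s) {n. n > 0}) \<le> real c"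
proof -
  note D = dirichlet_characterD[OF dc]
  have "cmod (\<Sum>k<N. X (int (1 + k)) * of_real (real (Suc k) powr (- s))) \<le> real c * real (Suc 0) powr (- s)" for N
  proof (rule abel_bound)
    show "cmod (\<Sum>k<n. X (int (1 + k))) \<le> real c" for n
      by (rule periodic_partial_sum_bound[OF D(1) D(3) sum0]) (rule dirichlet_character_norm_le[OF dc])
    show "real (Suc (Suc n)) powr - s \<le> real (Suc n) powr - s" for n
      using s by (intro powr_mono2') auto
  qed simp
  then have "cmod (\<Sum>k<N. lser (\<lambda>n. X (int n)) s (Suc k)) \<le> real c" for N by (simp add: lser_def)
  then show ?thesis using dirichlet_character_norm_le[OF dc] s
    by (intro LIMSEQ_le_const2[OF tendsto_norm[OF lser_limit]]) auto
qed

text \<open>If the series vanishes at 1, its partial sums \<open>T N\<close> are minus its tails,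
  hence at most \<open>c/N\<close>. Summation by parts against \<open>n^(-d)\<close>, whose
  increments are at most \<open>d/n\<close>, leaves the telescoping sum of
  \<open>c d/(n (n + 1))\<close>.\<close>

lemma L_bound_zero:
  assumes dc: "dirichlet_character c X" and sum0: "(\<Sum>r\<in>{0..<int c}. X r) = 0" and d: "d > 0"
    and lim: "(\<lambda>K. \<Sum>n<c * K. X (int n) / of_nat n) \<longlonglongrightarrow> 0"
  shows "cmod (infsum (lser (\<lambda>n. X (int n)) (1 + d)) {n. n > 0}) \<le> real c * d"
proof -
  note D = dirichlet_characterD[OF dc]
  define T where "T N = (\<Sum>n<N. X (int n) / of_nat n)" for N
  have T: "cmod (T N) \<le> real c / real N" if N: "N > 0" for N
  proof -
    have b: "cmod (T (N + M) - T N) \<le> real c / real N" for M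
    proof -
      have "T (N + M) - T N = (\<Sum>k<M. X (int (N + k)) * of_real (1 / real (N + k)))"
        unfolding T_def by (induction M) (auto simp: algebra_simps)
      also have "cmod \<dots> \<le> real c * (1 / real (N + 0))"
      proof (rule abel_bound)
        show "cmod (\<Sum>k<n. X (int (N + k))) \<le> real c" for n
          by (rule periodic_partial_sum_bound[OF D(1) D(3) sum0]) (rule dirichlet_character_norm_le[OF dc])
      qed (use N in \<open>auto intro!: divide_left_mono\<close>)
      finally show ?thesis by simp
    qed
    have "(\<lambda>K. cmod (T (c * K) - T N)) \<longlonglongrightarrow> cmod (0 - T N)"
      using lim unfolding T_def[symmetric] by (intro tendsto_intros)
    moreover have "cmod (T (c * K) - T N) \<le> real c / real N" if "K \<ge> N" for K
    proof -
      have "N \<le> c * K" using that D(1) by (metis Suc_leI le_trans mult_le_mono mult_1 One_nat_def)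
      then show ?thesis using b[of "c * K - N"] by simp
    qed
    ultimately have "cmod (0 - T N) \<le> real c / real N" by (intro LIMSEQ_le_const2) auto
    then show ?thesis by simp
  qed
  define h where "h n = real n powr (- d)" for n
  have h1: "h n \<le> 1" if "n > 0" for n using that d by (simp add: h_def powr_minus_divide ge_one_powr_ge_zero)
  have parts: "(\<Sum>k<N. lser (\<lambda>n. X (int n)) (1 + d) (Suc k)) =
     T (Suc N) * of_real (h (Suc N)) + (\<Sum>k<N. T (Suc (Suc k)) * of_real (h (Suc k) - h (Suc (Suc k))))" for N
  proof (induction N)
    case 0 then show ?case by (simp add: T_def)
  next
    case (Suc N)
    have "lser (\<lambda>n. X (int n)) (1 + d) (Suc N) = (T (Suc (Suc N)) - T (Suc N)) * of_real (h (Suc N))"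
    proof -
      have "real (Suc N) powr (- (1 + d)) = real (Suc N) powr (- d) / real (Suc N)"
        by (simp add: powr_add powr_minus_divide powr_diff)
      then show ?thesis by (simp add: lser_def T_def h_def del: of_nat_Suc)
    qed
    then show ?case using Suc by (simp add: algebra_simps)
  qed
  have bound: "cmod (\<Sum>k<N. lser (\<lambda>n. X (int n)) (1 + d) (Suc k)) \<le> real c / real (Suc N) + real c * d" for N
  proof -
    have "cmod (T (Suc N) * of_real (h (Suc N))) \<le> real c / real (Suc N) * 1"
      unfolding norm_mult using T[of "Suc N"] h1[of "Suc N"] by (intro mult_mono) (auto simp: h_def)
    moreover have "cmod (\<Sum>k<N. T (Suc (Suc k)) * of_real (h (Suc k) - h (Suc (Suc k)))) \<le> (\<Sum>k<N. real c * d * (1 / real (Suc k) - 1 / real (Suc (Suc k))))"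
    proof (rule sum_norm_le)
      fix k
      have "\<bar>h (Suc k) - h (Suc (Suc k))\<bar> \<le> d / real (Suc k)"
      proof -
        have "h (Suc (Suc k)) \<le> h (Suc k)" unfolding h_def using d by (intro powr_mono2') auto
        then show ?thesis using powr_neg_step(1)[OF d, of "Suc k"] by (simp add: h_def)
      qed
      then have "cmod (T (Suc (Suc k)) * of_real (h (Suc k) - h (Suc (Suc k)))) \<le> real c / real (Suc (Suc k)) * (d / real (Suc k))"
        unfolding norm_mult norm_of_real using T[of "Suc (Suc k)"] by (intro mult_mono) auto
      also have "\<dots> = real c * d * (1 / real (Suc k) - 1 / real (Suc (Suc k)))" by (simp add: field_simps)
      finally show "cmod (T (Suc (Suc k)) * of_real (h (Suc k) - h (Suc (Suc k)))) \<le> real c * d * (1 / real (Suc k) - 1 / real (Suc (Suc k)))" .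
    qed
    moreover have "(\<Sum>k<N. real c * d * (1 / real (Suc k) - 1 / real (Suc (Suc k)))) = real c * d * (1 - 1 / real (Suc N))"
      unfolding sum_distrib_left[symmetric] by (subst sum_lessThan_telescope') simp
    moreover have "real c * d * (1 - 1 / real (Suc N)) \<le> real c * d * 1" using d by (intro mult_left_mono) auto
    ultimately show ?thesis unfolding parts
      using norm_triangle_ineq[of "T (Suc N) * of_real (h (Suc N))" "\<Sum>k<N. T (Suc (Suc k)) * of_real (h (Suc k) - h (Suc (Suc k)))"] by linarith
  qed
  have "(\<lambda>N. real c / real (Suc N) + real c * d) \<longlonglongrightarrow> 0 + real c * d"
    by (intro tendsto_add tendsto_const LIMSEQ_Suc[OF lim_const_over_n])
  moreover have "(\<lambda>N. cmod (\<Sum>k<N. lser (\<lambda>n. X (int n)) (1 + d) (Suc k))) \<longlonglongrightarrow> cmod (infsum (lser (\<lambda>n. X (int n)) (1 + d)) {n. n > 0})"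
    using dirichlet_character_norm_le[OF dc] d by (intro tendsto_norm lser_limit) auto
  ultimately show ?thesis using bound by (auto intro: LIMSEQ_le)
qed

text \<open>A zero at 1 would contribute \<open>d^4\<close> to the product, which the pole of order
  3 from the zeta factor cannot compensate while the series of \<open>X^2\<close> stays
  bounded.\<close>

lemma L1_nonzero_complex:
  assumes dc: "dirichlet_character c X" and sum0: "(\<Sum>r\<in>{0..<int c}. X r) = 0"
    and sum2: "(\<Sum>r\<in>{0..<int c}. (X r)\<^sup>2) = 0"
    and lim: "(\<lambda>K. \<Sum>n<c * K. X (int n) / of_nat n) \<longlonglongrightarrow> 0"
  shows False
proof -
  note D = dirichlet_characterD[OF dc]
  have dc2: "dirichlet_character c (\<lambda>a. (X a)\<^sup>2)"
    using dc by (simp add: dirichlet_character_def power_mult_distrib)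
  \<comment> \<open>Chosen so that \<open>(2/d)^3 * (c d)^4 * c = 8 c^5 d\<close> equals
    1/2.\<close>
  define d where "d = 1 / (16 * real c ^ 5)"
  have c1: "real c \<ge> 1" using D(1) by simp
  then have c5: "real c ^ 5 \<ge> 1" by (rule one_le_power)
  have d: "0 < d" "d \<le> 1" using c1 c5 by (auto simp: d_def divide_le_eq intro: order_trans[of 1 "real c ^ 5"])
  let ?L = "\<lambda>f. cmod (infsum (lser f (1 + d)) {n. n > 0})"
  have "1 \<le> ?L (\<lambda>_. 1) ^ 3 * ?L (\<lambda>n. X (int n)) ^ 4 * ?L (\<lambda>n. (X (int n))\<^sup>2)"
  proof (rule euler_product_bound)
    show "cmod (X (int n)) = 1 \<or> X (int n) = 0" for n
      using dirichlet_character_norm[OF dc] D(4) by blast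
  qed (use D d in auto)
  also have "\<dots> \<le> (2 / d) ^ 3 * (real c * d) ^ 4 * real c"
  proof (intro mult_mono power_mono)
    have "1 + 1 / d \<le> 2 / d" using d by (simp add: field_simps)
    then show "?L (\<lambda>_. 1) \<le> 2 / d" using zeta_bound[OF d(1)] by linarith
    show "?L (\<lambda>n. X (int n)) \<le> real c * d" by (rule L_bound_zero[OF dc sum0 d(1) lim])
    show "?L (\<lambda>n. (X (int n))\<^sup>2) \<le> real c" using d by (intro L_bound[OF dc2 sum2]) auto
  qed (use d in auto)
  also have "\<dots> = 8 * real c ^ 5 * d" using d by (simp add: field_simps eval_nat_numeral)
  also have "\<dots> = 1 / 2" using c5 D(1) by (simp add: d_def)
  finally show False by simp
qed

text \<open>The sum is a multiple of \<open>L(1,X)\<close> by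
  \<open>partial_sums_odd_periodic\<close>. If \<open>X^2\<close> is trivial on units, its series
  has a pole at 1 and the Euler product argument fails; but then \<open>X\<close> is real, and the
  Lambert series argument applies.\<close>

theorem sum_wt_character_nonzero:
  assumes dc: "dirichlet_character c X" and odd: "X (- 1) = - 1"
  shows "(\<Sum>r\<in>{0..<int c}. of_real (wt c r) * X r) \<noteq> 0"
proof
  assume z: "(\<Sum>r\<in>{0..<int c}. of_real (wt c r) * X r) = 0"
  note D = dirichlet_characterD[OF dc]
  have lim: "(\<lambda>K. \<Sum>n<c * K. X (int n) / of_nat n) \<longlonglongrightarrow> 0"
  proof -
    have "X (- x) = - X x" for x
      using dirichlet_character_minus_one(1)[OF dc, of x] odd by (metis mult_minus1)
    from partial_sums_odd_periodic[OF D(1) D(3) this] show ?thesis unfolding z by simp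
  qed
  have sum0: "(\<Sum>r\<in>{0..<int c}. X r) = 0"
    by (rule dirichlet_character_sum_0[OF dc, of "- 1"]) (use odd in auto)
  have c1: "c > 1"
  proof (rule ccontr)
    assume "\<not> c > 1"
    then have "c = 1" using D(1) by simp
    then have "X (- 1) = X 1" by (intro periodic_cong[OF D(3)]) (simp add: cong_def)
    then show False using odd D(5) by simp
  qed
  show False
  proof (cases "\<forall>a. coprime a (int c) \<longrightarrow> (X a)\<^sup>2 = 1")
    case True
    then have "X a = 0 \<or> X a = 1 \<or> X a = - 1" for a
      using D(4)[of a] by (auto simp: power2_eq_1_iff)
    then show False by (rule L1_nonzero_real[OF dc c1 _ sum0 lim])
  next
    case False
    then obtain a where a: "coprime a (int c)" "(X a)\<^sup>2 \<noteq> 1" by blast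
    have dc2: "dirichlet_character c (\<lambda>a. (X a)\<^sup>2)"
      using dc by (simp add: dirichlet_character_def power_mult_distrib)
    have "(\<Sum>r\<in>{0..<int c}. (X r)\<^sup>2) = 0" by (rule dirichlet_character_sum_0[OF dc2 a])
    then show False by (rule L1_nonzero_complex[OF dc sum0 _ lim])
  qed
qed

section \<open>Odd functions on the units and the cotangent convolution\<close>

definition odd_unit_fun :: "nat \<Rightarrow> (int \<Rightarrow> complex) \<Rightarrow> bool" where
  "odd_unit_fun c f \<longleftrightarrow> periodic c f \<and> (\<forall>x. \<not> coprime x (int c) \<longrightarrow> f x = 0) \<and> (\<forall>x. f (- x) = - f x)"

definition wt_null :: "nat \<Rightarrow> (int \<Rightarrow> complex) \<Rightarrow> bool" where
  "wt_null c f \<longleftrightarrow> (\<forall>u. coprime u (int c) \<longrightarrow> (\<Sum>n\<in>{0..<int c}. of_real (wt c n) * f (n * u)) = 0)"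

lemma odd_unit_fun_dilation_comb:
  assumes "odd_unit_fun c f" "wt_null c f" "coprime g (int c)"
  shows "odd_unit_fun c (\<lambda>x. \<Sum>j<N. a j * f (g ^ j * x))" "wt_null c (\<lambda>x. \<Sum>j<N. a j * f (g ^ j * x))"
proof -
  have p: "periodic c f" using assms(1) by (simp add: odd_unit_fun_def)
  have "periodic c (\<lambda>x. f (g ^ j * x))" for j using periodic_affine[OF p, of 0 "g ^ j"] by simp
  then show "odd_unit_fun c (\<lambda>x. \<Sum>j<N. a j * f (g ^ j * x))"
    using assms(1) unfolding odd_unit_fun_def periodic_def by (simp add: sum_negf coprime_mult_left_iff)
  show "wt_null c (\<lambda>x. \<Sum>j<N. a j * f (g ^ j * x))"
    unfolding wt_null_def
  proof (intro allI impI)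
    fix u assume u: "coprime u (int c)"
    have "(\<Sum>n\<in>{0..<int c}. of_real (wt c n) * (\<Sum>j<N. a j * f (g ^ j * (n * u)))) =
      (\<Sum>j<N. a j * (\<Sum>n\<in>{0..<int c}. of_real (wt c n) * f (n * (g ^ j * u))))"
      by (simp only: sum_distrib_left, subst sum.swap) (simp only: mult_ac)
    also have "\<dots> = 0"
    proof -
      have "coprime (g ^ j * u) (int c)" for j using u assms(3) by simp
      then show ?thesis using assms(2) by (simp add: wt_null_def)
    qed
    finally show "(\<Sum>n\<in>{0..<int c}. of_real (wt c n) * (\<Sum>j<N. a j * f (g ^ j * (n * u)))) = 0" .
  qed
qed

lemma unit_power_cong_1:
  assumes "coprime g (int c)" "c > 0" shows "[g ^ totient c = 1] (mod int c)"
proof -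
  define b where "b = nat (g mod int c)"
  have b: "int b = g mod int c" using assms(2) by (simp add: b_def)
  have "coprime (int b) (int c)" using assms unfolding b by simp
  then have "[b ^ totient c = 1] (mod c)" by (intro euler_theorem) simp
  then have "[int b ^ totient c = 1] (mod int c)" by (metis cong_int_iff of_nat_1 of_nat_power)
  moreover have "[g ^ totient c = int b ^ totient c] (mod int c)" unfolding b by (intro cong_pow) (simp add: cong_def)
  ultimately show ?thesis by (rule cong_trans[rotated])
qed

text \<open>Dilations by units commute, so they can be diagonalized one after the other. The Fourier
  components \<open>F k\<close> of \<open>f\<close> along the powers of \<open>g\<close> are
  eigenvectors for \<open>g\<close>, keep the eigenvalues already obtained, and add up to
  \<open>N f\<close>, so that one of them is nonzero.\<close>

lemma common_eigenvector:
  assumes "finite B" "\<And>g. g \<in> B \<Longrightarrow> coprime g (int c)" "c > 0"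
    and "odd_unit_fun c f0" "wt_null c f0" "f0 x0 \<noteq> 0"
  shows "\<exists>f. odd_unit_fun c f \<and> wt_null c f \<and> (\<exists>x. f x \<noteq> 0) \<and> (\<forall>g\<in>B. \<exists>\<mu>. \<forall>x. f (g * x) = \<mu> * f x)"
  using assms(1,2)
proof (induction B rule: finite_induct)
  case empty then show ?case using assms by auto
next
  case (insert g B)
  then obtain f x1 where f: "odd_unit_fun c f" "wt_null c f" "f x1 \<noteq> 0" "\<And>g. g \<in> B \<Longrightarrow> \<exists>\<mu>. \<forall>x. f (g * x) = \<mu> * f x"
    by auto
  have g: "coprime g (int c)" using insert.prems by simp
  define N where "N = totient c"
  have N: "N > 0" using assms(3) by (simp add: N_def)
  define F where "F k x = (\<Sum>j<N. ee N (- (int k * int j)) * f (g ^ j * x))" for k x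
  have p: "periodic c f" using f(1) by (simp add: odd_unit_fun_def)
  have "(\<Sum>k<N. F k x1) = (\<Sum>j<N. (\<Sum>k<N. ee N (- (int k * int j))) * f (g ^ j * x1))"
    unfolding F_def by (subst sum.swap) (simp add: sum_distrib_right)
  also have "\<dots> = (\<Sum>j<N. if j = 0 then of_nat N * f x1 else 0)"
  proof (rule sum.cong[OF refl])
    fix j assume j: "j \<in> {..<N}"
    have "(\<Sum>k<N. ee N (- (int k * int j))) = (\<Sum>k\<in>{0..<int N}. ee N (- int j * k))"
      unfolding sum_int_of_nat by (simp add: mult.commute)
    also have "\<dots> = (if int N dvd - int j then of_nat N else 0)" by (rule sum_ee[OF N])
    also have "int N dvd - int j \<longleftrightarrow> j = 0" using j by (auto dest: dvd_imp_le)
    finally show "(\<Sum>k<N. ee N (- (int k * int j))) * f (g ^ j * x1) = (if j = 0 then of_nat N * f x1 else 0)" by simp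
  qed
  also have "\<dots> = of_nat N * f x1" using N by simp
  finally have "(\<Sum>k<N. F k x1) \<noteq> 0" using N f(3) by simp
  then obtain k where k: "F k x1 \<noteq> 0" by (meson sum.neutral)
  have "\<exists>\<mu>. \<forall>x. F k (g * x) = \<mu> * F k x"
  proof (intro exI allI)
    fix x
    have per: "ee N (- (int k * int (j + N))) * f (g ^ (j + N) * x) = ee N (- (int k * int j)) * f (g ^ j * x)" for j
    proof -
      have "[g ^ (j + N) * x = g ^ j * 1 * x] (mod int c)"
        unfolding power_add N_def by (intro cong_mult cong_refl unit_power_cong_1[OF g assms(3)])
      then have "f (g ^ (j + N) * x) = f (g ^ j * x)" using periodic_cong[OF p] by simp
      moreover have "- (int k * int (j + N)) = - (int k * int j) + int N * (- int k)" by (simp add: algebra_simps)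
      ultimately show ?thesis by (simp only: ee_add ee_self mult_1_right)
    qed
    have "F k (g * x) = (\<Sum>j<N. ee N (int k) * (ee N (- (int k * int (Suc j))) * f (g ^ Suc j * x)))"
      unfolding F_def
    proof (rule sum.cong[OF refl])
      fix j
      have "ee N (- (int k * int j)) = ee N (int k) * ee N (- (int k * int (Suc j)))"
        by (subst ee_add[symmetric]) (simp add: algebra_simps)
      then show "ee N (- (int k * int j)) * f (g ^ j * (g * x)) = ee N (int k) * (ee N (- (int k * int (Suc j))) * f (g ^ Suc j * x))"
        by (simp add: mult_ac)
    qed
    also have "\<dots> = ee N (int k) * (\<Sum>j<N. ee N (- (int k * int (Suc j))) * f (g ^ Suc j * x))" by (simp only: sum_distrib_left)
    also have "(\<Sum>j<N. ee N (- (int k * int (Suc j))) * f (g ^ Suc j * x)) = F k x"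
    proof -
      let ?h = "\<lambda>j. ee N (- (int k * int j)) * f (g ^ j * x)"
      have "(\<Sum>j<N. ?h (Suc j)) + ?h 0 = (\<Sum>j<Suc N. ?h j)" by (subst sum.lessThan_Suc_shift) simp
      also have "\<dots> = F k x + ?h (0 + N)" by (simp add: F_def)
      also have "?h (0 + N) = ?h 0" by (rule per)
      finally show ?thesis by simp
    qed
    finally show "F k (g * x) = ee N (int k) * F k x" .
  qed
  moreover have "\<exists>\<mu>. \<forall>x. F k (h * x) = \<mu> * F k x" if h: "h \<in> B" for h
  proof -
    obtain \<mu> where "\<And>x. f (h * x) = \<mu> * f x" using f(4)[OF h] by blast
    then have e: "f (g ^ j * (h * x)) = \<mu> * f (g ^ j * x)" for j x by (metis mult.left_commute)
    have "F k (h * x) = \<mu> * F k x" for x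
      unfolding F_def e by (simp add: sum_distrib_left mult.left_commute)
    then show ?thesis by blast
  qed
  moreover have "odd_unit_fun c (F k)" "wt_null c (F k)"
  proof -
    have F: "F k = (\<lambda>x. \<Sum>j<N. ee N (- (int k * int j)) * f (g ^ j * x))" by (rule ext) (simp only: F_def)
    show "odd_unit_fun c (F k)" "wt_null c (F k)"
      unfolding F by (rule odd_unit_fun_dilation_comb[OF f(1,2) g])+
  qed
  ultimately show ?case using k by (intro exI[of _ "F k"]) auto
qed

text \<open>The functions killed by the convolution form a dilation-invariant space; an eigenvector in it is a character.\<close>

theorem wt_null_imp_zero:
  assumes "c > 0" "odd_unit_fun c f" "wt_null c f"
  shows "f x = 0"
proof (rule ccontr)
  assume "f x \<noteq> 0"
  define B where "B = {g\<in>{0..<int c}. coprime g (int c)}"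
  obtain h y where h: "odd_unit_fun c h" "wt_null c h" "h y \<noteq> 0" "\<And>g. g \<in> B \<Longrightarrow> \<exists>\<mu>. \<forall>x. h (g * x) = \<mu> * h x"
  proof -
    have "finite B" unfolding B_def by (rule finite_subset[of _ "{0..<int c}"]) auto
    moreover have "\<And>g. g \<in> B \<Longrightarrow> coprime g (int c)" by (auto simp: B_def)
    ultimately have "finite B" "\<And>g. g \<in> B \<Longrightarrow> coprime g (int c)" by blast+
    from common_eigenvector[OF this assms \<open>f x \<noteq> 0\<close>] that show thesis by blast
  qed
  have p: "periodic c h" and supp: "\<And>x. \<not> coprime x (int c) \<Longrightarrow> h x = 0" and odd: "\<And>x. h (- x) = - h x"
    using h(1) by (auto simp: odd_unit_fun_def)
  have eig: "\<exists>\<mu>. \<forall>x. h (g * x) = \<mu> * h x" if "coprime g (int c)" for g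
  proof -
    have "g mod int c \<in> B" using that assms(1) by (simp add: B_def)
    moreover have "h (g mod int c * x) = h (g * x)" for x
      by (rule periodic_cong[OF p]) (intro cong_mult cong_refl, simp add: cong_def)
    ultimately show ?thesis using h(4) by metis
  qed
  have h1: "h 1 \<noteq> 0"
  proof
    assume "h 1 = 0"
    have "coprime y (int c)" using supp h(3) by blast
    then obtain \<mu> where "\<forall>x. h (y * x) = \<mu> * h x" using eig by blast
    then have "h y = \<mu> * h 1" by (metis mult.right_neutral)
    then show False using h(3) \<open>h 1 = 0\<close> by simp
  qed
  have hm: "h (a * b) * h 1 = h a * h b" for a b
  proof (cases "coprime a (int c)")
    case True
    then obtain \<mu> where m: "\<forall>x. h (a * x) = \<mu> * h x" using eig by blast
    then have "h a = \<mu> * h 1" by (metis mult.right_neutral)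
    moreover have "h (a * b) = \<mu> * h b" using m by blast
    ultimately show ?thesis by simp
  next
    case False
    then show ?thesis using supp by simp
  qed
  define X where "X a = h a / h 1" for a
  have nz: "h a \<noteq> 0" if a: "coprime a (int c)" for a
  proof -
    obtain b where b: "[a * b = 1] (mod int c)" using coprime_int_inverse[OF a] by blast
    have "h (a * b) = h 1" by (rule periodic_cong[OF p b])
    then show ?thesis using hm[of a b] h1 by auto
  qed
  have "dirichlet_character c X"
    unfolding dirichlet_character_def
  proof (intro conjI allI)
    fix a b
    show "X (a * b) = X a * X b" using hm[of a b] h1 by (simp add: X_def field_simps)
    show "X (a + int c) = X a" using p by (simp add: X_def periodic_def)
    show "X a = 0 \<longleftrightarrow> \<not> coprime a (int c)" using supp nz h1 by (auto simp: X_def)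
  qed (use assms in simp)
  moreover have "X (- 1) = - 1" using odd[of 1] h1 by (simp add: X_def)
  ultimately have "(\<Sum>r\<in>{0..<int c}. of_real (wt c r) * X r) \<noteq> 0" by (rule sum_wt_character_nonzero)
  moreover have "(\<Sum>r\<in>{0..<int c}. of_real (wt c r) * X r) = (\<Sum>r\<in>{0..<int c}. of_real (wt c r) * h (r * 1)) / h 1"
    by (simp add: X_def sum_divide_distrib)
  moreover have "(\<Sum>r\<in>{0..<int c}. of_real (wt c r) * h (r * 1)) = 0"
    using h(2) coprime_1_left unfolding wt_null_def by blast
  ultimately show False by simp
qed

section \<open>Functions annihilated by the cotangent pairing\<close>

definition bil :: "nat \<Rightarrow> (int \<Rightarrow> int \<Rightarrow> complex) \<Rightarrow> int \<Rightarrow> int \<Rightarrow> complex" where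
  "bil c F u v = (\<Sum>m\<in>{0..<int c}. \<Sum>l\<in>{0..<int c}. of_real (wt c l) * of_real (wt c m) * F (u * l) (v * m))"

text \<open>These functions form a linear space, stable under unit dilations and under exchange of
  the variables. The reductions below start from one member and produce members with smaller
  support.\<close>

definition null :: "nat \<Rightarrow> (int \<Rightarrow> int \<Rightarrow> complex) \<Rightarrow> bool" where
  "null c F \<longleftrightarrow> (\<forall>x. periodic c (F x)) \<and> (\<forall>y. periodic c (\<lambda>x. F x y)) \<and>
     (\<forall>u v. coprime u (int c) \<longrightarrow> coprime v (int c) \<longrightarrow> bil c F u v = 0)"

lemma nullD:
  assumes "null c F"
  shows "periodic c (F x)" "periodic c (\<lambda>x. F x y)" "coprime u (int c) \<Longrightarrow> coprime v (int c) \<Longrightarrow> bil c F u v = 0"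
    "[y = y'] (mod int c) \<Longrightarrow> F x y = F x y'" "[y = y'] (mod int c) \<Longrightarrow> F y x = F y' x"
proof -
  show 1: "periodic c (F x)" "periodic c (\<lambda>x. F x y)" for x y using assms by (auto simp: null_def)
  show "coprime u (int c) \<Longrightarrow> coprime v (int c) \<Longrightarrow> bil c F u v = 0" using assms by (auto simp: null_def)
  show "[y = y'] (mod int c) \<Longrightarrow> F x y = F x y'" by (rule periodic_cong[OF 1(1)])
  show "[y = y'] (mod int c) \<Longrightarrow> F y x = F y' x" by (rule periodic_cong[OF 1(2)])
qed

lemma null_flip: assumes "null c F" shows "null c (\<lambda>x y. F y x)"
proof -
  have "bil c (\<lambda>x y. F y x) u v = bil c F v u" for u v
    unfolding bil_def by (subst sum.swap) (simp add: mult_ac)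
  then show ?thesis using assms by (simp add: null_def)
qed

lemma null_add: "null c F \<Longrightarrow> null c G \<Longrightarrow> null c (\<lambda>x y. F x y + G x y)"
  by (simp add: null_def bil_def periodic_def distrib_left sum.distrib)

lemma null_scale: "null c F \<Longrightarrow> null c (\<lambda>x y. a * F x y)"
  by (simp add: null_def bil_def periodic_def mult.left_commute[of _ a] sum_distrib_left[symmetric])

lemma null_diff: "null c F \<Longrightarrow> null c G \<Longrightarrow> null c (\<lambda>x y. F x y - G x y)"
  using null_add[of c F "\<lambda>x y. - 1 * G x y"] null_scale[of c G "- 1"] by simp

lemma null_sum: "finite A \<Longrightarrow> (\<And>i. i \<in> A \<Longrightarrow> null c (F i)) \<Longrightarrow> null c (\<lambda>x y. \<Sum>i\<in>A. F i x y)"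
proof (induction A rule: finite_induct)
  case empty then show ?case by (simp add: null_def bil_def periodic_def)
next
  case (insert i A) then show ?case using null_add[of c "F i" "\<lambda>x y. \<Sum>i\<in>A. F i x y"] by simp
qed

lemma null_dilate: assumes "null c F" "coprime t (int c)" shows "null c (\<lambda>x y. F x (t * y))"
proof -
  have "bil c (\<lambda>x y. F x (t * y)) u v = bil c F u (t * v)" for u v by (simp add: bil_def mult.assoc)
  moreover have "periodic c (\<lambda>y. F x (t * y))" for x using periodic_affine[OF nullD(1)[OF assms(1)], of x 0 t] by simp
  ultimately show ?thesis using assms by (simp add: null_def)
qed

lemma null_cong: "null c F \<Longrightarrow> (\<And>x y. F x y = G x y) \<Longrightarrow> null c G"
proof -
  assume a: "null c F" "\<And>x y. F x y = G x y"
  then have "F = G" by (intro ext) auto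
  then show ?thesis using a by simp
qed

text \<open>Vanishing of the sums over cosets of the multiples of \<open>c/p\<close> in the second
  variable. For the functions considered here this is how primitivity of \<open>X2\<close> at
  \<open>p\<close> enters.\<close>

definition fiber_zero :: "nat \<Rightarrow> nat \<Rightarrow> (int \<Rightarrow> int \<Rightarrow> complex) \<Rightarrow> bool" where
  "fiber_zero c p F \<longleftrightarrow> (\<forall>x y. (\<Sum>r\<in>{0..<int p}. F x (y + r * (int c div int p))) = 0)"

lemma fiber_sum_unit:
  assumes F: "periodic c (F x)" and p: "p dvd c" "p > 0" and k: "coprime k (int p)"
  shows "(\<Sum>r\<in>{0..<int p}. F x (y + k * r * (int c div int p))) = (\<Sum>r\<in>{0..<int p}. F x (y + r * (int c div int p)))"
proof -
  obtain d where d: "c = p * d" using p(1) by (elim dvdE)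
  have cd: "int c div int p = int d" using p(2) by (simp add: d)
  have "periodic p (\<lambda>r. F x (y + r * int d))"
    unfolding periodic_def
  proof
    fix r
    have "y + (r + int p) * int d = (y + r * int d) + int c * 1" by (simp add: d algebra_simps)
    then show "F x (y + (r + int p) * int d) = F x (y + r * int d)" by (simp only: periodicD_mult[OF F])
  qed
  from sum_residues_mult[OF this k] show ?thesis unfolding cd by simp
qed

lemma fiber_zero_comp:
  assumes z: "fiber_zero c p F" and p: "p dvd c" "p > 0" and b: "coprime b (int p)"
    and F: "\<And>x. periodic c (F x)" and a: "\<And>y r. h (y + r * (int c div int p)) = h y"
  shows "fiber_zero c p (\<lambda>x y. h y * F (g x) (b * y))"
  unfolding fiber_zero_def
proof (intro allI)
  fix x y
  have "(\<Sum>r\<in>{0..<int p}. h (y + r * (int c div int p)) * F (g x) (b * (y + r * (int c div int p))))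
     = h y * (\<Sum>r\<in>{0..<int p}. F (g x) (b * y + b * r * (int c div int p)))"
    by (simp add: a sum_distrib_left algebra_simps)
  also have "\<dots> = 0" using fiber_sum_unit[of c F "g x" p b "b * y"] F p b z by (simp add: fiber_zero_def)
  finally show "(\<Sum>r\<in>{0..<int p}. h (y + r * (int c div int p)) * F (g x) (b * (y + r * (int c div int p)))) = 0" .
qed

lemma prime_coprime_int: "prime p \<Longrightarrow> \<not> int p dvd y \<Longrightarrow> coprime y (int p)"
  by (metis coprime_commute prime_imp_coprime prime_nat_int_transfer)

lemma coprime_one_add: "n dvd k \<Longrightarrow> coprime (1 + k) (n :: int)"
  by (rule coprimeI) (metis dvd_add_times_triv_right_iff dvd_add_left_iff dvd_trans)

text \<open>Averaging over the dilations \<open>1 + r c/p\<^sup>i\<^sup>+\<^sup>1\<close> detects divisibility of \<open>y\<close> by \<open>p\<^sup>i\<^sup>+\<^sup>1\<close>.\<close>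

lemma null_restrict_power:
  assumes p: "prime p" and z: "fiber_zero c p F" and N: "null c F" and c: "c > 0"
  shows "p ^ Suc i dvd c \<Longrightarrow> null c (\<lambda>x y. if int (p ^ i) dvd y then F x y else 0)"
proof (induction i)
  case 0 then show ?case using N by simp
next
  case (Suc i)
  let ?G = "\<lambda>x y. if int (p ^ i) dvd y then F x y else 0"
  have p0: "p > 0" using p prime_gt_0_nat by blast
  have "p ^ Suc i dvd c" using Suc.prems by (meson dvd_trans le_imp_power_dvd le_SucI order_refl)
  then have IH: "null c ?G" by (rule Suc.IH)
  obtain d where d: "c = p ^ Suc (Suc i) * d" using Suc.prems by (elim dvdE)
  \<comment> \<open>This is \<open>c/p^(i+1)\<close>. If \<open>y = p^i y'\<close>, multiplication
    by \<open>1 + r h\<close> moves \<open>y\<close> by \<open>y' r\<close> times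
    \<open>c/p\<close>: it fixes \<open>y\<close> modulo \<open>c\<close> if \<open>p\<close>
    divides \<open>y'\<close>, and otherwise runs through a whole fiber as \<open>r\<close>
    varies.\<close>
  define h where "h = int (p * d)"
  have t: "coprime (1 + r * h) (int c)" for r
  proof -
    have "coprime (1 + r * h) (int p)" "coprime (1 + r * h) (int d)"
      unfolding h_def by (auto intro: coprime_one_add)
    then show ?thesis by (simp add: d)
  qed
  have "null c (\<lambda>x y. \<Sum>r\<in>{0..<int p}. ?G x ((1 + r * h) * y))"
    by (intro null_sum null_dilate[OF IH] t) auto
  then have "null c (\<lambda>x y. (1 / of_nat p) * (\<Sum>r\<in>{0..<int p}. ?G x ((1 + r * h) * y)))" by (rule null_scale)
  then show ?case
  proof (rule null_cong)
    fix x y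
    have dv: "int (p ^ i) dvd (1 + r * h) * y \<longleftrightarrow> int (p ^ i) dvd y" for r
    proof -
      have "coprime (int (p ^ i)) (1 + r * h)" using t[of r] by (simp add: d coprime_commute)
      then show ?thesis by (rule coprime_dvd_mult_right_iff)
    qed
    show "1 / of_nat p * (\<Sum>r\<in>{0..<int p}. ?G x ((1 + r * h) * y)) = (if int (p ^ Suc i) dvd y then F x y else 0)"
    proof (cases "int (p ^ i) dvd y")
      case False
      then have "\<not> int (p ^ Suc i) dvd y" by (metis dvd_trans dvd_triv_right int_dvd_int_iff power_Suc)
      then show ?thesis using False dv by simp
    next
      case True
      then obtain y' where y': "y = int (p ^ i) * y'" ..
      have cp: "int c div int p = int (p ^ Suc i * d)" using p0 by (simp add: d)
      have e: "(1 + r * h) * y = y + y' * r * (int c div int p)" for r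
        unfolding cp by (simp add: y' h_def algebra_simps)
      have sum: "(\<Sum>r\<in>{0..<int p}. ?G x ((1 + r * h) * y)) = (\<Sum>r\<in>{0..<int p}. F x (y + y' * r * (int c div int p)))"
        using dv True e by simp
      show ?thesis
      proof (cases "int p dvd y'")
        case True
        then obtain w where w: "y' = int p * w" ..
        have "F x (y + y' * r * (int c div int p)) = F x y" for r
        proof (rule nullD(4)[OF N])
          have "y + y' * r * (int c div int p) = y + int c * (w * r)" unfolding cp by (simp add: w d algebra_simps)
          then show "[y + y' * r * (int c div int p) = y] (mod int c)" by (simp only: cong_def mod_mult_self2)
        qed
        then show ?thesis unfolding sum using True y' p0 by simp
      next
        case False
        have "\<not> int (p ^ Suc i) dvd y" using False p0 by (simp add: y' mult.commute[of "int p"])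
        moreover have "(\<Sum>r\<in>{0..<int p}. F x (y + y' * r * (int c div int p))) = 0"
          using fiber_sum_unit[of c F x p y' y, OF nullD(1)[OF N] _ p0 prime_coprime_int[OF p False]] z
          by (simp add: fiber_zero_def d)
        ultimately show ?thesis unfolding sum by simp
      qed
    qed
  qed
qed

text \<open>The condition \<open>p^2 | c\<close> makes the case \<open>i = 1\<close> of
  \<open>null_restrict_power\<close> available, and the restriction to the multiples of
  \<open>p\<close> is then subtracted.\<close>

lemma null_restrict:
  assumes p: "prime p" "p\<^sup>2 dvd c" and z: "fiber_zero c p F" and N: "null c F" and c: "c > 0"
  shows "null c (\<lambda>x y. if int p dvd y then 0 else F x y)"
proof -
  have "null c (\<lambda>x y. if int (p ^ 1) dvd y then F x y else 0)"
    by (rule null_restrict_power[OF p(1) z N c]) (use p(2) in \<open>simp add: numeral_2_eq_2\<close>)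
  from null_diff[OF N this] show ?thesis by (rule null_cong) simp
qed

text \<open>Averaging over units \<open>t\<close> with \<open>t \<equiv> 1 (mod d)\<close>; \<open>e\<close> is the idempotent that vanishes modulo \<open>p\<^sup>i\<^sup>+\<^sup>1\<close>.\<close>

lemma null_average:
  assumes c: "c = p ^ Suc i * d" "coprime p d" "d > 0" and p: "prime p"
    and e: "[e = 0] (mod int (p ^ Suc i))" "[e = 1] (mod int d)"
    and N: "null c F" and z: "fiber_zero c p F"
  shows "null c (\<lambda>x y. if int (p ^ i) dvd y then F x (e * y) * (if int (p ^ Suc i) dvd y then of_nat p - 1 else - 1) else 0)"
proof -
  let ?P = "p ^ Suc i"
  have p0: "p > 0" using p prime_gt_0_nat by blast
  have cP: "coprime ?P d" using c(2) by simp
  have c0: "c > 0" using c p0 by simp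
  have cong_c: "[a = b] (mod int c)" if "[a = b] (mod int ?P)" "[a = b] (mod int d)" for a b
    unfolding c(1) of_nat_mult using that cP by (intro coprime_cong_mult) (auto simp del: of_nat_power)
  \<comment> \<open>For \<open>j = 0\<close> this is \<open>e\<close> itself, which is not a unit;
    it supplies the term that completes the sum over \<open>j\<close> to a fiber sum, whence the
    value \<open>- F x (e * y)\<close>.\<close>
  define t where "t j = e + j * (1 - e)" for j
  have td: "[t j = 1] (mod int d)" for j
  proof -
    have "[e + j * (1 - e) = 1 + j * (1 - 1)] (mod int d)" by (intro cong_add cong_mult cong_diff e(2) cong_refl)
    then show ?thesis by (simp add: t_def)
  qed
  have tp: "[t j = j] (mod int ?P)" for j
  proof -
    have "[e + j * (1 - e) = 0 + j * (1 - 0)] (mod int ?P)" by (intro cong_add cong_mult cong_diff e(1) cong_refl)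
    then show ?thesis by (simp add: t_def)
  qed
  have unit: "coprime (t j) (int c)" if "j \<in> {1..<int p}" for j
  proof -
    have "\<not> int p dvd j" using that zdvd_not_zless[of j "int p"] by auto
    then have "coprime j (int p)" by (rule prime_coprime_int[OF p])
    then have "coprime j (int ?P)" by simp
    then have "coprime (t j) (int ?P)" using tp cong_imp_coprime cong_sym by blast
    moreover have "coprime (t j) (int d)" using td cong_imp_coprime cong_sym coprime_1_left by blast
    ultimately show ?thesis unfolding c(1) of_nat_mult by (simp only: coprime_mult_right_iff)
  qed
  let ?G = "\<lambda>x y. if int (p ^ i) dvd y then F x y else 0"
  have "null c ?G" by (rule null_restrict_power[OF p z N c0]) (simp only: c(1) dvd_triv_left)
  then have "null c (\<lambda>x y. \<Sum>j\<in>{1..<int p}. ?G x (t j * y))"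
    by (intro null_sum null_dilate[of c ?G] unit) auto
  then show ?thesis
  proof (rule null_cong)
    fix x y
    have dv: "int (p ^ i) dvd t j * y \<longleftrightarrow> int (p ^ i) dvd y" if "j \<in> {1..<int p}" for j
    proof -
      have "coprime (int (p ^ i)) (t j)" using unit[OF that] by (simp add: c(1) coprime_commute)
      then show ?thesis by (rule coprime_dvd_mult_right_iff)
    qed
    show "(\<Sum>j\<in>{1..<int p}. ?G x (t j * y)) =
       (if int (p ^ i) dvd y then F x (e * y) * (if int ?P dvd y then of_nat p - 1 else - 1) else 0)"
    proof (cases "int (p ^ i) dvd y")
      case False then show ?thesis using dv by simp
    next
      case True
      then obtain y' where y': "y = int (p ^ i) * y'" ..
      have G: "(\<Sum>j\<in>{1..<int p}. ?G x (t j * y)) = (\<Sum>j\<in>{1..<int p}. F x (t j * y))"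
        using dv True by (intro sum.cong) auto
      show ?thesis
      proof (cases "int ?P dvd y")
        case dvP: True
        have "F x (t j * y) = F x (e * y)" for j
        proof (rule nullD(4)[OF N], rule cong_c)
          show "[t j * y = e * y] (mod int ?P)" using dvP by (simp add: cong_def del: of_nat_power power_Suc)
          show "[t j * y = e * y] (mod int d)" using td e(2) by (meson cong_scalar_right cong_sym cong_trans)
        qed
        then show ?thesis unfolding G using dvP True p0 by (simp add: of_nat_diff)
      next
        case ndvP: False
        have pi0: "int (p ^ i) \<noteq> 0" using p0 by simp
        have ny: "\<not> int p dvd y'" using ndvP p0 by (simp add: y' mult.commute[of "int p"])
        have cp: "int c div int p = int (p ^ i) * int d" using p0 by (simp add: c(1))
        have "coprime (int d) (int p)" using c(2) by (simp add: coprime_commute)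
        \<comment> \<open>The factor \<open>g\<close> rewrites the shift by \<open>p^i y' j\<close>
          modulo \<open>p^(i+1)\<close> as a multiple of \<open>c/p = p^i d\<close>, which is 0
          modulo \<open>d\<close> as required.\<close>
        then obtain g where g: "[int d * g = 1] (mod int p)" using cong_solve_coprime_int by blast
        have "coprime (int d * g) (int p)" using g cong_imp_coprime cong_sym coprime_1_left by blast
        then have cyg: "coprime (y' * g) (int p)" using prime_coprime_int[OF p ny] by simp
        have split: "(\<Sum>j\<in>{0..<int p}. F x (t j * y)) = F x (e * y) + (\<Sum>j\<in>{1..<int p}. F x (t j * y))"
        proof -
          have "{0..<int p} = insert 0 {1..<int p}" using p0 by auto
          then show ?thesis by (simp add: t_def)
        qed
        have "(\<Sum>j\<in>{0..<int p}. F x (t j * y)) = (\<Sum>j\<in>{0..<int p}. F x (e * y + (y' * g) * j * (int c div int p)))"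
        proof (rule sum.cong[OF refl], rule nullD(4)[OF N], rule cong_c)
          fix j
          have 1: "[int (p ^ i) * (y' * j * (int d * g)) = int (p ^ i) * (y' * j)] (mod int ?P)"
          proof -
            have "[y' * j * (int d * g) = y' * j * 1] (mod int p)" by (intro cong_mult g cong_refl)
            then have "[int (p ^ i) * (y' * j * (int d * g)) = int (p ^ i) * (y' * j * 1)] (mod (int (p ^ i) * int p))"
              using pi0 by (simp add: cong_iff_dvd_diff right_diff_distrib[symmetric])
            then show ?thesis by (simp add: mult.commute)
          qed
          have "[e * y + y' * g * j * (int c div int p) = 0 * y + int (p ^ i) * (y' * j)] (mod int ?P)"
          proof (rule cong_add)
            show "[e * y = 0 * y] (mod int ?P)" by (intro cong_mult e(1) cong_refl)
            have "y' * g * j * (int c div int p) = int (p ^ i) * (y' * j * (int d * g))" unfolding cp by (simp only: mult_ac)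
            then show "[y' * g * j * (int c div int p) = int (p ^ i) * (y' * j)] (mod int ?P)" using 1 by (simp only:)
          qed
          moreover have "[t j * y = j * y] (mod int ?P)" by (intro cong_mult tp cong_refl)
          moreover have "j * y = 0 * y + int (p ^ i) * (y' * j)" by (simp add: y' mult_ac)
          ultimately show "[t j * y = e * y + y' * g * j * (int c div int p)] (mod int ?P)"
            by (metis cong_sym cong_trans)
          have "[e * y + y' * g * j * (int c div int p) = 1 * y + 0] (mod int d)"
            unfolding cp by (intro cong_add cong_mult e(2) cong_refl) (simp add: cong_0_iff)
          moreover have "[t j * y = 1 * y] (mod int d)" by (intro cong_mult td cong_refl)
          ultimately show "[t j * y = e * y + y' * g * j * (int c div int p)] (mod int d)"
            by (metis add.right_neutral cong_sym cong_trans)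
        qed
        also have "\<dots> = 0"
        proof -
          have "p dvd c" by (simp add: c(1))
          then show ?thesis
            using fiber_sum_unit[of c F x p "y' * g" "e * y", OF nullD(1)[OF N] _ p0 cyg] z by (simp add: fiber_zero_def)
        qed
        finally have "(\<Sum>j\<in>{1..<int p}. F x (t j * y)) = - F x (e * y)" using split by (simp add: add_eq_0_iff)
        then show ?thesis unfolding G using True ndvP by simp
      qed
    qed
  qed
qed

section \<open>Restriction to multiples as dilation, and the Frobenius operator\<close>

lemma bil_add: "bil c (\<lambda>x y. F x y + G x y) u v = bil c F u v + bil c G u v"
  by (simp add: bil_def distrib_left sum.distrib)

lemma bil_scale: "bil c (\<lambda>x y. a * F x y) u v = a * bil c F u v"
  by (simp add: bil_def mult.left_commute[of _ a] sum_distrib_left[symmetric])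

lemma bil_diff: "bil c (\<lambda>x y. F x y - G x y) u v = bil c F u v - bil c G u v"
  using bil_add[of c F "\<lambda>x y. - 1 * G x y" u v] bil_scale[of c "- 1" G u v] by simp

lemma bil_multiples:
  assumes n: "n > 0" "n dvd c" and c: "c > 0" and F: "\<And>x. periodic c (F x)" and v: "coprime v (int n)"
  shows "bil c (\<lambda>x y. if int n dvd y then F x y else 0) u v = bil c F u (int n * v) / of_nat n"
proof -
  define f where "f y = (\<Sum>l\<in>{0..<int c}. of_real (wt c l) * F (u * l) (v * y))" for y
  have f: "periodic c f"
    unfolding periodic_def f_def using periodic_affine[OF F, of _ 0 v] by (simp add: periodic_def)
  have dv: "int n dvd v * m \<longleftrightarrow> int n dvd m" for m
    using v coprime_commute coprime_dvd_mult_right_iff by metis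
  have "bil c (\<lambda>x y. if int n dvd y then F x y else 0) u v =
     (\<Sum>m\<in>{0..<int c}. if int n dvd m then of_real (wt c m) * f m else 0)"
    unfolding bil_def dv f_def by (intro sum.cong refl) (simp add: sum_distrib_left mult_ac)
  also have "\<dots> = (\<Sum>m\<in>{0..<int c}. of_real (wt c m) * f (int n * m)) / of_nat n"
    by (rule sum_wt_multiples[OF n c f])
  also have "(\<Sum>m\<in>{0..<int c}. of_real (wt c m) * f (int n * m)) = bil c F u (int n * v)"
    unfolding bil_def f_def by (simp add: sum_distrib_left mult_ac)
  finally show ?thesis .
qed

lemma bil_cong: assumes "\<And>x. periodic d (F x)" "[v = w] (mod int d)" shows "bil c F u v = bil c F u w"
proof -
  have "F x (v * m) = F x (w * m)" for x m
    by (rule periodic_cong[OF assms(1)]) (intro cong_mult assms(2) cong_refl)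
  then show ?thesis by (simp add: bil_def)
qed

text \<open>Multiplication by \<open>p\<close> acts on the second variable as a Frobenius operator prime to \<open>p\<close>.\<close>

lemma null_frobenius:
  assumes c: "c = p ^ Suc i * d" "coprime p d" "d > 0" and p: "prime p"
    and e: "[e = 0] (mod int (p ^ Suc i))" "[e = 1] (mod int d)"
    and N: "null c F" and z: "fiber_zero c p F"
  shows "null c (\<lambda>x y. if int p dvd y then 0 else F x (e * y) - F x (e * (int p * y)))"
proof -
  define H where "H x y = F x (e * y)" for x y
  define K where "K x y = H x y - H x (int p * y)" for x y
  have p0: "p > 0" using p prime_gt_0_nat by blast
  have c0: "c > 0" using c p0 by simp
  have dc: "d dvd c" by (simp add: c(1))
  have Hd: "periodic d (H x)" for x
    unfolding periodic_def
  proof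
    fix y
    obtain k where k: "e = int (p ^ Suc i) * k" using e(1) cong_0_iff by blast
    have "e * (y + int d) = e * y + int c * k" by (simp add: k c(1) algebra_simps)
    then show "H x (y + int d) = H x y" unfolding H_def by (simp only: periodicD_mult[OF nullD(1)[OF N]])
  qed
  have Hc: "periodic c (H x)" for x by (rule periodic_dvd[OF Hd dc])
  have Hx: "periodic c (\<lambda>x. H x y)" for y using nullD(2)[OF N] by (simp add: H_def)
  have Kd: "periodic d (K x)" for x
    using Hd[of x] periodic_affine[OF Hd[of x], of 0 "int p"] by (simp add: K_def periodic_def)
  have Kc: "periodic c (K x)" for x by (rule periodic_dvd[OF Kd dc])
  have Kx: "periodic c (\<lambda>x. K x y)" for y using Hx by (simp add: K_def periodic_def)
  have unit_lift: "\<exists>w. [w = v] (mod int d) \<and> coprime w (int c)" if "coprime v (int d)" for v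
    using coprime_lift[OF that dc c0] by metis
  \<comment> \<open>The averaged function is \<open>p\<close> times the restriction of
    \<open>H\<close> to multiples of \<open>p^(i+1)\<close>, minus its restriction to multiples of
    \<open>p^i\<close>. By \<open>bil_multiples\<close> restrictions are dilations divided by the
    same power of \<open>p\<close>. As \<open>H\<close> has period \<open>d\<close>, the dilation by
    \<open>p^i\<close> is undone by choosing the unit \<open>w\<close>.\<close>
  have H_eq: "bil c H u v = bil c H u (int p * v)" if u: "coprime u (int c)" and v: "coprime v (int d)" for u v
  proof -
    have "coprime (int p ^ i) (int d)" using c(2) by simp
    then obtain b where b: "[int p ^ i * b = 1] (mod int d)" "coprime b (int d)" using coprime_int_inverse by blast
    then have "coprime (b * v) (int d)" using v by simp
    then obtain w where w: "[w = b * v] (mod int d)" "coprime w (int c)" using unit_lift by blast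
    have wp: "coprime w (int p)" using w(2) by (simp add: c(1))
    have 1: "[int (p ^ i) * w = v] (mod int d)"
    proof -
      have "[int (p ^ i) * w = int p ^ i * (b * v)] (mod int d)" using w(1) by (auto intro: cong_mult)
      also have "int p ^ i * (b * v) = (int p ^ i * b) * v" by simp
      also have "[(int p ^ i * b) * v = 1 * v] (mod int d)" by (intro cong_mult b(1) cong_refl)
      finally show ?thesis by simp
    qed
    have 2: "[int (p ^ Suc i) * w = int p * v] (mod int d)"
      using cong_mult[OF cong_refl[of "int p"] 1] by (simp add: mult.assoc)
    let ?M = "\<lambda>k x y. if int (p ^ k) dvd y then H x y else 0"
    have M: "bil c (?M k) u w = bil c H u (int (p ^ k) * w) / of_nat (p ^ k)" if "k \<le> Suc i" for k
    proof -
      have "p ^ k dvd c" using that unfolding c(1) by (intro dvd_mult2 le_imp_power_dvd)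
      moreover have "coprime w (int (p ^ k))" using wp by simp
      ultimately show ?thesis using bil_multiples[of "p ^ k" c H w u] p0 c0 Hc by simp
    qed
    have "0 = bil c (\<lambda>x y. if int (p ^ i) dvd y then F x (e * y) * (if int (p ^ Suc i) dvd y then of_nat p - 1 else - 1) else 0) u w"
      using nullD(3)[OF null_average[OF c p e N z] u w(2)] by simp
    also have "\<dots> = bil c (\<lambda>x y. of_nat p * ?M (Suc i) x y - ?M i x y) u w"
    proof -
      have "int (p ^ i) dvd y" if "int (p ^ Suc i) dvd y" for y
        using that by (metis dvd_trans dvd_triv_right int_dvd_int_iff power_Suc)
      then have "(\<lambda>x y. if int (p ^ i) dvd y then F x (e * y) * (if int (p ^ Suc i) dvd y then of_nat p - 1 else - 1) else 0)
         = (\<lambda>x y. of_nat p * ?M (Suc i) x y - ?M i x y)"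
        by (intro ext) (simp add: H_def algebra_simps del: of_nat_power power_Suc)
      then show ?thesis by (simp only:)
    qed
    also have "\<dots> = of_nat p * (bil c H u (int (p ^ Suc i) * w) / of_nat (p ^ Suc i)) - bil c H u (int (p ^ i) * w) / of_nat (p ^ i)"
      unfolding bil_diff bil_scale by (simp only: M[of "Suc i"] M[of i] le_refl le_SucI)
    also have "\<dots> = (bil c H u (int p * v) - bil c H u v) / of_nat (p ^ i)"
      unfolding bil_cong[OF Hd 1] bil_cong[OF Hd 2] using p0 by (simp add: diff_divide_distrib)
    finally show ?thesis using p0 by simp
  qed
  have K0: "bil c K u v = 0" if "coprime u (int c)" "coprime v (int d)" for u v
  proof -
    have "bil c (\<lambda>x y. H x (int p * y)) u v = bil c H u (int p * v)" by (simp add: bil_def mult_ac)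
    then show ?thesis using H_eq[OF that] unfolding K_def bil_diff by simp
  qed
  \<comment> \<open>Removing the multiples of \<open>p\<close> subtracts the pairing dilated by
    \<open>p\<close>; it vanishes too, because \<open>K\<close> has period \<open>d\<close> and
    \<open>p\<close> is a unit modulo \<open>d\<close>.\<close>
  have "bil c (\<lambda>x y. if int p dvd y then 0 else K x y) u v = 0"
    if uv: "coprime u (int c)" "coprime v (int c)" for u v
  proof -
    have v: "coprime v (int d)" "coprime v (int p)" using uv(2) by (simp_all add: c(1))
    have "(\<lambda>x y. if int p dvd y then 0 else K x y) = (\<lambda>x y. K x y - (if int p dvd y then K x y else 0))"
      by (intro ext) simp
    then have "bil c (\<lambda>x y. if int p dvd y then 0 else K x y) u v = bil c K u v - bil c K u (int p * v) / of_nat p"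
      using bil_multiples[of p c K v u] p0 c0 Kc v(2) by (simp add: bil_diff c(1))
    moreover have "coprime (int p * v) (int d)" using v(1) c(2) by simp
    ultimately show ?thesis using K0 uv(1) v(1) by simp
  qed
  moreover have "periodic c (\<lambda>y. if int p dvd y then 0 else K x y)" for x
    using Kc[of x] by (simp add: periodic_def c(1) dvd_add_left_iff)
  moreover have "periodic c (\<lambda>x. if int p dvd y then 0 else K x y)" for y
    using Kx[of y] by (simp add: periodic_def)
  ultimately show ?thesis unfolding null_def K_def H_def by blast
qed

text \<open>What averaging over the dilations at a prime \<open>p\<close> exactly dividing \<open>c\<close> leaves of \<open>\<xi>(x + y)\<close>.\<close>

definition unit_part :: "nat \<Rightarrow> (int \<Rightarrow> complex) \<Rightarrow> int \<Rightarrow> int \<Rightarrow> complex" where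
  "unit_part p \<xi> x y = (if int p dvd x \<or> int p dvd y then 0 else \<xi> (x + y) + (\<xi> x + \<xi> y) / (of_nat p - 1))"

text \<open>Subtract from \<open>F\<close> the average of \<open>null_average\<close> with
  \<open>i = 0\<close>, divided by \<open>p - 1\<close>: on multiples of \<open>p\<close> this
  cancels \<open>F\<close>, elsewhere it adds \<open>F(x, e y)/(p - 1)\<close>, where
  \<open>e y\<close> is 0 modulo \<open>p\<close> and \<open>y\<close> modulo \<open>d\<close>.
  Doing so in both variables turns \<open>\<xi>(x + y)\<close> into \<open>unit_part\<close>; the
  term with both arguments removed is absent because \<open>\<xi> 0 = 0\<close>.\<close>

lemma null_unit_part:
  assumes c: "c = p * d" "coprime p d" "d > 0" and p: "prime p"
    and \<xi>: "periodic p \<xi>" "\<xi> 0 = 0" "(\<Sum>r\<in>{0..<int p}. \<xi> r) = 0"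
    and A: "\<And>x. periodic d (A x)" "\<And>y. periodic d (\<lambda>x. A x y)"
    and N: "null c (\<lambda>x y. A x y * \<xi> (x + y))"
  shows "null c (\<lambda>x y. A x y * unit_part p \<xi> x y)"
proof -
  have p0: "p > 0" and p1: "p > 1" using p prime_gt_0_nat prime_gt_1_nat by blast+
  have pc: "of_nat p - (1::complex) \<noteq> 0" using p1 by (metis of_nat_1 of_nat_eq_iff less_irrefl right_minus_eq)
  have "coprime (int d) (int p)" using c(2) by (simp add: coprime_commute)
  then obtain g where g: "[int d * g = 1] (mod int p)" using cong_solve_coprime_int by blast
  define e where "e = int p * (SOME h. [int p * h = 1] (mod int d))"
  have "coprime (int p) (int d)" using c(2) by simp
  then have "\<exists>h. [int p * h = 1] (mod int d)" using cong_solve_coprime_int by blast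
  then have ed: "[e = 1] (mod int d)" unfolding e_def by (rule someI_ex)
  have ep: "int p dvd e" by (simp add: e_def)
  have cp: "int c div int p = int d" using p0 by (simp add: c(1))
  have e': "[e = 0] (mod int (p ^ Suc 0))" "[e = 1] (mod int d)" using ed ep by (simp_all add: cong_0_iff)
  have c': "c = p ^ Suc 0 * d" using c by simp
  have sum0: "(\<Sum>r\<in>{0..<int p}. \<xi> (a + r * int d)) = 0" for a
    using sum_residues_affine[OF \<xi>(1) \<open>coprime (int d) (int p)\<close>, of a] \<xi>(3) by (simp add: mult.commute)
  have Ae: "A x (e * y) = A x y" "A (e * x) y = A x y" for x y
    using ed by (auto intro!: periodic_cong[OF A(1)] periodic_cong[OF A(2)] simp: cong_scalar_right[of e 1 _ y, simplified] cong_scalar_right[of e 1 _ x, simplified])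
  have Ar: "A x (y + r * int d) = A x y" for x y r using periodicD_mult[OF A(1), of x y r] by (simp add: mult.commute)
  have xe: "\<xi> (x + e * y) = \<xi> x" for x y
    by (rule periodic_cong[OF \<xi>(1)]) (use ep in \<open>simp add: cong_iff_dvd_diff\<close>)
  have step: "null c (\<lambda>x y. if int p dvd y then 0 else F x y + F x (e * y) / (of_nat p - 1))"
    if N: "null c F" and z: "fiber_zero c p F" for F
  proof (rule null_cong[OF null_diff[OF N null_scale[OF null_average[OF c' c(2,3) p e' N z], of "1 / (of_nat p - 1)"]]])
    fix x y
    have "F x (e * y) = F x y" if "int p dvd y"
    proof (rule nullD(4)[OF N])
      have "int p dvd e * y - y" using that by simp
      moreover have "int d dvd e * y - y" using cong_scalar_right[OF ed, of y] by (simp add: cong_iff_dvd_diff)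
      moreover have "coprime (int p) (int d)" using c(2) by simp
      ultimately have "int p * int d dvd e * y - y" by (rule divides_mult)
      then show "[e * y = y] (mod int c)" by (simp add: cong_iff_dvd_diff c(1))
    qed
    then show "F x y - 1 / (of_nat p - 1) * (if int (p ^ 0) dvd y
          then F x (e * y) * (if int (p ^ Suc 0) dvd y then of_nat p - 1 else - 1) else 0) =
         (if int p dvd y then 0 else F x y + F x (e * y) / (of_nat p - 1))"
      using pc by simp
  qed
  have z1: "fiber_zero c p (\<lambda>x y. A x y * \<xi> (x + y))"
    unfolding fiber_zero_def cp
  proof (intro allI)
    fix x y
    have "(\<Sum>r\<in>{0..<int p}. A x (y + r * int d) * \<xi> (x + (y + r * int d))) = A x y * (\<Sum>r\<in>{0..<int p}. \<xi> ((x + y) + r * int d))"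
      by (simp add: Ar sum_distrib_left add.assoc)
    then show "(\<Sum>r\<in>{0..<int p}. A x (y + r * int d) * \<xi> (x + (y + r * int d))) = 0" using sum0 by simp
  qed
  define G where "G y x = (if int p dvd y then 0 else A x y * (\<xi> (x + y) + \<xi> x / (of_nat p - 1)))" for x y
  have "null c (\<lambda>x y. if int p dvd y then 0 else A x y * \<xi> (x + y) + A x (e * y) * \<xi> (x + e * y) / (of_nat p - 1))"
    using step[OF N z1] by simp
  then have "null c (\<lambda>x y. G y x)" by (rule null_cong) (simp add: G_def Ae xe distrib_left)
  then have N2: "null c G" by (rule null_flip)
  have z2: "fiber_zero c p G"
    unfolding fiber_zero_def cp
  proof (intro allI)
    fix y x
    have Ax: "A (x + r * int d) y = A x y" for r using periodicD_mult[OF A(2)[of y], of x r] by (simp add: mult.commute)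
    have "(\<Sum>r\<in>{0..<int p}. A (x + r * int d) y * (\<xi> (x + r * int d + y) + \<xi> (x + r * int d) / (of_nat p - 1)))
       = A x y * ((\<Sum>r\<in>{0..<int p}. \<xi> ((x + y) + r * int d)) + (\<Sum>r\<in>{0..<int p}. \<xi> (x + r * int d)) / (of_nat p - 1))"
      by (simp add: Ax sum_distrib_left sum.distrib sum_divide_distrib distrib_left add_ac)
    then have "(\<Sum>r\<in>{0..<int p}. A (x + r * int d) y * (\<xi> (x + r * int d + y) + \<xi> (x + r * int d) / (of_nat p - 1))) = 0" by (simp add: sum0)
    then show "(\<Sum>r\<in>{0..<int p}. G y (x + r * int d)) = 0" by (cases "int p dvd y") (simp_all add: G_def)
  qed
  have xe0: "\<xi> (e * x) = 0" "\<xi> (e * x + y) = \<xi> y" for x y using xe[of 0 x] xe[of y x] \<xi>(2) by (simp_all add: add.commute)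
  from null_flip[OF step[OF N2 z2]] show ?thesis
    by (rule null_cong) (simp add: G_def unit_part_def Ae xe0 add_divide_distrib distrib_left)
qed

text \<open>Pair in \<open>x\<close> first: the odd part in \<open>y\<close> of the result vanishes
  by \<open>wt_null_imp_zero\<close>. Then, for fixed \<open>y\<close>, the odd part in
  \<open>x\<close> vanishes by the same theorem.\<close>

lemma null_unit_support_imp_zero:
  assumes c: "c > 0" and N: "null c F"
    and s: "\<And>x y. \<not> coprime x (int c) \<or> \<not> coprime y (int c) \<Longrightarrow> F x y = 0"
  shows "F x y - F x (- y) - F (- x) y + F (- x) (- y) = 0"
proof -
  have m: "coprime (- v) (int c) \<longleftrightarrow> coprime v (int c)" for v by simp
  have neg: "periodic c (\<lambda>y. f (- y))" if "periodic c f" for f using periodic_affine[OF that, of 0 "- 1"] by simp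
  have 1: "(\<Sum>l\<in>{0..<int c}. of_real (wt c l) * (F (u * l) y - F (u * l) (- y))) = 0" if u: "coprime u (int c)" for u y
  proof -
    define f where "f y = (\<Sum>l\<in>{0..<int c}. of_real (wt c l) * (F (u * l) y - F (u * l) (- y)))" for y
    have "odd_unit_fun c f"
      unfolding odd_unit_fun_def
    proof (intro conjI allI impI)
      show "periodic c f" using nullD(1)[OF N] neg[OF nullD(1)[OF N]] by (simp add: f_def periodic_def)
      show "f x = 0" if "\<not> coprime x (int c)" for x using s that m by (simp add: f_def)
      show "f (- x) = - f x" for x
        unfolding f_def by (simp add: sum_negf[symmetric]) (intro sum.cong refl, simp add: algebra_simps)
    qed
    moreover have "wt_null c f"
      unfolding wt_null_def
    proof (intro allI impI)
      fix v assume v: "coprime v (int c)"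
      have "(\<Sum>n\<in>{0..<int c}. of_real (wt c n) * f (n * v)) = bil c F u v - bil c F u (- v)"
        unfolding f_def bil_def sum_subtractf[symmetric] sum_distrib_left
        by (intro sum.cong refl) (simp add: algebra_simps)
      also have "\<dots> = 0" using nullD(3)[OF N u] v m by simp
      finally show "(\<Sum>n\<in>{0..<int c}. of_real (wt c n) * f (n * v)) = 0" .
    qed
    ultimately have "f y = 0" by (rule wt_null_imp_zero[OF c])
    then show ?thesis by (simp add: f_def)
  qed
  define g where "g x = (F x y - F x (- y)) - (F (- x) y - F (- x) (- y))" for x
  have "odd_unit_fun c g"
    unfolding odd_unit_fun_def
  proof (intro conjI allI impI)
    show "periodic c g" using nullD(2)[OF N] neg[OF nullD(2)[OF N]] by (simp add: g_def periodic_def)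
    show "g x = 0" if "\<not> coprime x (int c)" for x using s that m by (simp add: g_def)
  qed (simp add: g_def)
  moreover have "wt_null c g"
    unfolding wt_null_def
  proof (intro allI impI)
    fix u assume u: "coprime u (int c)"
    have "(\<Sum>n\<in>{0..<int c}. of_real (wt c n) * g (n * u)) =
       (\<Sum>l\<in>{0..<int c}. of_real (wt c l) * (F (u * l) y - F (u * l) (- y)))
      - (\<Sum>l\<in>{0..<int c}. of_real (wt c l) * (F ((- u) * l) y - F ((- u) * l) (- y)))"
      unfolding g_def sum_subtractf[symmetric] by (intro sum.cong refl) (simp add: algebra_simps)
    then show "(\<Sum>n\<in>{0..<int c}. of_real (wt c n) * g (n * u)) = 0" using 1[of u y] 1[of "- u" y] u m by simp
  qed
  ultimately have "g x = 0" by (rule wt_null_imp_zero[OF c])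
  then show ?thesis by (simp add: g_def algebra_simps)
qed

section \<open>Nonvanishing at levels without redundant primes\<close>

context dedekind_data
begin

text \<open>From 5 on, \<open>1 - 2/(p - 1)\<close> is positive, so \<open>unit_part\<close> does
  not vanish at units with unit sum.\<close>

definition simple_primes :: "nat set" where
  "simple_primes = {p. prime p \<and> p dvd q2 \<and> \<not> p dvd D \<and> \<not> p\<^sup>2 dvd q2 \<and> p \<ge> 5}"

definition idem :: "nat \<Rightarrow> int" where
  "idem p = (SOME e. [e = 1] (mod int p) \<and> [e = 0] (mod int (c div p)))"

text \<open>The component of \<open>X2\<close> at \<open>p\<close>: the argument is congruent to
  \<open>n\<close> modulo \<open>p\<close> and to 1 modulo \<open>c/p\<close>.\<close>

definition loc :: "nat \<Rightarrow> int \<Rightarrow> complex" where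
  "loc p n = X2 (1 + idem p * (n - 1))"

text \<open>Replaces the component of \<open>n\<close> at each prime of \<open>S\<close> by 1 and
  keeps \<open>n\<close> modulo the part of \<open>c\<close> prime to \<open>S\<close>.\<close>

definition shift :: "nat set \<Rightarrow> int \<Rightarrow> int" where
  "shift S n = n + (\<Sum>p\<in>S. idem p) * (1 - n)"

text \<open>For empty \<open>S\<close> this is \<open>X1 y * kap (x + y)\<close>; each prime
  \<open>p\<close> of \<open>S\<close> trades the local factor \<open>loc p (x + y)\<close> for
  \<open>unit_part\<close>.\<close>

definition ker :: "nat set \<Rightarrow> int \<Rightarrow> int \<Rightarrow> complex" where
  "ker S x y = X1 y * kap (shift S (x + y)) * (\<Prod>p\<in>S. unit_part p (loc p) x y)"

lemma kap_scale: assumes "coprime a (int D)" shows "kap (a * n) = X2 a * kap n"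
proof (cases "int D dvd n")
  case True
  then obtain k where k: "n = int D * k" ..
  have "a * n = int D * (a * k)" by (simp add: k)
  then show ?thesis by (simp only: kap_mult k D2(2))
next
  case False
  have "coprime (int D) a" using assms by (simp add: coprime_commute)
  then have "\<not> int D dvd a * n" using False by (simp add: coprime_dvd_mult_right_iff)
  then show ?thesis using False by (simp add: kap_eq_0)
qed

lemma kap_uminus: "kap (- n) = X2 (- 1) * kap n"
  using kap_scale[of "- 1" n] by simp

text \<open>Unit dilations change the argument of \<open>R\<close> and introduce a factor of
  absolute value 1, so the vanishing of \<open>R\<close> at all units says that
  \<open>X1 y * kap (x + y)\<close> is null.\<close>

lemma bil_kap:
  assumes u: "coprime u (int c)" and v: "coprime v (int c)" and u': "[u * u' = 1] (mod int c)"
  shows "bil c (\<lambda>x y. X1 y * kap (x + y)) u v = X1 v * X2 u * R (u' * v)"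
proof -
  have uD: "coprime u (int D)" using u by (simp add: c_eq)
  have "kap (u * l + v * m) = X2 u * kap (l + u' * v * m)" for l m
  proof -
    have "[u * u' * (v * m) = 1 * (v * m)] (mod int c)" by (intro cong_mult u' cong_refl)
    then have "[u * l + v * m = u * (l + u' * v * m)] (mod int c)"
      by (simp add: distrib_left mult.assoc cong_add_lcancel cong_sym_eq)
    then have "kap (u * l + v * m) = kap (u * (l + u' * v * m))" by (rule periodic_cong[OF kap_periodic])
    then show ?thesis by (simp only: kap_scale[OF uD])
  qed
  then show ?thesis
    unfolding bil_def R_def by (simp add: D1(2) sum_distrib_left mult_ac)
qed

lemma simple_primeD:
  assumes "p \<in> simple_primes"
  shows "prime p" "p > 0" "c = p * (c div p)" "coprime p (c div p)" "c div p = D * (q2 div p)" "p dvd q2"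
    "D dvd c div p" "q1 dvd c div p" "q2 = q2 div p * p" "q2 div p < q2" "c div p > 0"
proof -
  show p: "prime p" "p dvd q2" using assms by (auto simp: simple_primes_def)
  show p0: "p > 0" using p(1) prime_gt_0_nat by blast
  show q: "q2 = q2 div p * p" using p(2) by simp
  have cq: "c = p * (D * (q2 div p))" unfolding c_eq by (subst (1) q) (simp only: mult_ac)
  then show e: "c div p = D * (q2 div p)" using p0 by simp
  show "c = p * (c div p)" using cq e by simp
  have "\<not> p dvd q2 div p" using assms q unfolding simple_primes_def by (metis (no_types, lifting) mem_Collect_eq mult_dvd_mono dvd_refl power2_eq_square)
  then show "coprime p (c div p)" using assms p(1) prime_imp_coprime unfolding e simple_primes_def by auto
  show "D dvd c div p" by (simp add: e)
  then show "q1 dvd c div p" using q1_dvd_D dvd_trans by blast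
  show "q2 div p < q2" using p(1) q2_ge prime_gt_1_nat by (intro div_less_dividend) auto
  show "c div p > 0" using c_pos \<open>c = p * (c div p)\<close> by (metis gr0I mult_0_right less_irrefl)
qed

lemma finite_simple_primes: "finite simple_primes"
  by (rule finite_subset[of _ "{..q2}"]) (use q2_ge in \<open>auto simp: simple_primes_def intro: dvd_imp_le\<close>)

lemma idem:
  assumes "p \<in> simple_primes"
  shows "int p dvd idem p - 1" "int (c div p) dvd idem p"
proof -
  have "coprime (int (c div p)) (int p)" using simple_primeD(4)[OF assms] by (simp add: coprime_commute)
  then obtain h where h: "[int (c div p) * h = 1] (mod int p)" using cong_solve_coprime_int by blast
  then have "\<exists>e. [e = 1] (mod int p) \<and> [e = 0] (mod int (c div p))"
    by (intro exI[of _ "int (c div p) * h"]) (simp add: cong_0_iff)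
  then have "[idem p = 1] (mod int p) \<and> [idem p = 0] (mod int (c div p))" unfolding idem_def by (rule someI_ex)
  then show "int p dvd idem p - 1" "int (c div p) dvd idem p" by (auto simp: cong_iff_dvd_diff)
qed

lemma cong_simple_prime:
  assumes "p \<in> simple_primes" "int p dvd a - b" "int (c div p) dvd a - b"
  shows "[a = b] (mod int c)"
proof -
  have "coprime (int p) (int (c div p))" using simple_primeD(4)[OF assms(1)] by simp
  then have "int p * int (c div p) dvd a - b" using assms(2,3) by (intro divides_mult)
  then show ?thesis using simple_primeD(3)[OF assms(1)] by (metis cong_iff_dvd_diff of_nat_mult)
qed

lemma simple_prime_dvd: "p \<in> simple_primes \<Longrightarrow> q \<in> simple_primes \<Longrightarrow> q \<noteq> p \<Longrightarrow> q dvd c div p"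
proof -
  assume a: "p \<in> simple_primes" "q \<in> simple_primes" "q \<noteq> p"
  have "coprime q p" using a simple_primeD(1) primes_coprime by metis
  moreover have "q dvd p * (c div p)" using simple_primeD(3)[OF a(1)] simple_primeD(6)[OF a(2)] by (metis c_eq dvd_mult)
  ultimately show ?thesis by (simp add: coprime_dvd_mult_right_iff)
qed

lemma sum_idem_dvd:
  assumes "S \<subseteq> simple_primes"
  shows "p \<in> S \<Longrightarrow> int p dvd (\<Sum>q\<in>S. idem q) - 1"
    "(\<And>p. p \<in> S \<Longrightarrow> g dvd c div p) \<Longrightarrow> int g dvd (\<Sum>q\<in>S. idem q)"
proof -
  have fin: "finite S" using assms finite_simple_primes finite_subset by blast
  show "p \<in> S \<Longrightarrow> int p dvd (\<Sum>q\<in>S. idem q) - 1"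
  proof -
    assume p: "p \<in> S"
    have "int p dvd idem q" if q: "q \<in> S - {p}" for q
    proof -
      have "p dvd c div q" using simple_prime_dvd[of q p] q p assms by blast
      then have "int p dvd int (c div q)" by (simp only: int_dvd_int_iff)
      also have "\<dots> dvd idem q" using idem(2) q assms by blast
      finally show ?thesis .
    qed
    then have "int p dvd (\<Sum>q\<in>S-{p}. idem q)" by (rule dvd_sum)
    moreover have "(\<Sum>q\<in>S. idem q) = idem p + (\<Sum>q\<in>S-{p}. idem q)" using p fin by (rule sum.remove[rotated])
    moreover have "int p dvd idem p - 1" using idem(1) p assms by blast
    ultimately show ?thesis by (metis add_diff_eq add.commute dvd_add)
  qed
  show "int g dvd (\<Sum>q\<in>S. idem q)" if g: "\<And>p. p \<in> S \<Longrightarrow> g dvd c div p"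
  proof (rule dvd_sum)
    fix q assume q: "q \<in> S"
    then have "int g dvd int (c div q)" using g int_dvd_int_iff by blast
    also have "int (c div q) dvd idem q" using idem(2) q assms by blast
    finally show "int g dvd idem q" .
  qed
qed

lemma loc_props:
  assumes p: "p \<in> simple_primes"
  shows "periodic p (loc p)" "loc p 0 = 0" "(\<Sum>r\<in>{0..<int p}. loc p r) = 0" "loc p (a * b) = loc p a * loc p b"
    "loc p 1 = 1" "\<not> int p dvd a \<Longrightarrow> cmod (loc p a) = 1"
proof -
  note P = simple_primeD[OF p] and I = idem[OF p]
  have q2p: "X2 n = X2 m" if "[n = m] (mod int c)" for n m
    by (rule periodic_cong[OF D2(3)]) (use that in \<open>auto simp: c_eq intro: cong_modulus_mult\<close>, metis cong_modulus_mult mult.commute)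
  show "periodic p (loc p)"
    unfolding periodic_def loc_def
  proof
    fix x
    have "int c dvd idem p * int p" using I(2) P(3) by (metis dvd_refl mult.commute mult_dvd_mono of_nat_mult)
    then have "[1 + idem p * (x + int p - 1) = 1 + idem p * (x - 1)] (mod int c)"
      by (simp add: cong_iff_dvd_diff algebra_simps)
    then show "X2 (1 + idem p * (x + int p - 1)) = X2 (1 + idem p * (x - 1))" by (rule q2p)
  qed
  show "loc p 1 = 1" by (simp add: loc_def D2(5))
  have "int p dvd int q2" using P(6) by simp
  moreover have "int p dvd 1 - idem p" using I(1) by (metis dvd_minus_iff minus_diff_eq)
  ultimately have "\<not> coprime (1 - idem p) (int q2)" using P(1)
    by (metis coprime_common_divisor not_prime_unit prime_nat_int_transfer)
  then show "loc p 0 = 0" by (simp add: loc_def D2(4))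
  show "loc p (a * b) = loc p a * loc p b"
  proof -
    have "[(1 + idem p * (a - 1)) * (1 + idem p * (b - 1)) = 1 + idem p * (a * b - 1)] (mod int c)"
    proof (rule cong_simple_prime[OF p])
      have *: "(1 + idem p * (a - 1)) * (1 + idem p * (b - 1)) - (1 + idem p * (a * b - 1)) = idem p * (idem p - 1) * ((a - 1) * (b - 1))"
        by (simp add: algebra_simps)
      show "int p dvd (1 + idem p * (a - 1)) * (1 + idem p * (b - 1)) - (1 + idem p * (a * b - 1))"
        unfolding * by (intro dvd_mult2 dvd_mult I(1))
      show "int (c div p) dvd (1 + idem p * (a - 1)) * (1 + idem p * (b - 1)) - (1 + idem p * (a * b - 1))"
        unfolding * by (intro dvd_mult2 I(2))
    qed
    from q2p[OF this] show ?thesis by (simp add: loc_def D2(2))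
  qed
  show "cmod (loc p a) = 1" if "\<not> int p dvd a"
    unfolding loc_def
  proof (rule dirichlet_character_norm[OF dc2])
    have "coprime (1 + idem p * (a - 1)) (int p)"
    proof (rule prime_coprime_int[OF P(1)])
      have "(1 + idem p * (a - 1)) - a = (idem p - 1) * (a - 1)" by (simp add: algebra_simps)
      then have "int p dvd (1 + idem p * (a - 1)) - a" using I(1) by simp
      then show "\<not> int p dvd 1 + idem p * (a - 1)"
        using that dvd_diff[of "int p" "1 + idem p * (a - 1)" "(1 + idem p * (a - 1)) - a"] by auto
    qed
    moreover have "coprime (1 + idem p * (a - 1)) (int (c div p))"
      by (rule coprime_one_add) (simp add: I(2))
    ultimately have "coprime (1 + idem p * (a - 1)) (int (p * (c div p)))" by simp
    then show "coprime (1 + idem p * (a - 1)) (int q2)" using P(3) c_eq by (metis coprime_mult_right_iff of_nat_mult)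
  qed
  show "(\<Sum>r\<in>{0..<int p}. loc p r) = 0"
  proof -
    \<comment> \<open>As \<open>n\<close> varies, the argument of \<open>X2\<close> in
      \<open>loc p n\<close> runs through a progression with difference \<open>q2/p\<close>, up to
      the unit \<open>k\<close>, so \<open>primitive_character_class_sum\<close> applies.\<close>
    have "int (q2 div p) dvd idem p" using I(2) unfolding P(5) by (metis dvd_trans dvd_triv_right int_dvd_int_iff)
    then obtain k where k: "idem p = int (q2 div p) * k" ..
    have "\<not> int p dvd k"
    proof
      assume "int p dvd k"
      then have "int p dvd idem p" by (simp add: k)
      then have "int p dvd 1" using I(1) dvd_diff[of "int p" "idem p" "idem p - 1"] by simp
      then show False using P(1) by (metis not_prime_unit prime_nat_int_transfer)
    qed
    then have ck: "coprime k (int p)" by (rule prime_coprime_int[OF P(1)])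
    let ?f = "\<lambda>s. X2 ((1 - idem p) + int (q2 div p) * s)"
    have per: "periodic p ?f"
      unfolding periodic_def
    proof
      fix s
      have "int q2 = int (q2 div p) * int p" using P(9) by (metis of_nat_mult)
      then have "(1 - idem p) + int (q2 div p) * (s + int p) = ((1 - idem p) + int (q2 div p) * s) + int q2 * 1"
        by (simp add: distrib_left)
      then show "?f (s + int p) = ?f s" by (simp only: periodicD_mult[OF D2(3)])
    qed
    have "(\<Sum>r\<in>{0..<int p}. loc p r) = (\<Sum>r\<in>{0..<int p}. ?f (k * r))"
      by (rule sum.cong[OF refl]) (simp add: loc_def k algebra_simps)
    also have "\<dots> = (\<Sum>r\<in>{0..<int p}. ?f r)" by (rule sum_residues_mult[OF per ck])
    also have "\<dots> = 0" by (rule primitive_character_class_sum[OF prim2 P(9) P(10)])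
    finally show ?thesis .
  qed
qed

text \<open>Modulo \<open>c\<close>, \<open>n\<close> is the product of
  \<open>1 + idem p * (n - 1)\<close>, carrying the component at \<open>p\<close>, and
  \<open>n + idem p * (1 - n)\<close>, carrying the others. The first is 1 modulo \<open>D\<close>,
  so \<open>kap_scale\<close> extracts it.\<close>

lemma kap_split:
  assumes p: "p \<in> simple_primes"
  shows "kap n = loc p n * kap (n + idem p * (1 - n))"
proof -
  note I = idem[OF p]
  let ?a = "1 + idem p * (n - 1)"
  have Dv: "int D dvd idem p" using I(2) simple_primeD(7)[OF p] by (meson dvd_trans int_dvd_int_iff)
  have a: "coprime ?a (int D)" by (rule coprime_one_add) (simp add: Dv)
  have "[?a * (n + idem p * (1 - n)) = n] (mod int c)"
  proof (rule cong_simple_prime[OF p])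
    have *: "?a * (n + idem p * (1 - n)) - n = idem p * (idem p - 1) * ((n - 1) * (1 - n))"
      by (simp add: algebra_simps)
    show "int p dvd ?a * (n + idem p * (1 - n)) - n" unfolding * by (intro dvd_mult2 dvd_mult I(1))
    show "int (c div p) dvd ?a * (n + idem p * (1 - n)) - n" unfolding * by (intro dvd_mult2 I(2))
  qed
  from periodic_cong[OF kap_periodic this] show ?thesis by (simp only: kap_scale[OF a] loc_def)
qed

lemma unit_part_periodic:
  assumes "periodic p \<xi>"
  shows "periodic p (unit_part p \<xi> x)" "periodic p (\<lambda>x. unit_part p \<xi> x y)"
proof -
  have "\<xi> (x + (y + int p)) = \<xi> (x + y)" "\<xi> (x + int p + y) = \<xi> (x + y)" "\<xi> (x + int p) = \<xi> x" for x y
    using assms by (metis periodic_def add.assoc add.commute)+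
  then show "periodic p (unit_part p \<xi> x)" "periodic p (\<lambda>x. unit_part p \<xi> x y)"
    by (simp_all add: periodic_def unit_part_def dvd_add_left_iff)
qed

text \<open>Common factor of \<open>ker S\<close> and \<open>ker (insert p S)\<close>. Its period
  \<open>c/p\<close> in both variables lets it serve as the factor \<open>A\<close> of
  \<open>null_unit_part\<close>.\<close>

definition rest :: "nat set \<Rightarrow> nat \<Rightarrow> int \<Rightarrow> int \<Rightarrow> complex" where
  "rest S p x y = X1 y * kap (shift (insert p S) (x + y)) * (\<Prod>q\<in>S. unit_part q (loc q) x y)"

lemma rest_props:
  assumes S: "S \<subseteq> simple_primes" and p: "p \<in> simple_primes" "p \<notin> S"
  shows "ker S x y = rest S p x y * loc p (x + y)"
    "ker (insert p S) x y = rest S p x y * unit_part p (loc p) x y"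
    "periodic (c div p) (rest S p x)" "periodic (c div p) (\<lambda>x. rest S p x y)"
proof -
  note P = simple_primeD[OF p(1)] and I = idem[OF p(1)] and L = loc_props[OF p(1)]
  have fin: "finite S" using S finite_simple_primes finite_subset by blast
  let ?s = "\<Sum>q\<in>S. idem q"
  have sp: "int p dvd ?s"
    by (rule sum_idem_dvd(2)[OF S]) (use simple_prime_dvd[of _ p] S p in blast)
  have sh: "shift (insert p S) n = n + (idem p + ?s) * (1 - n)" for n using fin p(2) by (simp add: shift_def)
  have "kap (shift S n) = loc p n * kap (shift (insert p S) n)" for n
  proof -
    have "loc p (shift S n) = loc p n"
      by (rule periodic_cong[OF L(1)]) (use sp in \<open>simp add: shift_def cong_iff_dvd_diff\<close>)
    moreover have "[shift S n + idem p * (1 - shift S n) = shift (insert p S) n] (mod int c)"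
    proof (rule cong_simple_prime[OF p(1)])
      have *: "shift S n + idem p * (1 - shift S n) - shift (insert p S) n = - (idem p * (?s * (1 - n)))"
        unfolding sh unfolding shift_def by (simp add: algebra_simps)
      show "int p dvd shift S n + idem p * (1 - shift S n) - shift (insert p S) n" unfolding * using sp by simp
      show "int (c div p) dvd shift S n + idem p * (1 - shift S n) - shift (insert p S) n" unfolding * using I(2) by simp
    qed
    ultimately show ?thesis using kap_split[OF p(1), of "shift S n"] periodic_cong[OF kap_periodic] by metis
  qed
  then show "ker S x y = rest S p x y * loc p (x + y)" by (simp add: ker_def rest_def mult_ac)
  show "ker (insert p S) x y = rest S p x y * unit_part p (loc p) x y"
    using fin p(2) by (simp add: ker_def rest_def mult_ac)
  have "kap (shift (insert p S) (n + int (c div p))) = kap (shift (insert p S) n)" for n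
  proof (rule periodic_cong[OF kap_periodic], rule cong_simple_prime[OF p(1)])
    have *: "shift (insert p S) (n + int (c div p)) - shift (insert p S) n = int (c div p) * ((1 - idem p) - ?s)"
      unfolding sh by (simp add: algebra_simps)
    show "int (c div p) dvd shift (insert p S) (n + int (c div p)) - shift (insert p S) n" unfolding * by simp
    have "int p dvd (1 - idem p) - ?s" using sp I(1) by (metis dvd_diff dvd_diff_commute)
    then show "int p dvd shift (insert p S) (n + int (c div p)) - shift (insert p S) n" unfolding * by simp
  qed
  then have K: "kap (shift (insert p S) (x + int (c div p) + y)) = kap (shift (insert p S) (x + y))"
    "kap (shift (insert p S) (x + (y + int (c div p)))) = kap (shift (insert p S) (x + y))" for x y
    by (metis add.assoc add.commute)+
  have U: "unit_part q (loc q) x (y + int (c div p)) = unit_part q (loc q) x y"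
    "unit_part q (loc q) (x + int (c div p)) y = unit_part q (loc q) x y" if q: "q \<in> S" for q x y
  proof -
    have "q dvd c div p" using simple_prime_dvd[of p q] S p q by blast
    moreover have "periodic q (loc q)" using loc_props(1) S q by blast
    ultimately have "periodic (c div p) (unit_part q (loc q) x)" "periodic (c div p) (\<lambda>x. unit_part q (loc q) x y)"
      using unit_part_periodic periodic_dvd by blast+
    then show "unit_part q (loc q) x (y + int (c div p)) = unit_part q (loc q) x y"
      "unit_part q (loc q) (x + int (c div p)) y = unit_part q (loc q) x y" by (simp_all add: periodic_def)
  qed
  have X: "X1 (y + int (c div p)) = X1 y" for y using periodic_dvd[OF D1(3) P(8)] by (simp add: periodic_def)
  show "periodic (c div p) (rest S p x)" "periodic (c div p) (\<lambda>x. rest S p x y)"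
    unfolding periodic_def rest_def K X using U by (simp_all cong: prod.cong)
qed

lemma null_ker:
  assumes N: "null c (\<lambda>x y. X1 y * kap (x + y))" and S: "S \<subseteq> simple_primes"
  shows "null c (ker S)"
proof -
  have "finite S" using S finite_simple_primes finite_subset by blast
  then show ?thesis using S
  proof (induction S rule: finite_induct)
    case empty then show ?case using N by (simp add: ker_def[abs_def] shift_def)
  next
    case (insert p S)
    then have p: "p \<in> simple_primes" and S: "S \<subseteq> simple_primes" by auto
    note r = rest_props[OF S p insert.hyps(2)] and P = simple_primeD[OF p] and L = loc_props[OF p]
    have "null c (\<lambda>x y. rest S p x y * loc p (x + y))"
      using insert.IH[OF S] by (rule null_cong) (rule r(1))
    then have "null c (\<lambda>x y. rest S p x y * unit_part p (loc p) x y)"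
      by (rule null_unit_part[OF P(3,4,11,1) L(1,2,3) r(3,4)])
    then show ?case by (rule null_cong) (simp only: r(2))
  qed
qed

lemma ker_even:
  assumes "S \<subseteq> simple_primes" shows "ker S (- x) (- y) = ker S x y"
proof -
  have "finite S" using assms finite_simple_primes finite_subset by blast
  then show ?thesis using assms
  proof (induction S arbitrary: x y rule: finite_induct)
    case empty
    have "X1 (- y) * kap (- (x + y)) = (X1 (- 1) * X2 (- 1)) * (X1 y * kap (x + y))"
      using dirichlet_character_minus_one(1)[OF dc1, of y] kap_uminus[of "x + y"] by (simp only: mult_ac)
    then show ?case by (simp add: ker_def shift_def parity)
  next
    case (insert p S)
    then have p: "p \<in> simple_primes" and S: "S \<subseteq> simple_primes" by auto
    note r = rest_props[OF S p insert.hyps(2)] and P = simple_primeD[OF p] and L = loc_props[OF p]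
    have neg: "loc p (- a) = loc p (- 1) * loc p a" for a using L(4)[of "- 1" a] by simp
    have rr: "rest S p (- x) (- y) * loc p (- 1) = rest S p x y"
    proof -
      have "coprime (int (c div p)) (int p)" using P(4) by (simp add: coprime_commute)
      then obtain h where h: "[int (c div p) * h = 1] (mod int p)" using cong_solve_coprime_int by blast
      \<comment> \<open>Moving \<open>x\<close> by a multiple of \<open>c/p\<close> leaves
        \<open>rest\<close> unchanged and makes \<open>x' + y\<close> equal to 1 modulo
        \<open>p\<close>, so the induction hypothesis for \<open>ker S\<close> can be read as a
        statement about \<open>rest\<close>.\<close>
      define x' where "x' = x + int (c div p) * (h * (1 - x - y))"
      have "[x' + y = 1] (mod int p)"
      proof -
        have "[(x + y) + (int (c div p) * h) * (1 - x - y) = (x + y) + 1 * (1 - x - y)] (mod int p)"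
          by (intro cong_add cong_mult h cong_refl)
        then show ?thesis by (simp add: x'_def mult_ac add_ac)
      qed
      then have l: "loc p (x' + y) = 1" using periodic_cong[OF L(1)] L(5) by metis
      have l': "loc p (- x' + - y) = loc p (- 1)" using neg[of "x' + y"] l by simp
      have e: "rest S p x' y = rest S p x y" unfolding x'_def by (rule periodicD_mult[OF r(4)])
      have "- x' = - x + int (c div p) * (- (h * (1 - x - y)))" by (simp add: x'_def)
      then have e': "rest S p (- x') (- y) = rest S p (- x) (- y)" using periodicD_mult[OF r(4)] by metis
      have "ker S (- x') (- y) = ker S x' y" by (rule insert.IH[OF S])
      then show ?thesis unfolding r(1) l l' e e' by simp
    qed
    have "unit_part p (loc p) (- x) (- y) = loc p (- 1) * unit_part p (loc p) x y"
      using neg[of "x + y"] neg[of x] neg[of y] by (simp add: unit_part_def distrib_left add_divide_distrib)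
    then show ?case unfolding r(2) using rr by (metis mult.assoc)
  qed
qed

end

section \<open>The kinds of primes dividing \<open>q2\<close> but not \<open>D\<close>\<close>

context dedekind_data
begin

definition square_primes :: "nat set" where
  "square_primes = {p. prime p \<and> p dvd q2 \<and> \<not> p dvd D \<and> p\<^sup>2 dvd q2 \<and> p \<noteq> 2}"

text \<open>If 9 divides \<open>q2\<close>, the prime 3 is a square prime instead: units
  \<open>x\<close> and \<open>y\<close> congruent modulo 3 have a unit sum, so restricting both
  variables to units keeps something.\<close>

definition small_primes :: "nat set" where
  "small_primes = {p. prime p \<and> p dvd q2 \<and> \<not> p dvd D \<and> (p = 2 \<or> p = 3 \<and> \<not> p\<^sup>2 dvd q2)}"

lemma prime_cases:
  assumes "prime p" "p dvd c" "\<not> p dvd D"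
  shows "p \<in> simple_primes \<or> p \<in> square_primes \<or> p \<in> small_primes"
proof -
  have "p dvd q2" using assms by (simp add: c_eq prime_dvd_mult_iff)
  moreover have "p \<noteq> 2 \<Longrightarrow> p \<noteq> 3 \<Longrightarrow> p \<ge> 5"
  proof -
    assume "p \<noteq> 2" "p \<noteq> 3"
    moreover have "p \<noteq> 4" using assms(1) by (auto simp: prime_nat_iff dest!: spec[of _ 2])
    ultimately show "p \<ge> 5" using prime_ge_2_nat[OF assms(1)] by linarith
  qed
  ultimately show ?thesis using assms by (auto simp: simple_primes_def square_primes_def small_primes_def)
qed

text \<open>Since \<open>c/p = D * (q2/p)\<close>, the fiber through a multiple of \<open>D\<close>
  moves the argument of \<open>X2\<close> along a progression modulo \<open>q2/p\<close>; through
  other points all terms are 0.\<close>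

lemma kap_fiber_zero:
  assumes p: "prime p" "p dvd q2" and k: "coprime k (int p)"
  shows "(\<Sum>r\<in>{0..<int p}. kap (N + k * r * (int c div int p))) = 0"
proof -
  have p0: "p > 0" using p(1) prime_gt_0_nat by blast
  obtain g where g: "q2 = g * p" using p(2) by (metis dvdE mult.commute)
  have gl: "g < q2"
  proof -
    have "g > 0" using g q2_ge by (cases g) auto
    then have "g * 1 < g * p" using prime_gt_1_nat[OF p(1)] by (intro mult_strict_left_mono) auto
    then show ?thesis by (simp add: g)
  qed
  have cp: "int c div int p = int D * int g" using p0 by (simp add: c_eq g mult.assoc[symmetric])
  show ?thesis
  proof (cases "int D dvd N")
    case True
    then obtain M where M: "N = int D * M" ..
    have "N + k * r * (int D * int g) = int D * (M + int g * (k * r))" for r by (simp add: M algebra_simps)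
    then have "(\<Sum>r\<in>{0..<int p}. kap (N + k * r * (int c div int p))) = (\<Sum>r\<in>{0..<int p}. X2 (M + int g * (k * r)))"
      unfolding cp by (simp only: kap_mult)
    also have "\<dots> = (\<Sum>r\<in>{0..<int p}. X2 (M + int g * r))"
    proof (rule sum_residues_mult[OF _ k])
      show "periodic p (\<lambda>r. X2 (M + int g * r))"
        unfolding periodic_def
      proof
        fix r
        have "M + int g * (r + int p) = (M + int g * r) + int q2 * 1" by (simp add: g algebra_simps)
        then show "X2 (M + int g * (r + int p)) = X2 (M + int g * r)" by (simp only: periodicD_mult[OF D2(3)])
      qed
    qed
    also have "\<dots> = 0" by (rule primitive_character_class_sum[OF prim2 g gl])
    finally show ?thesis .
  next
    case False
    have "\<not> int D dvd N + k * r * (int D * int g)" for r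
    proof -
      have "int D dvd k * r * (int D * int g)" by simp
      then show ?thesis using False by (simp only: dvd_add_left_iff not_False_eq_True)
    qed
    then show ?thesis unfolding cp by (simp add: kap_eq_0)
  qed
qed

lemma shift_add: "shift S (n + m) = shift S n + (1 - (\<Sum>p\<in>S. idem p)) * m"
  by (simp add: shift_def algebra_simps)

lemma coprime_shift_multiplier:
  assumes "prime p" "p \<notin> simple_primes" "p dvd c"
  shows "int p dvd (\<Sum>q\<in>simple_primes. idem q)" "coprime (1 - (\<Sum>q\<in>simple_primes. idem q)) (int p)"
proof -
  have "p dvd c div q" if q: "q \<in> simple_primes" for q
  proof -
    have "coprime p q" using q assms simple_primeD(1)[OF q] primes_coprime by metis
    moreover have "p dvd q * (c div q)" using assms(3) simple_primeD(3)[OF q] by simp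
    ultimately show ?thesis by (simp add: coprime_dvd_mult_right_iff)
  qed
  then show 1: "int p dvd (\<Sum>q\<in>simple_primes. idem q)" by (rule sum_idem_dvd(2)[OF subset_refl])
  have "coprime (1 + - (\<Sum>q\<in>simple_primes. idem q)) (int p)" by (rule coprime_one_add) (use 1 in simp)
  then show "coprime (1 - (\<Sum>q\<in>simple_primes. idem q)) (int p)" by simp
qed

text \<open>All factors other than \<open>kap\<close> have period \<open>c/p\<close>:
  \<open>q1\<close> divides \<open>D\<close>, and the simple primes are different from
  \<open>p\<close>. Passing through \<open>shift\<close> only multiplies the step by a unit modulo
  \<open>p\<close>.\<close>

lemma fiber_zero_ker:
  assumes p: "prime p" "p dvd q2" "p \<notin> simple_primes"
    and h: "\<And>x y. periodic (c div p) (h x)" "\<And>x y. periodic (c div p) (\<lambda>x. h x y)"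
  shows "fiber_zero c p (\<lambda>x y. h x y * ker simple_primes x y)"
    "fiber_zero c p (\<lambda>y x. h x y * ker simple_primes x y)"
proof -
  have pc: "p dvd c" using p(2) by (simp add: c_eq)
  have p0: "p > 0" using p(1) prime_gt_0_nat by blast
  define d where "d = c div p"
  have d: "int c div int p = int d" by (simp add: d_def zdiv_int)
  have q1d: "q1 dvd d"
  proof -
    have "d = D * (q2 div p)" using p(2) by (simp add: d_def c_eq div_mult_swap)
    then show ?thesis using q1_dvd_D by simp
  qed
  have X: "X1 (y + r * int d) = X1 y" for y r
    using periodicD_mult[OF periodic_dvd[OF D1(3) q1d], of y r] by (simp add: mult.commute)
  have U: "unit_part q (loc q) x (y + r * int d) = unit_part q (loc q) x y"
     "unit_part q (loc q) (x + r * int d) y = unit_part q (loc q) x y" if q: "q \<in> simple_primes" for q x y r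
  proof -
    have "q dvd c" using simple_primeD(6)[OF q] by (simp add: c_eq)
    moreover have "coprime q p" using q p simple_primeD(1)[OF q] primes_coprime by metis
    moreover have "c = p * d" using pc by (simp add: d_def)
    ultimately have "q dvd d" by (simp add: coprime_dvd_mult_right_iff)
    then have "periodic d (unit_part q (loc q) x)" "periodic d (\<lambda>x. unit_part q (loc q) x y)"
      using unit_part_periodic[OF loc_props(1)[OF q]] periodic_dvd by blast+
    from periodicD_mult[OF this(1), of y r] periodicD_mult[OF this(2), of x r]
    show "unit_part q (loc q) x (y + r * int d) = unit_part q (loc q) x y"
     "unit_part q (loc q) (x + r * int d) y = unit_part q (loc q) x y" by (simp_all add: mult.commute)
  qed
  have H: "h x (y + r * int d) = h x y" "h (x + r * int d) y = h x y" for x y r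
    using periodicD_mult[OF h(1)[folded d_def], of x y r] periodicD_mult[OF h(2)[folded d_def, of y], of x r] by (simp_all add: mult.commute)
  let ?m = "1 - (\<Sum>q\<in>simple_primes. idem q)"
  have K: "(\<Sum>r\<in>{0..<int p}. kap (shift simple_primes (n + r * int d))) = 0" for n
    using kap_fiber_zero[OF p(1,2) coprime_shift_multiplier(2)[OF p(1,3) pc], of "shift simple_primes n"]
    by (simp add: shift_add d mult.assoc)
  show "fiber_zero c p (\<lambda>x y. h x y * ker simple_primes x y)"
    unfolding fiber_zero_def d
  proof (intro allI)
    fix x y
    have "(\<Sum>r\<in>{0..<int p}. h x (y + r * int d) * ker simple_primes x (y + r * int d)) =
       h x y * X1 y * (\<Prod>q\<in>simple_primes. unit_part q (loc q) x y) * (\<Sum>r\<in>{0..<int p}. kap (shift simple_primes ((x + y) + r * int d)))"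
      unfolding ker_def sum_distrib_left using U by (intro sum.cong refl) (simp add: H X add.assoc cong: prod.cong)
    then show "(\<Sum>r\<in>{0..<int p}. h x (y + r * int d) * ker simple_primes x (y + r * int d)) = 0" by (simp only: K mult_zero_right)
  qed
  show "fiber_zero c p (\<lambda>y x. h x y * ker simple_primes x y)"
    unfolding fiber_zero_def d
  proof (intro allI)
    fix y x
    have "x + r * int d + y = (x + y) + r * int d" for r by simp
    then have "(\<Sum>r\<in>{0..<int p}. h (x + r * int d) y * ker simple_primes (x + r * int d) y) =
       h x y * X1 y * (\<Prod>q\<in>simple_primes. unit_part q (loc q) x y) * (\<Sum>r\<in>{0..<int p}. kap (shift simple_primes ((x + y) + r * int d)))"
      unfolding ker_def sum_distrib_left using U by (intro sum.cong refl) (simp only: H X, simp cong: prod.cong)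
    then show "(\<Sum>r\<in>{0..<int p}. h (x + r * int d) y * ker simple_primes (x + r * int d) y) = 0" by (simp only: K mult_zero_right)
  qed
qed

definition off :: "nat set \<Rightarrow> int \<Rightarrow> complex" where
  "off B x = (if \<exists>p\<in>B. int p dvd x then 0 else 1)"

lemma off_insert: "off (insert p B) x = (if int p dvd x then 0 else off B x)"
  by (simp add: off_def)

lemma off_periodic: assumes "\<And>q. q \<in> B \<Longrightarrow> q dvd d" shows "periodic d (off B)"
  using assms by (simp add: periodic_def off_def dvd_add_left_iff cong: bex_cong)

lemma dvd_div_prime:
  assumes "prime p" "p dvd c" "prime q" "q dvd c" "q \<noteq> p" shows "q dvd c div p"
proof -
  have "coprime q p" using assms primes_coprime by metis
  moreover have "q dvd p * (c div p)" using assms by simp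
  ultimately show ?thesis by (simp add: coprime_dvd_mult_right_iff)
qed

lemma square_primesD: "p \<in> square_primes \<Longrightarrow> prime p" "p \<in> square_primes \<Longrightarrow> p dvd q2"
  "p \<in> square_primes \<Longrightarrow> p dvd c" "p \<in> square_primes \<Longrightarrow> p \<notin> simple_primes" "p \<in> square_primes \<Longrightarrow> p\<^sup>2 dvd c"
  "p \<in> square_primes \<Longrightarrow> \<not> p dvd D"
  by (auto simp: square_primes_def simple_primes_def c_eq)

lemma small_primesD: "p \<in> small_primes \<Longrightarrow> prime p" "p \<in> small_primes \<Longrightarrow> p dvd q2"
  "p \<in> small_primes \<Longrightarrow> p dvd c" "p \<in> small_primes \<Longrightarrow> p \<notin> simple_primes" "p \<in> small_primes \<Longrightarrow> p \<notin> square_primes"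
  "p \<in> small_primes \<Longrightarrow> \<not> p dvd D"
  by (auto simp: square_primes_def simple_primes_def small_primes_def c_eq)

lemma null_off:
  assumes N: "null c (ker simple_primes)" and B: "B \<subseteq> square_primes"
  shows "null c (\<lambda>x y. off B x * off B y * ker simple_primes x y)"
proof -
  have "finite square_primes"
    by (rule finite_subset[of _ "{..q2}"]) (use q2_ge in \<open>auto simp: square_primes_def intro: dvd_imp_le\<close>)
  then have "finite B" using B finite_subset by blast
  then show ?thesis using B
  proof (induction B rule: finite_induct)
    case empty then show ?case using N by (simp add: off_def)
  next
    case (insert p B)
    then have p: "p \<in> square_primes" and B: "B \<subseteq> square_primes" by auto
    note P = square_primesD(1-5)[OF p]
    have o: "periodic (c div p) (off B)"
      by (rule off_periodic) (use dvd_div_prime[OF P(1,3)] square_primesD B insert.hyps(2) in blast)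
    have pd: "p dvd c div p"
    proof -
      have "p * (c div p) = c" using P(3) by simp
      moreover have "p * p dvd c" using P(5) by (simp add: power2_eq_square)
      ultimately have "p * p dvd p * (c div p)" by simp
      then show ?thesis using prime_gt_0_nat[OF P(1)] by simp
    qed
    have o': "periodic (c div p) (off (insert p B))"
      by (rule off_periodic) (use dvd_div_prime[OF P(1,3)] square_primesD B pd in blast)
    have z1: "fiber_zero c p (\<lambda>x y. (off B x * off B y) * ker simple_primes x y)"
      by (rule fiber_zero_ker(1)[OF P(1,2,4)]) (use o in \<open>simp_all add: periodic_def\<close>)
    have z2: "fiber_zero c p (\<lambda>y x. (off B x * off (insert p B) y) * ker simple_primes x y)"
      by (rule fiber_zero_ker(2)[OF P(1,2,4)]) (use o o' in \<open>simp_all add: periodic_def\<close>)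
    have 1: "null c (\<lambda>x y. (off B x * off (insert p B) y) * ker simple_primes x y)"
      using null_restrict[OF P(1,5) z1 insert.IH[OF B] c_pos] by (rule null_cong) (simp add: off_insert)
    show ?case
      using null_flip[OF null_restrict[OF P(1,5) z2 null_flip[OF 1] c_pos]] by (rule null_cong) (simp add: off_insert)
  qed
qed

text \<open>The null function after the simple and the square primes are settled; non-units survive
  only at the small primes and at the primes of \<open>D\<close>.\<close>

definition main :: "int \<Rightarrow> int \<Rightarrow> complex" where
  "main x y = off square_primes x * off square_primes y * ker simple_primes x y"

text \<open>The dilations produced by applying \<open>F(x,y) \<mapsto> F(x,\<epsilon>y) - F(x,p\<epsilon>y)\<close> for each prime \<open>p\<close> in a list.\<close>

fun dil :: "nat list \<Rightarrow> (complex \<times> int) list" where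
  "dil [] = [(1, 1)]"
| "dil (p # ps) = dil ps @ map (\<lambda>(s, k). (- s, int p * k)) (dil ps)"

text \<open>An idempotent modulo \<open>c\<close>, with component 0 at the primes of
  \<open>ps\<close> and 1 at all other primes.\<close>

definition idem_for :: "nat list \<Rightarrow> int \<Rightarrow> bool" where
  "idem_for ps e \<longleftrightarrow> (\<forall>p\<in>set ps. \<forall>k. p ^ k dvd c \<longrightarrow> int (p ^ k) dvd e) \<and>
     (\<forall>q. q dvd c \<longrightarrow> (\<forall>p\<in>set ps. coprime q p) \<longrightarrow> [e = 1] (mod int q))"

definition comb :: "nat list \<Rightarrow> int \<Rightarrow> int \<Rightarrow> int \<Rightarrow> complex" where
  "comb ps e x y = off (set ps) y * (\<Sum>(s, k)\<leftarrow>dil ps. s * main x (e * k * y))"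

lemma dil_coprime: "prime q \<Longrightarrow> q \<notin> set ps \<Longrightarrow> \<forall>p\<in>set ps. prime p \<Longrightarrow> (s, k) \<in> set (dil ps) \<Longrightarrow> coprime k (int q)"
proof (induction ps arbitrary: s k)
  case (Cons p ps)
  have "coprime p q" using Cons.prems primes_coprime by (metis list.set_intros(1))
  then have "coprime (int p) (int q)" by simp
  then show ?case using Cons by auto
qed simp

lemma fiber_zero_sum_list:
  "(\<And>a. a \<in> set L \<Longrightarrow> fiber_zero c p (G a)) \<Longrightarrow> fiber_zero c p (\<lambda>x y. \<Sum>a\<leftarrow>L. G a x y)"
proof (induction L)
  case Nil then show ?case by (simp add: fiber_zero_def)
next
  case (Cons a L)
  then have "fiber_zero c p (G a)" "fiber_zero c p (\<lambda>x y. \<Sum>a\<leftarrow>L. G a x y)" by auto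
  then show ?case by (simp add: fiber_zero_def sum.distrib)
qed

lemma main_props:
  assumes "null c (\<lambda>x y. X1 y * kap (x + y))"
  shows "null c main" "p \<in> small_primes \<Longrightarrow> fiber_zero c p main"
proof -
  show "null c main"
    unfolding main_def[abs_def] by (rule null_off[OF null_ker[OF assms subset_refl] subset_refl])
  assume p: "p \<in> small_primes"
  note P = small_primesD[OF p]
  have o: "periodic (c div p) (off square_primes)"
    by (rule off_periodic) (use dvd_div_prime[OF P(1,3)] square_primesD P(5) in blast)
  show "fiber_zero c p main"
    unfolding main_def[abs_def] by (rule fiber_zero_ker(1)[OF P(1,2,4)]) (use o in \<open>simp_all add: periodic_def\<close>)
qed

text \<open>Iteration of \<open>null_frobenius\<close> over the small primes. The dilation factors
  produced so far are units at the next prime, so \<open>fiber_zero\<close> persists.\<close>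

lemma null_comb:
  assumes N: "null c (\<lambda>x y. X1 y * kap (x + y))"
  shows "distinct ps \<Longrightarrow> set ps \<subseteq> small_primes \<Longrightarrow> \<exists>e. idem_for ps e \<and> null c (comb ps e)"
proof (induction ps)
  case Nil
  have "null c (comb [] 1)" using main_props(1)[OF N] by (simp add: comb_def[abs_def] off_def)
  then show ?case by (intro exI[of _ 1]) (simp add: idem_for_def)
next
  case (Cons p ps)
  then obtain e where e: "idem_for ps e" "null c (comb ps e)" by auto
  have p: "p \<in> small_primes" "p \<notin> set ps" and ps: "set ps \<subseteq> small_primes" using Cons.prems by auto
  note P = small_primesD[OF p(1)]
  have psp: "\<forall>q\<in>set ps. prime q" using ps small_primesD(1) by blast
  obtain i d where i: "c = p ^ Suc i * d" "\<not> p dvd d"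
  proof -
    obtain n x where n: "\<not> p dvd x" "c = p ^ n * x"
      using multiplicity_decompose'[of c p] P(1) c_pos by (metis not_prime_unit not_gr_zero)
    have "n \<noteq> 0" using n P(3) by (cases n) auto
    then obtain j where "n = Suc j" by (cases n) auto
    with n that show thesis by blast
  qed
  have cpd: "coprime p d" using P(1) i(2) prime_imp_coprime by blast
  have d0: "d > 0" using i c_pos by (cases d) auto
  have "coprime (int (p ^ Suc i)) (int d)" using cpd by simp
  then obtain h where h: "[int (p ^ Suc i) * h = 1] (mod int d)" using cong_solve_coprime_int by blast
  define e' where "e' = int (p ^ Suc i) * h"
  have e'1: "[e' = 1] (mod int d)" using h by (simp only: e'_def)
  have e'0: "[e' = 0] (mod int (p ^ Suc i))" by (simp only: e'_def cong_0_iff dvd_triv_left)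
  have e'q: "[e' = 1] (mod int q)" if "q dvd c" "coprime q p" for q
  proof -
    have "q dvd d" using that i(1) by (simp add: coprime_dvd_mult_right_iff del: power_Suc)
    then show ?thesis using e'1 cong_dvd_modulus by (metis int_dvd_int_iff)
  qed
  have e'p: "int (p ^ k) dvd e'" if "p ^ k dvd c" for k
  proof -
    have "coprime (p ^ k) d" using cpd by simp
    then have "p ^ k dvd p ^ Suc i" using that i(1) by (metis coprime_dvd_mult_left_iff)
    then have "int (p ^ k) dvd int (p ^ Suc i)" by (simp only: int_dvd_int_iff)
    then show ?thesis unfolding e'_def by (rule dvd_mult2)
  qed
  have qp: "coprime q p" if "q \<in> set ps" for q
    using that psp p(2) P(1) primes_coprime by metis
  have id: "idem_for (p # ps) (e * e')"
    unfolding idem_for_def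
  proof (intro conjI ballI allI impI)
    fix q k assume "q \<in> set (p # ps)" "q ^ k dvd c"
    then show "int (q ^ k) dvd e * e'" using e'p e(1) by (auto simp: idem_for_def)
  next
    fix q assume "q dvd c" "\<forall>p'\<in>set (p # ps). coprime q p'"
    then have "[e = 1] (mod int q)" "[e' = 1] (mod int q)" using e(1) e'q by (auto simp: idem_for_def)
    then show "[e * e' = 1] (mod int q)" using cong_mult by fastforce
  qed
  have ep: "coprime e (int p)"
  proof -
    have "[e = 1] (mod int p)" using e(1) P(3) qp by (auto simp: idem_for_def coprime_commute)
    then show ?thesis by (meson cong_imp_coprime cong_sym coprime_1_left)
  qed
  have z: "fiber_zero c p (comb ps e)"
  proof -
    have o: "off (set ps) (y + r * (int c div int p)) = off (set ps) y" for y r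
    proof -
      have "periodic (c div p) (off (set ps))"
      proof (rule off_periodic)
        fix q assume q: "q \<in> set ps"
        then have "q \<in> small_primes" "q \<noteq> p" using ps p(2) by auto
        then show "q dvd c div p" using dvd_div_prime[OF P(1,3)] small_primesD(1,3) by blast
      qed
      from periodicD_mult[OF this, of y r] show ?thesis by (simp add: mult.commute zdiv_int)
    qed
    have "fiber_zero c p (\<lambda>x y. \<Sum>a\<leftarrow>dil ps. (off (set ps) y * fst a) * main x ((e * snd a) * y))"
    proof (rule fiber_zero_sum_list)
      fix a assume "a \<in> set (dil ps)"
      then have "coprime (snd a) (int p)" using dil_coprime[OF P(1) p(2) psp, of "fst a" "snd a"] by simp
      then have cp: "coprime (e * snd a) (int p)" using ep by simp
      show "fiber_zero c p (\<lambda>x y. off (set ps) y * fst a * main x (e * snd a * y))"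
        by (rule fiber_zero_comp[where g = "\<lambda>x. x" and h = "\<lambda>y. off (set ps) y * fst a", OF main_props(2)[OF N p(1)] P(3) prime_gt_0_nat[OF P(1)] cp])
          (simp_all add: o nullD(1)[OF main_props(1)[OF N]])
    qed
    then show ?thesis by (simp add: comb_def[abs_def] case_prod_unfold sum_list_const_mult mult.assoc)
  qed
  from null_frobenius[OF i(1) cpd d0 P(1) e'0 e'1 e(2) z]
  have "null c (comb (p # ps) (e * e'))"
  proof (rule null_cong)
    fix x y
    have off1: "off (set ps) (e' * y) = off (set ps) y" "off (set ps) (e' * (int p * y)) = off (set ps) y"
    proof -
      have c1: "coprime (int q) e'" if "q \<in> set ps" for q
      proof -
        have "[e' = 1] (mod int q)" using e'q qp[OF that] small_primesD(3) ps that by blast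
        then show ?thesis by (meson cong_imp_coprime cong_sym coprime_1_left coprime_commute)
      qed
      have c2: "coprime (int q) (int p)" if "q \<in> set ps" for q using qp[OF that] by simp
      show "off (set ps) (e' * y) = off (set ps) y" "off (set ps) (e' * (int p * y)) = off (set ps) y"
        using c1 c2 by (simp_all add: off_def coprime_dvd_mult_right_iff cong: bex_cong)
    qed
    have L: "(\<Sum>a\<leftarrow>map (\<lambda>a. (- fst a, int p * snd a)) L. fst a * main x (e * e' * snd a * y)) =
       - (\<Sum>a\<leftarrow>L. fst a * main x (e * snd a * (e' * (int p * y))))" for L
      by (induction L) (auto simp: mult_ac)
    have "comb (p # ps) (e * e') x y = off (insert p (set ps)) y * ((\<Sum>a\<leftarrow>dil ps. fst a * main x (e * e' * snd a * y))
        + (\<Sum>a\<leftarrow>map (\<lambda>a. (- fst a, int p * snd a)) (dil ps). fst a * main x (e * e' * snd a * y)))"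
      by (simp only: comb_def dil.simps map_append sum_list_append list.set(2) case_prod_unfold)
    moreover have "comb ps e x (e' * y) = off (set ps) y * (\<Sum>a\<leftarrow>dil ps. fst a * main x (e * e' * snd a * y))"
      by (simp only: comb_def off1 case_prod_unfold) (simp only: mult_ac)
    moreover have "comb ps e x (e' * (int p * y)) = off (set ps) y * (\<Sum>a\<leftarrow>dil ps. fst a * main x (e * snd a * (e' * (int p * y))))"
      by (simp only: comb_def off1 case_prod_unfold)
    ultimately show "(if int p dvd y then 0 else comb ps e x (e' * y) - comb ps e x (e' * (int p * y))) = comb (p # ps) (e * e') x y"
      unfolding L off_insert by (simp add: right_diff_distrib)
  qed
  with id show ?case by blast
qed

end

section \<open>Size of the factors at the simple primes\<close>

lemma norm_unit_part_ge:
  assumes "prime p" "p \<ge> 5" and n: "\<And>a. \<not> int p dvd a \<Longrightarrow> cmod (\<xi> a) = 1"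
    and "\<not> int p dvd x" "\<not> int p dvd y" "\<not> int p dvd x + y"
  shows "cmod (unit_part p \<xi> x y) \<ge> 1 - 2 / (real p - 1)" "unit_part p \<xi> x y \<noteq> 0"
proof -
  have p1: "cmod (of_nat p - 1) = real p - 1"
    using assms(2) by (metis (no_types, lifting) norm_of_nat of_nat_1 of_nat_diff one_le_numeral order_trans)
  have "cmod ((\<xi> x + \<xi> y) / (of_nat p - 1)) \<le> 2 / (real p - 1)"
    using norm_triangle_ineq[of "\<xi> x" "\<xi> y"] n assms(2,4,5) by (simp add: norm_divide p1 divide_right_mono)
  moreover have "cmod (\<xi> (x + y)) = 1" using n assms(6) by simp
  ultimately show 1: "cmod (unit_part p \<xi> x y) \<ge> 1 - 2 / (real p - 1)"
    using assms(4,5) norm_diff_ineq[of "\<xi> (x + y)" "(\<xi> x + \<xi> y) / (of_nat p - 1)"] by (simp add: unit_part_def)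
  have "1 - 2 / (real p - 1) > 0" using assms(2) by (simp add: field_simps)
  then show "unit_part p \<xi> x y \<noteq> 0" using 1 by auto
qed

text \<open>At \<open>(x, -x)\<close> only the correction term survives, of size at most
  \<open>2/(p - 1)\<close>, against at least \<open>1 - 2/(p - 1)\<close> at \<open>(x, y)\<close>.
  This settles \<open>p >= 7\<close>; for \<open>p = 5\<close> both bounds are 1/2. An odd character
  then gives 0 at \<open>(x, -x)\<close>; an even one is the quadratic character, and the listed
  pairs are such that \<open>\<xi> x = -1\<close> and \<open>\<xi> y = 1\<close>, so the correction
  at \<open>(x, y)\<close> cancels.\<close>

lemma unit_part_compare:
  assumes p: "prime p" "p \<ge> 5"
    and \<xi>: "periodic p \<xi>" "\<xi> 0 = 0" "(\<Sum>r\<in>{0..<int p}. \<xi> r) = 0" "\<And>a b. \<xi> (a * b) = \<xi> a * \<xi> b"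
      "\<xi> 1 = 1" "\<And>a. \<not> int p dvd a \<Longrightarrow> cmod (\<xi> a) = 1"
    and d: "(D, \<delta>) \<in> {(3, - 1), (4, - 1), (5, 1)}" and D: "\<not> int p dvd D"
    and x: "[x = D + \<delta>] (mod int p)" and y: "[y = - \<delta>] (mod int p)"
  shows "cmod (unit_part p \<xi> x (- x)) < cmod (unit_part p \<xi> x y)"
proof -
  have small: "\<not> int p dvd k" if "0 < k" "k < 5" for k :: int using zdvd_not_zless[of k "int p"] that p(2) by auto
  have six: "\<not> int p dvd 6"
  proof
    assume "int p dvd 6"
    then have "int p dvd 2 * 3" by simp
    moreover have "prime (int p)" using p(1) by simp
    ultimately have "int p dvd 2 \<or> int p dvd 3" by (simp only: prime_dvd_mult_iff)
    then show False using small by auto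
  qed
  have xy: "[x + y = D] (mod int p)" using cong_add[OF x y] by simp
  have "\<not> int p dvd D + \<delta>" using d small[of 2] small[of 3] six by auto
  then have px: "\<not> int p dvd x" using cong_dvd_iff[OF x] by simp
  have "\<not> int p dvd - \<delta>" using d small[of 1] by auto
  then have py: "\<not> int p dvd y" using cong_dvd_iff[OF y] by simp
  have pxy: "\<not> int p dvd x + y" using cong_dvd_iff[OF xy] D by simp
  have ge: "cmod (unit_part p \<xi> x y) \<ge> 1 - 2 / (real p - 1)"
    by (rule norm_unit_part_ge(1)[OF p \<xi>(6) px py pxy])
  have p1: "cmod (of_nat p - 1) = real p - 1"
    using p(2) by (metis (no_types, lifting) norm_of_nat of_nat_1 of_nat_diff one_le_numeral order_trans)
  have eq: "unit_part p \<xi> x (- x) = (\<xi> x + \<xi> (- x)) / (of_nat p - 1)" using px by (simp add: unit_part_def \<xi>(2))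
  have neg: "\<xi> (- a) = \<xi> (- 1) * \<xi> a" for a using \<xi>(4)[of "- 1" a] by simp
  have pm: "\<xi> (- 1) = 1 \<or> \<xi> (- 1) = - 1" using \<xi>(4)[of "- 1" "- 1"] \<xi>(5) by (simp add: square_eq_1_iff)
  show ?thesis
  proof (cases "p = 5")
    case False
    have "p \<noteq> 6" using p(1) by (auto simp: prime_nat_iff dest!: spec[of _ 2])
    then have p7: "p \<ge> 7" using False p(2) by linarith
    have "cmod (unit_part p \<xi> x (- x)) \<le> 2 / (real p - 1)"
      using norm_triangle_ineq[of "\<xi> x" "\<xi> (- x)"] \<xi>(6) px p7 by (simp add: eq norm_divide p1 divide_right_mono)
    moreover have "2 / (real p - 1) \<le> 1 / 3" using p7 by (simp add: field_simps)
    ultimately show ?thesis using ge by linarith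
  next
    case p5: True
    show ?thesis
    proof (cases "\<xi> (- 1) = - 1")
      case True
      then have "unit_part p \<xi> x (- x) = 0" using neg[of x] by (simp add: eq)
      moreover have "1 - 2 / (real p - 1) > 0" using p5 by simp
      then have "0 < cmod (unit_part p \<xi> x y)" using ge by linarith
      ultimately show ?thesis by simp
    next
      case False
      then have e: "\<xi> (- 1) = 1" using pm by simp
      have c: "\<xi> a = \<xi> b" if "[a = b] (mod 5)" for a b using periodic_cong[OF \<xi>(1)] that p5 by simp
      have v: "\<xi> 4 = 1" "\<xi> 3 = \<xi> 2"
        using c[of 4 "- 1"] c[of 3 "- 2"] neg[of 2] e by (auto simp: cong_def)
      have "{0..<5::int} = {0,1,2,3,4}" by auto
      then have "2 + 2 * \<xi> 2 = 0" using \<xi>(3) v by (simp add: p5 \<xi>(2,5))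
      then have "2 * (1 + \<xi> 2) = 0" by (simp only: distrib_left mult_1_right)
      then have "\<xi> 2 = - 1" by (simp add: add_eq_0_iff)
      moreover have "D \<noteq> 5" using D p5 by auto
      then have "D = 3 \<and> \<delta> = - 1 \<or> D = 4 \<and> \<delta> = - 1" using d by auto
      then have "\<xi> x = \<xi> 2 \<or> \<xi> x = \<xi> 3" "\<xi> y = 1" "\<xi> (x + y) = \<xi> 3 \<or> \<xi> (x + y) = \<xi> 4"
        using c[of x] c[of y] c[of "x + y"] x y xy p5 \<xi>(5) by auto
      ultimately have "\<xi> x = - 1" "\<xi> y = 1" "cmod (\<xi> (x + y)) = 1" using v by auto
      then show ?thesis using px py neg[of x] e unfolding eq by (simp add: unit_part_def p5)
    qed
  qed
qed

section \<open>Support and absolute value of \<open>main\<close>\<close>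

context dedekind_data
begin

abbreviation comp :: "int \<Rightarrow> int \<Rightarrow> nat \<Rightarrow> complex" where
  "comp x y p \<equiv> unit_part p (loc p) x y"

lemma shift_cong:
  assumes "int g dvd (\<Sum>q\<in>simple_primes. idem q)" shows "[shift simple_primes n = n] (mod int g)"
  using assms by (simp add: shift_def cong_iff_dvd_diff)

lemma D_dvd_sum_idem: "int D dvd (\<Sum>q\<in>simple_primes. idem q)"
  by (rule sum_idem_dvd(2)[OF subset_refl]) (rule simple_primeD(7))

lemma Dp_dvd_sum_idem:
  assumes "prime p" "p dvd D" "p dvd q2" shows "int (D * p) dvd (\<Sum>q\<in>simple_primes. idem q)"
proof (rule sum_idem_dvd(2)[OF subset_refl])
  fix q assume q: "q \<in> simple_primes"
  have "coprime p q" using q assms primes_coprime simple_primeD(1)[OF q] by (metis (mono_tags, lifting) simple_primes_def mem_Collect_eq)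
  moreover have "p dvd q2 div q * q" using assms(3) simple_primeD(9)[OF q] by simp
  ultimately have "p dvd q2 div q" by (simp add: coprime_dvd_mult_left_iff)
  then show "D * p dvd c div q" unfolding simple_primeD(5)[OF q] by simp
qed

text \<open>\<open>kap\<close> is nonzero only at multiples of \<open>D\<close> whose quotient is
  prime to \<open>q2\<close>; at the moduli in question \<open>shift\<close> does not change its
  argument.\<close>

lemma main_eq_0:
  shows "\<not> int D dvd x + y \<Longrightarrow> main x y = 0"
    and "p \<in> square_primes \<union> small_primes \<Longrightarrow> int p dvd x + y \<Longrightarrow> main x y = 0"
    and "prime p \<Longrightarrow> p dvd D \<Longrightarrow> p dvd q2 \<Longrightarrow> int (D * p) dvd x + y \<Longrightarrow> main x y = 0"
proof -
  let ?n = "shift simple_primes (x + y)"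
  have m: "kap ?n = 0 \<Longrightarrow> main x y = 0" by (simp add: main_def ker_def)
  have k: "kap ?n = 0" if p: "prime p" "p dvd q2" and d: "\<And>k. ?n = int D * k \<Longrightarrow> int p dvd k" for p
  proof (cases "int D dvd ?n")
    case True
    then obtain k where k: "?n = int D * k" ..
    then have "\<not> coprime k (int q2)" using d p by (metis coprime_common_divisor int_dvd_int_iff not_prime_unit prime_nat_int_transfer)
    then show ?thesis unfolding k kap_mult by (simp add: D2(4))
  qed (simp add: kap_eq_0)
  show "main x y = 0" if "\<not> int D dvd x + y"
    using m that cong_dvd_iff[OF shift_cong[OF D_dvd_sum_idem]] kap_eq_0 by blast
  show "main x y = 0" if p: "p \<in> square_primes \<union> small_primes" and d: "int p dvd x + y"
  proof (rule m, rule k)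
    show pp: "prime p" "p dvd q2" using p square_primesD small_primesD by blast+
    fix k assume k: "?n = int D * k"
    have "int p dvd ?n"
      using d cong_dvd_iff[OF shift_cong[OF coprime_shift_multiplier(1)[OF pp(1)]]] p square_primesD small_primesD by blast
    moreover have "\<not> int p dvd int D" using p square_primesD(6) small_primesD(6) by auto
    moreover have "prime (int p)" using pp by simp
    ultimately show "int p dvd k" unfolding k by (simp only: prime_dvd_mult_iff) simp
  qed
  show "main x y = 0" if p: "prime p" "p dvd D" "p dvd q2" and d: "int (D * p) dvd x + y"
  proof (rule m, rule k[OF p(1,3)])
    fix k assume k: "?n = int D * k"
    have "int (D * p) dvd ?n" using d cong_dvd_iff[OF shift_cong[OF Dp_dvd_sum_idem[OF p]]] by blast
    then show "int p dvd k" using D_pos unfolding k by simp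
  qed
qed

lemma norm_main:
  shows "cmod (main x y) \<le> (\<Prod>p\<in>simple_primes. cmod (comp x y p))"
    and "coprime y (int q1) \<Longrightarrow> int D dvd x + y \<Longrightarrow>
      (\<And>p. p \<in> square_primes \<Longrightarrow> \<not> int p dvd x \<and> \<not> int p dvd y) \<Longrightarrow>
      (\<And>p. p \<in> square_primes \<union> small_primes \<Longrightarrow> \<not> int p dvd x + y) \<Longrightarrow>
      (\<And>p. prime p \<Longrightarrow> p dvd D \<Longrightarrow> p dvd q2 \<Longrightarrow> \<not> int (D * p) dvd x + y) \<Longrightarrow>
      cmod (main x y) = (\<Prod>p\<in>simple_primes. cmod (comp x y p))"
proof -
  let ?n = "shift simple_primes (x + y)"
  have n: "cmod (main x y) = cmod (off square_primes x) * cmod (off square_primes y) * cmod (X1 y) * cmod (kap ?n) * (\<Prod>p\<in>simple_primes. cmod (comp x y p))"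
    by (simp add: main_def ker_def norm_mult prod_norm)
  have "cmod (off square_primes x) * cmod (off square_primes y) * cmod (X1 y) * cmod (kap ?n) \<le> 1 * 1 * 1 * 1"
    using dirichlet_character_norm_le[OF dc1, of y] norm_kap_le[of ?n]
    by (intro mult_mono mult_nonneg_nonneg) (auto simp: off_def)
  then show "cmod (main x y) \<le> (\<Prod>p\<in>simple_primes. cmod (comp x y p))"
    unfolding n using mult_right_mono[of _ 1 "\<Prod>p\<in>simple_primes. cmod (comp x y p)"] by (simp add: prod_nonneg)
  assume a: "coprime y (int q1)" "int D dvd x + y" "\<And>p. p \<in> square_primes \<Longrightarrow> \<not> int p dvd x \<and> \<not> int p dvd y"
    "\<And>p. p \<in> square_primes \<union> small_primes \<Longrightarrow> \<not> int p dvd x + y"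
    "\<And>p. prime p \<Longrightarrow> p dvd D \<Longrightarrow> p dvd q2 \<Longrightarrow> \<not> int (D * p) dvd x + y"
  have "off square_primes x = 1" "off square_primes y = 1" using a(3) by (auto simp: off_def)
  moreover have "cmod (X1 y) = 1" by (rule dirichlet_character_norm[OF dc1 a(1)])
  moreover have "cmod (kap ?n) = 1"
  proof -
    have "int D dvd ?n" using a(2) cong_dvd_iff[OF shift_cong[OF D_dvd_sum_idem]] by blast
    then obtain m where m: "?n = int D * m" ..
    have "coprime m (int q2)"
    proof (rule ccontr)
      assume "\<not> coprime m (int q2)"
      then have "gcd m (int q2) \<noteq> 1" by (simp add: coprime_iff_gcd_eq_1)
      then have "nat (gcd m (int q2)) \<noteq> 1" by simp
      then obtain p where p: "prime p" "p dvd nat (gcd m (int q2))" using prime_factor_nat by blast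
      have "int p dvd int (nat (gcd m (int q2)))" using p(2) by (simp only: int_dvd_int_iff)
      then have "int p dvd gcd m (int q2)" by simp
      then have pm: "int p dvd m" "p dvd q2" by (auto dest: dvd_trans)
      show False
      proof (cases "p dvd D")
        case True
        have "int (D * p) dvd ?n" using pm(1) unfolding m by simp
        then show False
          using a(5)[OF p(1) True pm(2)] cong_dvd_iff[OF shift_cong[OF Dp_dvd_sum_idem[OF p(1) True pm(2)]]] by blast
      next
        case False
        have pc: "p dvd c" using pm(2) by (simp add: c_eq)
        have pn: "int p dvd ?n" using pm(1) unfolding m by simp
        show False
        proof (cases "p \<in> simple_primes")
          case True
          \<comment> \<open>At a simple prime \<open>shift\<close> is congruent to 1, so
            \<open>p\<close> cannot divide the argument of \<open>kap\<close>.\<close>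
          have "int p dvd (\<Sum>q\<in>simple_primes. idem q) - 1" by (rule sum_idem_dvd(1)[OF subset_refl True])
          then have "int p dvd ((\<Sum>q\<in>simple_primes. idem q) - 1) * (1 - (x + y))" by (rule dvd_mult2)
          moreover have "?n = 1 + ((\<Sum>q\<in>simple_primes. idem q) - 1) * (1 - (x + y))"
            by (simp add: shift_def algebra_simps)
          ultimately have "int p dvd 1" using pn by (metis dvd_add_left_iff)
          then show False using p(1) by (metis not_prime_unit prime_nat_int_transfer)
        next
          case F: False
          then have "p \<in> square_primes \<union> small_primes" using prime_cases[OF p(1) pc False] by blast
          then show False using a(4) pn cong_dvd_iff[OF shift_cong[OF coprime_shift_multiplier(1)[OF p(1) F pc]]] by blast
        qed
      qed
    qed
    then show ?thesis unfolding m kap_mult by (rule dirichlet_character_norm[OF dc2])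
  qed
  ultimately show "cmod (main x y) = (\<Prod>p\<in>simple_primes. cmod (comp x y p))" unfolding n by simp
qed

lemma main_even: "main (- x) (- y) = main x y"
  by (simp add: main_def off_def ker_even[OF subset_refl])

text \<open>\<open>comb\<close> is supported on pairs of units. At small primes \<open>off\<close>
  restricts \<open>y\<close>, and \<open>p | x\<close> makes \<open>x + e k y\<close> divisible by
  \<open>p\<close>. At primes of \<open>D\<close> a nonzero value forces \<open>p\<close> to divide
  both variables or neither, and \<open>X1\<close> excludes the former by \<open>base\<close>. So
  the odd-odd part of \<open>comb\<close> is 0; as \<open>main\<close> is even, this is twice the
  difference between \<open>y\<close> and \<open>-y\<close>.\<close>

lemma main_relation:
  assumes N: "null c (\<lambda>x y. X1 y * kap (x + y))" and base: "\<And>p. prime p \<Longrightarrow> p dvd D \<Longrightarrow> p dvd q1"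
    and ps: "distinct ps" "set ps = small_primes"
  shows "\<exists>e. idem_for ps e \<and> (\<forall>x y. (\<forall>p\<in>set ps. \<not> int p dvd y) \<longrightarrow>
      (\<Sum>(s, k)\<leftarrow>dil ps. s * (main x (e * k * y) - main x (- (e * k * y)))) = 0)"
proof -
  obtain e where e: "idem_for ps e" "null c (comb ps e)" using null_comb[OF N ps(1)] ps(2) by auto
  have psp: "\<forall>p\<in>set ps. prime p" using ps(2) small_primesD(1) by blast
  have supp: "comb ps e x y = 0" if nu: "\<not> coprime x (int c) \<or> \<not> coprime y (int c)" for x y
  proof -
    obtain p where p: "prime p" "p dvd c" "int p dvd x \<or> int p dvd y"
    proof -
      obtain z where z: "\<not> coprime z (int c)" "z = x \<or> z = y" using nu by blast
      then have "nat (gcd z (int c)) \<noteq> 1" by (simp add: coprime_iff_gcd_eq_1)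
      then obtain p where p: "prime p" "p dvd nat (gcd z (int c))" using prime_factor_nat by blast
      have "int p dvd int (nat (gcd z (int c)))" using p(2) by (simp only: int_dvd_int_iff)
      then have "int p dvd gcd z (int c)" by simp
      then have "int p dvd z" "p dvd c" by (auto dest: dvd_trans)
      then show thesis using that[OF p(1)] z(2) by blast
    qed
    show ?thesis
    proof (cases "\<exists>q\<in>set ps. int q dvd y")
      case True then show ?thesis by (simp add: comb_def off_def)
    next
      case off: False
      have "main x (e * k * y) = 0" if k: "(s, k) \<in> set (dil ps)" for s k
      proof (cases "p \<in> set ps")
        case True
        then have pT: "p \<in> small_primes" using ps(2) by simp
        have px: "int p dvd x" using p(3) off True by blast
        have "p ^ 1 dvd c" using p(2) by simp
        then have "int (p ^ 1) dvd e" using e(1) True unfolding idem_for_def by blast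
        then have "int p dvd x + e * k * y" using px by simp
        then show ?thesis using pT main_eq_0(2) by blast
      next
        case pT: False
        have ck: "coprime k (int p)" by (rule dil_coprime[OF p(1) pT psp k])
        have "\<forall>q\<in>set ps. coprime p q" using psp pT p(1) primes_coprime by metis
        then have "[e = 1] (mod int p)" using e(1) p(2) by (simp add: idem_for_def)
        then have "coprime e (int p)" by (meson cong_imp_coprime cong_sym coprime_1_left)
        then have cek: "coprime (int p) (e * k)" using ck by (simp add: coprime_commute)
        have py: "int p dvd e * k * y \<longleftrightarrow> int p dvd y" by (rule coprime_dvd_mult_right_iff[OF cek])
        show ?thesis
        proof (cases "p dvd D")
          case True
          have "int p dvd y" if "int D dvd x + e * k * y"
          proof -
            have "int p dvd int D" using True by simp
            then have "int p dvd x + e * k * y" using that dvd_trans by blast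
            then show ?thesis using p(3) py by (metis dvd_add_right_iff)
          qed
          moreover have "X1 (e * k * y) = 0" if "int p dvd y"
          proof -
            have "int p dvd e * k * y" "int p dvd int q1" using that py base[OF p(1) True] by auto
            then have "\<not> coprime (e * k * y) (int q1)"
              using p(1) by (metis coprime_common_divisor not_prime_unit prime_nat_int_transfer)
            then show ?thesis by (simp add: D1(4))
          qed
          ultimately show ?thesis using main_eq_0(1) by (cases "int D dvd x + e * k * y") (auto simp: main_def ker_def)
        next
          case False
          have xy: "int p dvd x \<or> int p dvd e * k * y" using p(3) py by blast
          have "p \<in> simple_primes \<or> p \<in> square_primes" using prime_cases[OF p(1,2) False] pT ps(2) by blast
          then show ?thesis
          proof
            assume "p \<in> square_primes" then show ?thesis using xy by (auto simp: main_def off_def)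
          next
            assume ps: "p \<in> simple_primes"
            have "comp x (e * k * y) p = 0" using xy by (simp add: unit_part_def)
            then have "\<exists>q\<in>simple_primes. comp x (e * k * y) q = 0" using ps by blast
            then have "(\<Prod>p\<in>simple_primes. comp x (e * k * y) p) = 0" by (rule prod_zero[OF finite_simple_primes])
            then show ?thesis by (simp add: main_def ker_def)
          qed
        qed
      qed
      then have "(\<Sum>(s, k)\<leftarrow>dil ps. s * main x (e * k * y)) = (\<Sum>(s, k)\<leftarrow>dil ps. 0)"
        by (intro arg_cong[where f = sum_list] map_cong refl) auto
      then show ?thesis by (simp add: comb_def case_prod_unfold)
    qed
  qed
  have "(\<Sum>(s, k)\<leftarrow>dil ps. s * (main x (e * k * y) - main x (- (e * k * y)))) = 0" if y: "\<forall>p\<in>set ps. \<not> int p dvd y" for x y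
  proof -
    have o: "off (set ps) y = 1" "off (set ps) (- y) = 1" using y by (auto simp: off_def)
    have d: "(\<Sum>(s, k)\<leftarrow>L. s * (main x (e * k * y) - main x (- (e * k * y)))) =
       (\<Sum>(s, k)\<leftarrow>L. s * main x (e * k * y)) - (\<Sum>(s, k)\<leftarrow>L. s * main x (e * k * (- y)))" for L
      by (induction L) (auto simp: algebra_simps)
    have m: "main (- x) z = main x (- z)" for z using main_even[of x "- z"] by simp
    have "comb ps e x y - comb ps e x (- y) - comb ps e (- x) y + comb ps e (- x) (- y) = 0"
      by (rule null_unit_support_imp_zero[OF c_pos e(2) supp])
    moreover have "comb ps e (- x) y = comb ps e x (- y)" "comb ps e (- x) (- y) = comb ps e x y"
      by (simp_all add: comb_def o m)
    ultimately have "2 * (comb ps e x y - comb ps e x (- y)) = 0" by (simp add: algebra_simps)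
    then have "comb ps e x y - comb ps e x (- y) = 0" by (simp only: mult_eq_0_iff) simp
    then show ?thesis unfolding d by (simp add: comb_def o)
  qed
  with e(1) show ?thesis by blast
qed

end

lemma int_prime_dvd_mult: "prime p \<Longrightarrow> int p dvd a * b \<longleftrightarrow> int p dvd a \<or> int p dvd b"
  by (metis prime_dvd_mult_iff prime_nat_int_transfer)

section \<open>Points at which a single dilation survives\<close>

context dedekind_data
begin

lemma finite_square_primes: "finite square_primes"
  by (rule finite_subset[of _ "{..q2}"]) (use q2_ge in \<open>auto simp: square_primes_def intro: dvd_imp_le\<close>)

lemma idem_forD:
  assumes "idem_for ps e" "set ps = small_primes"
  shows "p \<in> small_primes \<Longrightarrow> int p dvd e" "q dvd c \<Longrightarrow> \<forall>p\<in>small_primes. coprime q p \<Longrightarrow> [e = 1] (mod int q)"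
    "[e = 1] (mod int D)" "coprime e (int q1)" "p \<in> simple_primes \<union> square_primes \<Longrightarrow> [e = 1] (mod int p)"
proof -
  show 1: "q dvd c \<Longrightarrow> \<forall>p\<in>small_primes. coprime q p \<Longrightarrow> [e = 1] (mod int q)" for q
    using assms by (auto simp: idem_for_def)
  show "int p dvd e" if "p \<in> small_primes"
  proof -
    have "p ^ 1 dvd c" using small_primesD(3)[OF that] by simp
    then have "int (p ^ 1) dvd e" using assms that unfolding idem_for_def by blast
    then show ?thesis by simp
  qed
  have "\<forall>p\<in>small_primes. coprime D p"
  proof
    fix p assume "p \<in> small_primes"
    then have "coprime p D" using small_primesD(1,6) by (simp add: prime_imp_coprime)
    then show "coprime D p" by (simp only: coprime_commute)
  qed
  then show D: "[e = 1] (mod int D)" using 1[of D] by (simp add: c_eq)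
  then have "[e = 1] (mod int q1)" using q1_dvd_D cong_dvd_modulus by (metis int_dvd_int_iff)
  then show "coprime e (int q1)" by (meson cong_imp_coprime cong_sym coprime_1_left)
  show "[e = 1] (mod int p)" if p: "p \<in> simple_primes \<union> square_primes"
  proof (rule 1)
    have pp: "prime p" "p dvd q2" using p square_primesD simple_primeD by auto
    then show "p dvd c" by (simp add: c_eq)
    show "\<forall>q\<in>small_primes. coprime p q"
    proof
      fix q assume "q \<in> small_primes"
      then have "prime q" "p \<noteq> q" using small_primesD(1,4,5) p by auto
      then show "coprime p q" using pp(1) primes_coprime by blast
    qed
  qed
qed

text \<open>For \<open>x = D z - \<kappa> e\<close> the sum \<open>x + e k\<close> is
  \<open>D z + (k - \<kappa>) e\<close>, and \<open>e\<close> is 1 modulo \<open>D\<close>, so the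
  terms with \<open>k\<close> not congruent to \<open>\<kappa>\<close> vanish. At the simple and
  square primes \<open>z\<close> is chosen so that \<open>x\<close>, \<open>e \<kappa>\<close> and
  their sum are \<open>-2 \<kappa>\<close>, \<open>\<kappa>\<close> and \<open>-\<kappa>\<close>,
  all units; at the small primes and those of \<open>D\<close> it is 1.\<close>

lemma main_isolate:
  assumes e: "idem_for ps e" "set ps = small_primes" and \<kappa>: "coprime \<kappa> (int D)"
    and \<kappa>p: "\<And>p. p \<in> simple_primes \<union> square_primes \<Longrightarrow> \<not> int p dvd \<kappa> \<and> \<not> int p dvd 2"
  shows "\<exists>x. main x (e * \<kappa>) \<noteq> 0 \<and> (\<forall>k. \<not> int D dvd k - \<kappa> \<longrightarrow> main x (e * k) = 0)"
proof -
  note I = idem_forD[OF e]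
  define M where "M = (\<Prod>p\<in>simple_primes \<union> square_primes. p)"
  define L where "L = D * (\<Prod>p\<in>small_primes. p)"
  have fin: "finite (simple_primes \<union> square_primes)" using finite_simple_primes finite_square_primes by simp
  have finT: "finite small_primes" using e(2) by (metis List.finite_set)
  have Mp: "p dvd M" if "p \<in> simple_primes \<union> square_primes" for p unfolding M_def using fin that by (rule dvd_prodI)
  have Lp: "p dvd L" if "p \<in> small_primes" for p unfolding L_def using dvd_prodI[OF finT that, of "\<lambda>p. p"] by simp
  have pr: "prime p \<and> \<not> p dvd D" if "p \<in> simple_primes \<union> square_primes" for p
    using that by (auto simp: simple_primes_def square_primes_def)
  have cDM: "coprime D M"
    unfolding M_def
  proof (rule prod_coprime_right)
    fix p assume "p \<in> simple_primes \<union> square_primes"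
    then have "coprime p D" using pr by (simp add: prime_imp_coprime)
    then show "coprime D p" by (simp only: coprime_commute)
  qed
  have cLM: "coprime L M"
  proof -
    have "coprime (\<Prod>p\<in>small_primes. p) M"
      unfolding M_def
    proof (intro prod_coprime_right prod_coprime_left)
      fix p q assume "p \<in> small_primes" "q \<in> simple_primes \<union> square_primes"
      then have "prime p" "prime q" "p \<noteq> q" using small_primesD(1,4,5) pr by auto
      then show "coprime p q" by (rule primes_coprime)
    qed
    then show ?thesis using cDM by (simp add: L_def)
  qed
  have "coprime (int D) (int M)" using cDM by simp
  then obtain D' where D': "[int D * D' = 1] (mod int M)" using cong_solve_coprime_int by blast
  have "coprime (int L) (int M)" using cLM by simp
  then obtain z where z: "[z = 1] (mod int L)" "[z = - \<kappa> * D'] (mod int M)"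
    using binary_chinese_remainder_int by blast
  define x where "x = int D * z - \<kappa> * e"
  have xk: "x + e * k = int D * z + (k - \<kappa>) * e" for k by (simp add: x_def algebra_simps)
  have n: "x + e * \<kappa> = int D * z" by (simp add: x_def)
  have DzM: "[int D * z = - \<kappa>] (mod int p)" if "p \<in> simple_primes \<union> square_primes" for p
  proof -
    have "[int D * z = int D * (- \<kappa> * D')] (mod int M)" by (intro cong_mult z(2) cong_refl)
    also have "int D * (- \<kappa> * D') = - \<kappa> * (int D * D')" by simp
    also have "[- \<kappa> * (int D * D') = - \<kappa> * 1] (mod int M)" by (intro cong_mult D' cong_refl)
    finally show ?thesis using Mp[OF that] cong_dvd_modulus by (metis int_dvd_int_iff mult.right_neutral)
  qed
  have z1: "\<not> int p dvd z" if "prime p" "p dvd L" for p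
  proof
    assume a: "int p dvd z"
    have "[z = 1] (mod int p)" using z(1) that(2) cong_dvd_modulus by (metis int_dvd_int_iff)
    then have "int p dvd 1" using a cong_dvd_iff by blast
    then show False using that(1) by (metis not_prime_unit prime_nat_int_transfer)
  qed
  have P: "\<not> int p dvd x \<and> \<not> int p dvd e * \<kappa> \<and> \<not> int p dvd x + e * \<kappa>" if p: "p \<in> simple_primes \<union> square_primes" for p
  proof -
    have ek: "[e * \<kappa> = 1 * \<kappa>] (mod int p)" by (intro cong_mult I(5)[OF p] cong_refl)
    have nk: "[x + e * \<kappa> = - \<kappa>] (mod int p)" unfolding n by (rule DzM[OF p])
    have "[x = - (2 * \<kappa>)] (mod int p)" using cong_diff[OF nk ek] by simp
    moreover have "\<not> int p dvd - (2 * \<kappa>)" using \<kappa>p[OF p] int_prime_dvd_mult pr[OF p] by simp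
    moreover have "\<not> int p dvd 1 * \<kappa>" "\<not> int p dvd - \<kappa>" using \<kappa>p[OF p] by auto
    ultimately show ?thesis using cong_dvd_iff[OF ek] cong_dvd_iff[OF nk] cong_dvd_iff by blast
  qed
  have "cmod (main x (e * \<kappa>)) = (\<Prod>p\<in>simple_primes. cmod (comp x (e * \<kappa>) p))"
  proof (rule norm_main(2))
    have "int q1 dvd int D" using q1_dvd_D by simp
    then have "coprime \<kappa> (int q1)" by (rule coprime_divisors[OF dvd_refl _ \<kappa>])
    then show "coprime (e * \<kappa>) (int q1)" using I(4) by simp
    show "int D dvd x + e * \<kappa>" unfolding n by simp
    show "p \<in> square_primes \<Longrightarrow> \<not> int p dvd x \<and> \<not> int p dvd e * \<kappa>" for p using P by blast
    show "p \<in> square_primes \<union> small_primes \<Longrightarrow> \<not> int p dvd x + e * \<kappa>" for p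
    proof (cases "p \<in> square_primes")
      case True then show ?thesis using P by blast
    next
      case False
      assume "p \<in> square_primes \<union> small_primes"
      then have p: "p \<in> small_primes" using False by blast
      then show ?thesis unfolding n using z1[OF small_primesD(1)[OF p] Lp[OF p]] int_prime_dvd_mult[OF small_primesD(1)[OF p]] small_primesD(6)[OF p] by auto
    qed
    show "\<not> int (D * p) dvd x + e * \<kappa>" if "prime p" "p dvd D" "p dvd q2" for p
      unfolding n using z1[OF that(1)] that(2) D_pos by (simp add: L_def)
  qed
  moreover have "(\<Prod>p\<in>simple_primes. cmod (comp x (e * \<kappa>) p)) \<noteq> 0"
  proof -
    have "comp x (e * \<kappa>) p \<noteq> 0" if p: "p \<in> simple_primes" for p
    proof (rule norm_unit_part_ge(2))
      show "prime p" "p \<ge> 5" using p by (auto simp: simple_primes_def)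
      show "\<And>a. \<not> int p dvd a \<Longrightarrow> cmod (loc p a) = 1" by (rule loc_props(6)[OF p])
      show "\<not> int p dvd x" "\<not> int p dvd e * \<kappa>" "\<not> int p dvd x + e * \<kappa>" using P[of p] p by auto
    qed
    then show ?thesis using finite_simple_primes by simp
  qed
  ultimately have "main x (e * \<kappa>) \<noteq> 0" by auto
  moreover have "main x (e * k) = 0" if k: "\<not> int D dvd k - \<kappa>" for k
  proof (rule main_eq_0(1))
    have "coprime (int D) e" using I(3) by (meson cong_imp_coprime cong_sym coprime_1_left coprime_commute)
    then have "\<not> int D dvd (k - \<kappa>) * e" using k by (simp add: coprime_dvd_mult_left_iff)
    then show "\<not> int D dvd x + e * k" unfolding xk by (simp add: dvd_add_right_iff)
  qed
  ultimately show ?thesis by blast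
qed

text \<open>The three moduli \<open>D\<close> for which \<open>k \<equiv> 1 (mod D)\<close> for a second dilation factor \<open>k\<close>.\<close>

lemma main_special:
  assumes e: "idem_for ps e" "set ps = small_primes"
    and d: "(int D, \<delta>) \<in> {(3, - 1), (4, - 1), (5, 1)}" and k: "k = 1 + int D * \<delta>"
    and T: "\<And>p. p \<in> square_primes \<Longrightarrow> \<not> int p dvd int D + \<delta>"
    and rel: "main (int D + \<delta> * e) (- (e * \<delta>)) + main (int D + \<delta> * e) (- (e * k * \<delta>)) = 0"
  shows False
proof -
  note I = idem_forD[OF e]
  \<comment> \<open>Here \<open>x + y = D\<close>, while \<open>x + y' = D (1 - e)\<close> with
    \<open>1 - e\<close> divisible by \<open>D\<close> and by the simple and square primes. So
    \<open>main x y\<close> attains the bound of \<open>norm_main\<close>, whereas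
    \<open>main x y'\<close> is 0 or strictly smaller as soon as \<open>q2\<close> has a prime that
    is not small; the relation then forces all its primes to be small.\<close>
  define x where "x = int D + \<delta> * e"
  define y where "y = - (e * \<delta>)"
  define y' where "y' = - (e * k * \<delta>)"
  have dd: "\<delta> * \<delta> = 1" using d by auto
  have xy: "x + y = int D" by (simp add: x_def y_def)
  have xy': "x + y' = int D * (1 - e)"
  proof -
    have "x + y' = int D - e * (\<delta> * \<delta>) * int D" by (simp add: x_def y'_def k algebra_simps)
    then show ?thesis by (simp add: dd algebra_simps)
  qed
  have pr: "prime p \<and> \<not> p dvd D" if "p \<in> simple_primes \<union> square_primes" for p
    using that by (auto simp: simple_primes_def square_primes_def)
  have xm: "[x = int D + \<delta>] (mod int p)" "[y = - \<delta>] (mod int p)" if p: "p \<in> simple_primes \<union> square_primes" for p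
  proof -
    have "[int D + \<delta> * e = int D + \<delta> * 1] (mod int p)" "[- \<delta> * e = - \<delta> * 1] (mod int p)"
      by (intro cong_add cong_mult I(5)[OF p] cong_refl)+
    then show "[x = int D + \<delta>] (mod int p)" "[y = - \<delta>] (mod int p)" by (simp_all add: x_def y_def mult.commute)
  qed
  have dcop: "coprime \<delta> (int n)" for n using d by auto
  have cy: "coprime y (int q1)" using I(4) dcop by (simp add: y_def)
  have nD: "\<not> int p dvd \<delta>" if "prime p" for p
    using dcop[of p] that by (metis coprime_common_divisor dvd_refl not_prime_unit prime_nat_int_transfer)
  have n1: "cmod (main x y) = (\<Prod>p\<in>simple_primes. cmod (comp x y p))"
  proof (rule norm_main(2)[OF cy])
    show "int D dvd x + y" by (simp add: xy)
    show "\<not> int p dvd x \<and> \<not> int p dvd y" if p: "p \<in> square_primes" for p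
      using T[OF p] nD[OF square_primesD(1)[OF p]] cong_dvd_iff[OF xm(1)[of p]] cong_dvd_iff[OF xm(2)[of p]] p by auto
    show "\<not> int p dvd x + y" if "p \<in> square_primes \<union> small_primes" for p
      using that square_primesD(6) small_primesD(6) unfolding xy by auto
    show "\<not> int (D * p) dvd x + y" if "prime p" "p dvd D" "p dvd q2" for p
    proof
      assume "int (D * p) dvd x + y"
      then have "D * p dvd D * 1" unfolding xy by (simp only: int_dvd_int_iff mult_1_right)
      then have "p dvd 1" using D_pos by simp
      then show False using that(1) by simp
    qed
  qed
  have cmp: "cmod (comp x y' p) < cmod (comp x y p)" if p: "p \<in> simple_primes" for p
  proof -
    have "[e = 1] (mod int p)" using I(5) p by blast
    then have "[int D * (1 - e) = int D * (1 - 1)] (mod int p)" by (intro cong_mult cong_diff cong_refl)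
    then have "[(x + y') - x = 0 - x] (mod int p)" unfolding xy' by (intro cong_diff cong_refl) simp
    then have "[y' = - x] (mod int p)" by simp
    then have "comp x y' p = comp x (- x) p" by (rule periodic_cong[OF unit_part_periodic(1)[OF loc_props(1)[OF p]]])
    moreover have "cmod (comp x (- x) p) < cmod (comp x y p)"
    proof (rule unit_part_compare[where D = "int D" and \<delta> = \<delta>])
      show "prime p" "p \<ge> 5" "\<not> int p dvd int D" using p by (auto simp: simple_primes_def)
      show "[x = int D + \<delta>] (mod int p)" "[y = - \<delta>] (mod int p)" using xm p by blast+
    qed (rule loc_props[OF p] d, assumption?)+
    ultimately show ?thesis by simp
  qed
  have pos: "(\<Prod>p\<in>simple_primes. cmod (comp x y p)) > 0"
    by (rule prod_pos) (use cmp norm_ge_zero le_less_trans in blast)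
  have eq: "cmod (main x y) = cmod (main x y')"
    using rel unfolding x_def[symmetric] y_def[symmetric] y'_def[symmetric] by (metis add_eq_0_iff norm_minus_cancel)
  have B: "square_primes = {}"
  proof (rule ccontr)
    assume "square_primes \<noteq> {}"
    then obtain p where p: "p \<in> square_primes" by blast
    have "[e = 1] (mod int p)" using I(5) p by blast
    then have "int p dvd 1 - e" by (metis cong_iff_dvd_diff cong_sym)
    then have "int p dvd x + y'" unfolding xy' by simp
    then have "main x y' = 0" using main_eq_0(2) p by blast
    then show False using n1 eq pos by simp
  qed
  have A: "\<not> p dvd D" if p: "prime p" "p dvd q2" for p
  proof
    assume pD: "p dvd D"
    have "[e = 1] (mod int p)" using I(3) pD cong_dvd_modulus by (metis int_dvd_int_iff)
    then have "int p dvd 1 - e" by (metis cong_iff_dvd_diff cong_sym)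
    then have "int (D * p) dvd x + y'" unfolding xy' by simp
    then have "main x y' = 0" by (rule main_eq_0(3)[OF p(1) pD p(2)])
    then show False using n1 eq pos by simp
  qed
  have C: "simple_primes = {}"
  proof (rule ccontr)
    assume "simple_primes \<noteq> {}"
    then obtain p where "p \<in> simple_primes" by blast
    then have "(\<Prod>p\<in>simple_primes. cmod (comp x y' p)) < (\<Prod>p\<in>simple_primes. cmod (comp x y p))"
    proof (rule prod_mono_strict[OF _ _ finite_simple_primes])
      show "cmod (comp x y' p) < cmod (comp x y p)" by (rule cmp) fact
      show "0 < cmod (comp x y q)" if "q \<in> simple_primes" for q
        by (rule le_less_trans[OF norm_ge_zero cmp[OF that]])
      show "0 \<le> cmod (comp x y' q) \<and> cmod (comp x y' q) \<le> cmod (comp x y q)" if "q \<in> simple_primes" for q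
        using cmp[OF that] by simp
    qed
    then show False using norm_main(1)[of x y'] n1 eq by simp
  qed
  have M: "main x w = X1 w * kap (x + w)" for w
    by (simp add: main_def B C off_def ker_def shift_def)
  \<comment> \<open>With only small primes left in \<open>q2\<close>, \<open>e\<close> vanishes
    modulo \<open>q2\<close>, so both values of \<open>kap\<close> are 1 and the two terms of the
    relation add up instead of cancelling.\<close>
  have q2e: "int q2 dvd e"
  proof (cases "e = 0")
    case False
    have "q2 dvd nat \<bar>e\<bar>"
    proof (rule multiplicity_le_imp_dvd)
      show "q2 \<noteq> 0" using q2_ge by simp
      fix p :: nat assume p: "prime p"
      show "multiplicity p q2 \<le> multiplicity p (nat \<bar>e\<bar>)"
      proof (cases "p dvd q2")
        case True
        then have "p \<in> small_primes" using prime_cases[OF p _ A[OF p True]] B C by (auto simp: c_eq)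
        moreover have "p ^ multiplicity p q2 dvd c" by (simp add: c_eq multiplicity_dvd)
        ultimately have "int (p ^ multiplicity p q2) dvd e" using e unfolding idem_for_def by blast
        then have "p ^ multiplicity p q2 dvd nat \<bar>e\<bar>" by (metis dvd_abs_iff int_dvd_int_iff abs_ge_zero nat_0_le)
        then show ?thesis using False p by (intro multiplicity_geI) (auto simp: prime_gt_1_nat)
      qed (simp add: not_dvd_imp_multiplicity_0)
    qed
    then show ?thesis by (metis dvd_abs_iff int_dvd_int_iff abs_ge_zero nat_0_le)
  qed simp
  have "kap (x + y) = 1" using kap_mult[of 1] by (simp add: xy D2(5))
  moreover have "kap (x + y') = 1"
  proof -
    have "X2 (1 - e) = X2 1" by (rule periodic_cong[OF D2(3)]) (use q2e in \<open>simp add: cong_iff_dvd_diff\<close>)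
    then show ?thesis by (simp add: xy' kap_mult D2(5))
  qed
  moreover have "X1 y' = X1 y"
  proof (rule periodic_cong[OF D1(3)])
    have "int q1 dvd int D" using q1_dvd_D by simp
    moreover have "y' - y = int D * (- (e * \<delta> * \<delta>))" by (simp add: y'_def y_def k algebra_simps)
    ultimately show "[y' = y] (mod int q1)" unfolding cong_iff_dvd_diff by (metis dvd_mult2)
  qed
  ultimately have "main x y + main x y' = 2 * X1 y" by (simp add: M)
  then have "X1 y = 0" using rel by (simp add: x_def y_def y'_def)
  then show False using cy D1(4) by blast
qed


end

section \<open>Case distinction over the small primes 2 and 3\<close>

context dedekind_data
begin

text \<open>The relation involves \<open>main x (e k)\<close> for the signed products
  \<open>k\<close> of distinct small primes, and isolating \<open>k = 1\<close> contradicts it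
  unless another such \<open>k\<close> is 1 modulo \<open>D\<close>. As \<open>D >= 3\<close> is
  prime to the small primes, this happens only for \<open>k = -2\<close>, \<open>D = 3\<close>;
  \<open>k = -3\<close>, \<open>D = 4\<close>; \<open>k = 6\<close>, \<open>D = 5\<close>; and
  \<open>k = -6\<close>, \<open>D = 7\<close>.\<close>

theorem R_nonzero_base:
  assumes base: "\<And>p. prime p \<Longrightarrow> p dvd D \<Longrightarrow> p dvd q1"
  shows "\<exists>a. coprime a (int c) \<and> R a \<noteq> 0"
proof (rule ccontr)
  assume "\<not> ?thesis"
  then have R0: "R a = 0" if "coprime a (int c)" for a using that by blast
  have N: "null c (\<lambda>x y. X1 y * kap (x + y))"
    unfolding null_def
  proof (intro conjI allI impI)
    show "periodic c (\<lambda>y. X1 y * kap (x + y))" for x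
      using X1_periodic_c periodic_affine[OF kap_periodic, of x 1] by (simp add: periodic_def)
    show "periodic c (\<lambda>x. X1 y * kap (x + y))" for y
      using periodic_affine[OF kap_periodic, of y 1] by (simp add: periodic_def add.commute)
    fix u v assume uv: "coprime u (int c)" "coprime v (int c)"
    obtain u' where u': "[u * u' = 1] (mod int c)" "coprime u' (int c)" using coprime_int_inverse[OF uv(1)] by blast
    show "bil c (\<lambda>x y. X1 y * kap (x + y)) u v = 0"
      unfolding bil_kap[OF uv u'(1)] using R0[of "u' * v"] u'(2) uv(2) by simp
  qed
  have D3: "int D \<ge> 3" using D_ge by simp
  have dvd_small: "int D \<le> \<bar>k\<bar>" if "int D dvd k" "k \<noteq> 0" for k using that zdvd_imp_le[of "int D" "\<bar>k\<bar>"] by simp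
  have sub: "small_primes \<subseteq> {2, 3}" by (auto simp: small_primes_def)
  have odd: "odd D" if "2 \<in> small_primes" using small_primesD(6)[OF that] .
  have n3: "\<not> 3 dvd D" if "3 \<in> small_primes" using small_primesD(6)[OF that] .
  have p2: "\<not> int p dvd 1" "\<not> int p dvd 2" if p: "p \<in> simple_primes \<union> square_primes" for p
  proof -
    have "prime p" "p \<noteq> 2" using p by (auto simp: simple_primes_def square_primes_def)
    then have "p \<ge> 3" using prime_ge_2_nat[of p] by linarith
    then show "\<not> int p dvd 1" "\<not> int p dvd 2" using zdvd_not_zless[of _ "int p"] by auto
  qed
  have q3: "\<not> int p dvd 3" if p: "p \<in> square_primes" "3 \<in> small_primes" for p
  proof
    assume "int p dvd 3"
    then have "p dvd 3" by presburger
    moreover have "prime (3::nat)" by simp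
    ultimately have "p = 3" using square_primesD(1)[OF p(1)] by (metis primes_dvd_imp_eq)
    then show False using small_primesD(5)[OF p(2)] p(1) by simp
  qed
  have q6: "\<not> int p dvd 6" if p: "p \<in> square_primes" "3 \<in> small_primes" for p
  proof
    assume "int p dvd 6"
    then have "int p dvd 2 * 3" by simp
    then have "int p dvd 2 \<or> int p dvd 3" by (simp only: int_prime_dvd_mult[OF square_primesD(1)[OF p(1)]])
    then show False using q3[OF p] p2[of p] p(1) by blast
  qed
  have iso1: "\<exists>x. main x e \<noteq> 0 \<and> (\<forall>k. \<not> int D dvd k - 1 \<longrightarrow> main x (e * k) = 0)"
    if "idem_for ps e" "set ps = small_primes" for ps e
    using main_isolate[OF that, of 1] p2 by simp
  have rel: "\<exists>e. idem_for ps e \<and> (\<forall>x y. (\<forall>p\<in>set ps. \<not> int p dvd y) \<longrightarrow>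
      (\<Sum>(s, k)\<leftarrow>dil ps. s * (main x (e * k * y) - main x (- (e * k * y)))) = 0)"
    if "distinct ps" "set ps = small_primes" for ps
    by (rule main_relation[OF N base that])
  \<comment> \<open>At the first argument \<open>D + \<delta> e\<close> all terms with
    \<open>k\<close> not congruent to 1 modulo \<open>D\<close> drop out; the two that remain are
    those refuted by \<open>main_special\<close>.\<close>
  have kill: "main (int D + \<delta> * e) (- (e * k * \<delta>)) = 0"
    if e: "idem_for ps e" "set ps = small_primes" and d: "\<delta> * \<delta> = 1" and k: "\<not> int D dvd k - 1" for ps e \<delta> k
  proof (rule main_eq_0(1))
    have "coprime (int D) e" using idem_forD(3)[OF e] by (meson cong_imp_coprime cong_sym coprime_1_left coprime_commute)
    moreover have "coprime (int D) \<delta>" using d by (metis coprime_1_right coprime_mult_right_iff)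
    ultimately have "\<not> int D dvd (k - 1) * (e * \<delta>)" using k by (simp add: coprime_dvd_mult_left_iff)
    moreover have "int D + \<delta> * e + - (e * k * \<delta>) = int D * 1 - (k - 1) * (e * \<delta>)" by (simp add: algebra_simps)
    ultimately show "\<not> int D dvd int D + \<delta> * e + - (e * k * \<delta>)" by (metis dvd_diff_right_iff dvd_triv_left)
  qed
  consider "small_primes = {}" | "small_primes = {2}" | "small_primes = {3}" | "small_primes = {2, 3}"
    using sub by blast
  then show False
  proof cases
    case 1
    then have S: "distinct []" "set [] = small_primes" by simp_all
    obtain e where e: "idem_for [] e" and R: "\<forall>x y. (\<forall>p\<in>set []. \<not> int p dvd y) \<longrightarrow>
      (\<Sum>(s, k)\<leftarrow>dil []. s * (main x (e * k * y) - main x (- (e * k * y)))) = 0" using rel[OF S] by blast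
    have r: "main x e = main x (- e)" for x
    proof -
      have "(\<Sum>(s, k)\<leftarrow>dil []. s * (main x (e * k * 1) - main x (- (e * k * 1)))) = 0" using R by auto
      then show ?thesis by simp
    qed
    obtain x where x: "main x e \<noteq> 0" "\<And>k. \<not> int D dvd k - 1 \<Longrightarrow> main x (e * k) = 0" using iso1[OF e S(2)] by blast
    have "\<not> int D dvd - 1 - 1" using dvd_small[of "- 2"] D3 by auto
    then show False using x(2)[of "- 1"] x(1) r[of x] by simp
  next
    case 2
    then have S: "set [2] = small_primes" by simp
    have "distinct [2::nat]" by simp
    from rel[OF this S] obtain e where e: "idem_for [2] e" and R: "\<forall>x y. (\<forall>p\<in>set [2]. \<not> int p dvd y) \<longrightarrow>
      (\<Sum>(s, k)\<leftarrow>dil [2]. s * (main x (e * k * y) - main x (- (e * k * y)))) = 0" by blast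
    have r: "main x (e * y) - main x (- (e * y)) - (main x (e * 2 * y) - main x (- (e * 2 * y))) = 0" if "odd y" for x y
    proof -
      have "\<forall>p\<in>set [2]. \<not> int p dvd y" using that by simp
      then have "(\<Sum>(s, k)\<leftarrow>dil [2]. s * (main x (e * k * y) - main x (- (e * k * y)))) = 0" using R by blast
      then show ?thesis by (simp add: algebra_simps)
    qed
    have d: "\<not> int D dvd - 1 - 1" "\<not> int D dvd 2 - 1" using dvd_small[of "- 2"] dvd_small[of 1] D3 by auto
    show False
    proof (cases "D = 3")
      case True
      have "main (int D + - 1 * e) (- (e * (- 1))) + main (int D + - 1 * e) (- (e * (- 2) * (- 1))) = 0"
        using r[of 1 "int D + - 1 * e"] kill[OF e S, of "- 1" "- 1"] kill[OF e S, of "- 1" 2] d by (simp add: mult.commute)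
      then show False
        by (rule main_special[OF e S, rotated 3]) (use True p2 in auto)
    next
      case False
      obtain x where x: "main x e \<noteq> 0" "\<And>k. \<not> int D dvd k - 1 \<Longrightarrow> main x (e * k) = 0" using iso1[OF e S] by auto
      have "\<not> int D dvd - 2 - 1" using dvd_small[of "- 3"] D3 False by auto
      then show False using r[of 1 x] x(1) x(2)[of "- 1"] x(2)[of 2] x(2)[of "- 2"] d by (simp add: mult.commute)
    qed
  next
    case 3
    then have S: "set [3] = small_primes" by simp
    have "distinct [3::nat]" by simp
    from rel[OF this S] obtain e where e: "idem_for [3] e" and R: "\<forall>x y. (\<forall>p\<in>set [3]. \<not> int p dvd y) \<longrightarrow>
      (\<Sum>(s, k)\<leftarrow>dil [3]. s * (main x (e * k * y) - main x (- (e * k * y)))) = 0" by blast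
    have r: "main x (e * y) - main x (- (e * y)) - (main x (e * 3 * y) - main x (- (e * 3 * y))) = 0" if "\<not> 3 dvd y" for x y
    proof -
      have "\<forall>p\<in>set [3]. \<not> int p dvd y" using that by simp
      then have "(\<Sum>(s, k)\<leftarrow>dil [3]. s * (main x (e * k * y) - main x (- (e * k * y)))) = 0" using R by blast
      then show ?thesis by (simp add: algebra_simps)
    qed
    have "D \<noteq> 3" using n3 3 by auto
    have d: "\<not> int D dvd - 1 - 1" "\<not> int D dvd 3 - 1" using dvd_small[of "- 2"] dvd_small[of 2] D3 by auto
    show False
    proof (cases "D = 4")
      case True
      have "main (int D + - 1 * e) (- (e * (- 1))) + main (int D + - 1 * e) (- (e * (- 3) * (- 1))) = 0"
        using r[of 1 "int D + - 1 * e"] kill[OF e S, of "- 1" "- 1"] kill[OF e S, of "- 1" 3] d by (simp add: mult.commute)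
      then show False
        by (rule main_special[OF e S, rotated 3]) (use True q3 3 in auto)
    next
      case False
      obtain x where x: "main x e \<noteq> 0" "\<And>k. \<not> int D dvd k - 1 \<Longrightarrow> main x (e * k) = 0" using iso1[OF e S] by auto
      have "\<not> int D dvd - 3 - 1" using dvd_small[of "- 4"] D3 False \<open>D \<noteq> 3\<close> by auto
      then show False using r[of 1 x] x(1) x(2)[of "- 1"] x(2)[of 3] x(2)[of "- 3"] d by (simp add: mult.commute)
    qed
  next
    case 4
    then have S: "set [3, 2] = small_primes" by auto
    have "distinct [3, 2::nat]" by simp
    from rel[OF this S] obtain e where e: "idem_for [3, 2] e" and R: "\<forall>x y. (\<forall>p\<in>set [3, 2]. \<not> int p dvd y) \<longrightarrow>
      (\<Sum>(s, k)\<leftarrow>dil [3, 2]. s * (main x (e * k * y) - main x (- (e * k * y)))) = 0" by blast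
    have r: "main x (e * y) - main x (- (e * y)) - (main x (e * 2 * y) - main x (- (e * 2 * y)))
       - (main x (e * 3 * y) - main x (- (e * 3 * y))) + (main x (e * 6 * y) - main x (- (e * 6 * y))) = 0"
       if "odd y" "\<not> 3 dvd y" for x y
    proof -
      have "\<forall>p\<in>set [3, 2]. \<not> int p dvd y" using that by simp
      then have "(\<Sum>(s, k)\<leftarrow>dil [3, 2]. s * (main x (e * k * y) - main x (- (e * k * y)))) = 0" using R by blast
      then show ?thesis by (simp add: algebra_simps)
    qed
    have D: "D \<noteq> 3" "D \<noteq> 4" "D \<noteq> 6" using n3 odd 4 by auto
    have d: "\<not> int D dvd - 1 - 1" "\<not> int D dvd 2 - 1" "\<not> int D dvd - 2 - 1" "\<not> int D dvd 3 - 1" "\<not> int D dvd - 3 - 1"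
      using dvd_small[of "- 2"] dvd_small[of 1] dvd_small[of "- 3"] dvd_small[of 2] dvd_small[of "- 4"] D3 D by auto
    have d6: "\<not> int D dvd - 6 - 1" if "D \<noteq> 7"
    proof
      assume "int D dvd - 6 - 1"
      then have "D dvd 7" by (simp add: int_dvd_int_iff[symmetric])
      moreover have "prime (7::nat)" by simp
      ultimately have "D = 1 \<or> D = 7" by (simp add: prime_nat_iff)
      then show False using that D_ge by auto
    qed
    consider "D = 5" | "D = 7" | "D \<noteq> 5" "D \<noteq> 7" by blast
    then show False
    proof cases
      case 1
      have "main (int D + 1 * e) (- (e * 1)) + main (int D + 1 * e) (- (e * 6 * 1)) = 0"
        using r[of "- 1" "int D + 1 * e"] kill[OF e S, of 1 "- 1"] kill[OF e S, of 1 2] kill[OF e S, of 1 "- 2"]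
          kill[OF e S, of 1 3] kill[OF e S, of 1 "- 3"] kill[OF e S, of 1 "- 6"] d d6 1 by (simp add: mult.commute)
      then show False
        by (rule main_special[OF e S, rotated 3]) (use 1 q6 4 in auto)
    next
      case 2
      \<comment> \<open>Modulo 7 none of -2 and plus or minus 1, 3, 6 is congruent to 2, so
        \<open>k = 2\<close> can be isolated instead of \<open>k = 1\<close>.\<close>
      have "coprime (2::int) (int D)" using 2 by simp
      then obtain x where x: "main x (e * 2) \<noteq> 0" "\<And>k. \<not> int D dvd k - 2 \<Longrightarrow> main x (e * k) = 0"
        using main_isolate[OF e S, of 2] p2 by auto
      show False using r[of 1 x] x(1) x(2)[of 1] x(2)[of "- 1"] x(2)[of "- 2"] x(2)[of 3] x(2)[of "- 3"] x(2)[of 6] x(2)[of "- 6"] 2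
        by (simp add: mult.commute)
    next
      case 3
      obtain x where x: "main x e \<noteq> 0" "\<And>k. \<not> int D dvd k - 1 \<Longrightarrow> main x (e * k) = 0" using iso1[OF e S] by auto
      have "\<not> int D dvd 6 - 1" using dvd_small[of 5] D3 D 3 by auto
      then show False using r[of 1 x] x(1) x(2)[of "- 1"] x(2)[of 2] x(2)[of "- 2"] x(2)[of 3] x(2)[of "- 3"] x(2)[of 6] x(2)[of "- 6"] d d6 3
        by (simp add: mult.commute)
    qed
  qed
qed

end

section \<open>Raising the level\<close>

text \<open>Dual to \<open>wt_distribution\<close>: in the Fourier expansion the sum over
  \<open>b\<close> keeps only the frequencies divisible by \<open>p\<close>.\<close>

lemma B1_distribution:
  assumes "p > 0" "c > 0"
  shows "(\<Sum>b\<in>{0..<int p}. B1 (of_int (k + b * int c) / of_nat (p * c))) = B1 (of_int k / of_nat c)"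
proof -
  have pc: "p * c > 0" using assms by simp
  have e: "ee (p * c) (m * (k + b * int c)) = ee (p * c) (m * k) * ee p (m * b)" for m b
  proof -
    have "m * (k + b * int c) = m * k + int c * (m * b)" by (simp add: algebra_simps)
    then show ?thesis using ee_scale[OF assms(2), of p "m * b"] by (simp only: ee_add mult.commute[of p c])
  qed
  have "complex_of_real (\<Sum>b\<in>{0..<int p}. B1 (of_int (k + b * int c) / of_nat (p * c))) =
     (\<Sum>b\<in>{0..<int p}. \<i> / 2 * (\<Sum>m\<in>{0..<int (p * c)}. of_real (wt (p * c) m) * ee (p * c) (m * (k + b * int c))))"
    by (simp only: of_real_sum B1_fourier[OF pc])
  also have "\<dots> = \<i> / 2 * (\<Sum>m\<in>{0..<int (p * c)}. of_real (wt (p * c) m) * ee (p * c) (m * k) * (\<Sum>b\<in>{0..<int p}. ee p (m * b)))"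
    unfolding e sum_distrib_left by (subst sum.swap) (simp only: mult_ac)
  also have "\<dots> = \<i> / 2 * (\<Sum>m\<in>{0..<int (p * c)}. if int p dvd m then of_real (wt (p * c) m) * ee (p * c) (m * k) * of_nat p else 0)"
    unfolding sum_ee[OF assms(1)] by (intro arg_cong2[where f = times] sum.cong refl) simp
  also have "\<dots> = \<i> / 2 * (\<Sum>m\<in>{0..<int c}. of_real (wt c m) * ee c (m * k))"
  proof -
    have "of_real (wt (p * c) (int p * m)) * ee (p * c) (int p * m * k) * of_nat p = of_real (wt c m) * ee c (m * k)" for m
    proof -
      have "of_real (wt (p * c) (int p * m)) * of_nat p = (of_real (wt c m) :: complex)"
        using wt_scale[OF assms(1), of c m] by (metis mult.commute of_real_mult of_real_of_nat_eq)
      then show ?thesis using ee_scale[OF assms(1), of c "m * k"] by (simp add: mult.assoc mult.left_commute)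
    qed
    then show ?thesis unfolding sum_residues_dvd[OF assms(1)] by simp
  qed
  also have "\<dots> = complex_of_real (B1 (of_int k / of_nat c))" by (simp only: B1_fourier[OF assms(2)])
  finally show ?thesis by (simp only: of_real_eq_iff)
qed

lemma B1_scale: "p > 0 \<Longrightarrow> B1 (of_int (int p * k) / of_nat (p * c)) = B1 (of_int k / of_nat c)"
  by simp

section \<open>The sum over \<open>n\<close> and a Hecke relation for Dedekind sums\<close>

definition inner_sum :: "nat \<Rightarrow> (int \<Rightarrow> complex) \<Rightarrow> nat \<Rightarrow> int \<Rightarrow> complex" where
  "inner_sum q X c y = (\<Sum>n\<in>{0..<int q}. cnj (X n) * of_real (B1 (of_int (n * int (c div q) + y) / of_nat c)))"

lemma dedekind_sum_inner:
  assumes "q1 dvd c" "c > 0"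
  shows "dedekind_sum q1 X1 X2 a c = (\<Sum>j\<in>{0..<int c}. cnj (X2 j) * of_real (B1 (of_int j / of_nat c)) * inner_sum q1 X1 c (a * j))"
proof -
  obtain k where k: "c = q1 * k" using assms(1) by (elim dvdE)
  have "of_int n / real q1 + of_int (a * j) / real c = of_int (n * int (c div q1) + a * j) / real c" for n j
    using assms(2) k by (cases "q1 = 0") (auto simp: field_simps)
  then show ?thesis unfolding dedekind_sum_def inner_sum_def by (simp only: sum_distrib_left mult_ac)
qed

lemma inner_sum_periodic: assumes "c > 0" shows "periodic c (inner_sum q X c)"
proof -
  have "B1 (of_int (x + (y + int c)) / real c) = B1 (of_int (x + y) / real c)" for x y
    using B1_periodic[OF assms] unfolding periodic_def by (metis add.assoc)
  then show ?thesis by (simp only: periodic_def inner_sum_def simp_thms)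
qed

lemma inner_sum_scale:
  assumes "p > 0" "q dvd c" shows "inner_sum q X (p * c) (int p * y) = inner_sum q X c y"
proof -
  have "n * int (p * c div q) + int p * y = int p * (n * int (c div q) + y)" for n
  proof -
    have "p * c div q = p * (c div q)" using assms(2) by (simp add: div_mult_swap)
    then show ?thesis by (simp add: algebra_simps)
  qed
  then show ?thesis unfolding inner_sum_def by (simp only: B1_scale[OF assms(1)])
qed

context
  fixes q1 q2 :: nat and X1 X2 :: "int \<Rightarrow> complex"
  assumes dc1: "dirichlet_character q1 X1" and dc2: "dirichlet_character q2 X2"
begin

text \<open>At level \<open>p c\<close> the step \<open>c/q1\<close> is multiplied by
  \<open>p\<close>, so after \<open>B1_distribution\<close> the variable \<open>n\<close> occurs as
  \<open>p n\<close>; substituting it back produces \<open>X1 p\<close>.\<close>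

lemma inner_sum_distribution:
  assumes p: "prime p" "\<not> p dvd q1" and c: "q1 dvd c" "c > 0"
  shows "(\<Sum>b\<in>{0..<int p}. inner_sum q1 X1 (p * c) (y + b * int c)) = X1 (int p) * inner_sum q1 X1 c y"
proof -
  note D1 = dirichlet_characterD[OF dc1]
  have p0: "p > 0" using p(1) prime_gt_0_nat by blast
  have cp: "coprime (int p) (int q1)" using p prime_imp_coprime by simp
  define h where "h n = cnj (X1 n) * of_real (B1 (of_int (n * int (c div q1) + y) / of_nat c))" for n
  have h: "periodic q1 h"
    unfolding periodic_def
  proof
    fix n
    have "int q1 * int (c div q1) = int c" using c(1) by (metis dvd_mult_div_cancel of_nat_mult)
    then have "(n + int q1) * int (c div q1) + y = (n * int (c div q1) + y) + int c" by (simp add: algebra_simps)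
    then have "B1 (of_int ((n + int q1) * int (c div q1) + y) / of_nat c) = B1 (of_int (n * int (c div q1) + y) / of_nat c)"
      using B1_periodic[OF c(2)] by (simp only: periodic_def)
    moreover have "X1 (n + int q1) = X1 n" using D1(3) by (simp add: periodic_def)
    ultimately show "h (n + int q1) = h n" by (simp only: h_def)
  qed
  have "(\<Sum>b\<in>{0..<int p}. inner_sum q1 X1 (p * c) (y + b * int c)) =
    (\<Sum>n\<in>{0..<int q1}. cnj (X1 n) * of_real (\<Sum>b\<in>{0..<int p}. B1 (of_int ((n * int (p * c div q1) + y) + b * int c) / of_nat (p * c))))"
    unfolding inner_sum_def of_real_sum sum_distrib_left by (subst sum.swap) (simp only: add.assoc)
  also have "\<dots> = (\<Sum>n\<in>{0..<int q1}. X1 (int p) * h (int p * n))"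
  proof (rule sum.cong[OF refl])
    fix n
    have "n * int (p * c div q1) + y = int p * n * int (c div q1) + y" using c(1) by (simp add: div_mult_swap[symmetric])
    moreover have "cnj (X1 n) = X1 (int p) * cnj (X1 (int p * n))"
    proof -
      have "X1 (int p) * cnj (X1 (int p)) = 1"
        using dirichlet_character_norm[OF dc1 cp] by (metis complex_norm_square one_power2 of_real_1)
      then show ?thesis by (simp add: D1(2) mult.assoc[symmetric])
    qed
    ultimately show "cnj (X1 n) * of_real (\<Sum>b\<in>{0..<int p}. B1 (of_int ((n * int (p * c div q1) + y) + b * int c) / of_nat (p * c)))
       = X1 (int p) * h (int p * n)"
      unfolding B1_distribution[OF p0 c(2)] h_def by (simp only: mult.assoc)
  qed
  also have "\<dots> = X1 (int p) * (\<Sum>n\<in>{0..<int q1}. h n)"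
    unfolding sum_distrib_left[symmetric] sum_residues_mult[OF h cp] ..
  finally show ?thesis by (simp only: h_def inner_sum_def)
qed

lemma sum_B1_lift:
  assumes "p > 0" "c > 0" "q2 dvd c" "periodic c h"
  shows "(\<Sum>j\<in>{0..<int (p * c)}. cnj (X2 j) * of_real (B1 (of_int j / of_nat (p * c))) * h j) =
     (\<Sum>j\<in>{0..<int c}. cnj (X2 j) * of_real (B1 (of_int j / of_nat c)) * h j)"
proof -
  have X: "periodic c X2" using dirichlet_characterD(3)[OF dc2] assms(3) by (rule periodic_dvd)
  have "(\<Sum>j\<in>{0..<int (p * c)}. cnj (X2 j) * of_real (B1 (of_int j / of_nat (p * c))) * h j) =
    (\<Sum>r\<in>{0..<int c}. \<Sum>s\<in>{0..<int p}. cnj (X2 (r + int c * s)) * of_real (B1 (of_int (r + int c * s) / of_nat (p * c))) * h (r + int c * s))"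
    using sum_residues_split[OF assms(2), of _ p] by (simp only: mult.commute[of p c])
  also have "\<dots> = (\<Sum>r\<in>{0..<int c}. cnj (X2 r) * h r * of_real (\<Sum>s\<in>{0..<int p}. B1 (of_int (r + s * int c) / of_nat (p * c))))"
    unfolding periodicD_mult[OF X] periodicD_mult[OF assms(4)] of_real_sum sum_distrib_left by (simp only: mult_ac)
  finally show ?thesis unfolding B1_distribution[OF assms(1,2)] by (simp only: mult_ac)
qed

lemma dedekind_sum_scale:
  assumes "p > 0" "c > 0" "q1 dvd c" "q2 dvd c"
  shows "dedekind_sum q1 X1 X2 (int p * a) (p * c) = dedekind_sum q1 X1 X2 a c"
proof -
  have "periodic c (\<lambda>j. inner_sum q1 X1 c (a * j))"
    using periodic_affine[OF inner_sum_periodic[OF assms(2)], of _ _ 0 a] by simp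
  from sum_B1_lift[OF assms(1,2,4) this] show ?thesis
    using assms by (simp only: dedekind_sum_inner dvd_mult nat_0_less_mult_iff mult.assoc inner_sum_scale)
qed

text \<open>For \<open>j\<close> prime to \<open>p\<close> the shifts \<open>b c j\<close> run
  through all lifts and \<open>inner_sum_distribution\<close> applies. For \<open>p | j\<close> they
  have no effect, and rescaling \<open>j\<close> by \<open>p\<close> returns to level
  \<open>c\<close>; the correction for these \<open>j\<close> yields the terms with
  \<open>X2 p\<close>.\<close>

lemma dedekind_sum_hecke:
  assumes p: "prime p" "\<not> p dvd q1" and c: "c > 0" "q1 dvd c" "q2 dvd c"
  shows "(\<Sum>b\<in>{0..<int p}. dedekind_sum q1 X1 X2 (a + b * int c) (p * c)) =
    (X1 (int p) + of_nat p * cnj (X2 (int p))) * dedekind_sum q1 X1 X2 a c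
     - X1 (int p) * cnj (X2 (int p)) * dedekind_sum q1 X1 X2 (int p * a) c"
proof -
  note D2 = dirichlet_characterD[OF dc2]
  have p0: "p > 0" using p(1) prime_gt_0_nat by blast
  have pc: "p * c > 0" "q1 dvd p * c" using p0 c by auto
  let ?w = "\<lambda>j. cnj (X2 j) * complex_of_real (B1 (of_int j / of_nat (p * c)))"
  let ?v = "\<lambda>j. cnj (X2 j) * complex_of_real (B1 (of_int j / of_nat c))"
  let ?g = "inner_sum q1 X1 c"
  let ?G = "inner_sum q1 X1 (p * c)"
  have b: "(\<Sum>b\<in>{0..<int p}. ?G ((a + b * int c) * j)) =
     (if int p dvd j then of_nat p * ?G (a * j) - X1 (int p) * ?g (a * j) else 0) + X1 (int p) * ?g (a * j)" for j
  proof (cases "int p dvd j")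
    case True
    then obtain i where i: "j = int p * i" ..
    have "?G ((a + b * int c) * j) = ?G (a * j)" for b
    proof -
      have "(a + b * int c) * j = a * j + int (p * c) * (b * i)" by (simp add: i algebra_simps)
      then show ?thesis by (simp only: periodicD_mult[OF inner_sum_periodic[OF pc(1)]])
    qed
    then show ?thesis using True by simp
  next
    case False
    have per: "periodic p (\<lambda>b. ?G (a * j + b * int c))"
      unfolding periodic_def
    proof
      fix b
      have "a * j + (b + int p) * int c = (a * j + b * int c) + int (p * c) * 1" by (simp add: algebra_simps)
      then show "?G (a * j + (b + int p) * int c) = ?G (a * j + b * int c)"
        by (simp only: periodicD_mult[OF inner_sum_periodic[OF pc(1)]])
    qed
    have "(\<Sum>b\<in>{0..<int p}. ?G ((a + b * int c) * j)) = (\<Sum>b\<in>{0..<int p}. ?G (a * j + (j * b) * int c))"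
      by (intro sum.cong refl) (simp add: algebra_simps)
    also have "\<dots> = (\<Sum>b\<in>{0..<int p}. ?G (a * j + b * int c))"
      by (rule sum_residues_mult[OF per prime_coprime_int[OF p(1) False]])
    also have "\<dots> = X1 (int p) * ?g (a * j)" by (rule inner_sum_distribution[OF p c(2,1)])
    finally show ?thesis using False by simp
  qed
  have "(\<Sum>b\<in>{0..<int p}. dedekind_sum q1 X1 X2 (a + b * int c) (p * c)) =
    (\<Sum>j\<in>{0..<int (p * c)}. ?w j * (\<Sum>b\<in>{0..<int p}. ?G ((a + b * int c) * j)))"
    unfolding dedekind_sum_inner[OF pc(2,1)] sum_distrib_left by (rule sum.swap)
  also have "\<dots> = (\<Sum>j\<in>{0..<int (p * c)}. if int p dvd j then ?w j * (of_nat p * ?G (a * j) - X1 (int p) * ?g (a * j)) else 0)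
      + X1 (int p) * (\<Sum>j\<in>{0..<int (p * c)}. ?w j * ?g (a * j))"
    unfolding b sum_distrib_left sum.distrib[symmetric] by (intro sum.cong refl) (simp add: algebra_simps)
  also have "(\<Sum>j\<in>{0..<int (p * c)}. ?w j * ?g (a * j)) = dedekind_sum q1 X1 X2 a c"
  proof -
    have "periodic c (\<lambda>j. ?g (a * j))" using periodic_affine[OF inner_sum_periodic[OF c(1)], of _ _ 0 a] by simp
    from sum_B1_lift[OF p0 c(1,3) this] show ?thesis by (simp only: dedekind_sum_inner[OF c(2,1)])
  qed
  also have "(\<Sum>j\<in>{0..<int (p * c)}. if int p dvd j then ?w j * (of_nat p * ?G (a * j) - X1 (int p) * ?g (a * j)) else 0)
    = (\<Sum>j\<in>{0..<int c}. cnj (X2 (int p)) * ?v j * (of_nat p * ?g (a * j) - X1 (int p) * ?g (int p * a * j)))"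
    unfolding sum_residues_dvd[OF p0]
  proof (rule sum.cong[OF refl])
    fix j
    have "?G (a * (int p * j)) = ?g (a * j)" using inner_sum_scale[OF p0 c(2), of X1 "a * j"] by (simp only: mult_ac)
    moreover have "?w (int p * j) = cnj (X2 (int p)) * ?v j" by (simp only: B1_scale[OF p0] D2(2) complex_cnj_mult mult.assoc)
    moreover have "a * (int p * j) = int p * a * j" by simp
    ultimately show "?w (int p * j) * (of_nat p * ?G (a * (int p * j)) - X1 (int p) * ?g (a * (int p * j))) =
      cnj (X2 (int p)) * ?v j * (of_nat p * ?g (a * j) - X1 (int p) * ?g (int p * a * j))" by (simp only:)
  qed
  also have "\<dots> = of_nat p * cnj (X2 (int p)) * dedekind_sum q1 X1 X2 a c
      - X1 (int p) * cnj (X2 (int p)) * dedekind_sum q1 X1 X2 (int p * a) c"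
    unfolding dedekind_sum_inner[OF c(2,1)] sum_distrib_left sum_subtractf[symmetric]
    by (intro sum.cong refl) (simp add: algebra_simps)
  finally show ?thesis by (simp add: algebra_simps)
qed

end

text \<open>Expand \<open>|p z - w|^2\<close> and apply
  \<open>2 Re(z conj w) <= |z|^2 + |w|^2\<close> to \<open>p - 1\<close> of the \<open>p\<close>
  cross terms. Equality of the total norms combines the rest into
  \<open>(p - 1)^2 |z|^2\<close>.\<close>

lemma norm_linear_comb_ge:
  fixes z w :: "'a \<Rightarrow> complex"
  assumes "(\<Sum>a\<in>A. (cmod (w a))\<^sup>2) = (\<Sum>a\<in>A. (cmod (z a))\<^sup>2)" "p \<ge> 1"
  shows "(\<Sum>a\<in>A. (cmod (of_real p * z a - w a))\<^sup>2) \<ge> (\<Sum>a\<in>A. (cmod (z a - w a))\<^sup>2) + (p - 1)\<^sup>2 * (\<Sum>a\<in>A. (cmod (z a))\<^sup>2)"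
proof -
  have e: "(cmod (of_real t * z a - w a))\<^sup>2 = t\<^sup>2 * (cmod (z a))\<^sup>2 - 2 * t * Re (z a * cnj (w a)) + (cmod (w a))\<^sup>2" for t a
    unfolding cmod_power2 by (simp add: power2_eq_square algebra_simps)
  have r: "2 * Re (z a * cnj (w a)) \<le> (cmod (z a))\<^sup>2 + (cmod (w a))\<^sup>2" for a
    using e[of 1 a] zero_le_power2[of "cmod (of_real 1 * z a - w a)"] by simp
  have "(cmod (z a - w a))\<^sup>2 + (p\<^sup>2 - p) * (cmod (z a))\<^sup>2 - (p - 1) * (cmod (w a))\<^sup>2 \<le> (cmod (of_real p * z a - w a))\<^sup>2" for a
  proof -
    have "(p - 1) * (2 * Re (z a * cnj (w a))) \<le> (p - 1) * ((cmod (z a))\<^sup>2 + (cmod (w a))\<^sup>2)"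
      using assms(2) r[of a] by (intro mult_left_mono) auto
    then show ?thesis using e[of p a] e[of 1 a] by (simp add: algebra_simps power2_eq_square)
  qed
  then have "(\<Sum>a\<in>A. (cmod (z a - w a))\<^sup>2 + (p\<^sup>2 - p) * (cmod (z a))\<^sup>2 - (p - 1) * (cmod (w a))\<^sup>2) \<le> (\<Sum>a\<in>A. (cmod (of_real p * z a - w a))\<^sup>2)"
    by (rule sum_mono)
  moreover have "(\<Sum>a\<in>A. (cmod (z a - w a))\<^sup>2 + (p\<^sup>2 - p) * (cmod (z a))\<^sup>2 - (p - 1) * (cmod (w a))\<^sup>2) =
     (\<Sum>a\<in>A. (cmod (z a - w a))\<^sup>2) + (p - 1)\<^sup>2 * (\<Sum>a\<in>A. (cmod (z a))\<^sup>2)"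
    unfolding sum.distrib sum_subtractf sum_distrib_left[symmetric] assms(1)
    by (simp add: algebra_simps power2_eq_square)
  ultimately show ?thesis by simp
qed

lemma coprime_add_multiple: "coprime (a + b * n) n \<longleftrightarrow> coprime a (n :: int)"
  unfolding coprime_iff_gcd_eq_1 by (metis gcd.commute gcd_add_mult add.commute)

lemma sum_units_mult:
  fixes h :: "int \<Rightarrow> real"
  assumes h: "periodic c h" and u: "coprime u (int c)" and c: "c > 0"
  shows "(\<Sum>a\<in>{a\<in>{0..<int c}. coprime a (int c)}. h (u * a)) = (\<Sum>a\<in>{a\<in>{0..<int c}. coprime a (int c)}. h a)"
proof -
  define k where "k a = (if coprime a (int c) then h a else 0)" for a
  have k: "periodic c k" using h coprime_add_multiple[of _ 1 "int c"] by (simp add: periodic_def k_def)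
  have "(\<Sum>a\<in>{a\<in>{0..<int c}. coprime a (int c)}. h (u * a)) = (\<Sum>a\<in>{0..<int c}. k (u * a))"
    unfolding sum.inter_filter[OF finite_atLeastLessThan_int] using u by (intro sum.cong refl) (simp add: k_def)
  also have "\<dots> = (\<Sum>a\<in>{0..<int c}. k a)" by (rule sum_residues_mult[OF k u])
  finally show ?thesis unfolding sum.inter_filter[OF finite_atLeastLessThan_int] k_def .
qed

text \<open>\<open>F\<close> below is the isometry \<open>F f a = f (p a)\<close>; the claim is that \<open>(p - sF)f\<close> and \<open>(ptF - 1)(p - sF)f\<close> are too large.\<close>

lemma frobenius_isometry_injective:
  fixes f :: "int \<Rightarrow> complex" and s t :: complex
  assumes f: "periodic c f" and c: "c > 0" and p: "prime p" "coprime (int p) (int c)" and st: "cmod s = 1" "cmod t = 1"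
    and eq: "\<And>a. coprime a (int c) \<Longrightarrow>
      t * (of_nat p * t) ^ e * (of_nat p * t * (of_nat p * f (int p * a) - s * f (int p * (int p * a))) - (of_nat p * f a - s * f (int p * a)))
       = s ^ Suc e * (s * (f (int p * a) - t * f (int p * (int p * a))) - (f a - t * f (int p * a)))"
  shows "coprime a (int c) \<Longrightarrow> f a = 0"
proof -
  let ?U = "{a\<in>{0..<int c}. coprime a (int c)}"
  let ?N = "\<lambda>h. \<Sum>a\<in>?U. (cmod (h a))\<^sup>2"
  let ?F = "\<lambda>h a. h (int p * a)"
  have p2: "real p \<ge> 2" using prime_ge_2_nat[OF p(1)] by simp
  have fin: "finite ?U" by (rule finite_subset[of _ "{0..<int c}"]) auto
  have Fp: "periodic c (?F h)" if "periodic c h" for h :: "int \<Rightarrow> complex"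
    using periodic_affine[OF that, of 0 "int p"] by simp
  have iso: "?N (\<lambda>a. u * ?F h a) = ?N h" if "periodic c h" "cmod u = 1" for u h
  proof -
    have "periodic c (\<lambda>a. (cmod (h a))\<^sup>2)" using that(1) by (simp add: periodic_def)
    from sum_units_mult[OF this p(2) c] show ?thesis using that(2) by (simp add: norm_mult)
  qed
  have ge: "?N (\<lambda>a. of_nat p * h a - u * ?F h a) \<ge> ?N (\<lambda>a. h a - u * ?F h a) + (real p - 1)\<^sup>2 * ?N h"
    if "periodic c h" "cmod u = 1" for u h
    using norm_linear_comb_ge[of "\<lambda>a. u * ?F h a" ?U h "real p"] iso[OF that] p2 by simp
  have ge': "?N (\<lambda>a. of_nat p * u * ?F h a - h a) \<ge> ?N (\<lambda>a. u * ?F h a - h a) + (real p - 1)\<^sup>2 * ?N h"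
    if "periodic c h" "cmod u = 1" for u h
    using norm_linear_comb_ge[of h ?U "\<lambda>a. u * ?F h a" "real p"] iso[OF that] p2 by (simp add: mult.assoc)
  define h where "h a = of_nat p * f a - s * ?F f a" for a
  define g where "g a = t * ?F f a - f a" for a
  have hp: "periodic c h" and gp: "periodic c g"
    using f Fp[OF f] by (simp_all add: periodic_def h_def g_def)
  have E: "t * (of_nat p * t) ^ e * (of_nat p * t * ?F h a - h a) = - (s ^ Suc e) * (s * ?F g a - g a)" if "a \<in> ?U" for a
  proof -
    have "coprime a (int c)" using that by simp
    from eq[OF this] show ?thesis by (simp add: h_def g_def algebra_simps)
  qed
  \<comment> \<open>Norms in \<open>E\<close>, where \<open>s\<close> and \<open>t\<close> have
    absolute value 1, bound \<open>p t F h - h\<close> by \<open>s F g - g\<close>. The estimates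
    \<open>ge'\<close> and \<open>ge\<close> give the reverse inequality with the surplus
    \<open>(p - 1)^2\<close> times the norm of \<open>h\<close>, so \<open>h = 0\<close>, and once
    more \<open>f = 0\<close>.\<close>
  have "(real p ^ e)\<^sup>2 * ?N (\<lambda>a. of_nat p * t * ?F h a - h a) = ?N (\<lambda>a. s * ?F g a - g a)"
  proof -
    have "cmod (t * (of_nat p * t) ^ e) = real p ^ e" by (simp add: norm_mult norm_power st)
    moreover have "cmod (- (s ^ Suc e)) = 1" by (simp add: norm_mult norm_power st)
    ultimately have "real p ^ e * cmod (of_nat p * t * ?F h a - h a) = cmod (s * ?F g a - g a)" if "a \<in> ?U" for a
      using E[OF that] by (metis norm_mult mult_1)
    then have "(real p ^ e)\<^sup>2 * (cmod (of_nat p * t * ?F h a - h a))\<^sup>2 = (cmod (s * ?F g a - g a))\<^sup>2" if "a \<in> ?U" for a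
      using that by (metis power_mult_distrib)
    then show ?thesis unfolding sum_distrib_left by (intro sum.cong refl) blast
  qed
  moreover have "?N (\<lambda>a. of_nat p * t * ?F h a - h a) \<le> (real p ^ e)\<^sup>2 * ?N (\<lambda>a. of_nat p * t * ?F h a - h a)"
  proof -
    have "(real p ^ e)\<^sup>2 \<ge> 1" using p2 by (simp add: one_le_power)
    moreover have "?N (\<lambda>a. of_nat p * t * ?F h a - h a) \<ge> 0" by (intro sum_nonneg) simp
    ultimately show ?thesis using mult_right_mono[of 1 "(real p ^ e)\<^sup>2"] by fastforce
  qed
  moreover have "?N (\<lambda>a. of_nat p * t * ?F h a - h a) \<ge> ?N (\<lambda>a. t * ?F h a - h a) + (real p - 1)\<^sup>2 * ?N h"
    by (rule ge'[OF hp st(2)])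
  \<comment> \<open>The two operators commute: both sides are
    \<open>(t F - 1)(p - s F) f\<close>.\<close>
  moreover have "?N (\<lambda>a. t * ?F h a - h a) = ?N (\<lambda>a. of_nat p * g a - s * ?F g a)"
    by (intro sum.cong refl) (simp add: h_def g_def algebra_simps)
  moreover have "?N (\<lambda>a. of_nat p * g a - s * ?F g a) \<ge> ?N (\<lambda>a. g a - s * ?F g a) + (real p - 1)\<^sup>2 * ?N g"
    by (rule ge[OF gp st(1)])
  moreover have "(real p - 1)\<^sup>2 * ?N g \<ge> 0" by (intro mult_nonneg_nonneg sum_nonneg) auto
  moreover have "?N (\<lambda>a. g a - s * ?F g a) = ?N (\<lambda>a. s * ?F g a - g a)" by (simp only: norm_minus_commute)
  ultimately have "(real p - 1)\<^sup>2 * ?N h \<le> 0" by linarith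
  moreover have "(real p - 1)\<^sup>2 \<ge> 1"
    using power_mono[of 1 "real p - 1" 2] p2 by simp
  moreover have Nh: "?N h \<ge> 0" by (intro sum_nonneg) simp
  ultimately have "?N h \<le> 0" using mult_right_mono[of 1 "(real p - 1)\<^sup>2" "?N h"] by linarith
  moreover have "?N h \<ge> ?N (\<lambda>a. f a - s * ?F f a) + (real p - 1)\<^sup>2 * ?N f"
    unfolding h_def by (rule ge[OF f st(1)])
  moreover have "?N (\<lambda>a. f a - s * ?F f a) \<ge> 0" by (intro sum_nonneg) simp
  moreover have Nf: "?N f \<ge> 0" by (intro sum_nonneg) simp
  moreover have "(real p - 1)\<^sup>2 * ?N f \<ge> ?N f" using mult_right_mono[OF \<open>(real p - 1)\<^sup>2 \<ge> 1\<close> Nf] by simp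
  ultimately have "?N f = 0" by linarith
  then have z: "f a = 0" if "a \<in> ?U" for a using that fin by (simp add: sum_nonneg_eq_0_iff)
  assume a: "coprime a (int c)"
  have "a mod int c \<in> ?U" using a c by (simp add: coprime_iff_gcd_eq_1)
  then show "f a = 0" using z periodic_mod[OF f] by metis
qed

section \<open>Propagation of nonvanishing to multiples of the level\<close>

context
  fixes q1 q2 :: nat and X1 X2 :: "int \<Rightarrow> complex"
  assumes dc1: "dirichlet_character q1 X1" and dc2: "dirichlet_character q2 X2"
begin

abbreviation (input) "S \<equiv> dedekind_sum q1 X1 X2"

lemma dedekind_sum_periodic:
  assumes "c > 0" "q1 dvd c" shows "periodic c (\<lambda>a. S a c)"
  unfolding dedekind_sum_inner[OF assms(2,1)] periodic_def
proof
  fix a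
  have "inner_sum q1 X1 c ((a + int c) * j) = inner_sum q1 X1 c (a * j)" for j
    using periodicD_mult[OF inner_sum_periodic[OF assms(1)], of q1 X1 "a * j" j] by (simp add: algebra_simps)
  then show "(\<Sum>j\<in>{0..<int c}. cnj (X2 j) * of_real (B1 (of_int j / of_nat c)) * inner_sum q1 X1 c ((a + int c) * j)) =
    (\<Sum>j\<in>{0..<int c}. cnj (X2 j) * of_real (B1 (of_int j / of_nat c)) * inner_sum q1 X1 c (a * j))" by simp
qed

definition nonvanishing :: "nat \<Rightarrow> bool" where
  "nonvanishing c \<longleftrightarrow> (\<exists>a. coprime a (int c) \<and> S a c \<noteq> 0)"

text \<open>Here \<open>X2 p = 0\<close>, so the Hecke relation is multiplication by the nonzero
  value \<open>X1 p\<close>; and all lifts \<open>a + b c\<close> are units, because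
  \<open>p\<close> already divides \<open>c\<close>.\<close>

lemma nonvanishing_ramified:
  assumes p: "prime p" "\<not> p dvd q1" "p dvd q2" and c: "c > 0" "q1 dvd c" "q2 dvd c" and n: "nonvanishing c"
  shows "nonvanishing (p * c)"
proof (rule ccontr)
  assume v: "\<not> nonvanishing (p * c)"
  obtain a where a: "coprime a (int c)" "S a c \<noteq> 0" using n by (auto simp: nonvanishing_def)
  have "p dvd c" using p(3) c(3) dvd_trans by blast
  then obtain d where d: "c = p * d" by (elim dvdE)
  have cop: "coprime (a + b * int c) (int (p * c))" for b
  proof -
    have "coprime (a + b * int c) (int c)"
      using a(1) by (simp only: coprime_add_multiple)
    moreover have "coprime (a + b * int c) (int p)" using calculation by (simp add: d)
    ultimately show ?thesis by simp
  qed
  have "X2 (int p) = 0"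
  proof -
    have "\<not> coprime (int p) (int q2)" using p(1,3) by (metis coprime_common_divisor dvd_refl int_dvd_int_iff not_prime_unit prime_nat_int_transfer)
    then show ?thesis using dirichlet_characterD(4)[OF dc2] by blast
  qed
  then have "(\<Sum>b\<in>{0..<int p}. S (a + b * int c) (p * c)) = X1 (int p) * S a c"
    using dedekind_sum_hecke[OF dc1 dc2 p(1,2) c, of a] by simp
  moreover have "(\<Sum>b\<in>{0..<int p}. S (a + b * int c) (p * c)) = 0"
    using v cop by (intro sum.neutral) (auto simp: nonvanishing_def)
  moreover have "X1 (int p) \<noteq> 0" using dirichlet_characterD(4)[OF dc1] p(1,2) prime_imp_coprime by simp
  ultimately show False using a(2) by simp
qed

text \<open>The sums \<open>H k a\<close> over all lifts of \<open>a\<close> satisfy a linear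
  recursion with characteristic roots \<open>s\<close> and \<open>p t\<close>, hence the closed form
  \<open>Hk\<close>. If everything vanished at level \<open>p^(e+1) c\<close>, only the non-unit
  lifts of \<open>p a\<close> would remain in \<open>H (e+1) (p a)\<close>, and these sum to
  \<open>H e a\<close>; this equation is excluded by
  \<open>frobenius_isometry_injective\<close>.\<close>

lemma nonvanishing_unramified:
  assumes p: "prime p" "\<not> p dvd q1" "\<not> p dvd q2" "\<not> p dvd c" and c: "c > 0" "q1 dvd c" "q2 dvd c" and n: "nonvanishing c"
  shows "nonvanishing (p ^ Suc e * c)"
proof (rule ccontr)
  assume v: "\<not> nonvanishing (p ^ Suc e * c)"
  have p0: "p > 0" using p(1) prime_gt_0_nat by blast
  have cpc: "coprime (int p) (int c)" using p(1,4) prime_imp_coprime by simp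
  define s where "s = X1 (int p)"
  define t where "t = cnj (X2 (int p))"
  have st: "cmod s = 1" "cmod t = 1"
    using dirichlet_character_norm[OF dc1, of "int p"] dirichlet_character_norm[OF dc2, of "int p"] p(1-3)
    by (simp_all add: s_def t_def prime_imp_coprime)
  define f where "f a = S a c" for a
  have f: "periodic c f" unfolding f_def by (rule dedekind_sum_periodic[OF c(1,2)])
  define H where "H k a = (\<Sum>b\<in>{0..<int (p ^ k)}. S (a + b * int c) (p ^ k * c))" for k a
  have ck: "p ^ k * c > 0" "q1 dvd p ^ k * c" "q2 dvd p ^ k * c" for k using p0 c by auto
  have Hs: "H (Suc k) a = (s + of_nat p * t) * H k a - s * t * (\<Sum>b\<in>{0..<int (p ^ k)}. S (int p * (a + b * int c)) (p ^ k * c))" for k a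
  proof -
    have e1: "p ^ Suc k = p ^ k * p" and e2: "p ^ Suc k * c = p * (p ^ k * c)" by simp_all
    have "H (Suc k) a = (\<Sum>b\<in>{0..<int (p ^ k * p)}. S (a + b * int c) (p * (p ^ k * c)))"
      unfolding H_def e2 unfolding e1 ..
    also have "\<dots> = (\<Sum>r\<in>{0..<int (p ^ k)}. \<Sum>b\<in>{0..<int p}. S (a + (r + int (p ^ k) * b) * int c) (p * (p ^ k * c)))"
      by (rule sum_residues_split) (use p0 in simp)
    also have "\<dots> = (\<Sum>r\<in>{0..<int (p ^ k)}. \<Sum>b\<in>{0..<int p}. S ((a + r * int c) + b * int (p ^ k * c)) (p * (p ^ k * c)))"
      by (simp add: algebra_simps)
    finally show ?thesis
      unfolding dedekind_sum_hecke[OF dc1 dc2 p(1,2) ck] H_def s_def t_def sum_subtractf sum_distrib_left by simp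
  qed
  have one: "{0..<1::int} = {0}" by auto
  have H0: "H 0 a = f a" for a by (simp add: H_def f_def one)
  have H1: "H (Suc 0) a = (s + of_nat p * t) * f a - s * t * f (int p * a)" for a
    using Hs[of 0 a] by (simp add: H0 f_def one)
  have H2: "H (Suc (Suc k)) a = (s + of_nat p * t) * H (Suc k) a - s * t * of_nat p * H k a" for k a
  proof -
    have "(\<Sum>b\<in>{0..<int (p ^ Suc k)}. S (int p * (a + b * int c)) (p ^ Suc k * c)) = (\<Sum>b\<in>{0..<int (p ^ k * p)}. S (a + b * int c) (p ^ k * c))"
      using dedekind_sum_scale[OF dc1 dc2 p0 ck] by (simp only: power_Suc mult.assoc) (simp only: mult.commute[of "p ^ k" p])
    also have "\<dots> = of_nat p * H k a"
      unfolding H_def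
    proof (rule sum_residues_period)
      show "periodic (p ^ k) (\<lambda>b. S (a + b * int c) (p ^ k * c))"
        unfolding periodic_def
      proof
        fix b
        have "a + (b + int (p ^ k)) * int c = (a + b * int c) + int (p ^ k * c) * 1" by (simp add: algebra_simps)
        then show "S (a + (b + int (p ^ k)) * int c) (p ^ k * c) = S (a + b * int c) (p ^ k * c)"
          using periodicD_mult[OF dedekind_sum_periodic[OF ck(1,2)[of k]]] by (simp only:)
      qed
    qed (use p0 in simp)
    finally show ?thesis using Hs[of "Suc k" a] by simp
  qed
  have Hk: "(of_nat p * t - s) * H k a = t * (of_nat p * t) ^ k * (of_nat p * f a - s * f (int p * a)) - s ^ Suc k * (f a - t * f (int p * a))
     \<and> (of_nat p * t - s) * H (Suc k) a = t * (of_nat p * t) ^ Suc k * (of_nat p * f a - s * f (int p * a)) - s ^ Suc (Suc k) * (f a - t * f (int p * a))" for k a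
  proof (induction k)
    case 0
    show ?case unfolding H0 H1 by (simp add: algebra_simps)
  next
    case (Suc k)
    have "(of_nat p * t - s) * H (Suc (Suc k)) a = (s + of_nat p * t) * ((of_nat p * t - s) * H (Suc k) a) - s * t * of_nat p * ((of_nat p * t - s) * H k a)"
      unfolding H2 by (simp add: algebra_simps)
    also have "\<dots> = t * (of_nat p * t) ^ Suc (Suc k) * (of_nat p * f a - s * f (int p * a)) - s ^ Suc (Suc (Suc k)) * (f a - t * f (int p * a))"
      unfolding conjunct1[OF Suc] conjunct2[OF Suc] by (simp add: algebra_simps)
    finally show ?case using Suc by blast
  qed
  have HH: "H (Suc e) (int p * a) = H e a" if a: "coprime a (int c)" for a
  proof -
    have "coprime (int c) (int p)" using cpc by (simp add: coprime_commute)
    have "H (Suc e) (int p * a) = (\<Sum>b\<in>{0..<int (p * p ^ e)}. if int p dvd b then S (int p * a + b * int c) (p ^ Suc e * c) else 0)"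
      unfolding H_def power_Suc
    proof (rule sum.cong[OF refl])
      fix b
      have "S (int p * a + b * int c) (p * p ^ e * c) = 0" if "\<not> int p dvd b"
      proof -
        have "coprime (int p * a + b * int c) (int c)"
        proof -
          have "coprime (int p * a) (int c)" using a cpc by simp
          then show ?thesis by (simp only: coprime_add_multiple)
        qed
        moreover have "\<not> int p dvd int p * a + b * int c"
        proof
          assume "int p dvd int p * a + b * int c"
          then have "int p dvd b * int c" by (simp add: dvd_add_right_iff)
          then show False using that cpc by (simp add: coprime_dvd_mult_left_iff)
        qed
        then have "coprime (int p * a + b * int c) (int p)" by (rule prime_coprime_int[OF p(1)])
        then have "coprime (int p * a + b * int c) (int p ^ Suc e)" by simp
        ultimately have "coprime (int p * a + b * int c) (int (p ^ Suc e * c))" by simp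
        then show ?thesis using v by (simp add: nonvanishing_def)
      qed
      then show "S (int p * a + b * int c) (p * p ^ e * c) = (if int p dvd b then S (int p * a + b * int c) (p * p ^ e * c) else 0)" by auto
    qed
    also have "\<dots> = (\<Sum>b\<in>{0..<int (p ^ e)}. S (int p * a + int p * b * int c) (p ^ Suc e * c))"
      by (rule sum_residues_dvd[OF p0])
    also have "\<dots> = H e a"
    proof -
      have "S (int p * a + int p * b * int c) (p ^ Suc e * c) = S (a + b * int c) (p ^ e * c)" for b
        using dedekind_sum_scale[OF dc1 dc2 p0 ck[of e], of "a + b * int c"] by (simp add: distrib_left mult.assoc)
      then show ?thesis by (simp only: H_def)
    qed
    finally show ?thesis .
  qed
  have "f a = 0" if "coprime a (int c)" for a
  proof (rule frobenius_isometry_injective[OF f c(1) p(1) cpc st _ that])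
    fix a assume a: "coprime a (int c)"
    have "(of_nat p * t - s) * H (Suc e) (int p * a) = (of_nat p * t - s) * H e a" by (simp only: HH[OF a])
    then show "t * (of_nat p * t) ^ e * (of_nat p * t * (of_nat p * f (int p * a) - s * f (int p * (int p * a))) - (of_nat p * f a - s * f (int p * a)))
       = s ^ Suc e * (s * (f (int p * a) - t * f (int p * (int p * a))) - (f a - t * f (int p * a)))"
      unfolding conjunct1[OF Hk[of e]] conjunct2[OF Hk[of e]] by (simp add: algebra_simps)
  qed
  then show False using n by (auto simp: nonvanishing_def f_def)
qed

text \<open>Induction on the level. A prime of \<open>D\<close> not dividing \<open>q1\<close> is
  removed, one factor at a time if it divides \<open>q2\<close> and with its full power in
  \<open>c\<close> otherwise, until \<open>R_nonzero_base\<close> applies.\<close>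

theorem nonvanishing_all:
  assumes prim: "primitive_character q1 X1" "nontrivial_character q1 X1" "primitive_character q2 X2" "nontrivial_character q2 X2"
    and parity: "X1 (- 1) * X2 (- 1) = 1"
  shows "q1 * q2 dvd c \<Longrightarrow> c > 0 \<Longrightarrow> nonvanishing c"
proof (induction c rule: less_induct)
  case (less c)
  have q20: "q2 > 0" "q1 > 0" using dirichlet_characterD(1) dc1 dc2 by auto
  define D where "D = c div q2"
  have cD: "c = D * q2" using less.prems(1) by (simp add: D_def dvd_mult_right)
  have qD: "q1 dvd D" using less.prems(1) q20 by (simp add: cD)
  have D0: "D > 0" using less.prems(2) cD by (cases D) auto
  interpret dedekind_data q1 q2 D c X1 X2
    by unfold_locales (use prim parity cD D0 qD in auto)
  show ?case
  proof (cases "\<forall>p. prime p \<longrightarrow> p dvd D \<longrightarrow> p dvd q1")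
    case True
    then obtain a where "coprime a (int c)" "R a \<noteq> 0" using R_nonzero_base by blast
    moreover have "(real D)\<^sup>2 * real q1 * real q2 / 16 > 0" using D0 q20 by simp
    ultimately show ?thesis using norm_dedekind_sum[of a] unfolding nonvanishing_def
      by (intro exI[of _ a]) auto
  next
    case False
    then obtain p where p: "prime p" "p dvd D" "\<not> p dvd q1" by blast
    have p1: "p > 1" using p(1) prime_gt_1_nat by blast
    show ?thesis
    proof (cases "p dvd q2")
      case True
      obtain D' where D': "D = p * D'" using p(2) by (elim dvdE)
      have "coprime q1 p" using p(1,3) prime_imp_coprime coprime_commute by blast
      then have "q1 dvd D'" using qD by (simp add: D' coprime_dvd_mult_right_iff)
      then have d: "q1 * q2 dvd D' * q2" by simp
      have c': "c = p * (D' * q2)" by (simp add: cD D')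
      have pos: "D' * q2 > 0" using less.prems(2) c' by (cases "D' * q2") auto
      have "D' * q2 < c" using p1 pos unfolding c' by simp
      then have "nonvanishing (D' * q2)" using less.IH d pos by blast
      then show ?thesis unfolding c'
        using nonvanishing_ramified[OF p(1,3) True pos] d by (metis dvd_mult_left dvd_mult_right)
    next
      case False
      obtain e d where ed: "\<not> p dvd d" "c = p ^ e * d"
        using multiplicity_decompose'[of c p] p(1) less.prems(2) by (metis not_prime_unit not_gr_zero)
      have "p dvd c" using p(2) by (simp add: cD)
      then have "e \<noteq> 0" using ed by (cases e) auto
      then obtain i where i: "e = Suc i" by (cases e) auto
      have "coprime (q1 * q2) p" using p(1,3) False prime_imp_coprime coprime_commute
        by (metis prime_dvd_mult_iff)
      then have "coprime (q1 * q2) (p ^ e)" by simp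
      then have d: "q1 * q2 dvd d" using less.prems(1) unfolding ed(2) by (simp only: coprime_dvd_mult_right_iff)
      have pos: "d > 0" using less.prems(2) ed by (cases d) auto
      have "d < p ^ e * d"
      proof -
        have "1 < p ^ e" using p1 by (intro one_less_power) (auto simp: i)
        then have "1 * d < p ^ e * d" using pos by (intro mult_strict_right_mono)
        then show ?thesis by simp
      qed
      then have "nonvanishing d" using less.IH d pos ed(2) by blast
      then show ?thesis unfolding ed(2) i
        using nonvanishing_unramified[OF p(1,3) False ed(1) pos] d by (metis dvd_mult_left dvd_mult_right)
    qed
  qed
qed

end

section \<open>The upper bound\<close>

lemma harm_le_ln: assumes "n > 0" shows "harm n \<le> 1 + ln (real n)"
proof -
  have "harm n - ln (real n) \<le> harm 1 - ln (real (1::nat))"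
    by (rule euler_mascheroni_sequence_decreasing) (use assms in auto)
  then show ?thesis by (simp add: harm_def)
qed

lemma sum_inverse_int: "(\<Sum>l\<in>{1..int n}. 1 / real_of_int l) = harm n"
  unfolding harm_def
  by (rule sum.reindex_bij_witness[where i = int and j = nat]) (auto simp: inverse_eq_divide)

text \<open>The least element contributes at most \<open>1/s\<close>; the others exceed it by
  positive multiples of \<open>M\<close> and contribute at most \<open>1/M\<close> times a harmonic
  sum.\<close>

lemma sum_inverse_class:
  assumes A: "A \<subseteq> {1..int h}" and M: "M > 0" and c: "\<And>l l'. l \<in> A \<Longrightarrow> l' \<in> A \<Longrightarrow> M dvd l - l'"
    and s: "s > 0" "\<And>l. l \<in> A \<Longrightarrow> s \<le> real_of_int l"
  shows "(\<Sum>l\<in>A. 1 / real_of_int l) \<le> 1 / s + harm h / real_of_int M"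
proof (cases "A = {}")
  case True then show ?thesis using s(1) M by (simp add: harm_nonneg)
next
  case False
  have fin: "finite A" using A finite_subset by blast
  define \<mu> where "\<mu> = Min A"
  have \<mu>: "\<mu> \<in> A" "\<And>l. l \<in> A \<Longrightarrow> \<mu> \<le> l" using False fin by (auto simp: \<mu>_def)
  have \<mu>1: "\<mu> \<ge> 1" using \<mu>(1) A by auto
  let ?k = "\<lambda>l. (l - \<mu>) div M"
  have k: "l = \<mu> + M * ?k l" if "l \<in> A" for l using c[OF that \<mu>(1)] by simp
  have "(\<Sum>l\<in>A - {\<mu>}. 1 / real_of_int l) \<le> (\<Sum>l\<in>A - {\<mu>}. 1 / real_of_int M * (1 / real_of_int (?k l)))"
  proof (rule sum_mono)
    fix l assume l: "l \<in> A - {\<mu>}"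
    then have "l > \<mu>" using \<mu>(2)[of l] by auto
    then have k0: "?k l > 0" using k[of l] l M by (metis DiffD1 add_cancel_left_right less_add_same_cancel1 zero_less_mult_pos)
    have "M * ?k l \<le> l" using k[of l] l \<mu>1 by auto
    then have "real_of_int M * real_of_int (?k l) \<le> real_of_int l" by (metis of_int_le_iff of_int_mult)
    moreover have "real_of_int M * real_of_int (?k l) > 0" using M k0 by simp
    ultimately have "1 / real_of_int l \<le> 1 / (real_of_int M * real_of_int (?k l))" by (intro divide_left_mono) (auto intro: mult_pos_pos)
    then show "1 / real_of_int l \<le> 1 / real_of_int M * (1 / real_of_int (?k l))" by simp
  qed
  also have "\<dots> = 1 / real_of_int M * (\<Sum>j\<in>?k ` (A - {\<mu>}). 1 / real_of_int j)"
  proof -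
    have "inj_on ?k (A - {\<mu>})"
    proof (rule inj_onI)
      fix l l' assume "l \<in> A - {\<mu>}" "l' \<in> A - {\<mu>}" "?k l = ?k l'"
      then show "l = l'" using k[of l] k[of l'] by simp
    qed
    then show ?thesis by (simp only: sum_distrib_left sum.reindex o_def)
  qed
  also have "\<dots> \<le> 1 / real_of_int M * (\<Sum>j\<in>{1..int h}. 1 / real_of_int j)"
  proof (intro mult_left_mono sum_mono2)
    show "?k ` (A - {\<mu>}) \<subseteq> {1..int h}"
    proof
      fix j assume "j \<in> ?k ` (A - {\<mu>})"
      then obtain l where l: "l \<in> A" "l \<noteq> \<mu>" "j = ?k l" by blast
      have "l > \<mu>" using l \<mu>(2)[of l] by auto
      moreover have "l = \<mu> + M * j" using k[OF l(1)] l(3) by simp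
      ultimately have "M * j > 0" by simp
      then have j: "j > 0" using M by (simp add: zero_less_mult_iff)
      then have "j * 1 \<le> j * M" using M by (intro mult_left_mono) auto
      then have "j \<le> l" using \<open>l = \<mu> + M * j\<close> \<mu>1 by (simp add: mult.commute)
      moreover have "l \<le> int h" using l(1) A by auto
      ultimately show "j \<in> {1..int h}" using j by auto
    qed
  qed (use M in auto)
  finally have "(\<Sum>l\<in>A - {\<mu>}. 1 / real_of_int l) \<le> harm h / real_of_int M" unfolding sum_inverse_int by simp
  moreover have "1 / real_of_int \<mu> \<le> 1 / s" using s \<mu>1 \<mu>(1) by (intro divide_left_mono) auto
  moreover have "(\<Sum>l\<in>A. 1 / real_of_int l) = 1 / real_of_int \<mu> + (\<Sum>l\<in>A - {\<mu>}. 1 / real_of_int l)"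
    by (rule sum.remove[OF fin \<mu>(1)])
  ultimately show ?thesis by linarith
qed

lemma abs_wt_le: assumes "m \<noteq> 0" "2 * \<bar>m\<bar> \<le> int c" shows "\<bar>wt c m\<bar> \<le> 1 / real_of_int \<bar>m\<bar>"
proof -
  have a: "\<bar>wt c m\<bar> = \<bar>wt c \<bar>m\<bar>\<bar>" by (simp add: abs_if wt_minus)
  have m: "\<bar>m\<bar> > 0" using assms by simp
  have "wt c \<bar>m\<bar> \<le> 1 / (pi * of_int \<bar>m\<bar>)" "0 \<le> wt c \<bar>m\<bar>" using wt_nonneg_le[OF m assms(2)] by blast+
  moreover have "1 / (pi * of_int \<bar>m\<bar>) \<le> 1 / (1 * real_of_int \<bar>m\<bar>)"
    using m pi_ge_two by (intro divide_left_mono mult_right_mono mult_pos_pos) auto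
  ultimately show ?thesis unfolding a by simp
qed

lemma abs_wt_le2: assumes "0 < m" "m < int c" shows "\<bar>wt c m\<bar> \<le> 1 / real_of_int m + 1 / real_of_int (int c - m)"
proof (cases "2 * m \<le> int c")
  case True
  have "\<bar>wt c m\<bar> \<le> 1 / real_of_int m" using abs_wt_le[of m c] True assms by simp
  moreover have "1 / real_of_int (int c - m) \<ge> 0" using assms by simp
  ultimately show ?thesis by linarith
next
  case False
  have "wt c m = wt c (m - int c)" using wt_periodic[of c] unfolding periodic_def by (metis diff_add_cancel)
  then have "\<bar>wt c m\<bar> \<le> 1 / real_of_int (int c - m)" using abs_wt_le[of "m - int c" c] False assms by simp
  moreover have "1 / real_of_int m \<ge> 0" using assms by simp
  ultimately show ?thesis by linarith
qed

lemma sum_residues_le_symmetric: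
  fixes f :: "int \<Rightarrow> real"
  assumes "periodic c f" "\<And>x. f x \<ge> 0"
  shows "(\<Sum>x\<in>{0..<int c}. f x) \<le> (\<Sum>x\<in>{- int (c div 2)..int (c div 2)}. f x)"
proof -
  define h where "h x = (if x \<le> int (c div 2) then x else x - int c)" for x
  have "f x = f (h x)" for x
    unfolding h_def using periodicD_mult[OF assms(1), of x "- 1"] by simp
  then have "(\<Sum>x\<in>{0..<int c}. f x) = (\<Sum>x\<in>{0..<int c}. f (h x))" by simp
  also have "\<dots> = (\<Sum>x\<in>h ` {0..<int c}. f x)"
  proof -
    have "inj_on h {0..<int c}" unfolding inj_on_def h_def by auto
    then show ?thesis by (simp add: sum.reindex o_def)
  qed
  also have "\<dots> \<le> (\<Sum>x\<in>{- int (c div 2)..int (c div 2)}. f x)"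
    by (rule sum_mono2) (auto simp: h_def assms(2))
  finally show ?thesis .
qed

lemma sum_abs_wt: "(\<Sum>m\<in>{0..<int c}. \<bar>wt c m\<bar>) \<le> 2 * harm c"
proof -
  have "(\<Sum>m\<in>{0..<int c}. \<bar>wt c m\<bar>) \<le> (\<Sum>m\<in>{- int (c div 2)..int (c div 2)}. \<bar>wt c m\<bar>)"
    by (rule sum_residues_le_symmetric) (use wt_periodic[of c] in \<open>auto simp: periodic_def\<close>)
  also have "{- int (c div 2)..int (c div 2)} = insert 0 ({1..int (c div 2)} \<union> uminus ` {1..int (c div 2)})"
    by (auto simp: image_iff intro!: bexI[of _ "- _"])
  also have "(\<Sum>m\<in>\<dots>. \<bar>wt c m\<bar>) = (\<Sum>m\<in>{1..int (c div 2)}. \<bar>wt c m\<bar>) + (\<Sum>m\<in>uminus ` {1..int (c div 2)}. \<bar>wt c m\<bar>)"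
    by (subst sum.insert, simp, force, subst sum.union_disjoint) (auto simp: wt_dvd)
  also have "\<dots> = 2 * (\<Sum>m\<in>{1..int (c div 2)}. \<bar>wt c m\<bar>)"
  proof -
    have "(\<Sum>m\<in>uminus ` A. \<bar>wt c m\<bar>) = (\<Sum>m\<in>A. \<bar>wt c m\<bar>)" for A
      by (subst sum.reindex) (simp_all add: inj_on_def wt_minus)
    then show ?thesis by (simp only: mult_2)
  qed
  also have "\<dots> \<le> 2 * (\<Sum>m\<in>{1..int (c div 2)}. 1 / real_of_int m)"
  proof (intro mult_left_mono sum_mono)
    fix m assume m: "m \<in> {1..int (c div 2)}"
    moreover have "2 * int (c div 2) \<le> int c" by linarith
    ultimately have "2 * \<bar>m\<bar> \<le> int c" by auto
    then show "\<bar>wt c m\<bar> \<le> 1 / real_of_int m" using abs_wt_le[of m c] m by simp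
  qed simp
  also have "\<dots> = 2 * harm (c div 2)" by (simp only: sum_inverse_int)
  also have "\<dots> \<le> 2 * harm c" by (intro mult_left_mono harm_mono) auto
  finally show ?thesis .
qed

text \<open>Total weight of those \<open>l\<close> for which \<open>kap (l + x)\<close> can be
  nonzero.\<close>

definition wt_class :: "nat \<Rightarrow> nat \<Rightarrow> int \<Rightarrow> real" where
  "wt_class c D x = (\<Sum>l\<in>{0..<int c}. if int D dvd l + x then \<bar>wt c l\<bar> else 0)"

lemma wt_class_periodic: "periodic D (wt_class c D)"
  unfolding periodic_def wt_class_def by (simp add: add.assoc[symmetric])

lemma wt_class_nonneg: "wt_class c D x \<ge> 0"
  unfolding wt_class_def by (intro sum_nonneg) auto

lemma wt_class_bound:
  assumes D: "D > 0" "D dvd c" "c > 0" and A: "0 < A" "0 < B"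
    and a: "\<And>l. 0 < l \<Longrightarrow> l < int c \<Longrightarrow> int D dvd l + x \<Longrightarrow> A \<le> real_of_int l \<and> B \<le> real_of_int (int c - l)"
  shows "wt_class c D x \<le> 1 / A + 1 / B + 2 * harm c / real D"
proof -
  let ?S = "{l\<in>{1..<int c}. int D dvd l + x}"
  let ?T = "(\<lambda>l. int c - l) ` ?S"
  have "wt_class c D x = (\<Sum>l\<in>{l\<in>{0..<int c}. int D dvd l + x}. \<bar>wt c l\<bar>)"
    unfolding wt_class_def sum.inter_filter[OF finite_atLeastLessThan_int] ..
  also have "\<dots> = (\<Sum>l\<in>?S. \<bar>wt c l\<bar>)"
  proof (rule sum.mono_neutral_right)
    show "\<forall>i\<in>{l\<in>{0..<int c}. int D dvd l + x} - ?S. \<bar>wt c i\<bar> = 0"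
    proof
      fix i assume "i \<in> {l\<in>{0..<int c}. int D dvd l + x} - ?S"
      then have "i = 0" by auto
      then show "\<bar>wt c i\<bar> = 0" by (simp add: wt_dvd)
    qed
    show "finite {l\<in>{0..<int c}. int D dvd l + x}" by (rule finite_subset[of _ "{0..<int c}"]) auto
  qed auto
  also have "\<dots> \<le> (\<Sum>l\<in>?S. 1 / real_of_int l + 1 / real_of_int (int c - l))"
    by (intro sum_mono abs_wt_le2) auto
  also have "\<dots> = (\<Sum>l\<in>?S. 1 / real_of_int l) + (\<Sum>l\<in>?T. 1 / real_of_int l)"
    by (subst sum.reindex) (auto simp: sum.distrib inj_on_def)
  also have "(\<Sum>l\<in>?S. 1 / real_of_int l) \<le> 1 / A + harm c / real_of_int (int D)"
  proof (rule sum_inverse_class)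
    fix l l' assume "l \<in> ?S" "l' \<in> ?S"
    then have "int D dvd (l + x) - (l' + x)" by (intro dvd_diff) auto
    then show "int D dvd l - l'" by simp
  qed (use D a A in auto)
  also have "(\<Sum>l\<in>?T. 1 / real_of_int l) \<le> 1 / B + harm c / real_of_int (int D)"
  proof (rule sum_inverse_class)
    fix l l' assume "l \<in> ?T" "l' \<in> ?T"
    then obtain k k' where k: "l = int c - k" "l' = int c - k'" "int D dvd k + x" "int D dvd k' + x" by blast
    then have "int D dvd (k' + x) - (k + x)" by (intro dvd_diff)
    then show "int D dvd l - l'" by (simp add: k)
  qed (use D a A in auto)
  finally show ?thesis by simp
qed

text \<open>For \<open>0 < x < D\<close> the elements of the class of \<open>-x\<close> lie at
  distance at least \<open>D - x\<close> from 0 and at least \<open>x\<close> from \<open>c\<close>.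
  These two distances determine the bound up to a logarithm; for \<open>x = 0\<close> both are at
  least \<open>D\<close>.\<close>

lemma wt_class_le:
  assumes D: "D > 0" "D dvd c" "c > 0"
  shows "wt_class c D 0 \<le> 4 * harm c / real D"
    "0 < x \<Longrightarrow> x < int D \<Longrightarrow> wt_class c D x \<le> 3 * harm c * (1 / real_of_int x + 1 / real_of_int (int D - x))"
proof -
  have h: "harm c \<ge> (1::real)"
  proof -
    have "harm 1 \<le> (harm c :: real)" using D(3) by (intro harm_mono) auto
    then show ?thesis by (simp add: harm_def)
  qed
  obtain k where k: "c = D * k" using D(2) by (elim dvdE)
  have "wt_class c D 0 \<le> 1 / real D + 1 / real D + 2 * harm c / real D"
  proof (rule wt_class_bound[OF D])
    fix l assume l: "0 < l" "l < int c" "int D dvd l + 0"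
    have "int D \<le> l" using l by (intro zdvd_imp_le) auto
    moreover have "int D \<le> int c - l" using l by (intro zdvd_imp_le) (auto simp: k)
    ultimately show "real D \<le> real_of_int l \<and> real D \<le> real_of_int (int c - l)" by linarith
  qed (use D in auto)
  also have "\<dots> = (2 + 2 * harm c) / real D" by (simp add: add_divide_distrib)
  also have "\<dots> \<le> 4 * harm c / real D" using h by (intro divide_right_mono) auto
  finally show "wt_class c D 0 \<le> 4 * harm c / real D" .
  assume x: "0 < x" "x < int D"
  let ?A = "real_of_int (int D - x)" and ?B = "real_of_int x"
  have "wt_class c D x \<le> 1 / ?A + 1 / ?B + 2 * harm c / real D"
  proof (rule wt_class_bound[OF D])
    fix l assume l: "0 < l" "l < int c" "int D dvd l + x"
    have "int D \<le> l + x" using l x by (intro zdvd_imp_le) auto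
    moreover have "int D dvd int c - l - x + int D"
    proof -
      have "int D dvd int c" by (simp add: k)
      then have "int D dvd int c - (l + x)" using l(3) by (rule dvd_diff)
      moreover have "int c - (l + x) = int c - l - x" by simp
      ultimately show ?thesis by simp
    qed
    then have "int D dvd int c - l - x" by simp
    moreover have "int c - l - x \<ge> 0"
    proof (rule ccontr)
      assume "\<not> ?thesis"
      moreover have "int c - l - x > - int D" using l(2) x(2) by linarith
      moreover have "int D dvd - (int c - l - x)" using \<open>int D dvd int c - l - x\<close> by (simp only: dvd_minus_iff)
      ultimately show False using zdvd_not_zless[of "- (int c - l - x)" "int D"] by linarith
    qed
    ultimately show "?A \<le> real_of_int l \<and> ?B \<le> real_of_int (int c - l)" by linarith
  qed (use x in auto)
  also have "2 * harm c / real D \<le> 2 * harm c * (1 / ?A)"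
  proof -
    have "2 * harm c / real D \<le> 2 * harm c / ?A" using x h by (intro divide_left_mono) auto
    then show ?thesis by simp
  qed
  also have "1 / ?A + 1 / ?B + 2 * harm c * (1 / ?A) \<le> 3 * harm c * (1 / ?A) + 3 * harm c * (1 / ?B)"
  proof -
    have "u + v + 2 * harm c * u \<le> 3 * harm c * u + 3 * harm c * v" if "u \<ge> 0" "v \<ge> 0" for u v :: real
      using mult_right_mono[OF h that(1)] mult_right_mono[OF h that(2)] that by (simp add: algebra_simps)
    from this[of "1 / ?A" "1 / ?B"] show ?thesis using x by simp
  qed
  finally show "wt_class c D x \<le> 3 * harm c * (1 / ?B + 1 / ?A)" by (simp add: algebra_simps)
qed

lemma sum_inverse_squares: "(\<Sum>y\<in>{1..int n}. 1 / (real_of_int y)\<^sup>2) \<le> 2"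
proof -
  have "(\<Sum>y\<in>{1..int n}. 1 / (real_of_int y)\<^sup>2) = (\<Sum>y\<in>{1..n}. 1 / (real y)\<^sup>2)"
    by (rule sum.reindex_bij_witness[where i = int and j = nat]) auto
  also have "\<dots> \<le> 2 - 1 / real n"
  proof (induction n)
    case (Suc n)
    show ?case
    proof (cases "n = 0")
      case False
      then have "1 / real n - 1 / real (Suc n) = 1 / (real n * real (Suc n))" by (simp add: field_simps)
      moreover have "1 / (real (Suc n))\<^sup>2 \<le> 1 / (real n * real (Suc n))"
        unfolding power2_eq_square using False by (intro divide_left_mono mult_right_mono mult_pos_pos) auto
      ultimately have "1 / (real (Suc n))\<^sup>2 \<le> 1 / real n - 1 / real (Suc n)" by simp
      then show ?thesis using Suc by simp
    qed simp
  qed simp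
  finally show ?thesis using divide_nonneg_nonneg[of 1 "real n"] by linarith
qed


lemma weighted_cauchy_schwarz:
  fixes w u :: "'a \<Rightarrow> real"
  assumes "\<And>i. i \<in> I \<Longrightarrow> w i \<ge> 0"
  shows "(\<Sum>i\<in>I. w i * u i)\<^sup>2 \<le> (\<Sum>i\<in>I. w i) * (\<Sum>i\<in>I. w i * (u i)\<^sup>2)"
proof -
  have "(\<Sum>i\<in>I. w i * u i) = (\<Sum>i\<in>I. sqrt (w i) * (sqrt (w i) * u i))"
    by (intro sum.cong refl) (simp add: assms mult.assoc[symmetric])
  then have "(\<Sum>i\<in>I. w i * u i)\<^sup>2 \<le> (\<Sum>i\<in>I. (sqrt (w i))\<^sup>2) * (\<Sum>i\<in>I. (sqrt (w i) * u i)\<^sup>2)"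
    using Cauchy_Schwarz_ineq_sum by simp
  also have "\<dots> = (\<Sum>i\<in>I. w i) * (\<Sum>i\<in>I. w i * (u i)\<^sup>2)"
    by (intro arg_cong2[where f = times] sum.cong refl) (simp_all add: assms power_mult_distrib)
  finally show ?thesis .
qed

lemma harm_ge_1: "c > 0 \<Longrightarrow> harm c \<ge> (1::real)"
proof -
  assume "c > 0"
  then have "harm 1 \<le> (harm c :: real)" by (intro harm_mono) auto
  then show ?thesis by (simp add: harm_def)
qed

text \<open>For \<open>g = gcd m D\<close>, the map \<open>a \<mapsto> a m\<close> covers each multiple of \<open>g\<close> modulo \<open>D\<close> exactly \<open>g\<close> times.\<close>

lemma sum_wt_class_squares:
  assumes D: "D > 0" "c = D * q"  "c > 0"
  shows "(\<Sum>a\<in>{0..<int c}. (wt_class c D (a * m))\<^sup>2) \<le> real q * (88 * (harm c)\<^sup>2)"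
proof -
  define L where "L = (harm c :: real)"
  have L1: "L \<ge> 1" unfolding L_def by (rule harm_ge_1[OF D(3)])
  have Dc: "D dvd c" using D by simp
  define h where "h x = (wt_class c D x)\<^sup>2" for x
  have h: "periodic D h" using wt_class_periodic[of D c] by (simp add: periodic_def h_def)
  define g where "g = nat (gcd m (int D))"
  have g0: "g > 0" using D by (simp add: g_def)
  have gi: "int g = gcd m (int D)" by (simp add: g_def)
  obtain m' where m': "m = int g * m'" unfolding gi using gcd_dvd1 by blast
  have "int g dvd int D" unfolding gi by simp
  then obtain D' where D': "D = g * D'" by (auto elim: dvdE)
  have D'0: "D' > 0" using D(1) D' by (cases D') auto
  have cop: "coprime m' (int D')"
  proof -
    have "gcd (int g * m') (int g * int D') = int g" using gi m' D' by simp
    then have "int g * gcd m' (int D') = int g" by (simp add: gcd_mult_left)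
    then show ?thesis using g0 by (simp add: coprime_iff_gcd_eq_1)
  qed
  define k where "k y = h (int g * y)" for y
  have k: "periodic D' k"
    unfolding periodic_def
  proof
    fix y
    have "int g * (y + int D') = int g * y + int D * 1" by (simp add: D' algebra_simps)
    then show "k (y + int D') = k y" unfolding k_def by (simp only: periodicD_mult[OF h])
  qed
  have am: "periodic D (\<lambda>a. h (a * m))" using periodic_affine[OF h, of 0 m] by (simp add: mult.commute)
  have "(\<Sum>a\<in>{0..<int c}. h (a * m)) = real q * (\<Sum>a\<in>{0..<int D}. h (a * m))"
    using sum_residues_period[OF D(1) am, of q] by (simp add: D(2))
  also have "(\<Sum>a\<in>{0..<int D}. h (a * m)) = (\<Sum>a\<in>{0..<int (D' * g)}. k (m' * a))"
    by (simp add: k_def m' D' mult_ac)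
  also have "\<dots> = real g * (\<Sum>a\<in>{0..<int D'}. k (m' * a))"
    by (rule sum_residues_period[OF D'0]) (use periodic_affine[OF k, of 0 m'] in simp)
  also have "(\<Sum>a\<in>{0..<int D'}. k (m' * a)) = (\<Sum>y\<in>{0..<int D'}. k y)"
    by (rule sum_residues_mult[OF k cop])
  also have "{0..<int D'} = insert 0 {1..<int D'}" using D'0 by auto
  also have "(\<Sum>y\<in>\<dots>. k y) = k 0 + (\<Sum>y\<in>{1..<int D'}. k y)" by simp
  finally have E: "(\<Sum>a\<in>{0..<int c}. h (a * m)) = real q * (real g * (k 0 + (\<Sum>y\<in>{1..<int D'}. k y)))" .
  \<comment> \<open>The square of the constant 3 and \<open>(u + v)^2 <= 2 (u^2 + v^2)\<close> give
    18; two sums of inverse squares, each at most 2, give 72. With the 16 of \<open>K0\<close> this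
    makes 88.\<close>
  have K1: "(\<Sum>y\<in>{1..<int D'}. k y) \<le> 72 * L\<^sup>2 / (real g)\<^sup>2"
  proof -
    have "k y \<le> 18 * L\<^sup>2 / (real g)\<^sup>2 * (1 / (real_of_int y)\<^sup>2 + 1 / (real_of_int (int D' - y))\<^sup>2)" if y: "y \<in> {1..<int D'}" for y
    proof -
      have x: "0 < int g * y" "int g * y < int D" using y g0 by (simp_all add: D')
      have "wt_class c D (int g * y) \<le> 3 * L * (1 / real_of_int (int g * y) + 1 / real_of_int (int D - int g * y))"
        unfolding L_def by (rule wt_class_le(2)[OF D(1) Dc D(3) x])
      also have "\<dots> = 3 * L / real g * (1 / real_of_int y + 1 / real_of_int (int D' - y))"
      proof -
        have "real_of_int (int D - int g * y) = real g * real_of_int (int D' - y)" by (simp add: D' algebra_simps)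
        moreover have "3 * L * (1 / (real g * u) + 1 / (real g * v)) = 3 * L / real g * (1 / u + 1 / v)" for u v :: real
          by (simp add: distrib_left)
        ultimately show ?thesis by (simp only: of_int_mult of_int_of_nat_eq)
      qed
      finally have "k y \<le> (3 * L / real g * (1 / real_of_int y + 1 / real_of_int (int D' - y)))\<^sup>2"
        unfolding k_def h_def by (rule power_mono) (rule wt_class_nonneg)
      also have "\<dots> = 9 * L\<^sup>2 / (real g)\<^sup>2 * (1 / real_of_int y + 1 / real_of_int (int D' - y))\<^sup>2"
        by (simp add: power_mult_distrib power_divide)
      also have "\<dots> \<le> 9 * L\<^sup>2 / (real g)\<^sup>2 * (2 * (1 / (real_of_int y)\<^sup>2 + 1 / (real_of_int (int D' - y))\<^sup>2))"
      proof (rule mult_left_mono)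
        have "(u + v)\<^sup>2 \<le> 2 * (u\<^sup>2 + v\<^sup>2)" for u v :: real
          using zero_le_power2[of "u - v"] by (simp add: power2_eq_square algebra_simps)
        from this[of "1 / real_of_int y" "1 / real_of_int (int D' - y)"]
        show "(1 / real_of_int y + 1 / real_of_int (int D' - y))\<^sup>2 \<le> 2 * (1 / (real_of_int y)\<^sup>2 + 1 / (real_of_int (int D' - y))\<^sup>2)"
          by (simp only: power_divide one_power2)
      qed simp
      also have "9 * L\<^sup>2 / (real g)\<^sup>2 * (2 * u) = 18 * L\<^sup>2 / (real g)\<^sup>2 * u" for u by simp
      finally show ?thesis .
    qed
    then have "(\<Sum>y\<in>{1..<int D'}. k y) \<le> (\<Sum>y\<in>{1..<int D'}. 18 * L\<^sup>2 / (real g)\<^sup>2 * (1 / (real_of_int y)\<^sup>2 + 1 / (real_of_int (int D' - y))\<^sup>2))"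
      by (rule sum_mono)
    also have "\<dots> = 18 * L\<^sup>2 / (real g)\<^sup>2 * ((\<Sum>y\<in>{1..<int D'}. 1 / (real_of_int y)\<^sup>2) + (\<Sum>y\<in>{1..<int D'}. 1 / (real_of_int (int D' - y))\<^sup>2))"
      by (simp only: sum.distrib[symmetric] sum_distrib_left[symmetric])
    also have "(\<Sum>y\<in>{1..<int D'}. 1 / (real_of_int (int D' - y))\<^sup>2) = (\<Sum>y\<in>{1..<int D'}. 1 / (real_of_int y)\<^sup>2)"
      by (rule sum.reindex_bij_witness[where i = "\<lambda>y. int D' - y" and j = "\<lambda>y. int D' - y"]) auto
    also have "18 * L\<^sup>2 / (real g)\<^sup>2 * ((\<Sum>y\<in>{1..<int D'}. 1 / (real_of_int y)\<^sup>2) + (\<Sum>y\<in>{1..<int D'}. 1 / (real_of_int y)\<^sup>2))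
       \<le> 18 * L\<^sup>2 / (real g)\<^sup>2 * (2 + 2)"
    proof (intro mult_left_mono add_mono)
      have "{1..<int D'} = {1..int (D' - 1)}" using D'0 by auto
      then show "(\<Sum>y\<in>{1..<int D'}. 1 / (real_of_int y)\<^sup>2) \<le> 2" "(\<Sum>y\<in>{1..<int D'}. 1 / (real_of_int y)\<^sup>2) \<le> 2"
        using sum_inverse_squares[of "D' - 1"] by (simp_all only:)
    qed simp
    finally show ?thesis by simp
  qed
  have K0: "k 0 \<le> 16 * L\<^sup>2 / (real D)\<^sup>2"
  proof -
    have "k 0 \<le> (4 * L / real D)\<^sup>2"
      unfolding k_def h_def L_def mult_zero_right by (rule power_mono[OF wt_class_le(1)[OF D(1) Dc D(3)] wt_class_nonneg])
    then show ?thesis by (simp add: power_mult_distrib power_divide)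
  qed
  have "(\<Sum>a\<in>{0..<int c}. h (a * m)) \<le> real q * (real g * (16 * L\<^sup>2 / (real D)\<^sup>2 + 72 * L\<^sup>2 / (real g)\<^sup>2))"
    unfolding E by (intro mult_left_mono add_mono K0 K1) auto
  also have "\<dots> \<le> real q * (88 * L\<^sup>2)"
  proof (rule mult_left_mono)
    have "g \<le> D" using D' D'0 by simp
    then have gD: "real g \<le> real D" by (simp only: of_nat_le_iff)
    have "real g * (16 * L\<^sup>2 / (real D)\<^sup>2) \<le> real D * (16 * L\<^sup>2 / (real D)\<^sup>2)" using gD by (intro mult_right_mono) auto
    also have "\<dots> = 16 * L\<^sup>2 / real D" using D(1) by (simp add: power2_eq_square)
    also have "\<dots> \<le> 16 * L\<^sup>2 / 1" using D(1) by (intro divide_left_mono) auto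
    finally have 1: "real g * (16 * L\<^sup>2 / (real D)\<^sup>2) \<le> 16 * L\<^sup>2" by simp
    have "real g * (72 * L\<^sup>2 / (real g)\<^sup>2) = 72 * L\<^sup>2 / real g" using g0 by (simp add: power2_eq_square)
    also have "\<dots> \<le> 72 * L\<^sup>2 / 1" using g0 by (intro divide_left_mono) auto
    finally show "real g * (16 * L\<^sup>2 / (real D)\<^sup>2 + 72 * L\<^sup>2 / (real g)\<^sup>2) \<le> 88 * L\<^sup>2" using 1 by (simp add: distrib_left)
  qed simp
  finally have "(\<Sum>a\<in>{0..<int c}. h (a * m)) \<le> real q * (88 * L\<^sup>2)" .
  then show ?thesis by (simp only: h_def L_def)
qed

context dedekind_data
begin

text \<open>Cauchy--Schwarz with the weights \<open>|wt c m|\<close> allows averaging over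
  \<open>a\<close> for each \<open>m\<close> separately; 352 is \<open>2 * 2 * 88\<close>.\<close>

theorem R_upper_bound: "(\<Sum>a\<in>{0..<int c}. (cmod (R a))\<^sup>2) \<le> 352 * real q2 * (harm c) ^ 4"
proof -
  let ?L = "harm c :: real"
  let ?W = "\<Sum>m\<in>{0..<int c}. \<bar>wt c m\<bar>"
  have W: "?W \<le> 2 * ?L" by (rule sum_abs_wt)
  have W0: "?W \<ge> 0" by (intro sum_nonneg) auto
  have R: "cmod (R a) \<le> (\<Sum>m\<in>{0..<int c}. \<bar>wt c m\<bar> * wt_class c D (a * m))" for a
  proof -
    have "cmod (R a) \<le> (\<Sum>m\<in>{0..<int c}. \<Sum>l\<in>{0..<int c}. cmod (of_real (wt c l) * of_real (wt c m) * X1 m * kap (l + a * m)))"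
      unfolding R_def by (intro order_trans[OF norm_sum] sum_mono norm_sum)
    also have "\<dots> \<le> (\<Sum>m\<in>{0..<int c}. \<Sum>l\<in>{0..<int c}. \<bar>wt c m\<bar> * (if int D dvd l + a * m then \<bar>wt c l\<bar> else 0))"
    proof (intro sum_mono)
      fix m l
      show "cmod (of_real (wt c l) * of_real (wt c m) * X1 m * kap (l + a * m)) \<le> \<bar>wt c m\<bar> * (if int D dvd l + a * m then \<bar>wt c l\<bar> else 0)"
      proof (cases "int D dvd l + a * m")
        case True
        have "cmod (X1 m) * cmod (kap (l + a * m)) \<le> 1 * 1"
          using dirichlet_character_norm_le[OF dc1] norm_kap_le by (intro mult_mono) auto
        then have "\<bar>wt c l\<bar> * \<bar>wt c m\<bar> * (cmod (X1 m) * cmod (kap (l + a * m))) \<le> \<bar>wt c l\<bar> * \<bar>wt c m\<bar> * 1"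
          by (intro mult_left_mono) auto
        then show ?thesis using True by (simp add: norm_mult mult_ac)
      qed (simp add: kap_eq_0)
    qed
    finally show ?thesis by (simp add: wt_class_def sum_distrib_left)
  qed
  have "(cmod (R a))\<^sup>2 \<le> ?W * (\<Sum>m\<in>{0..<int c}. \<bar>wt c m\<bar> * (wt_class c D (a * m))\<^sup>2)" for a
  proof -
    have "(cmod (R a))\<^sup>2 \<le> (\<Sum>m\<in>{0..<int c}. \<bar>wt c m\<bar> * wt_class c D (a * m))\<^sup>2" by (rule power_mono[OF R]) simp
    also have "\<dots> \<le> ?W * (\<Sum>m\<in>{0..<int c}. \<bar>wt c m\<bar> * (wt_class c D (a * m))\<^sup>2)" by (rule weighted_cauchy_schwarz) simp
    finally show ?thesis .
  qed
  then have "(\<Sum>a\<in>{0..<int c}. (cmod (R a))\<^sup>2) \<le> (\<Sum>a\<in>{0..<int c}. ?W * (\<Sum>m\<in>{0..<int c}. \<bar>wt c m\<bar> * (wt_class c D (a * m))\<^sup>2))"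
    by (rule sum_mono)
  also have "\<dots> = ?W * (\<Sum>m\<in>{0..<int c}. \<bar>wt c m\<bar> * (\<Sum>a\<in>{0..<int c}. (wt_class c D (a * m))\<^sup>2))"
    unfolding sum_distrib_left by (rule sum.swap)
  also have "\<dots> \<le> ?W * (\<Sum>m\<in>{0..<int c}. \<bar>wt c m\<bar> * (real q2 * (88 * ?L\<^sup>2)))"
    by (intro mult_left_mono sum_mono sum_wt_class_squares[OF D_pos c_eq c_pos] W0) auto
  also have "\<dots> = ?W * ?W * (real q2 * (88 * ?L\<^sup>2))" by (simp only: sum_distrib_right mult.assoc)
  also have "\<dots> \<le> (2 * ?L) * (2 * ?L) * (real q2 * (88 * ?L\<^sup>2))"
    using W W0 by (intro mult_right_mono mult_mono) (auto simp: harm_nonneg)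
  also have "\<dots> = 352 * real q2 * ?L ^ 4" by (simp add: power2_eq_square power4_eq_xxxx)
  finally show ?thesis .
qed

end

section \<open>The lower bound for large level\<close>

lemma sum_inverse_abs_class:
  assumes A: "A \<subseteq> {- int h..int h} - {0}" and M: "M > 0" and c: "\<And>l l'. l \<in> A \<Longrightarrow> l' \<in> A \<Longrightarrow> M dvd l - l'"
    and s: "s > 0" "\<And>l. l \<in> A \<Longrightarrow> s \<le> real_of_int \<bar>l\<bar>"
  shows "(\<Sum>l\<in>A. 1 / real_of_int \<bar>l\<bar>) \<le> 2 * (1 / s + harm h / real_of_int M)"
proof -
  have fin: "finite A" using A finite_subset by blast
  let ?P = "{l\<in>A. l > 0}" and ?N = "uminus ` {l\<in>A. l < 0}"
  have "A = {l\<in>A. l > 0} \<union> {l\<in>A. l < 0}" using A by auto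
  then have "(\<Sum>l\<in>A. 1 / real_of_int \<bar>l\<bar>) = (\<Sum>l\<in>{l\<in>A. l > 0} \<union> {l\<in>A. l < 0}. 1 / real_of_int \<bar>l\<bar>)" by simp
  also have "\<dots> = (\<Sum>l\<in>?P. 1 / real_of_int \<bar>l\<bar>) + (\<Sum>l\<in>{l\<in>A. l < 0}. 1 / real_of_int \<bar>l\<bar>)"
    by (rule sum.union_disjoint) (use fin in auto)
  also have "(\<Sum>l\<in>?P. 1 / real_of_int \<bar>l\<bar>) = (\<Sum>l\<in>?P. 1 / real_of_int l)" by (intro sum.cong) auto
  also have "(\<Sum>l\<in>{l\<in>A. l < 0}. 1 / real_of_int \<bar>l\<bar>) = (\<Sum>l\<in>?N. 1 / real_of_int l)"
    by (subst sum.reindex) (auto simp: inj_on_def intro!: sum.cong)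
  also have "(\<Sum>l\<in>?P. 1 / real_of_int l) \<le> 1 / s + harm h / real_of_int M"
    by (rule sum_inverse_class) (use A M c s in \<open>auto, (fastforce+)?\<close>)
  also have "(\<Sum>l\<in>?N. 1 / real_of_int l) \<le> 1 / s + harm h / real_of_int M"
  proof (rule sum_inverse_class)
    show "?N \<subseteq> {1..int h}" using A by fastforce
    show "M dvd l - l'" if ll: "l \<in> ?N" "l' \<in> ?N" for l l'
    proof -
      obtain k k' where "l = - k" "l' = - k'" "k \<in> A" "k' \<in> A" using ll by blast
      then show ?thesis using c[of k' k] by simp
    qed
    show "s \<le> real_of_int l" if l: "l \<in> ?N" for l
    proof -
      obtain k where "l = - k" "k \<in> A" "k < 0" using l by blast
      then show ?thesis using s(2)[of k] by simp
    qed
  qed (use M s in auto)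
  finally show ?thesis by simp
qed

lemma sum_inverse_abs: "(\<Sum>l\<in>{- int h..int h} - {0}. 1 / real_of_int \<bar>l\<bar>) = 2 * harm h"
proof -
  have "{- int h..int h} - {0} = {1..int h} \<union> uminus ` {1..int h}" by (auto simp: image_iff intro!: bexI[of _ "- _"])
  moreover have "(\<Sum>l\<in>uminus ` A. 1 / real_of_int \<bar>l\<bar>) = (\<Sum>l\<in>A. 1 / real_of_int \<bar>l\<bar>)" for A
    by (subst sum.reindex) (simp_all add: inj_on_def)
  moreover have "(\<Sum>l\<in>{1..int h}. 1 / real_of_int \<bar>l\<bar>) = harm h"
    unfolding sum_inverse_int[symmetric] by (intro sum.cong) auto
  moreover have "(\<Sum>l\<in>{1..int h} \<union> uminus ` {1..int h}. 1 / real_of_int \<bar>l\<bar>) =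
     (\<Sum>l\<in>{1..int h}. 1 / real_of_int \<bar>l\<bar>) + (\<Sum>l\<in>uminus ` {1..int h}. 1 / real_of_int \<bar>l\<bar>)"
    by (rule sum.union_disjoint) auto
  ultimately show ?thesis by (simp only: mult_2)
qed

text \<open>\<open>l \<noteq> b m\<close> with \<open>M | l - b m\<close> forces \<open>2|l| \<ge> M\<close> or \<open>4|m| \<ge> M\<close>.\<close>

lemma off_diagonal_bound:
  assumes c: "c > 0" and M: "M > 0" "M dvd c" and b: "b = 1 \<or> b = (2::int)"
  shows "(\<Sum>m\<in>{0..<int c}. \<Sum>l\<in>{0..<int c}. if int M dvd l - b * m \<and> \<not> int c dvd l - b * m then \<bar>wt c m\<bar> * \<bar>wt c l\<bar> else 0)
     \<le> 36 * (harm c)\<^sup>2 / real M"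
proof -
  define h where "h = c div 2"
  let ?I = "{- int h..int h}" and ?J = "{- int h..int h} - {0}"
  let ?H = "harm h :: real" and ?L = "harm c :: real"
  let ?f = "\<lambda>m l. if int M dvd l - b * m \<and> \<not> int c dvd l - b * m then \<bar>wt c m\<bar> * \<bar>wt c l\<bar> else 0"
  have HL: "?H \<le> ?L" unfolding h_def by (rule harm_mono) simp
  have L1: "?L \<ge> 1" by (rule harm_ge_1[OF c])
  have wp: "wt c (x + int c) = wt c x" for x using wt_periodic[of c] by (simp add: periodic_def)
  have dM: "int M dvd int c" using M(2) by simp
  have p1: "periodic c (?f m)" for m
    unfolding periodic_def
  proof
    fix x
    have "int M dvd x + int c - b * m \<longleftrightarrow> int M dvd x - b * m" "int c dvd x + int c - b * m \<longleftrightarrow> int c dvd x - b * m"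
      using dvd_add_left_iff[OF dM, of "x - b * m"] dvd_add_left_iff[OF dvd_refl, of "int c" "x - b * m"] by (simp_all add: algebra_simps)
    then show "?f m (x + int c) = ?f m x" by (simp only: wp)
  qed
  have p2: "periodic c (\<lambda>m. \<Sum>l\<in>?I. ?f m l)"
    unfolding periodic_def
  proof
    fix x
    have e: "l - b * (x + int c) = (l - b * x) - int c * b" for l by (simp add: algebra_simps)
    have dM': "int M dvd int c * b" using dM by simp
    have "int M dvd l - b * (x + int c) \<longleftrightarrow> int M dvd l - b * x" "int c dvd l - b * (x + int c) \<longleftrightarrow> int c dvd l - b * x" for l
      unfolding e using dvd_diff_left_iff[OF dM', of "l - b * x"] dvd_diff_left_iff[of "int c" "int c * b" "l - b * x"] by simp_all
    then show "(\<Sum>l\<in>?I. ?f (x + int c) l) = (\<Sum>l\<in>?I. ?f x l)" by (simp only: wp)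
  qed
  have "(\<Sum>m\<in>{0..<int c}. \<Sum>l\<in>{0..<int c}. ?f m l) \<le> (\<Sum>m\<in>{0..<int c}. \<Sum>l\<in>?I. ?f m l)"
    unfolding h_def by (intro sum_mono sum_residues_le_symmetric p1) auto
  also have "\<dots> \<le> (\<Sum>m\<in>?I. \<Sum>l\<in>?I. ?f m l)"
    unfolding h_def by (rule sum_residues_le_symmetric[OF p2[unfolded h_def]]) (intro sum_nonneg, auto)
  also have "\<dots> = (\<Sum>m\<in>?J. \<Sum>l\<in>?J. ?f m l)"
  proof -
    have z: "wt c 0 = 0" by (simp add: wt_dvd)
    have "(\<Sum>l\<in>?I. ?f m l) = (\<Sum>l\<in>?J. ?f m l)" for m
      by (rule sum.mono_neutral_right) (auto simp: z cong: if_cong)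
    moreover have "(\<Sum>m\<in>?I. \<Sum>l\<in>?J. ?f m l) = (\<Sum>m\<in>?J. \<Sum>l\<in>?J. ?f m l)"
      by (rule sum.mono_neutral_right) (auto simp: z cong: if_cong)
    ultimately show ?thesis by simp
  qed
  also have "\<dots> \<le> (\<Sum>m\<in>?J. \<Sum>l\<in>?J. (if int M dvd l - b * m \<and> int M \<le> 2 * \<bar>l\<bar> then 1 / real_of_int \<bar>m\<bar> * (1 / real_of_int \<bar>l\<bar>) else 0)
      + (if int M dvd l - b * m \<and> int M \<le> 4 * \<bar>m\<bar> then 1 / real_of_int \<bar>m\<bar> * (1 / real_of_int \<bar>l\<bar>) else 0))"
  proof (intro sum_mono)
    fix m l assume ml: "m \<in> ?J" "l \<in> ?J"
    define w where "w = 1 / real_of_int \<bar>m\<bar> * (1 / real_of_int \<bar>l\<bar>)"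
    have nn: "0 \<le> w" by (simp add: w_def)
    show "?f m l \<le> (if int M dvd l - b * m \<and> int M \<le> 2 * \<bar>l\<bar> then 1 / real_of_int \<bar>m\<bar> * (1 / real_of_int \<bar>l\<bar>) else 0)
      + (if int M dvd l - b * m \<and> int M \<le> 4 * \<bar>m\<bar> then 1 / real_of_int \<bar>m\<bar> * (1 / real_of_int \<bar>l\<bar>) else 0)"
    proof (cases "int M dvd l - b * m \<and> \<not> int c dvd l - b * m")
      case True
      have h2: "2 * int h \<le> int c" unfolding h_def by linarith
      have "\<bar>wt c m\<bar> \<le> 1 / real_of_int \<bar>m\<bar>" "\<bar>wt c l\<bar> \<le> 1 / real_of_int \<bar>l\<bar>"
        using abs_wt_le[of m c] abs_wt_le[of l c] ml h2 by auto
      then have 1: "\<bar>wt c m\<bar> * \<bar>wt c l\<bar> \<le> w" unfolding w_def by (intro mult_mono) auto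
      have "l - b * m \<noteq> 0" using True by auto
      then have "int M \<le> \<bar>l - b * m\<bar>" using True zdvd_imp_le[of "int M" "\<bar>l - b * m\<bar>"] by simp
      then have "int M \<le> 2 * \<bar>l\<bar> \<or> int M \<le> 4 * \<bar>m\<bar>" using b by auto
      then show ?thesis unfolding w_def[symmetric] using True 1 nn by auto
    qed auto
  qed
  also have "\<dots> = (\<Sum>m\<in>?J. 1 / real_of_int \<bar>m\<bar> * (\<Sum>l\<in>{l\<in>?J. int M dvd l - b * m \<and> int M \<le> 2 * \<bar>l\<bar>}. 1 / real_of_int \<bar>l\<bar>))
     + (\<Sum>l\<in>?J. 1 / real_of_int \<bar>l\<bar> * (\<Sum>m\<in>{m\<in>?J. int M dvd l - b * m \<and> int M \<le> 4 * \<bar>m\<bar>}. 1 / real_of_int \<bar>m\<bar>))"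
  proof -
    have f: "finite ?J" by simp
    have 1: "(\<Sum>m\<in>?J. \<Sum>l\<in>?J. if int M dvd l - b * m \<and> int M \<le> 2 * \<bar>l\<bar> then 1 / real_of_int \<bar>m\<bar> * (1 / real_of_int \<bar>l\<bar>) else 0)
      = (\<Sum>m\<in>?J. 1 / real_of_int \<bar>m\<bar> * (\<Sum>l\<in>{l\<in>?J. int M dvd l - b * m \<and> int M \<le> 2 * \<bar>l\<bar>}. 1 / real_of_int \<bar>l\<bar>))"
      unfolding sum.inter_filter[OF f] sum_distrib_left by (intro sum.cong refl) simp
    have 2: "(\<Sum>m\<in>?J. \<Sum>l\<in>?J. if int M dvd l - b * m \<and> int M \<le> 4 * \<bar>m\<bar> then 1 / real_of_int \<bar>m\<bar> * (1 / real_of_int \<bar>l\<bar>) else 0)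
      = (\<Sum>l\<in>?J. 1 / real_of_int \<bar>l\<bar> * (\<Sum>m\<in>{m\<in>?J. int M dvd l - b * m \<and> int M \<le> 4 * \<bar>m\<bar>}. 1 / real_of_int \<bar>m\<bar>))"
      unfolding sum.inter_filter[OF f] sum_distrib_left by (subst sum.swap) (intro sum.cong refl, simp)
    show ?thesis unfolding sum.distrib 1 2 ..
  qed
  also have "\<dots> \<le> (\<Sum>m\<in>?J. 1 / real_of_int \<bar>m\<bar> * (6 * ?L / real M)) + (\<Sum>l\<in>?J. 1 / real_of_int \<bar>l\<bar> * (12 * ?L / real M))"
  proof (intro add_mono sum_mono mult_left_mono)
    fix m
    have "(\<Sum>l\<in>{l\<in>?J. int M dvd l - b * m \<and> int M \<le> 2 * \<bar>l\<bar>}. 1 / real_of_int \<bar>l\<bar>) \<le> 2 * (1 / (real M / 2) + ?H / real_of_int (int M))"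
    proof (rule sum_inverse_abs_class)
      fix l l' assume "l \<in> {l\<in>?J. int M dvd l - b * m \<and> int M \<le> 2 * \<bar>l\<bar>}" "l' \<in> {l\<in>?J. int M dvd l - b * m \<and> int M \<le> 2 * \<bar>l\<bar>}"
      then have "int M dvd l - b * m" "int M dvd l' - b * m" by auto
      from dvd_diff[OF this] show "int M dvd l - l'" by simp
    next
      fix l assume "l \<in> {l\<in>?J. int M dvd l - b * m \<and> int M \<le> 2 * \<bar>l\<bar>}"
      then show "real M / 2 \<le> real_of_int \<bar>l\<bar>" by simp linarith
    qed (use M in auto)
    also have "\<dots> = (4 + 2 * ?H) / real M" by (simp add: add_divide_distrib)
    also have "\<dots> \<le> 6 * ?L / real M" using HL L1 by (intro divide_right_mono) auto
    finally show "(\<Sum>l\<in>{l\<in>?J. int M dvd l - b * m \<and> int M \<le> 2 * \<bar>l\<bar>}. 1 / real_of_int \<bar>l\<bar>) \<le> 6 * ?L / real M" .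
  next
    fix l
    \<comment> \<open>For \<open>b = 2\<close> and even \<open>M\<close> the congruence determines
      \<open>m\<close> only modulo \<open>M/2\<close>.\<close>
    define M' where "M' = (if even M \<and> b = 2 then int M div 2 else int M)"
    have M': "M' > 0" "real M / 2 \<le> real_of_int M'"
      using M(1) by (auto simp: M'_def elim!: evenE)
    have cl: "M' dvd x" if "int M dvd b * x" for x
    proof (cases "b = 2")
      case True
      show ?thesis
      proof (cases "even M")
        case e: True
        then obtain k where k: "M = 2 * k" by (elim evenE)
        have "2 * int k dvd 2 * x" using that True by (simp add: k)
        then have "int k dvd x" by simp
        then show ?thesis using True e by (simp add: M'_def k)
      next
        case o: False
        then have "coprime (int M) 2" by simp
        then show ?thesis using that True o by (simp add: M'_def coprime_dvd_mult_right_iff)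
      qed
    qed (use that b in \<open>simp add: M'_def\<close>)
    have "(\<Sum>m\<in>{m\<in>?J. int M dvd l - b * m \<and> int M \<le> 4 * \<bar>m\<bar>}. 1 / real_of_int \<bar>m\<bar>) \<le> 2 * (1 / (real M / 4) + ?H / real_of_int M')"
    proof (rule sum_inverse_abs_class)
      fix m m' assume "m \<in> {m\<in>?J. int M dvd l - b * m \<and> int M \<le> 4 * \<bar>m\<bar>}" "m' \<in> {m\<in>?J. int M dvd l - b * m \<and> int M \<le> 4 * \<bar>m\<bar>}"
      then have "int M dvd l - b * m'" "int M dvd l - b * m" by auto
      from dvd_diff[OF this] have "int M dvd b * (m - m')" by (simp add: algebra_simps)
      then show "M' dvd m - m'" by (rule cl)
    next
      fix m assume "m \<in> {m\<in>?J. int M dvd l - b * m \<and> int M \<le> 4 * \<bar>m\<bar>}"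
      then show "real M / 4 \<le> real_of_int \<bar>m\<bar>" by simp linarith
    qed (use M M' in auto)
    also have "?H / real_of_int M' \<le> ?H / (real M / 2)" using M(1) M' by (intro divide_left_mono mult_pos_pos harm_nonneg) auto
    also have "2 * (1 / (real M / 4) + ?H / (real M / 2)) = (8 + 4 * ?H) / real M" by (simp add: add_divide_distrib)
    also have "\<dots> \<le> 12 * ?L / real M" using HL L1 by (intro divide_right_mono) auto
    finally show "(\<Sum>m\<in>{m\<in>?J. int M dvd l - b * m \<and> int M \<le> 4 * \<bar>m\<bar>}. 1 / real_of_int \<bar>m\<bar>) \<le> 12 * ?L / real M" by simp
  qed auto
  also have "\<dots> = 2 * ?H * (18 * ?L / real M)"
    unfolding sum_distrib_right[symmetric] sum_inverse_abs by (simp add: algebra_simps)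
  also have "\<dots> \<le> 2 * ?L * (18 * ?L / real M)" using HL L1 by (intro mult_right_mono) auto
  also have "\<dots> = 36 * ?L\<^sup>2 / real M" by (simp add: power2_eq_square)
  finally show ?thesis .
qed

text \<open>Telescoping against \<open>1/(y - 1/2) - 1/(y + 1/2)\<close>. The precision matters:
  with the bound 1 in place of 2/3 the estimate of \<open>norm_diag_ge\<close> would leave nothing
  positive.\<close>

lemma sum_inverse_squares_tail: "(\<Sum>y\<in>{2..int n}. 1 / (real_of_int y)\<^sup>2) \<le> 2 / 3"
proof (cases "n = 0")
  case False
  then obtain k where k: "n = Suc k" by (cases n) auto
  have "(\<Sum>y\<in>{2..int n}. 1 / (real_of_int y)\<^sup>2) = (\<Sum>y\<in>{2..n}. 1 / (real y)\<^sup>2)"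
    by (rule sum.reindex_bij_witness[where i = int and j = nat]) auto
  also have "\<dots> \<le> 2 / 3 - 1 / (real n + 1 / 2)"
    unfolding k
  proof (induction k)
    case (Suc k)
    have "1 / (real (Suc (Suc k)))\<^sup>2 \<le> 1 / (real (Suc k) + 1 / 2) - 1 / (real (Suc (Suc k)) + 1 / 2)"
    proof -
      define x where "x = real (Suc (Suc k))"
      have x: "x \<ge> 2" by (simp add: x_def)
      have "1 / (x - 1 / 2) - 1 / (x + 1 / 2) = 1 / ((x - 1 / 2) * (x + 1 / 2))" using x by (simp add: field_simps)
      moreover have "1 / x\<^sup>2 \<le> 1 / ((x - 1 / 2) * (x + 1 / 2))"
        using x by (intro divide_left_mono mult_pos_pos) (auto simp: algebra_simps power2_eq_square)
      ultimately show ?thesis by (simp add: x_def)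
    qed
    then show ?case using Suc by simp
  qed simp
  also have "\<dots> \<le> 2 / 3" by simp
  finally show ?thesis .
qed simp

text \<open>From \<open>cot x * cot (2 x) = (cot^2 x - 1)/2\<close>. A nonzero weight ensures that
  neither \<open>sin\<close> nor \<open>cos\<close> vanishes. It reduces the diagonal with factor 2
  to squares of weights.\<close>

lemma wt_double:
  assumes nz: "wt c m \<noteq> 0" shows "wt c m * wt c (2 * m) = ((wt c m)\<^sup>2 - 1 / (real c)\<^sup>2) / 2"
proof -
  define x where "x = pi * of_int m / real c"
  have c: "c \<noteq> 0" using nz by (auto simp: wt_def)
  have s: "sin x \<noteq> 0" "cos x \<noteq> 0" using nz by (auto simp: wt_def cot_def x_def)
  have d: "wt c m = cot x / real c" "wt c (2 * m) = cot (2 * x) / real c" by (simp_all add: wt_def x_def mult_ac)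
  have "cot x * cot (2 * x) = ((cot x)\<^sup>2 - 1) / 2"
  proof -
    have "cot (2 * x) = ((cos x)\<^sup>2 - (sin x)\<^sup>2) / (2 * sin x * cos x)" by (simp only: cot_def sin_double cos_double)
    then show ?thesis using s by (simp add: cot_def field_simps power2_eq_square)
  qed
  then show ?thesis unfolding d using c by (simp add: field_simps power2_eq_square)
qed

section \<open>A sieve for the admissible residues modulo \<open>q2\<close>\<close>

context dedekind_data
begin

text \<open>The factor \<open>2\<close> makes \<open>-\<beta> + k D\<close> coprime to \<open>c\<close> for suitable \<open>k\<close> when \<open>c\<close> is even and \<open>D\<close> is odd.\<close>

definition \<beta> :: int where "\<beta> = (if even c \<and> odd D then 2 else 1)"

text \<open>Local condition at \<open>p\<close> that both \<open>y\<close> and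
  \<open>-\<beta> + D/y\<close> be units; their product is \<open>D - \<beta> y\<close>.\<close>

definition good :: "nat \<Rightarrow> int \<Rightarrow> bool" where
  "good p y \<longleftrightarrow> \<not> int p dvd y \<and> \<not> int p dvd int D - \<beta> * y"

lemma \<beta>_cases: "\<beta> = 1 \<or> \<beta> = 2" by (simp add: \<beta>_def)

text \<open>If \<open>p\<close> divides \<open>\<beta>\<close> or \<open>D\<close>, the second
  condition of \<open>good\<close> follows from the first; otherwise it excludes one further nonzero
  class. The choice of \<open>\<beta>\<close> puts 2 into the former case, so that a class survives
  there.\<close>

lemma bad_classes:
  assumes p: "prime p" "p dvd q2"
  shows "\<exists>F y0. (F \<longrightarrow> \<not> int p dvd y0) \<and> (p = 2 \<longrightarrow> \<not> F) \<and> (\<forall>y. \<not> good p y \<longleftrightarrow> int p dvd y \<or> (F \<and> int p dvd y - y0))"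
proof (cases "int p dvd \<beta> \<or> p dvd D")
  case True
  have "int p dvd y" if "int p dvd int D - \<beta> * y" for y
  proof (cases "p dvd D")
    case pD: True
    have "\<not> int p dvd \<beta>"
    proof
      assume "int p dvd \<beta>"
      then have "int p dvd 2" using \<beta>_cases by auto
      then have "p dvd 2" by presburger
      then have "p = 2" using p(1) by (metis primes_dvd_imp_eq two_is_prime_nat)
      then have "\<beta> = 1" using pD by (simp add: \<beta>_def)
      then show False using \<open>int p dvd \<beta>\<close> p(1) by simp
    qed
    moreover have "int p dvd int D" using pD by simp
    then have "int p dvd \<beta> * y" using dvd_diff[OF _ that, of "int D"] by simp
    ultimately show ?thesis using p(1) by (metis prime_dvd_mult_iff prime_nat_int_transfer)
  next
    case False
    then have "int p dvd \<beta> * y" using True by simp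
    then have "int p dvd int D" using that by (metis diff_add_cancel dvd_add)
    then show ?thesis using False by simp
  qed
  then show ?thesis by (intro exI[of _ False]) (auto simp: good_def)
next
  case False
  have "coprime (int p) \<beta>" using False p(1) by (metis prime_imp_coprime prime_nat_int_transfer)
  then have "coprime \<beta> (int p)" by (simp only: coprime_commute)
  then obtain b' where b': "[\<beta> * b' = 1] (mod int p)" using cong_solve_coprime_int by blast
  have p2: "p \<noteq> 2"
  proof
    assume "p = 2"
    then have "even c" using p(2) by (simp add: c_eq)
    then show False using False \<open>p = 2\<close> by (simp add: \<beta>_def split: if_splits)
  qed
  have bb: "int p dvd \<beta> * b' * int D - int D"
  proof -
    have "[\<beta> * b' * int D = 1 * int D] (mod int p)" by (intro cong_mult b' cong_refl)
    then show ?thesis by (simp add: cong_iff_dvd_diff)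
  qed
  have e: "int p dvd int D - \<beta> * y \<longleftrightarrow> int p dvd y - b' * int D" for y
  proof -
    have "int p dvd int D - \<beta> * y \<longleftrightarrow> int p dvd (int D - \<beta> * y) + (\<beta> * b' * int D - int D)"
      using bb by (simp only: dvd_add_left_iff)
    also have "(int D - \<beta> * y) + (\<beta> * b' * int D - int D) = \<beta> * (b' * int D - y)" by (simp add: algebra_simps)
    also have "int p dvd \<beta> * (b' * int D - y) \<longleftrightarrow> int p dvd b' * int D - y"
      by (rule coprime_dvd_mult_right_iff) fact
    also have "\<dots> \<longleftrightarrow> int p dvd y - b' * int D" by (rule dvd_diff_commute)
    finally show ?thesis .
  qed
  have "\<not> int p dvd b' * int D"
  proof
    assume "int p dvd b' * int D"
    then have "int p dvd \<beta> * b' * int D" by (simp add: mult.assoc)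
    then have "int p dvd int D" using dvd_diff[OF _ bb, of "\<beta> * b' * int D"] by simp
    then show False using False by simp
  qed
  then show ?thesis using p2 e by (intro exI[of _ True] exI[of _ "b' * int D"]) (auto simp: good_def)
qed

lemma good_cong: "[y = y'] (mod int p) \<Longrightarrow> good p y \<longleftrightarrow> good p y'"
proof -
  assume a: "[y = y'] (mod int p)"
  have "[int D - \<beta> * y = int D - \<beta> * y'] (mod int p)" by (intro cong_diff cong_mult a cong_refl)
  then show ?thesis using cong_dvd_iff[OF a] cong_dvd_iff unfolding good_def by blast
qed

definition admissible :: "nat set \<Rightarrow> int set" where
  "admissible P = {y\<in>{0..<int q2}. \<forall>p\<in>P. good p y}"

lemma finite_admissible: "finite (admissible P)"
  unfolding admissible_def by (rule finite_subset[of _ "{0..<int q2}"]) auto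

lemma sum_admissible: "(\<Sum>y\<in>admissible P. h y) = (\<Sum>y\<in>{0..<int q2}. if \<forall>p\<in>P. good p y then h y else 0)"
  unfolding admissible_def by (rule sum.inter_filter) simp

text \<open>The arguments form a progression with difference \<open>t e\<close>. With
  \<open>g = gcd (t e) q2\<close> the sum is a multiple of a class sum modulo \<open>g\<close>,
  which vanishes unless \<open>g = q2\<close>. In that case \<open>q2/e\<close>, the number of
  terms, divides \<open>gcd t q2\<close>.\<close>

lemma progression_bound:
  assumes e: "e dvd q2" "e > 0"
  shows "cmod (\<Sum>y\<in>{0..<int q2}. if int e dvd y - r then X2 (t * y + m) else 0) \<le> of_int (gcd t (int q2))"
proof -
  obtain n where n: "q2 = e * n" using e(1) by (elim dvdE)
  have q20: "q2 > 0" using q2_ge by simp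
  then have n0: "n > 0" using n by (cases n) auto
  define r0 where "r0 = r mod int e"
  define A where "A = t * r0 + m"
  have r0: "r0 \<in> {0..<int e}" using e(2) by (simp add: r0_def)
  have dv: "int e dvd x + int e * s - r \<longleftrightarrow> x = r0" if "x \<in> {0..<int e}" for x s
  proof -
    have "int e dvd x + int e * s - r \<longleftrightarrow> (x + int e * s) mod int e = r mod int e" by (rule mod_eq_dvd_iff[symmetric])
    then show ?thesis using that by (simp add: r0_def)
  qed
  have "(\<Sum>y\<in>{0..<int q2}. if int e dvd y - r then X2 (t * y + m) else 0) =
    (\<Sum>x\<in>{0..<int e}. \<Sum>s\<in>{0..<int n}. if int e dvd x + int e * s - r then X2 (t * (x + int e * s) + m) else 0)"
    unfolding n by (rule sum_residues_split[OF e(2)])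
  also have "\<dots> = (\<Sum>x\<in>{0..<int e}. if x = r0 then (\<Sum>s\<in>{0..<int n}. X2 (t * (x + int e * s) + m)) else 0)"
    by (intro sum.cong refl) (simp add: dv)
  also have "\<dots> = (\<Sum>s\<in>{0..<int n}. X2 (A + t * int e * s))"
    using r0 by (simp add: A_def algebra_simps)
  finally have S: "(\<Sum>y\<in>{0..<int q2}. if int e dvd y - r then X2 (t * y + m) else 0) = (\<Sum>s\<in>{0..<int n}. X2 (A + t * int e * s))" .
  define g where "g = nat (gcd (t * int e) (int q2))"
  have gi: "int g = gcd (t * int e) (int q2)" by (simp add: g_def)
  have g0: "g > 0" using q20 by (simp add: g_def)
  obtain u where u: "t * int e = int g * u" unfolding gi using gcd_dvd1 by blast
  have "int g dvd int q2" unfolding gi by simp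
  then obtain k where k: "q2 = g * k" by (auto elim: dvdE)
  have k0: "k > 0" using k q20 by (cases k) auto
  have "int e dvd int g" unfolding gi using n by (intro gcd_greatest) auto
  then obtain f where f: "g = e * f" by (auto elim: dvdE)
  have nk: "n = k * f" using n k f e(2) by (simp add: mult.commute)
  have cop: "coprime u (int k)"
  proof -
    have "gcd (int g * u) (int g * int k) = int g" using gi u k by simp
    then have "int g * gcd u (int k) = int g" by (simp add: gcd_mult_left)
    then show ?thesis using g0 by (simp add: coprime_iff_gcd_eq_1)
  qed
  have per: "periodic k (\<lambda>s. X2 (A + int g * s))"
    unfolding periodic_def
  proof
    fix s
    have "A + int g * (s + int k) = (A + int g * s) + int q2 * 1" by (simp add: k algebra_simps)
    then show "X2 (A + int g * (s + int k)) = X2 (A + int g * s)" by (simp only: periodicD_mult[OF D2(3)])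
  qed
  have S2: "(\<Sum>s\<in>{0..<int n}. X2 (A + t * int e * s)) = of_nat f * (\<Sum>s\<in>{0..<int k}. X2 (A + int g * s))"
  proof -
    have "(\<Sum>s\<in>{0..<int (k * f)}. X2 (A + int g * (u * s))) = of_nat f * (\<Sum>s\<in>{0..<int k}. X2 (A + int g * (u * s)))"
      by (rule sum_residues_period[OF k0]) (use periodic_affine[OF per, of 0 u] in simp)
    also have "(\<Sum>s\<in>{0..<int k}. X2 (A + int g * (u * s))) = (\<Sum>s\<in>{0..<int k}. X2 (A + int g * s))"
      by (rule sum_residues_mult[OF per cop])
    finally show ?thesis by (simp only: nk u mult.assoc)
  qed
  show ?thesis
  proof (cases "g < q2")
    case True
    have "(\<Sum>s\<in>{0..<int k}. X2 (A + int g * s)) = 0" by (rule primitive_character_class_sum[OF prim2 k True])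
    then show ?thesis unfolding S S2 by simp
  next
    case False
    have "g \<le> q2" using k k0 by simp
    then have "g = q2" using False by simp
    then have "int q2 dvd t * int e" using u by simp
    then have "int e * int n dvd int e * t" by (simp add: n mult.commute)
    then have "int n dvd t" using e(2) by simp
    moreover have "int n dvd int q2" by (simp add: n)
    ultimately have "int n dvd gcd t (int q2)" by simp
    then have le: "int n \<le> gcd t (int q2)" using q20 by (intro zdvd_imp_le) auto
    have "cmod (\<Sum>s\<in>{0..<int n}. X2 (A + t * int e * s)) \<le> (\<Sum>s\<in>{0..<int n}. 1)"
      by (intro order_trans[OF norm_sum] sum_mono dirichlet_character_norm_le[OF dc2])
    also have "\<dots> = real_of_int (int n)" by simp
    also have "\<dots> \<le> of_int (gcd t (int q2))" using le by (simp only: of_int_le_iff)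
    finally show ?thesis unfolding S .
  qed
qed

text \<open>Each prime turns one sum into three: without its condition, and over each of at most two
  bad classes, which the Chinese remainder theorem absorbs into the modulus
  \<open>e\<close>.\<close>

lemma sieve_bound:
  assumes "finite P" "\<And>p. p \<in> P \<Longrightarrow> prime p \<and> p dvd q2"
  shows "e dvd q2 \<Longrightarrow> e > 0 \<Longrightarrow> (\<And>p. p \<in> P \<Longrightarrow> coprime p e) \<Longrightarrow>
    cmod (\<Sum>y\<in>{0..<int q2}. if (\<forall>p\<in>P. good p y) \<and> int e dvd y - r then X2 (t * y + m) else 0) \<le> 3 ^ card P * of_int (gcd t (int q2))"
  using assms
proof (induction P arbitrary: e r rule: finite_induct)
  case empty
  then show ?case using progression_bound[of e r t m] by simp
next
  case (insert p P)
  let ?G = "real_of_int (gcd t (int q2))"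
  have p: "prime p" "p dvd q2" using insert.prems(4)[of p] by auto
  have pe: "coprime p e" using insert.prems(3)[of p] by simp
  have IH: "e' dvd q2 \<Longrightarrow> e' > 0 \<Longrightarrow> (\<And>p. p \<in> P \<Longrightarrow> coprime p e') \<Longrightarrow>
    cmod (\<Sum>y\<in>{0..<int q2}. if (\<forall>p\<in>P. good p y) \<and> int e' dvd y - r' then X2 (t * y + m) else 0) \<le> 3 ^ card P * ?G" for e' r'
    using insert.IH[of e' r'] insert.prems(4) by blast
  have p0: "p > 0" using p(1) prime_gt_0_nat by blast
  have cl: "\<exists>r'. \<forall>y. int e dvd y - r \<and> int p dvd y - z \<longleftrightarrow> int (e * p) dvd y - r'" for z
  proof -
    have "coprime (int e) (int p)" using pe by (simp add: coprime_commute)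
    then obtain r' where r': "[r' = r] (mod int e)" "[r' = z] (mod int p)" using binary_chinese_remainder_int by blast
    have "int e dvd y - r \<and> int p dvd y - z \<longleftrightarrow> int (e * p) dvd y - r'" for y
    proof -
      have "int e dvd y - r \<longleftrightarrow> int e dvd y - r'" "int p dvd y - z \<longleftrightarrow> int p dvd y - r'"
        using r' by (metis cong_iff_dvd_diff cong_sym cong_trans)+
      moreover have "int e dvd y - r' \<and> int p dvd y - r' \<longleftrightarrow> int e * int p dvd y - r'"
        using \<open>coprime (int e) (int p)\<close> by (metis divides_mult dvd_mult_left dvd_mult_right)
      ultimately show ?thesis by simp
    qed
    then show ?thesis by blast
  qed
  have ep: "e * p dvd q2" using insert.prems(1) p(2) pe by (intro divides_mult) (auto simp: coprime_commute)
  have cep: "coprime q (e * p)" if "q \<in> P" for q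
  proof -
    have "q \<noteq> p" using that insert.hyps(2) by blast
    then have "coprime q p" using insert.prems(4)[of q] that p(1) primes_coprime by blast
    then show ?thesis using insert.prems(3)[of q] that by simp
  qed
  have B: "cmod (\<Sum>y\<in>{0..<int q2}. if (\<forall>p\<in>P. good p y) \<and> int e dvd y - r \<and> int p dvd y - z then X2 (t * y + m) else 0) \<le> 3 ^ card P * ?G" for z
  proof -
    obtain r' where "\<forall>y. int e dvd y - r \<and> int p dvd y - z \<longleftrightarrow> int (e * p) dvd y - r'" using cl by blast
    then show ?thesis using IH[OF ep _ cep, of r'] p0 insert.prems(2) by (simp only: conj_assoc nat_0_less_mult_iff simp_thms)
  qed
  obtain F y0 where F: "F \<longrightarrow> \<not> int p dvd y0" "\<And>y. \<not> good p y \<longleftrightarrow> int p dvd y \<or> (F \<and> int p dvd y - y0)"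
    using bad_classes[OF p] by blast
  let ?T = "\<lambda>C. \<Sum>y\<in>{0..<int q2}. if (\<forall>p\<in>P. good p y) \<and> int e dvd y - r \<and> C y then X2 (t * y + m) else 0"
  have split: "(\<Sum>y\<in>{0..<int q2}. if (\<forall>p\<in>insert p P. good p y) \<and> int e dvd y - r then X2 (t * y + m) else 0)
     = ?T (\<lambda>y. True) - ?T (\<lambda>y. int p dvd y - 0) - ?T (\<lambda>y. F \<and> int p dvd y - y0)"
    unfolding sum_subtractf[symmetric]
  proof (rule sum.cong[OF refl])
    fix y
    have "\<not> (int p dvd y \<and> F \<and> int p dvd y - y0)" 
      using F(1) dvd_diff[of "int p" y "y - y0"] by auto
    then show "(if (\<forall>p\<in>insert p P. good p y) \<and> int e dvd y - r then X2 (t * y + m) else 0) =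
      (if (\<forall>p\<in>P. good p y) \<and> int e dvd y - r \<and> True then X2 (t * y + m) else 0)
      - (if (\<forall>p\<in>P. good p y) \<and> int e dvd y - r \<and> int p dvd y - 0 then X2 (t * y + m) else 0)
      - (if (\<forall>p\<in>P. good p y) \<and> int e dvd y - r \<and> F \<and> int p dvd y - y0 then X2 (t * y + m) else 0)"
      using F(2)[of y] by auto
  qed
  have G0: "3 ^ card P * ?G \<ge> 0" by simp
  have 1: "cmod (?T (\<lambda>y. True)) \<le> 3 ^ card P * ?G"
    using IH[OF insert.prems(1,2), of r] insert.prems(3) by simp
  have 2: "cmod (?T (\<lambda>y. int p dvd y - 0)) \<le> 3 ^ card P * ?G" by (rule B)
  have 3: "cmod (?T (\<lambda>y. F \<and> int p dvd y - y0)) \<le> 3 ^ card P * ?G"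
    using B[of y0] G0 by (cases F) auto
  have "cmod (?T (\<lambda>y. True) - ?T (\<lambda>y. int p dvd y - 0) - ?T (\<lambda>y. F \<and> int p dvd y - y0))
     \<le> 3 ^ card P * ?G + 3 ^ card P * ?G + 3 ^ card P * ?G"
    using norm_triangle_ineq4[of "?T (\<lambda>y. True) - ?T (\<lambda>y. int p dvd y - 0)" "?T (\<lambda>y. F \<and> int p dvd y - y0)"]
      norm_triangle_ineq4[of "?T (\<lambda>y. True)" "?T (\<lambda>y. int p dvd y - 0)"] 1 2 3 by linarith
  then show ?case unfolding split using insert.hyps by (simp add: mult_ac)
qed

text \<open>Shifts by multiples of \<open>M\<close>, the product of the earlier primes, preserve the
  earlier conditions. One of the shifts by 0, \<open>M\<close> and \<open>2 M\<close> avoids the bad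
  classes at the new prime, so each prime costs at most a factor 3.\<close>

lemma card_admissible:
  assumes "finite P" "\<And>p. p \<in> P \<Longrightarrow> prime p \<and> p dvd q2"
  shows "q2 \<le> 3 ^ card P * card (admissible P)"
  using assms
proof (induction P rule: finite_induct)
  case empty
  have "admissible {} = {0..<int q2}" by (auto simp: admissible_def)
  then show ?case by simp
next
  case (insert p P)
  have p: "prime p" "p dvd q2" using insert.prems[of p] by auto
  have q20: "int q2 > 0" using q2_ge by simp
  define M where "M = int (\<Prod>q\<in>P. q)"
  have MP: "int q dvd M" if "q \<in> P" for q
    unfolding M_def using dvd_prodI[OF insert.hyps(1) that, of "\<lambda>q. q"] by (simp only: int_dvd_int_iff)
  have pM: "\<not> int p dvd M"
  proof
    assume "int p dvd M"
    then have "p dvd (\<Prod>q\<in>P. q)" unfolding M_def by (simp only: int_dvd_int_iff)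
    then obtain q where "q \<in> P" "p dvd q" using p(1) insert.hyps(1) by (auto simp: prime_dvd_prod_iff)
    then show False using insert.prems[of q] insert.hyps(2) p(1) primes_dvd_imp_eq by blast
  qed
  obtain F y0 where F: "F \<longrightarrow> \<not> int p dvd y0" "p = 2 \<longrightarrow> \<not> F" "\<And>y. \<not> good p y \<longleftrightarrow> int p dvd y \<or> (F \<and> int p dvd y - y0)"
    using bad_classes[OF p] by blast
  let ?A = "\<lambda>j. {y\<in>{0..<int q2}. (y + j * M) mod int q2 \<in> admissible (insert p P)}"
  have cov: "admissible P \<subseteq> ?A 0 \<union> ?A 1 \<union> ?A 2"
  proof
    fix y assume y: "y \<in> admissible P"
    have "\<exists>j\<in>{0, 1, 2}. good p (y + j * M)"
    proof (rule ccontr)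
      assume "\<not> ?thesis"
      then have bad: "\<not> good p (y + 0 * M)" "\<not> good p (y + 1 * M)" "\<not> good p (y + 2 * M)" by auto
      have diff: "\<not> (int p dvd x \<and> int p dvd x + M)" for x using pM by (metis dvd_add_right_iff)
      have diff2: "\<not> (int p dvd x \<and> int p dvd x + 2 * M)" if "p \<noteq> 2" for x
      proof
        assume "int p dvd x \<and> int p dvd x + 2 * M"
        then have "int p dvd 2 * M" by (metis dvd_add_right_iff)
        then have "int p dvd 2 \<or> int p dvd M" using p(1) by (metis prime_dvd_mult_iff prime_nat_int_transfer)
        then have "p dvd 2" using pM by presburger
        then show False using that p(1) by (metis primes_dvd_imp_eq two_is_prime_nat)
      qed
      show False
      proof (cases F)
        case False
        then show False using bad F(3) diff[of y] by simp
      next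
        case True
        then have "p \<noteq> 2" using F(2) by blast
        have "(int p dvd y \<or> int p dvd y - y0) \<and> (int p dvd y + M \<or> int p dvd (y - y0) + M) \<and> (int p dvd y + 2 * M \<or> int p dvd (y - y0) + 2 * M)"
          using bad F(3) True by (simp add: algebra_simps)
        moreover have "y + 2 * M = (y + M) + M" "(y - y0) + 2 * M = ((y - y0) + M) + M" by simp_all
        ultimately show False
          using diff[of y] diff[of "y - y0"] diff[of "y + M"] diff[of "(y - y0) + M"] diff2[OF \<open>p \<noteq> 2\<close>, of y] diff2[OF \<open>p \<noteq> 2\<close>, of "y - y0"]
          by metis
      qed
    qed
    then obtain j where j: "j \<in> {0, 1, 2}" "good p (y + j * M)" by blast
    have g: "good q ((y + j * M) mod int q2) \<longleftrightarrow> good q (y + j * M)" if "q dvd q2" for q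
    proof (rule good_cong)
      have "[(y + j * M) mod int q2 = y + j * M] (mod int q2)" by simp
      then show "[(y + j * M) mod int q2 = y + j * M] (mod int q)" using that cong_dvd_modulus by (metis int_dvd_int_iff)
    qed
    have "good q ((y + j * M) mod int q2)" if q: "q \<in> insert p P" for q
    proof (cases "q = p")
      case True then show ?thesis using g p(2) j(2) by simp
    next
      case False
      then have "q \<in> P" using q by blast
      then have "good q y" using y by (simp add: admissible_def)
      moreover have "[y + j * M = y] (mod int q)" using MP[OF \<open>q \<in> P\<close>] by (simp add: cong_iff_dvd_diff)
      ultimately have "good q (y + j * M)" using good_cong by blast
      then show ?thesis using g insert.prems[OF q] by blast
    qed
    then have "(y + j * M) mod int q2 \<in> admissible (insert p P)" using q20 by (simp add: admissible_def)
    then show "y \<in> ?A 0 \<union> ?A 1 \<union> ?A 2" using j(1) y by (auto simp: admissible_def)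
  qed
  have c: "card (?A j) \<le> card (admissible (insert p P))" for j
  proof (rule card_inj_on_le[OF _ _ finite_admissible])
    show "inj_on (\<lambda>y. (y + j * M) mod int q2) (?A j)"
    proof (rule inj_onI)
      fix x y assume a: "x \<in> ?A j" "y \<in> ?A j" "(x + j * M) mod int q2 = (y + j * M) mod int q2"
      then have "[x + j * M = y + j * M] (mod int q2)" by (simp add: cong_def)
      then have "[x = y] (mod int q2)" by (simp add: cong_add_rcancel)
      then show "x = y" using a by (simp add: cong_def)
    qed
  qed auto
  have fA: "finite (?A j)" for j by (rule finite_subset[of _ "{0..<int q2}"]) auto
  have "card (admissible P) \<le> card (?A 0 \<union> ?A 1 \<union> ?A 2)" by (rule card_mono) (use cov fA in blast)+
  also have "\<dots> \<le> card (?A 0) + card (?A 1) + card (?A 2)"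
    using card_Un_le[of "?A 0 \<union> ?A 1" "?A 2"] card_Un_le[of "?A 0" "?A 1"] by linarith
  also have "\<dots> \<le> 3 * card (admissible (insert p P))" using c[of 0] c[of 1] c[of 2] by linarith
  finally have "3 ^ card P * card (admissible P) \<le> 3 ^ card P * (3 * card (admissible (insert p P)))" by simp
  moreover have "q2 \<le> 3 ^ card P * card (admissible P)" using insert.IH insert.prems by blast
  ultimately have "q2 \<le> 3 ^ card P * (3 * card (admissible (insert p P)))" by linarith
  then show ?case using insert.hyps by (simp add: mult_ac)
qed

end

section \<open>Diagonal and off-diagonal contributions\<close>

context dedekind_data
begin

text \<open>At \<open>a = -\<beta> + k D\<close> the condition \<open>D | l + a m\<close> reads
  \<open>D | l - \<beta> m\<close>, independently of \<open>k\<close>; the variable \<open>t\<close>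
  is defined by \<open>l = \<beta> m + D t\<close>.\<close>

lemma R_row:
  "R (- \<beta> + k * int D) = (\<Sum>m\<in>{0..<int c}. \<Sum>t\<in>{0..<int q2}. of_real (wt c m * wt c (\<beta> * m + int D * t)) * X1 m * X2 (t + k * m))"
  unfolding R_def
proof (rule sum.cong[OF refl])
  fix m
  define a where "a = - \<beta> + k * int D"
  define G where "G l = of_real (wt c l) * of_real (wt c m) * X1 m * kap (l + a * m)" for l
  have G: "periodic c G"
    using wt_periodic[of c] periodic_affine[OF kap_periodic, of "a * m" 1] by (simp add: periodic_def G_def add.commute)
  have "(\<Sum>l\<in>{0..<int c}. G l) = (\<Sum>n\<in>{0..<int c}. G (n + \<beta> * m))" by (rule sum_residues_shift[OF G, symmetric])
  also have "\<dots> = (\<Sum>n\<in>{0..<int (D * q2)}. if int D dvd n then G (n + \<beta> * m) else 0)"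
    unfolding c_eq[symmetric]
  proof (rule sum.cong[OF refl])
    fix n
    have e: "n + \<beta> * m + a * m = n + int D * (k * m)" by (simp add: a_def algebra_simps)
    have "\<not> int D dvd n \<Longrightarrow> kap (n + \<beta> * m + a * m) = 0" unfolding e by (simp add: kap_eq_0 dvd_add_left_iff)
    then show "G (n + \<beta> * m) = (if int D dvd n then G (n + \<beta> * m) else 0)" by (simp add: G_def)
  qed
  also have "\<dots> = (\<Sum>t\<in>{0..<int q2}. G (int D * t + \<beta> * m))" by (rule sum_residues_dvd[OF D_pos])
  also have "\<dots> = (\<Sum>t\<in>{0..<int q2}. of_real (wt c m * wt c (\<beta> * m + int D * t)) * X1 m * X2 (t + k * m))"
  proof (rule sum.cong[OF refl])
    fix t
    have "int D * t + \<beta> * m + a * m = int D * (t + k * m)" by (simp add: a_def algebra_simps)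
    then have "kap (int D * t + \<beta> * m + a * m) = X2 (t + k * m)" by (simp only: kap_mult)
    then show "G (int D * t + \<beta> * m) = of_real (wt c m * wt c (\<beta> * m + int D * t)) * X1 m * X2 (t + k * m)"
      by (simp add: G_def add.commute mult_ac)
  qed
  finally show "(\<Sum>l\<in>{0..<int c}. of_real (wt c l) * of_real (wt c m) * X1 m * kap (l + (- \<beta> + k * int D) * m)) =
    (\<Sum>t\<in>{0..<int q2}. of_real (wt c m * wt c (\<beta> * m + int D * t)) * X1 m * X2 (t + k * m))"
    by (simp only: G_def a_def)
qed

lemma R_periodic: "periodic c R"
  unfolding periodic_def
proof
  fix a
  have "l + (a + int c) * m = (l + a * m) + int c * m" for l m by (simp add: algebra_simps)
  then show "R (a + int c) = R a" unfolding R_def by (simp only: periodicD_mult[OF kap_periodic])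
qed

text \<open>The contribution of \<open>t = 0\<close> in \<open>R_lower_bound\<close>, the same for
  every \<open>y\<close>.\<close>

definition diag :: complex where
  "diag = (\<Sum>m\<in>{0..<int c}. of_real (wt c m * wt c (\<beta> * m)) * X1 m * X2 m)"

text \<open>By \<open>parity\<close> the terms \<open>m = 1\<close> and \<open>m = -1\<close>
  reinforce each other; all others are bounded absolutely. With \<open>P = 1/pi^2 >= 1/16\<close>
  the margin is about \<open>0.66 P\<close> for \<open>\<beta> = 1\<close> and about
  \<open>0.33 P - 0.01\<close> for \<open>\<beta> = 2\<close>; the latter is just above 1/100 and
  uses \<open>c >= 100\<close>.\<close>

lemma norm_diag_ge: assumes "c \<ge> 100" shows "cmod diag \<ge> 1 / 100"
proof -
  define h where "h = c div 2"
  define z where "z m = \<bar>wt c m * wt c (\<beta> * m)\<bar>" for m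
  define f where "f m = of_real (wt c m * wt c (\<beta> * m)) * X1 m * X2 m" for m
  have wp: "wt c (x + int c * k) = wt c x" for x k by (rule periodicD_mult[OF wt_periodic])
  have wp1: "wt c (x + int c) = wt c x" for x using wp[of x 1] by simp
  have bm: "\<beta> * (m + int c) = \<beta> * m + int c * \<beta>" for m by (simp add: algebra_simps)
  have zp: "periodic c z" unfolding periodic_def z_def bm wp wp1 by simp
  have z_minus: "z (- m) = z m" for m by (simp add: z_def wt_minus)
  have h2: "2 * int h \<le> int c" "h \<ge> 50" using assms unfolding h_def by linarith+
  have ne: "int c - 1 \<noteq> 1" "1 \<in> {0..<int c}" "int c - 1 \<in> {0..<int c}" using assms by auto
  have split: "(\<Sum>m\<in>{0..<int c}. g m) = g 1 + (g (int c - 1) + (\<Sum>m\<in>{0..<int c} - {1} - {int c - 1}. g m))" for g :: "int \<Rightarrow> 'a::comm_monoid_add"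
    using sum.remove[of "{0..<int c}" 1 g] sum.remove[of "{0..<int c} - {1}" "int c - 1" g] ne by simp
  have m1: "g (int c - 1) = g (- 1)" if "periodic c g" for g :: "int \<Rightarrow> 'a"
    using periodicD_mult[OF that, of "- 1" 1] by simp
  have f1: "f 1 = of_real (wt c 1 * wt c \<beta>)" by (simp add: f_def D1(5) D2(5))
  have fm: "f (- 1) = of_real (wt c 1 * wt c \<beta>)" using parity by (simp add: f_def wt_minus mult.assoc)
  have fp: "periodic c f"
  proof -
    have "periodic c X2" by (rule periodic_dvd[OF D2(3)]) (simp add: c_eq)
    then show ?thesis using X1_periodic_c unfolding periodic_def f_def bm wp wp1 by simp
  qed
  have nf: "cmod (f m) \<le> z m" for m
  proof -
    have "cmod (X1 m) * cmod (X2 m) \<le> 1 * 1"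
      using dirichlet_character_norm_le[OF dc1] dirichlet_character_norm_le[OF dc2] by (intro mult_mono) auto
    then have "\<bar>wt c m * wt c (\<beta> * m)\<bar> * (cmod (X1 m) * cmod (X2 m)) \<le> \<bar>wt c m * wt c (\<beta> * m)\<bar> * 1" by (intro mult_left_mono) auto
    then show ?thesis by (simp add: f_def z_def norm_mult abs_mult mult.assoc)
  qed
  let ?rest = "\<Sum>m\<in>{0..<int c} - {1} - {int c - 1}. z m"
  have rest: "?rest \<le> 2 * (\<Sum>m\<in>{2..int h}. z m)"
  proof -
    have "2 * z 1 + ?rest = (\<Sum>m\<in>{0..<int c}. z m)" using split[of z] m1[OF zp] z_minus[of 1] by simp
    also have "\<dots> \<le> (\<Sum>m\<in>{- int h..int h}. z m)"
      unfolding h_def by (rule sum_residues_le_symmetric[OF zp]) (simp add: z_def)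
    also have "{- int h..int h} = insert 0 (insert 1 (insert (- 1) ({2..int h} \<union> uminus ` {2..int h})))"
      using h2(2) by (auto simp: image_iff intro!: bexI[of _ "- _"])
    also have "(\<Sum>m\<in>\<dots>. z m) = z 0 + (z 1 + (z (- 1) + (\<Sum>m\<in>{2..int h} \<union> uminus ` {2..int h}. z m)))"
    proof -
      have "0 \<notin> insert 1 (insert (- 1) ({2..int h} \<union> uminus ` {2..int h}))" "1 \<notin> insert (- 1) ({2..int h} \<union> uminus ` {2..int h})"
        "- 1 \<notin> {2..int h} \<union> uminus ` {2..int h}" by auto
      then show ?thesis by (simp only: sum.insert finite_insert finite_Un finite_imageI finite_atLeastAtMost_int simp_thms)
    qed
    also have "(\<Sum>m\<in>{2..int h} \<union> uminus ` {2..int h}. z m) = (\<Sum>m\<in>{2..int h}. z m) + (\<Sum>m\<in>uminus ` {2..int h}. z m)"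
      by (rule sum.union_disjoint) auto
    also have "(\<Sum>m\<in>uminus ` {2..int h}. z m) = (\<Sum>m\<in>{2..int h}. z m)"
      by (subst sum.reindex) (simp_all add: inj_on_def z_minus)
    finally show ?thesis using z_minus[of 1] by (simp add: z_def wt_dvd)
  qed
  have diag: "cmod diag \<ge> 2 * (wt c 1 * wt c \<beta>) - ?rest"
  proof -
    have "diag = of_real (2 * (wt c 1 * wt c \<beta>)) + (\<Sum>m\<in>{0..<int c} - {1} - {int c - 1}. f m)"
    proof -
      have "diag = (\<Sum>m\<in>{0..<int c}. f m)" by (simp only: diag_def f_def)
      then show ?thesis using split[of f] m1[OF fp] by (simp add: f1 fm)
    qed
    moreover have "cmod (\<Sum>m\<in>{0..<int c} - {1} - {int c - 1}. f m) \<le> ?rest"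
      by (intro order_trans[OF norm_sum] sum_mono nf)
    moreover have "cmod (of_real (2 * (wt c 1 * wt c \<beta>))) \<ge> 2 * (wt c 1 * wt c \<beta>)" by (simp only: norm_of_real abs_ge_self)
    ultimately show ?thesis
      using norm_diff_ineq[of "of_real (2 * (wt c 1 * wt c \<beta>))" "\<Sum>m\<in>{0..<int c} - {1} - {int c - 1}. f m"] by simp
  qed
  define W where "W = (\<Sum>m\<in>{2..int h}. (wt c m)\<^sup>2)"
  have W: "W \<le> (2 / 3) / pi\<^sup>2"
  proof -
    have "(wt c m)\<^sup>2 \<le> 1 / pi\<^sup>2 * (1 / (real_of_int m)\<^sup>2)" if "m \<in> {2..int h}" for m
    proof -
      have "0 < m" "2 * m \<le> int c" using that h2 by auto
      from wt_nonneg_le[OF this] have "(wt c m)\<^sup>2 \<le> (1 / (pi * real_of_int m))\<^sup>2" by (intro power_mono)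
      then show ?thesis by (simp add: power_divide power_mult_distrib)
    qed
    then have "W \<le> (\<Sum>m\<in>{2..int h}. 1 / pi\<^sup>2 * (1 / (real_of_int m)\<^sup>2))" unfolding W_def by (rule sum_mono)
    also have "\<dots> \<le> 1 / pi\<^sup>2 * (2 / 3)"
      unfolding sum_distrib_left[symmetric] by (intro mult_left_mono sum_inverse_squares_tail) simp
    finally show ?thesis by simp
  qed
  have c2: "(real c)\<^sup>2 \<ge> 10000" using power_mono[of 100 "real c" 2] assms by simp
  have w1: "(wt c 1)\<^sup>2 \<ge> (998 / 1000) / pi\<^sup>2"
  proof -
    have "8 / (real c)\<^sup>2 \<le> 8 / 10000" using c2 assms by (intro divide_left_mono) auto
    then have "(9992 / 10000) / pi \<le> (1 - 8 / (real c)\<^sup>2) / pi" by (intro divide_right_mono) auto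
    also have "\<dots> \<le> wt c 1" using assms by (intro wt_1_ge) auto
    finally have "((9992 / 10000) / pi)\<^sup>2 \<le> (wt c 1)\<^sup>2" by (intro power_mono) auto
    moreover have "(998 / 1000) / pi\<^sup>2 \<le> ((9992 / 10000) / pi)\<^sup>2" unfolding power_divide by (intro divide_right_mono) (auto simp: power2_eq_square)
    ultimately show ?thesis by linarith
  qed
  have p16: "1 / pi\<^sup>2 \<ge> 1 / 16"
  proof -
    have "pi\<^sup>2 \<le> 4\<^sup>2" using pi_less_4 by (intro power_mono) auto
    then show ?thesis by (intro divide_left_mono) auto
  qed
  have w10: "wt c 1 \<noteq> 0" using w1 pi_gt_zero by (auto simp: divide_le_0_iff)
  define P where "P = 1 / pi\<^sup>2"
  have P: "P \<ge> 1 / 16" "W \<le> 2 / 3 * P" "(wt c 1)\<^sup>2 \<ge> 998 / 1000 * P" using p16 W w1 by (simp_all add: P_def)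
  show ?thesis
  proof (cases "\<beta> = 1")
    case True
    have "(\<Sum>m\<in>{2..int h}. z m) = W" unfolding W_def z_def True by (intro sum.cong) (auto simp: power2_eq_square)
    moreover have "wt c 1 * wt c \<beta> = (wt c 1)\<^sup>2" by (simp add: True power2_eq_square)
    ultimately show ?thesis using diag rest P by linarith
  next
    case False
    then have b2: "\<beta> = 2" using \<beta>_cases by simp
    have "z m \<le> (wt c m)\<^sup>2 / 2 + 1 / (2 * (real c)\<^sup>2)" for m
    proof (cases "wt c m = 0")
      case True then show ?thesis by (simp add: z_def)
    next
      case False
      have "\<bar>((wt c m)\<^sup>2 - 1 / (real c)\<^sup>2) / 2\<bar> \<le> (wt c m)\<^sup>2 / 2 + 1 / (2 * (real c)\<^sup>2)"
        using zero_le_power2[of "wt c m"] zero_le_power2[of "real c"] by (simp add: abs_le_iff field_simps)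
      then show ?thesis by (simp only: z_def b2 wt_double[OF False])
    qed
    then have "(\<Sum>m\<in>{2..int h}. z m) \<le> (\<Sum>m\<in>{2..int h}. (wt c m)\<^sup>2 / 2 + 1 / (2 * (real c)\<^sup>2))" by (rule sum_mono)
    also have "\<dots> = W / 2 + real (h - 1) * (1 / (2 * (real c)\<^sup>2))"
      using h2(2) by (simp add: sum.distrib W_def sum_divide_distrib nat_diff_distrib)
    also have "\<dots> \<le> W / 2 + real c * (1 / (2 * (real c)\<^sup>2))"
    proof -
      have "real (h - 1) \<le> real c" using h2 by linarith
      then show ?thesis by (intro add_left_mono mult_right_mono) auto
    qed
    also have "real c * (1 / (2 * (real c)\<^sup>2)) = 1 / (2 * real c)" using assms by (simp add: power2_eq_square)
    also have "1 / (2 * real c) \<le> 1 / 200" using assms by (intro divide_left_mono) auto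
    finally have Z: "(\<Sum>m\<in>{2..int h}. z m) \<le> W / 2 + 1 / 200" by simp
    have "wt c 1 * wt c \<beta> = ((wt c 1)\<^sup>2 - 1 / (real c)\<^sup>2) / 2" using wt_double[OF w10] by (simp add: b2)
    moreover have "1 / (real c)\<^sup>2 \<le> 1 / 10000" using c2 assms by (intro divide_left_mono) auto
    ultimately have "2 * (wt c 1 * wt c \<beta>) \<ge> (wt c 1)\<^sup>2 - 1 / 10000" by simp
    then show ?thesis using diag rest Z P by linarith
  qed
qed

text \<open>Under \<open>l = \<beta> m + D t\<close>, divisibility of \<open>t\<close> by
  \<open>d\<close> becomes divisibility of \<open>l - \<beta> m\<close> by \<open>d D\<close>, and
  \<open>t\<close> not 0 modulo \<open>q2\<close> becomes \<open>l - \<beta> m\<close> not 0 modulo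
  \<open>c\<close>.\<close>

lemma off_diagonal_row:
  assumes d: "d dvd q2" "d > 0"
  shows "(\<Sum>t\<in>{1..<int q2}. if int d dvd t then \<bar>wt c (\<beta> * m + int D * t)\<bar> else 0)
    \<le> (\<Sum>l\<in>{0..<int c}. if int (d * D) dvd l - \<beta> * m \<and> \<not> int c dvd l - \<beta> * m then \<bar>wt c l\<bar> else 0)"
proof -
  define G where "G l = (if int (d * D) dvd l - \<beta> * m \<and> \<not> int c dvd l - \<beta> * m then \<bar>wt c l\<bar> else 0)" for l
  have G0: "G l \<ge> 0" for l by (simp add: G_def)
  have "d * D dvd c" using d(1) by (simp add: c_eq mult.commute)
  then have dc: "int (d * D) dvd int c" by (simp only: int_dvd_int_iff)
  have "periodic c G"
    unfolding periodic_def
  proof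
    fix x
    have "int (d * D) dvd x + int c - \<beta> * m \<longleftrightarrow> int (d * D) dvd x - \<beta> * m" "int c dvd x + int c - \<beta> * m \<longleftrightarrow> int c dvd x - \<beta> * m"
      using dvd_add_left_iff[OF dc, of "x - \<beta> * m"] dvd_add_left_iff[OF dvd_refl, of "int c" "x - \<beta> * m"] by (simp_all add: algebra_simps)
    moreover have "wt c (x + int c) = wt c x" using wt_periodic[of c] by (simp add: periodic_def)
    ultimately show "G (x + int c) = G x" by (simp only: G_def)
  qed
  then have "(\<Sum>l\<in>{0..<int c}. G l) = (\<Sum>n\<in>{0..<int c}. G (n + \<beta> * m))" by (rule sum_residues_shift[symmetric])
  also have "\<dots> \<ge> (\<Sum>n\<in>{0..<int (D * q2)}. if int D dvd n then G (n + \<beta> * m) else 0)"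
    unfolding c_eq[symmetric] by (intro sum_mono) (simp add: G0)
  also have "(\<Sum>n\<in>{0..<int (D * q2)}. if int D dvd n then G (n + \<beta> * m) else 0) = (\<Sum>t\<in>{0..<int q2}. G (int D * t + \<beta> * m))"
    by (rule sum_residues_dvd[OF D_pos])
  also have "\<dots> \<ge> (\<Sum>t\<in>{1..<int q2}. G (int D * t + \<beta> * m))" by (rule sum_mono2) (auto simp: G0)
  also have "(\<Sum>t\<in>{1..<int q2}. G (int D * t + \<beta> * m)) = (\<Sum>t\<in>{1..<int q2}. if int d dvd t then \<bar>wt c (\<beta> * m + int D * t)\<bar> else 0)"
  proof (rule sum.cong[OF refl])
    fix t assume t: "t \<in> {1..<int q2}"
    have "\<not> int q2 dvd t" using t zdvd_not_zless[of t "int q2"] by auto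
    then have "\<not> int c dvd int D * t" using D_pos by (simp add: c_eq)
    moreover have "int (d * D) dvd int D * t \<longleftrightarrow> int d dvd t" using D_pos by (simp add: mult.commute)
    ultimately show "G (int D * t + \<beta> * m) = (if int d dvd t then \<bar>wt c (\<beta> * m + int D * t)\<bar> else 0)"
      by (simp add: G_def add.commute del: of_nat_mult)
  qed
  finally show ?thesis by (simp only: G_def)
qed

end

context dedekind_data
begin

text \<open>Bound the gcd by the sum of all common divisors \<open>d\<close> of \<open>t\<close> and
  \<open>q2\<close>. The weight \<open>d\<close> is recovered from the modulus \<open>d D\<close> in
  \<open>off_diagonal_bound\<close>, so only the number of divisors is lost.\<close>

lemma off_diagonal_total:
  "(\<Sum>m\<in>{0..<int c}. \<Sum>t\<in>{1..<int q2}. \<bar>wt c m\<bar> * \<bar>wt c (\<beta> * m + int D * t)\<bar> * of_int (gcd t (int q2)))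
    \<le> 36 * (harm c)\<^sup>2 * real (card {d. d dvd q2}) / real D"
proof -
  have q20: "q2 > 0" using q2_ge by simp
  have fin: "finite {d. d dvd q2}" using q20 by simp
  let ?f = "\<lambda>m t. \<bar>wt c m\<bar> * \<bar>wt c (\<beta> * m + int D * t)\<bar>"
  have g: "real_of_int (gcd t (int q2)) \<le> (\<Sum>d\<in>{d. d dvd q2}. if int d dvd t then real d else 0)" for t
  proof -
    define d0 where "d0 = nat (gcd t (int q2))"
    have d0: "int d0 = gcd t (int q2)" by (simp add: d0_def)
    have "int d0 dvd int q2" "int d0 dvd t" unfolding d0 by simp_all
    then have "d0 \<in> {d. d dvd q2}" "int d0 dvd t" by simp_all
    moreover have "real_of_int (gcd t (int q2)) = real d0" by (simp only: d0[symmetric] of_int_of_nat_eq)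
    ultimately show ?thesis
      using member_le_sum[of d0 "{d. d dvd q2}" "\<lambda>d. if int d dvd t then real d else 0"] fin by simp
  qed
  have "(\<Sum>m\<in>{0..<int c}. \<Sum>t\<in>{1..<int q2}. ?f m t * of_int (gcd t (int q2)))
    \<le> (\<Sum>m\<in>{0..<int c}. \<Sum>t\<in>{1..<int q2}. \<Sum>d\<in>{d. d dvd q2}. real d * (\<bar>wt c m\<bar> * (if int d dvd t then \<bar>wt c (\<beta> * m + int D * t)\<bar> else 0)))"
  proof (intro sum_mono)
    fix m t
    have "?f m t * of_int (gcd t (int q2)) \<le> ?f m t * (\<Sum>d\<in>{d. d dvd q2}. if int d dvd t then real d else 0)"
      by (rule mult_left_mono[OF g]) simp
    also have "\<dots> = (\<Sum>d\<in>{d. d dvd q2}. real d * (\<bar>wt c m\<bar> * (if int d dvd t then \<bar>wt c (\<beta> * m + int D * t)\<bar> else 0)))"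
      unfolding sum_distrib_left by (intro sum.cong refl) simp
    finally show "?f m t * of_int (gcd t (int q2)) \<le> (\<Sum>d\<in>{d. d dvd q2}. real d * (\<bar>wt c m\<bar> * (if int d dvd t then \<bar>wt c (\<beta> * m + int D * t)\<bar> else 0)))" .
  qed
  also have "\<dots> = (\<Sum>m\<in>{0..<int c}. \<Sum>d\<in>{d. d dvd q2}. real d * (\<bar>wt c m\<bar> * (\<Sum>t\<in>{1..<int q2}. if int d dvd t then \<bar>wt c (\<beta> * m + int D * t)\<bar> else 0)))"
    unfolding sum_distrib_left by (intro sum.cong refl sum.swap)
  also have "\<dots> \<le> (\<Sum>m\<in>{0..<int c}. \<Sum>d\<in>{d. d dvd q2}. real d * (\<bar>wt c m\<bar> *
      (\<Sum>l\<in>{0..<int c}. if int (d * D) dvd l - \<beta> * m \<and> \<not> int c dvd l - \<beta> * m then \<bar>wt c l\<bar> else 0)))"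
  proof (intro sum_mono mult_left_mono off_diagonal_row)
    fix d assume d: "d \<in> {d. d dvd q2}"
    then show "d dvd q2" "d > 0" using q20 by (auto intro: dvd_pos_nat)
  qed auto
  also have "\<dots> = (\<Sum>d\<in>{d. d dvd q2}. real d * (\<Sum>m\<in>{0..<int c}. \<Sum>l\<in>{0..<int c}.
      if int (d * D) dvd l - \<beta> * m \<and> \<not> int c dvd l - \<beta> * m then \<bar>wt c m\<bar> * \<bar>wt c l\<bar> else 0))"
  proof -
    have "\<bar>wt c m\<bar> * (\<Sum>l\<in>{0..<int c}. if int (d * D) dvd l - \<beta> * m \<and> \<not> int c dvd l - \<beta> * m then \<bar>wt c l\<bar> else 0) =
      (\<Sum>l\<in>{0..<int c}. if int (d * D) dvd l - \<beta> * m \<and> \<not> int c dvd l - \<beta> * m then \<bar>wt c m\<bar> * \<bar>wt c l\<bar> else 0)" for m d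
      unfolding sum_distrib_left by (intro sum.cong refl) simp
    then show ?thesis by (simp only: sum_distrib_left) (rule sum.swap)
  qed
  also have "\<dots> \<le> (\<Sum>d\<in>{d. d dvd q2}. 36 * (harm c)\<^sup>2 / real D)"
  proof (rule sum_mono)
    fix d assume d: "d \<in> {d. d dvd q2}"
    then have d0: "d > 0" using q20 by (auto intro: dvd_pos_nat)
    have dc: "d * D dvd c" using d by (simp add: c_eq mult.commute)
    have "real d * (\<Sum>m\<in>{0..<int c}. \<Sum>l\<in>{0..<int c}.
      if int (d * D) dvd l - \<beta> * m \<and> \<not> int c dvd l - \<beta> * m then \<bar>wt c m\<bar> * \<bar>wt c l\<bar> else 0) \<le> real d * (36 * (harm c)\<^sup>2 / real (d * D))"
      using d0 D_pos by (intro mult_left_mono off_diagonal_bound[OF c_pos _ dc \<beta>_cases]) auto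
    also have "\<dots> = 36 * (harm c)\<^sup>2 / real D" using d0 by simp
    finally show "real d * (\<Sum>m\<in>{0..<int c}. \<Sum>l\<in>{0..<int c}.
      if int (d * D) dvd l - \<beta> * m \<and> \<not> int c dvd l - \<beta> * m then \<bar>wt c m\<bar> * \<bar>wt c l\<bar> else 0) \<le> 36 * (harm c)\<^sup>2 / real D" .
  qed
  also have "\<dots> = 36 * (harm c)\<^sup>2 * real (card {d. d dvd q2}) / real D" by simp
  finally show ?thesis .
qed

text \<open>\<open>T\<close> correlates \<open>R\<close> at the units \<open>a y\<close> with
  \<open>X2\<close>. The terms \<open>t = 0\<close> give \<open>N diag\<close>, of size at least
  \<open>N/100\<close>, and \<open>big\<close> keeps the others below \<open>N/200\<close>: 7200 is
  \<open>36 * 200\<close>, one factor \<open>3^w\<close> comes from the sieve and the other from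
  \<open>N >= q2/3^w\<close>. Cauchy--Schwarz then yields \<open>N/200^2\<close>.\<close>

theorem R_lower_bound:
  assumes c100: "c \<ge> 100"
    and big: "7200 * 9 ^ card (prime_factors q2) * real (card {d. d dvd q2}) * (harm c)\<^sup>2 \<le> real c"
  shows "(\<Sum>a\<in>{a\<in>{0..<int c}. coprime a (int c)}. (cmod (R a))\<^sup>2) \<ge> real q2 / (40000 * 3 ^ card (prime_factors q2))"
proof -
  define PF where "PF = prime_factors q2"
  define w where "w = card PF"
  define Y where "Y = admissible PF"
  define N where "N = real (card Y)"
  have q20: "q2 > 0" using q2_ge by simp
  have PF: "finite PF" "\<And>p. p \<in> PF \<Longrightarrow> prime p \<and> p dvd q2" by (auto simp: PF_def)
  have finY: "finite Y" unfolding Y_def by (rule finite_admissible)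
  have Ng: "real q2 \<le> 3 ^ w * N"
  proof -
    have "q2 \<le> 3 ^ w * card Y" unfolding w_def Y_def by (rule card_admissible[OF PF])
    then have "real q2 \<le> real (3 ^ w * card Y)" by (simp only: of_nat_le_iff)
    then show ?thesis by (simp add: N_def)
  qed
  have N0: "N > 0"
  proof (rule ccontr)
    assume "\<not> N > 0"
    then have "N = 0" by (simp add: N_def)
    then show False using Ng q20 by simp
  qed
  have Yu: "coprime y (int q2)" if y: "y \<in> Y" for y
  proof (rule ccontr)
    assume "\<not> coprime y (int q2)"
    then have "nat (gcd y (int q2)) \<noteq> 1" by (simp add: coprime_iff_gcd_eq_1)
    then obtain p where p: "prime p" "p dvd nat (gcd y (int q2))" using prime_factor_nat by blast
    have "int p dvd int (nat (gcd y (int q2)))" using p(2) by (simp only: int_dvd_int_iff)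
    then have "int p dvd gcd y (int q2)" by simp
    then have "int p dvd y" "p dvd q2" by (auto dest: dvd_trans)
    then show False using y p(1) q20 by (auto simp: Y_def admissible_def PF_def good_def prime_factors_dvd)
  qed
  define k where "k y = (SOME z. [y * z = 1] (mod int q2))" for y
  have k: "[y * k y = 1] (mod int q2)" if "y \<in> Y" for y
  proof -
    have "\<exists>z. [y * z = 1] (mod int q2)" using Yu[OF that] cong_solve_coprime_int by blast
    then show ?thesis unfolding k_def by (rule someI_ex)
  qed
  \<comment> \<open>At primes of \<open>q2\<close>, \<open>y * a y\<close> is
    \<open>D - \<beta> y\<close>, a unit by \<open>good\<close>. The remaining primes of
    \<open>c\<close> divide \<open>D\<close>, where \<open>a y\<close> is \<open>-\<beta>\<close>, a
    unit by the choice of \<open>\<beta>\<close>.\<close>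
  define a where "a y = - \<beta> + k y * int D" for y
  have au: "coprime (a y) (int c)" if y: "y \<in> Y" for y
  proof (rule ccontr)
    assume "\<not> coprime (a y) (int c)"
    then have "nat (gcd (a y) (int c)) \<noteq> 1" by (simp add: coprime_iff_gcd_eq_1)
    then obtain p where p: "prime p" "p dvd nat (gcd (a y) (int c))" using prime_factor_nat by blast
    have "int p dvd int (nat (gcd (a y) (int c)))" using p(2) by (simp only: int_dvd_int_iff)
    then have "int p dvd gcd (a y) (int c)" by simp
    then have pa: "int p dvd a y" "p dvd c" by (auto dest: dvd_trans)
    show False
    proof (cases "p dvd q2")
      case True
      have "[y * k y = 1] (mod int p)" using k[OF y] True cong_dvd_modulus by (metis int_dvd_int_iff)
      then have "[y * k y * int D - \<beta> * y = 1 * int D - \<beta> * y] (mod int p)" by (intro cong_diff cong_mult cong_refl)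
      moreover have "y * k y * int D - \<beta> * y = y * a y" by (simp add: a_def algebra_simps)
      ultimately have "int p dvd int D - \<beta> * y" using pa(1) cong_dvd_iff by fastforce
      moreover have "good p y" using y p(1) True q20 by (auto simp: Y_def admissible_def PF_def prime_factors_dvd)
      ultimately show False by (simp add: good_def)
    next
      case False
      then have "p dvd D" using pa(2) p(1) by (simp add: c_eq prime_dvd_mult_iff)
      then have "int p dvd k y * int D" by simp
      then have "int p dvd \<beta>" using dvd_diff[OF _ pa(1), of "k y * int D"] by (simp add: a_def)
      then have "int p dvd 2" using \<beta>_cases by auto
      then have "p dvd 2" by presburger
      then have "p = 2" using p(1) by (metis primes_dvd_imp_eq two_is_prime_nat)
      then have "\<beta> = 1" using \<open>p dvd D\<close> by (simp add: \<beta>_def)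
      then show False using \<open>int p dvd \<beta>\<close> p(1) by simp
    qed
  qed
  define C where "C t m = (\<Sum>y\<in>Y. X2 (t * y + m))" for t m
  have Cb: "cmod (C t m) \<le> 3 ^ w * of_int (gcd t (int q2))" for t m
    using sieve_bound[OF PF, of 1 0 t m] by (simp add: C_def Y_def sum_admissible w_def)
  define T where "T = (\<Sum>y\<in>Y. X2 y * R (a y))"
  have row: "X2 y * R (a y) = (\<Sum>m\<in>{0..<int c}. \<Sum>t\<in>{0..<int q2}. of_real (wt c m * wt c (\<beta> * m + int D * t)) * X1 m * X2 (t * y + m))"
    if y: "y \<in> Y" for y
  proof -
    \<comment> \<open>The reason for taking \<open>k y\<close> inverse to \<open>y\<close>: the
      factor \<open>X2 y\<close> makes the argument linear in \<open>y\<close>, as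
      \<open>sieve_bound\<close> requires.\<close>
    have "X2 y * X2 (t + k y * m) = X2 (t * y + m)" for t m
    proof -
      have "[y * k y * m + t * y = 1 * m + t * y] (mod int q2)" by (intro cong_add cong_mult k[OF y] cong_refl)
      then have "X2 (y * k y * m + t * y) = X2 (1 * m + t * y)" by (rule periodic_cong[OF D2(3)])
      then show ?thesis unfolding D2(2)[symmetric] by (simp add: algebra_simps)
    qed
    then have e: "X2 y * (r * X1 m * X2 (t + k y * m)) = r * X1 m * X2 (t * y + m)" for r t m by (metis mult.assoc mult.left_commute)
    show ?thesis unfolding a_def R_row sum_distrib_left by (simp only: e)
  qed
  let ?g = "\<lambda>m t. of_real (wt c m * wt c (\<beta> * m + int D * t)) * X1 m * C t m"
  have T: "T = (\<Sum>m\<in>{0..<int c}. \<Sum>t\<in>{0..<int q2}. ?g m t)"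
  proof -
    have "T = (\<Sum>y\<in>Y. \<Sum>m\<in>{0..<int c}. \<Sum>t\<in>{0..<int q2}. of_real (wt c m * wt c (\<beta> * m + int D * t)) * X1 m * X2 (t * y + m))"
      unfolding T_def by (intro sum.cong refl row)
    also have "\<dots> = (\<Sum>m\<in>{0..<int c}. \<Sum>y\<in>Y. \<Sum>t\<in>{0..<int q2}. of_real (wt c m * wt c (\<beta> * m + int D * t)) * X1 m * X2 (t * y + m))"
      by (rule sum.swap)
    also have "\<dots> = (\<Sum>m\<in>{0..<int c}. \<Sum>t\<in>{0..<int q2}. ?g m t)"
      unfolding C_def sum_distrib_left by (intro sum.cong refl sum.swap)
    finally show ?thesis .
  qed
  have "{0..<int q2} = insert 0 {1..<int q2}" using q20 by auto
  then have T2: "T = of_real N * diag + (\<Sum>m\<in>{0..<int c}. \<Sum>t\<in>{1..<int q2}. ?g m t)"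
    unfolding T by (simp add: C_def N_def diag_def sum.distrib sum_distrib_left mult_ac)
  have err: "cmod (\<Sum>m\<in>{0..<int c}. \<Sum>t\<in>{1..<int q2}. ?g m t) \<le> N / 200"
  proof -
    have "cmod (\<Sum>m\<in>{0..<int c}. \<Sum>t\<in>{1..<int q2}. ?g m t) \<le> (\<Sum>m\<in>{0..<int c}. \<Sum>t\<in>{1..<int q2}. cmod (?g m t))"
      by (intro order_trans[OF norm_sum] sum_mono norm_sum)
    also have "\<dots> \<le> (\<Sum>m\<in>{0..<int c}. \<Sum>t\<in>{1..<int q2}. 3 ^ w * (\<bar>wt c m\<bar> * \<bar>wt c (\<beta> * m + int D * t)\<bar> * of_int (gcd t (int q2))))"
    proof (intro sum_mono)
      fix m t
      have "cmod (X1 m) * cmod (C t m) \<le> 1 * (3 ^ w * of_int (gcd t (int q2)))"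
        using dirichlet_character_norm_le[OF dc1] Cb by (intro mult_mono) auto
      then have "\<bar>wt c m\<bar> * \<bar>wt c (\<beta> * m + int D * t)\<bar> * (cmod (X1 m) * cmod (C t m)) \<le> \<bar>wt c m\<bar> * \<bar>wt c (\<beta> * m + int D * t)\<bar> * (1 * (3 ^ w * of_int (gcd t (int q2))))"
        by (intro mult_left_mono) auto
      then show "cmod (?g m t) \<le> 3 ^ w * (\<bar>wt c m\<bar> * \<bar>wt c (\<beta> * m + int D * t)\<bar> * of_int (gcd t (int q2)))"
        by (simp add: norm_mult abs_mult mult_ac)
    qed
    also have "\<dots> = 3 ^ w * (\<Sum>m\<in>{0..<int c}. \<Sum>t\<in>{1..<int q2}. \<bar>wt c m\<bar> * \<bar>wt c (\<beta> * m + int D * t)\<bar> * of_int (gcd t (int q2)))"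
      by (simp only: sum_distrib_left)
    also have "\<dots> \<le> 3 ^ w * (36 * (harm c)\<^sup>2 * real (card {d. d dvd q2}) / real D)"
      by (intro mult_left_mono off_diagonal_total) simp
    also have "\<dots> \<le> N / 200"
    proof -
      have "7200 * 3 ^ w * real (card {d. d dvd q2}) * (harm c)\<^sup>2 * 3 ^ w \<le> real D * real q2"
      proof -
        have "(9::real) ^ w = 3 ^ w * 3 ^ w" by (simp add: power_mult_distrib[symmetric])
        then show ?thesis using big by (simp add: w_def[symmetric] PF_def[symmetric] c_eq mult_ac)
      qed
      also have "\<dots> \<le> real D * (3 ^ w * N)" using Ng by (intro mult_left_mono) auto
      finally have "3 ^ w * (7200 * 3 ^ w * real (card {d. d dvd q2}) * (harm c)\<^sup>2) \<le> 3 ^ w * (real D * N)" by (simp add: mult_ac)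
      then have "7200 * 3 ^ w * real (card {d. d dvd q2}) * (harm c)\<^sup>2 \<le> real D * N" by simp
      then show ?thesis using D_pos by (simp add: field_simps)
    qed
    finally show ?thesis .
  qed
  have Tg: "cmod T \<ge> N / 200"
  proof -
    have "cmod (of_real N * diag) \<ge> N * (1 / 100)"
      using norm_diag_ge[OF c100] N0 by (simp add: norm_mult mult_left_mono[of "1 / 100" "cmod diag" N, simplified])
    moreover have "cmod T \<ge> cmod (of_real N * diag) - cmod (\<Sum>m\<in>{0..<int c}. \<Sum>t\<in>{1..<int q2}. ?g m t)"
      unfolding T2 by (rule norm_diff_ineq)
    ultimately show ?thesis using err by linarith
  qed
  let ?Q = "\<Sum>y\<in>Y. (cmod (R (a y)))\<^sup>2"
  have "cmod T \<le> (\<Sum>y\<in>Y. 1 * cmod (R (a y)))"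
    unfolding T_def
  proof (intro order_trans[OF norm_sum] sum_mono)
    fix y show "cmod (X2 y * R (a y)) \<le> 1 * cmod (R (a y))"
      unfolding norm_mult using dirichlet_character_norm_le[OF dc2] by (intro mult_right_mono) auto
  qed
  then have "(cmod T)\<^sup>2 \<le> (\<Sum>y\<in>Y. 1 * cmod (R (a y)))\<^sup>2" by (intro power_mono) auto
  also have "\<dots> \<le> (\<Sum>y\<in>Y. 1) * (\<Sum>y\<in>Y. 1 * (cmod (R (a y)))\<^sup>2)" by (rule weighted_cauchy_schwarz) simp
  also have "\<dots> = N * ?Q" by (simp add: N_def)
  finally have "(cmod T)\<^sup>2 \<le> N * ?Q" .
  moreover have "(N / 200)\<^sup>2 \<le> (cmod T)\<^sup>2" using Tg N0 by (intro power_mono) auto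
  ultimately have "N * (N / 40000) \<le> N * ?Q" by (simp add: power2_eq_square)
  then have "N / 40000 \<le> ?Q" using N0 by (simp only: mult_le_cancel_left_pos)
  moreover have "?Q \<le> (\<Sum>a\<in>{a\<in>{0..<int c}. coprime a (int c)}. (cmod (R a))\<^sup>2)"
  proof -
    have inj: "inj_on (\<lambda>y. a y mod int c) Y"
    proof (rule inj_onI)
      fix y z assume yz: "y \<in> Y" "z \<in> Y" "a y mod int c = a z mod int c"
      then have "int c dvd a y - a z" by (simp add: mod_eq_dvd_iff)
      moreover have "a y - a z = int D * (k y - k z)" by (simp add: a_def algebra_simps)
      ultimately have "int D * int q2 dvd int D * (k y - k z)" by (simp add: c_eq)
      then have kk: "[k y = k z] (mod int q2)" using D_pos by (simp add: cong_iff_dvd_diff)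
      have "[y * (z * k z) = y * 1] (mod int q2)" by (intro cong_mult k[OF yz(2)] cong_refl)
      moreover have "[y * (z * k z) = y * (z * k y)] (mod int q2)" by (intro cong_mult cong_sym[OF kk] cong_refl)
      moreover have "y * (z * k y) = z * (y * k y)" by simp
      moreover have "[z * (y * k y) = z * 1] (mod int q2)" by (intro cong_mult k[OF yz(1)] cong_refl)
      ultimately have "[y = z] (mod int q2)" by (metis cong_sym cong_trans mult.right_neutral)
      moreover have "y \<in> {0..<int q2}" "z \<in> {0..<int q2}" using yz by (auto simp: Y_def admissible_def)
      ultimately show "y = z" by (simp add: cong_def)
    qed
    have "?Q = (\<Sum>y\<in>Y. (cmod (R (a y mod int c)))\<^sup>2)" by (simp only: periodic_mod[OF R_periodic])
    also have "\<dots> = (\<Sum>x\<in>(\<lambda>y. a y mod int c) ` Y. (cmod (R x))\<^sup>2)" by (simp add: sum.reindex[OF inj])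
    also have "\<dots> \<le> (\<Sum>a\<in>{a\<in>{0..<int c}. coprime a (int c)}. (cmod (R a))\<^sup>2)"
    proof (rule sum_mono2)
      show "finite {a\<in>{0..<int c}. coprime a (int c)}" by (rule finite_subset[of _ "{0..<int c}"]) auto
      show "(\<lambda>y. a y mod int c) ` Y \<subseteq> {a\<in>{0..<int c}. coprime a (int c)}"
        using au c_pos by (auto simp: coprime_iff_gcd_eq_1)
    qed simp
    finally show ?thesis .
  qed
  moreover have "real q2 / (40000 * 3 ^ w) \<le> N / 40000" using Ng by (simp add: field_simps)
  ultimately show ?thesis unfolding w_def PF_def by linarith
qed

end

section \<open>Uniformity in the characters\<close>

text \<open>A character is determined by its values on one period, each of which is 0 or a root of
  unity of order dividing \<open>totient q\<close>.\<close>

lemma finite_dirichlet_characters: "finite {\<xi>. dirichlet_character q \<xi>}"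
proof (cases "q = 0")
  case True
  then show ?thesis by (simp add: dirichlet_character_def)
next
  case False
  define Z where "Z = insert 0 {z::complex. z ^ totient q = 1}"
  have t: "totient q > 0" using False by simp
  then have "card {z::complex. z ^ totient q = 1} = totient q" by (intro card_complex_roots_unity) linarith
  then have "finite {z::complex. z ^ totient q = 1}" using t by (intro card_ge_0_finite) simp
  then have Z: "finite Z" by (simp add: Z_def)
  let ?r = "\<lambda>\<xi>. restrict \<xi> {0..<int q}"
  have "inj_on ?r {\<xi>. dirichlet_character q \<xi>}"
  proof (rule inj_onI)
    fix \<xi> \<psi> assume a: "\<xi> \<in> {\<xi>. dirichlet_character q \<xi>}" "\<psi> \<in> {\<xi>. dirichlet_character q \<xi>}" "?r \<xi> = ?r \<psi>"
    show "\<xi> = \<psi>"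
    proof
      fix x
      have "x mod int q \<in> {0..<int q}" using False by simp
      then have "\<xi> (x mod int q) = \<psi> (x mod int q)" using fun_cong[OF a(3), of "x mod int q"] by simp
      then show "\<xi> x = \<psi> x" using a dirichlet_characterD(3) periodic_mod by (metis mem_Collect_eq)
    qed
  qed
  moreover have "?r ` {\<xi>. dirichlet_character q \<xi>} \<subseteq> {0..<int q} \<rightarrow>\<^sub>E Z"
  proof
    fix f assume "f \<in> ?r ` {\<xi>. dirichlet_character q \<xi>}"
    then obtain \<xi> where x: "dirichlet_character q \<xi>" "f = ?r \<xi>" by blast
    have "\<xi> a \<in> Z" for a
      using dirichlet_character_root[OF x(1), of a] dirichlet_characterD(4)[OF x(1), of a] by (auto simp: Z_def)
    then show "f \<in> {0..<int q} \<rightarrow>\<^sub>E Z" unfolding x(2) by auto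
  qed
  moreover have "finite ({0..<int q} \<rightarrow>\<^sub>E Z)" by (intro finite_PiE Z) auto
  ultimately show ?thesis using inj_on_finite by blast
qed

lemma finite_uniform_lower:
  fixes v w :: "'a \<Rightarrow> real"
  assumes "finite F" "\<And>x. x \<in> F \<Longrightarrow> v x > 0" "\<And>x. x \<in> F \<Longrightarrow> w x \<ge> 0"
  shows "\<exists>A>0. \<forall>x\<in>F. A * w x \<le> v x"
  using assms
proof (induction F rule: finite_induct)
  case empty then show ?case by (intro exI[of _ 1]) auto
next
  case (insert x F)
  then obtain A where A: "A > 0" "\<forall>x\<in>F. A * w x \<le> v x" by blast
  have x: "v x > 0" "w x \<ge> 0" using insert.prems by auto
  \<comment> \<open>Adding 1 keeps the denominator positive when \<open>w x = 0\<close>.\<close>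
  define B where "B = min A (v x / (w x + 1))"
  have "B > 0" using A x by (simp add: B_def)
  moreover have "B * w y \<le> v y" if "y \<in> insert x F" for y
  proof (cases "y = x")
    case True
    have "B * w x \<le> v x / (w x + 1) * (w x + 1)"
      using x \<open>B > 0\<close> by (intro mult_mono) (auto simp: B_def)
    then show ?thesis using x True by simp
  next
    case False
    then have y: "y \<in> F" using that by blast
    then have "B * w y \<le> A * w y" using insert.prems(2)[of y] by (intro mult_right_mono) (auto simp: B_def)
    then show ?thesis using A(2) y by force
  qed
  ultimately show ?case by blast
qed

section \<open>Bounds for divisor counts, prime factors and harmonic numbers\<close>

lemma card_divisors_le: assumes "n > 0" shows "real (card {d. d dvd n}) \<le> 2 * sqrt (real n)"
proof -
  define A where "A = {d. d dvd n \<and> d * d \<le> n}"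
  have fin: "finite {d. d dvd n}" using assms by simp
  then have finA: "finite A" by (rule finite_subset[rotated]) (auto simp: A_def)
  have "{d. d dvd n} \<subseteq> A \<union> (\<lambda>d. n div d) ` A"
  proof
    fix d assume "d \<in> {d. d dvd n}"
    then obtain e where e: "n = d * e" by (auto elim: dvdE)
    show "d \<in> A \<union> (\<lambda>d. n div d) ` A"
    proof (cases "d \<le> e")
      case True
      then show ?thesis using e by (auto simp: A_def)
    next
      case False
      then have "e \<in> A" using e by (auto simp: A_def)
      moreover have "e > 0" using e assms by (cases e) auto
      then have "n div e = d" using e by simp
      ultimately show ?thesis by force
    qed
  qed
  then have "card {d. d dvd n} \<le> card (A \<union> (\<lambda>d. n div d) ` A)" using finA by (intro card_mono) auto
  also have "\<dots> \<le> card A + card A"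
    using card_Un_le[of A "(\<lambda>d. n div d) ` A"] card_image_le[OF finA, of "\<lambda>d. n div d"] by linarith
  finally have "real (card {d. d dvd n}) \<le> 2 * real (card A)" by simp
  moreover have "real (card A) \<le> sqrt (real n)"
  proof -
    have "A \<subseteq> {1..nat \<lfloor>sqrt (real n)\<rfloor>}"
    proof
      fix d assume d: "d \<in> A"
      then have "d > 0" using assms by (auto simp: A_def intro: dvd_pos_nat)
      moreover have "real d * real d \<le> real n" using d by (simp add: A_def flip: of_nat_mult)
      then have "real d \<le> sqrt (real n)" by (intro real_le_rsqrt) (simp add: power2_eq_square)
      then have "d \<le> nat \<lfloor>sqrt (real n)\<rfloor>" by (simp add: le_nat_floor)
      ultimately show "d \<in> {1..nat \<lfloor>sqrt (real n)\<rfloor>}" by simp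
    qed
    then have "card A \<le> nat \<lfloor>sqrt (real n)\<rfloor>" using card_mono[of "{1..nat \<lfloor>sqrt (real n)\<rfloor>}" A] by simp
    then show ?thesis by (meson of_nat_floor order_trans of_nat_le_iff real_sqrt_ge_zero of_nat_0_le_iff)
  qed
  ultimately show ?thesis by linarith
qed

lemma prod_prime_factors_le: assumes "n > 0" shows "(\<Prod>p\<in>prime_factors n. p) \<le> (n::nat)"
proof -
  have "(\<Prod>p\<in>prime_factors n. p) \<le> (\<Prod>p\<in>prime_factors n. p ^ multiplicity p n)"
  proof (rule prod_mono)
    fix p assume p: "p \<in> prime_factors n"
    then have "multiplicity p n \<ge> 1" by (simp add: prime_factors_multiplicity)
    moreover have "p \<ge> 1" using in_prime_factors_imp_prime[OF p] by (rule prime_ge_1_nat)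
    ultimately have "p ^ 1 \<le> p ^ multiplicity p n" by (intro power_increasing)
    then show "0 \<le> p \<and> p \<le> p ^ multiplicity p n" by simp
  qed
  also have "\<dots> = n" using prime_factorization_nat[OF assms] by simp
  finally show ?thesis .
qed

text \<open>Primes with \<open>p^\<delta> >= r\<close> pay for themselves; the others are less than
  \<open>P\<close>, hence contribute at most \<open>r^P\<close>.\<close>

lemma power_omega_bound:
  fixes r \<delta> :: real
  assumes "r \<ge> 1" "\<delta> > 0"
  shows "\<exists>C\<ge>1. \<forall>n>0. r ^ card (prime_factors n) \<le> C * real n powr \<delta>"
proof -
  define P where "P = nat \<lceil>r powr (1 / \<delta>)\<rceil>"
  have P: "r \<le> real p powr \<delta>" if "p \<ge> P" for p
  proof -
    have "r powr (1 / \<delta>) \<le> real p" using that unfolding P_def by linarith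
    then have "(r powr (1 / \<delta>)) powr \<delta> \<le> real p powr \<delta>" using assms by (intro powr_mono2) auto
    then show ?thesis using assms by (simp add: powr_powr)
  qed
  have "r ^ card (prime_factors n) \<le> r ^ P * real n powr \<delta>" if n: "n > 0" for n
  proof -
    let ?S = "prime_factors n"
    have "r ^ card ?S = (\<Prod>p\<in>?S. r)" by simp
    also have "\<dots> \<le> (\<Prod>p\<in>?S. (if p < P then r else 1) * real p powr \<delta>)"
    proof (rule prod_mono)
      fix p assume p: "p \<in> ?S"
      have "p \<ge> 1" using in_prime_factors_imp_prime[OF p] by (rule prime_ge_1_nat)
      then have p1: "1 \<le> real p powr \<delta>" using assms by (intro ge_one_powr_ge_zero) auto
      show "0 \<le> r \<and> r \<le> (if p < P then r else 1) * real p powr \<delta>"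
        using P[of p] p1 assms mult_left_mono[OF p1, of r] by auto
    qed
    also have "\<dots> = (\<Prod>p\<in>?S. if p < P then r else 1) * (\<Prod>p\<in>?S. real p powr \<delta>)" by (rule prod.distrib)
    also have "\<dots> \<le> r ^ P * real n powr \<delta>"
    proof (rule mult_mono)
      have "(\<Prod>p\<in>?S. if p < P then r else 1) = r ^ card {p\<in>?S. p < P}"
        by (simp flip: prod.inter_filter)
      also have "\<dots> \<le> r ^ P"
      proof (rule power_increasing)
        show "card {p\<in>?S. p < P} \<le> P" using card_mono[of "{..<P}" "{p\<in>?S. p < P}"] by auto
      qed (use assms in simp)
      finally show "(\<Prod>p\<in>?S. if p < P then r else 1) \<le> r ^ P" .
      have "(\<Prod>p\<in>?S. real p powr \<delta>) = (\<Prod>p\<in>?S. real p) powr \<delta>" by (rule prod_powr_distrib[symmetric])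
      also have "\<dots> = real (\<Prod>p\<in>?S. p) powr \<delta>" by simp
      also have "\<dots> \<le> real n powr \<delta>"
      proof (rule powr_mono2)
        show "real (\<Prod>p\<in>?S. p) \<le> real n" using prod_prime_factors_le[OF n] by (simp only: of_nat_le_iff)
      qed (use assms in \<open>auto intro: prod_nonneg\<close>)
      finally show "(\<Prod>p\<in>?S. real p powr \<delta>) \<le> real n powr \<delta>" .
    qed (use assms in \<open>auto intro: prod_nonneg\<close>)
    finally show ?thesis .
  qed
  moreover have "r ^ P \<ge> 1" using assms by simp
  ultimately show ?thesis by blast
qed

lemma harm_powr_bound:
  assumes "\<delta> > 0" "c > 0"
  shows "harm c \<le> (1 + 1 / \<delta>) * real c powr \<delta>"
proof -
  have c1: "real c \<ge> 1" using assms by simp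
  have "harm c \<le> 1 + ln (real c)" using assms by (intro harm_le_ln)
  also have "ln (real c) \<le> real c powr \<delta> / \<delta>" by (rule ln_powr_bound[OF c1 assms(1)])
  also have "1 \<le> real c powr \<delta>" using c1 assms by (intro ge_one_powr_ge_zero) auto
  finally show ?thesis by (simp add: algebra_simps)
qed

section \<open>Bounds for the second moment\<close>

abbreviation (input) moment :: "nat \<Rightarrow> (int \<Rightarrow> complex) \<Rightarrow> (int \<Rightarrow> complex) \<Rightarrow> nat \<Rightarrow> real" where
  "moment q1 X1 X2 c \<equiv> (\<Sum>a\<in>{a\<in>{0..<int c}. coprime a (int c)}. (cmod (dedekind_sum q1 X1 X2 a c))\<^sup>2)"

lemma moment_pos:
  assumes "primitive_character q1 X1" "nontrivial_character q1 X1" "primitive_character q2 X2" "nontrivial_character q2 X2"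
    and "X1 (- 1) * X2 (- 1) = 1" "c > 0" "q1 * q2 dvd c"
  shows "moment q1 X1 X2 c > 0"
proof -
  have dc: "dirichlet_character q1 X1" "dirichlet_character q2 X2" using assms by (auto simp: primitive_character_def)
  have "nonvanishing q1 X1 X2 c" by (rule nonvanishing_all[OF dc assms(1-5,7,6)])
  then obtain a where a: "coprime a (int c)" "dedekind_sum q1 X1 X2 a c \<noteq> 0" by (auto simp: nonvanishing_def[OF dc])
  have "q1 dvd c" using assms(7) by (rule dvd_mult_left)
  then have "dedekind_sum q1 X1 X2 (a mod int c) c \<noteq> 0"
    using a(2) periodic_mod[OF dedekind_sum_periodic[OF dc assms(6)]] by metis
  moreover have "a mod int c \<in> {a\<in>{0..<int c}. coprime a (int c)}" using a(1) assms(6) by (simp add: coprime_iff_gcd_eq_1)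
  moreover have "finite {a\<in>{0..<int c}. coprime a (int c)}" by (rule finite_subset[of _ "{0..<int c}"]) auto
  ultimately show ?thesis by (intro sum_pos2[of _ "a mod int c"]) auto
qed

context dedekind_data
begin

lemma moment_eq: "moment q1 X1 X2 c = (real D)\<^sup>2 * real q1 * real q2 / 16 * (\<Sum>a\<in>{a\<in>{0..<int c}. coprime a (int c)}. (cmod (R a))\<^sup>2)"
  by (rule sum_norm_dedekind_sum)

text \<open>The factor 1/16 of \<open>moment_eq\<close> turns 352 into 22, and the two factors
  \<open>q2\<close> complete \<open>D^2\<close> to \<open>c^2\<close>.\<close>

lemma moment_upper: "moment q1 X1 X2 c \<le> 22 * real q1 * (real c)\<^sup>2 * harm c ^ 4"
proof -
  have "(\<Sum>a\<in>{a\<in>{0..<int c}. coprime a (int c)}. (cmod (R a))\<^sup>2) \<le> (\<Sum>a\<in>{0..<int c}. (cmod (R a))\<^sup>2)"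
    by (rule sum_mono2) auto
  also have "\<dots> \<le> 352 * real q2 * harm c ^ 4" by (rule R_upper_bound)
  finally have "moment q1 X1 X2 c \<le> (real D)\<^sup>2 * real q1 * real q2 / 16 * (352 * real q2 * harm c ^ 4)"
    unfolding moment_eq by (intro mult_left_mono) auto
  also have "\<dots> = 22 * real q1 * (real c)\<^sup>2 * harm c ^ 4" by (simp add: c_eq power2_eq_square)
  finally show ?thesis .
qed

text \<open>As in the upper bound, with \<open>640000 = 16 * 40000\<close>.\<close>

lemma moment_lower:
  assumes "c \<ge> 100" "7200 * 9 ^ card (prime_factors q2) * real (card {d. d dvd q2}) * (harm c)\<^sup>2 \<le> real c"
  shows "real q1 * (real c)\<^sup>2 / (640000 * 3 ^ card (prime_factors q2)) \<le> moment q1 X1 X2 c"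
proof -
  have "real q1 * (real c)\<^sup>2 / (640000 * 3 ^ card (prime_factors q2)) =
    (real D)\<^sup>2 * real q1 * real q2 / 16 * (real q2 / (40000 * 3 ^ card (prime_factors q2)))"
    by (simp add: c_eq power2_eq_square)
  also have "\<dots> \<le> moment q1 X1 X2 c"
    unfolding moment_eq by (intro mult_left_mono R_lower_bound[OF assms]) auto
  finally show ?thesis .
qed

end

theorem theorem1p2:
  fixes \<epsilon> :: real
  assumes "\<epsilon> > 0"
  shows "\<exists>A>0. \<exists>B>0. \<forall>(q1::nat) (q2::nat) (\<chi>1 :: int \<Rightarrow> complex) (\<chi>2 :: int \<Rightarrow> complex) (c::nat).
           primitive_character q1 \<chi>1 \<longrightarrow> nontrivial_character q1 \<chi>1 \<longrightarrow>
           primitive_character q2 \<chi>2 \<longrightarrow> nontrivial_character q2 \<chi>2 \<longrightarrow>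
           \<chi>1 (-1) * \<chi>2 (-1) = 1 \<longrightarrow>
           c > 0 \<longrightarrow> q1 * q2 dvd c \<longrightarrow>
             A * real q1 * real c powr (2 - \<epsilon>)
               \<le> (\<Sum>a\<in>{a\<in>{0..<int c}. coprime a (int c)}. (cmod (dedekind_sum q1 \<chi>1 \<chi>2 a c))\<^sup>2) \<and>
             (\<Sum>a\<in>{a\<in>{0..<int c}. coprime a (int c)}. (cmod (dedekind_sum q1 \<chi>1 \<chi>2 a c))\<^sup>2)
               \<le> B * real q1 * real c powr (2 + \<epsilon>)"
proof -
  obtain C3 where C3: "C3 \<ge> 1" "\<forall>n>0. 3 ^ card (prime_factors n) \<le> C3 * real n powr \<epsilon>"
    using power_omega_bound[of 3 \<epsilon>] assms by auto
  obtain C9 where C9: "C9 \<ge> 1" "\<forall>n>0. 9 ^ card (prime_factors n) \<le> C9 * real n powr (1 / 8)"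
    using power_omega_bound[of 9 "1 / 8"] by auto
  \<comment> \<open>The factor \<open>14400 = 7200 * 2\<close> includes the 2 of
    \<open>card_divisors_le\<close>; 17 is \<open>1 + 16\<close> from \<open>harm_powr_bound\<close>
    with exponent 1/16.\<close>
  define K where "K = 14400 * C9 * 17\<^sup>2"
  have K: "K > 0" using C9 by (simp add: K_def)
  \<comment> \<open>From \<open>N\<close> on, \<open>K <= c^(1/4)\<close>. The estimates of the
    hypothesis of \<open>moment_lower\<close> cost \<open>c^(1/8 + 1/2 + 1/8) = c^(3/4)\<close>, so
    that hypothesis holds.\<close>
  define N where "N = max 100 (nat \<lceil>K ^ 4\<rceil>)"
  define good :: "nat \<times> nat \<times> (int \<Rightarrow> complex) \<times> (int \<Rightarrow> complex) \<times> nat \<Rightarrow> bool" where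
    "good = (\<lambda>(q1, q2, X1, X2, c). primitive_character q1 X1 \<and> nontrivial_character q1 X1 \<and>
        primitive_character q2 X2 \<and> nontrivial_character q2 X2 \<and> X1 (- 1) * X2 (- 1) = 1 \<and> c > 0 \<and> q1 * q2 dvd c)"
  \<comment> \<open>The data with level below \<open>N\<close>; a finite set, because
    \<open>q1\<close> and \<open>q2\<close> divide \<open>c\<close>. There the constant comes from
    the positivity of the moment alone.\<close>
  define F where "F = {x. good x \<and> snd (snd (snd (snd x))) < N}"
  have "finite F"
  proof (rule finite_subset)
    let ?X = "\<Union>q\<in>{..N}. {\<xi>. dirichlet_character q \<xi>}"
    show "F \<subseteq> {..N} \<times> {..N} \<times> ?X \<times> ?X \<times> {..N}"
    proof
      fix x assume "x \<in> F"
      then obtain q1 q2 X1 X2 c where x: "x = (q1, q2, X1, X2, c)" "good (q1, q2, X1, X2, c)" "c < N"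
        unfolding F_def by (metis (mono_tags, lifting) mem_Collect_eq prod.collapse snd_conv)
      have d: "dirichlet_character q1 X1" "dirichlet_character q2 X2" "c > 0" "q1 dvd c" "q2 dvd c"
        using x(2) by (auto simp: good_def primitive_character_def dest: dvd_mult_left dvd_mult_right)
      then have "q1 \<le> N" "q2 \<le> N" using x(3) by (meson dvd_imp_le le_trans less_imp_le)+
      then show "x \<in> {..N} \<times> {..N} \<times> ?X \<times> ?X \<times> {..N}" using d x by auto
    qed
    have "finite ?X" by (intro finite_UN_I finite_dirichlet_characters) auto
    then show "finite ({..N} \<times> {..N} \<times> ?X \<times> ?X \<times> {..N})" by (intro finite_cartesian_product) auto
  qed
  moreover have "(\<lambda>(q1, q2, X1, X2, c). moment q1 X1 X2 c) x > 0" if "x \<in> F" for x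
    using that moment_pos by (auto simp: F_def good_def split: prod.splits)
  moreover have "(\<lambda>(q1, q2, X1, X2, c). real q1 * real c powr (2 - \<epsilon>)) x \<ge> 0"
    for x :: "nat \<times> nat \<times> (int \<Rightarrow> complex) \<times> (int \<Rightarrow> complex) \<times> nat"
    by (cases x) auto
  ultimately obtain A0 where A0: "A0 > 0"
    "\<forall>x\<in>F. A0 * (\<lambda>(q1, q2, X1, X2, c). real q1 * real c powr (2 - \<epsilon>)) x \<le> (\<lambda>(q1, q2, X1, X2, c). moment q1 X1 X2 c) x"
    using finite_uniform_lower[of F "\<lambda>(q1, q2, X1, X2, c). moment q1 X1 X2 c" "\<lambda>(q1, q2, X1, X2, c). real q1 * real c powr (2 - \<epsilon>)"]
    by blast
  define A where "A = min A0 (1 / (640000 * C3))"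
  \<comment> \<open>\<open>harm c\<close> enters to the fourth power, so it is bounded with exponent
    \<open>\<epsilon>/4\<close>.\<close>
  define B where "B = 22 * (1 + 4 / \<epsilon>) ^ 4"
  have "1 + 4 / \<epsilon> > 0" using assms by (intro add_pos_pos) auto
  then have AB: "A > 0" "B > 0" using A0(1) C3(1) by (auto simp: A_def B_def)
  have "A * real q1 * real c powr (2 - \<epsilon>) \<le> moment q1 X1 X2 c \<and> moment q1 X1 X2 c \<le> B * real q1 * real c powr (2 + \<epsilon>)"
    if g: "good (q1, q2, X1, X2, c)" for q1 q2 X1 X2 c
  proof -
    have c0: "c > 0" "q1 * q2 dvd c" using g by (auto simp: good_def)
    have dc: "dirichlet_character q1 X1" "dirichlet_character q2 X2" using g by (auto simp: good_def primitive_character_def)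
    have q20: "q2 > 0" using dirichlet_characterD(1) dc by blast
    define D where "D = c div q2"
    have cD: "c = D * q2" using c0(2) by (simp add: D_def dvd_mult_right)
    have qD: "q1 dvd D" using c0(2) q20 by (simp add: cD)
    have D0: "D > 0" using c0(1) cD by (cases D) auto
    interpret dedekind_data q1 q2 D c X1 X2
    proof unfold_locales
      show "primitive_character q1 X1" "nontrivial_character q1 X1" "primitive_character q2 X2" "nontrivial_character q2 X2"
        "X1 (- 1) * X2 (- 1) = 1" using g unfolding good_def by simp_all
    qed (fact cD D0 qD)+
    have c1: "real c \<ge> 1" using c0 by simp
    have p2: "real c powr 2 = (real c)\<^sup>2" using c0 by (simp add: powr_numeral)
    have "q2 \<le> c" using cD D0 by simp
    then have q2c: "real q2 \<le> real c" by (simp only: of_nat_le_iff)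
    have up: "moment q1 X1 X2 c \<le> B * real q1 * real c powr (2 + \<epsilon>)"
    proof -
      have "harm c ^ 4 \<le> ((1 + 1 / (\<epsilon> / 4)) * real c powr (\<epsilon> / 4)) ^ 4"
        using assms c0 by (intro power_mono harm_powr_bound harm_nonneg) auto
      also have "\<dots> = (1 + 4 / \<epsilon>) ^ 4 * real c powr \<epsilon>"
        using c0 by (simp add: power_mult_distrib powr_power)
      finally have "22 * real q1 * (real c)\<^sup>2 * harm c ^ 4 \<le> 22 * real q1 * (real c)\<^sup>2 * ((1 + 4 / \<epsilon>) ^ 4 * real c powr \<epsilon>)"
        by (intro mult_left_mono) auto
      also have "\<dots> = B * real q1 * real c powr (2 + \<epsilon>)" by (simp add: B_def powr_add p2 mult_ac)
      finally show ?thesis using moment_upper by linarith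
    qed
    have "A * real q1 * real c powr (2 - \<epsilon>) \<le> moment q1 X1 X2 c"
    proof (cases "c < N")
      case True
      then have "(q1, q2, X1, X2, c) \<in> F" using g by (simp add: F_def)
      then have "A0 * (real q1 * real c powr (2 - \<epsilon>)) \<le> moment q1 X1 X2 c" using A0(2) by fastforce
      moreover have "A * (real q1 * real c powr (2 - \<epsilon>)) \<le> A0 * (real q1 * real c powr (2 - \<epsilon>))"
        by (intro mult_right_mono) (auto simp: A_def)
      ultimately show ?thesis by (simp add: mult.assoc)
    next
      case False
      then have c100: "c \<ge> 100" and "nat \<lceil>K ^ 4\<rceil> \<le> c" by (simp_all only: N_def not_less max.bounded_iff)
      then have "K ^ 4 \<le> real c" by linarith
      then have Kc: "K \<le> real c powr (1 / 4)"
      proof -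
        have "(K powr 4) powr (1 / 4) = K" using K by (simp only: powr_powr) simp
        then have "K = (K ^ 4) powr (1 / 4)" using K by (simp add: powr_numeral)
        also have "\<dots> \<le> real c powr (1 / 4)" using \<open>K ^ 4 \<le> real c\<close> K by (intro powr_mono2) auto
        finally show ?thesis .
      qed
      have "7200 * 9 ^ card (prime_factors q2) * real (card {d. d dvd q2}) * (harm c)\<^sup>2 \<le>
        7200 * (C9 * real c powr (1 / 8)) * (2 * real c powr (1 / 2)) * (17 * real c powr (1 / 16))\<^sup>2"
      proof (intro mult_mono power_mono mult_nonneg_nonneg)
        have "9 ^ card (prime_factors q2) \<le> C9 * real q2 powr (1 / 8)" using C9(2) q20 by blast
        also have "\<dots> \<le> C9 * real c powr (1 / 8)" using q2c C9(1) by (intro mult_left_mono powr_mono2) auto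
        finally show "9 ^ card (prime_factors q2) \<le> C9 * real c powr (1 / 8)" .
        have "real (card {d. d dvd q2}) \<le> 2 * sqrt (real q2)" by (rule card_divisors_le[OF q20])
        also have "\<dots> \<le> 2 * sqrt (real c)" using q2c by simp
        finally show "real (card {d. d dvd q2}) \<le> 2 * real c powr (1 / 2)" using c0 by (simp add: powr_half_sqrt)
        show "harm c \<le> 17 * real c powr (1 / 16)" using harm_powr_bound[of "1 / 16" c] c0 by simp
      qed (use C9(1) in \<open>auto simp: harm_nonneg\<close>)
      also have "\<dots> = K * real c powr (3 / 4)"
      proof -
        have "(17 * real c powr (1 / 16))\<^sup>2 = 17\<^sup>2 * real c powr (1 / 8)" using c0 by (simp add: power_mult_distrib powr_power)
        moreover have "real c powr (1 / 8) * real c powr (1 / 2) * real c powr (1 / 8) = real c powr (3 / 4)"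
          by (simp flip: powr_add)
        ultimately show ?thesis by (simp add: K_def mult_ac)
      qed
      also have "\<dots> \<le> real c powr (1 / 4) * real c powr (3 / 4)" using Kc by (intro mult_right_mono) auto
      also have "\<dots> = real c" using c0 by (simp flip: powr_add)
      finally have low: "real q1 * (real c)\<^sup>2 / (640000 * 3 ^ card (prime_factors q2)) \<le> moment q1 X1 X2 c"
        by (rule moment_lower[OF c100])
      have "3 ^ card (prime_factors q2) \<le> C3 * real c powr \<epsilon>"
      proof -
        have "3 ^ card (prime_factors q2) \<le> C3 * real q2 powr \<epsilon>" using C3(2) q20 by blast
        also have "\<dots> \<le> C3 * real c powr \<epsilon>" using q2c C3(1) assms by (intro mult_left_mono powr_mono2) auto
        finally show ?thesis .
      qed
      then have "real q1 * (real c)\<^sup>2 / (640000 * (C3 * real c powr \<epsilon>)) \<le> real q1 * (real c)\<^sup>2 / (640000 * 3 ^ card (prime_factors q2))"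
        using C3(1) c0 by (intro divide_left_mono mult_left_mono mult_pos_pos) auto
      moreover have "real q1 * (real c)\<^sup>2 / (640000 * (C3 * real c powr \<epsilon>)) = 1 / (640000 * C3) * (real q1 * real c powr (2 - \<epsilon>))"
        by (simp add: powr_diff p2)
      moreover have "A * (real q1 * real c powr (2 - \<epsilon>)) \<le> 1 / (640000 * C3) * (real q1 * real c powr (2 - \<epsilon>))"
        by (intro mult_right_mono) (auto simp: A_def)
      ultimately show ?thesis using low by (simp add: mult.assoc)
    qed
    then show ?thesis using up by blast
  qed
  then show ?thesis using AB unfolding good_def by (intro exI[of _ A] conjI exI[of _ B]) auto
qed

end
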